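(* Let $D$ be a Dedekind domain with quotient field $F\neq D$, let $M_1,\ldots,M_n$ ($n>1$) be distinct maximal ideals of $D$, and let $I=M_1^{e_1}\cdots M_n^{e_n}$, where $e_1,\ldots,e_n$ are positive integers. For $i=1,\ldots,n$ let $S(M_i)=\{(K_{i,j},1,\tfrac{e_1\cdots e_n}{e_i})\mid j=1,\ldots,e_i\}$, where $K_{i,j}=D/M_i$ for all $j$. Then $S=\{S(M_1),\ldots,S(M_n)\}$ is a realizable $e_1\cdots e_n$-consistent system for $\{D_{M_1},\ldots,D_{M_n}\}$. Therefore there exists a Dedekind domain $E$ that is a finite separable integral extension domain of $D$ such that $[L:F]=e_1\cdots e_n$, where $L$ is the quotient field of $E$, and, for $i=1,\ldots,n$, there exist exactly $e_i$ maximal ideals $N_{i,1},\ldots,N_{i,e_i}$ in $E$ that lie over $M_i$ and, for $j=1,\ldots,e_i$, $[(E/N_{i,j}):(D/M_i)]=1$ and $M_iE_{N_{i,j}}=N_{i,j}^{\frac{e_1\cdots e_n}{e_i}}E_{N_{i,j}}$; so $IE=(\mathrm{Rad}(IE))^{e_1\cdots e_n}$.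
   Context: A DVR is a rank one discrete valuation ring. A finite separable integral extension domain $E$ of a domain $D$ is a domain $E\supseteq D$ that is integral over $D$ and finitely generated as a $D$-module, and whose quotient field is a finite separable algebraic extension of the quotient field of $D$. $\mathrm{Rad}(J)$ is the radical of the ideal $J$. Let $(V_1,N_1),\ldots,(V_n,N_n)$ be distinct DVRs with quotient field $F$ (here $V_i=D_{M_i}$, and one writes $S(M_i)$ for $S(D_{M_i})$), and put $K_i=V_i/N_i$ ($=D/M_i$). For a positive integer $m$, an $m$-consistent system for $\{V_1,\ldots,V_n\}$ is a collection $S=\{S(V_1),\ldots,S(V_n)\}$ such that: (1) $S(V_i)=\{(K_{i,j},f_{i,j},e_{i,j})\mid j=1,\ldots,s_i\}$ is a finite family indexed by $j$ (repetitions of triples are allowed), where $K_{i,j}$ is a simple algebraic field extension of $K_i$, $f_{i,j}=[K_{i,j}:K_i]$, and $s_i,e_{i,j}$ are positive integers; (2) for each $i$, $\sum_{j=1}^{s_i}e_{i,j}f_{i,j}=m$. Such a system $S$ is realizable for $\{V_1,\ldots,V_n\}$ if there exists a separable algebraic extension field $L$ of $F$ such that: (a) $[L:F]=m$; (b) for $1\le i\le n$, $V_i$ has exactly $s_i$ extensions $(V_{i,1},N_{i,1}),\ldots,(V_{i,s_i},N_{i,s_i})$ to valuation rings of $L$; (c) (for a suitable numbering) the residue field $V_{i,j}/N_{i,j}$ is $K_i$-isomorphic to $K_{i,j}$, and the ramification index of $V_{i,j}$ over $V_i$ is $e_{i,j}$, i.e. $N_iV_{i,j}=N_{i,j}^{e_{i,j}}$.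 Such an $L$ is called a realization of $S$. *)

theory Defs
  imports
    "HOL-Algebra.Algebraic_Closure"
    "HOL-Algebra.Finite_Extensions"
    "HOL-Algebra.Generated_Fields"
    "HOL-Algebra.Ideal_Product"
    "HOL-Algebra.QuotRing"
    "HOL-Algebra.Ring_Divisibility"
begin

text \<open>
  Subrings of a field \<open>F\<close> (domains with quotient field \<open>F\<close>, valuation rings of \<open>F\<close>) are
  given by their carrier sets \<open>D\<close>; the corresponding ring is \<open>F\<lparr>carrier := D\<rparr>\<close>.
  An extension field of \<open>F\<close> is a field \<open>L\<close> together with a ring homomorphism
  \<open>h \<in> ring_hom F L\<close>; such an \<open>h\<close> is injective, and \<open>F\<close>, \<open>D\<close>, an ideal \<open>M\<close> of \<open>D\<close>, etc. are
  identified with their images under \<open>h\<close>.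
\<close>

section \<open>Domains and their quotient fields\<close>

definition localization :: "'a ring \<Rightarrow> 'a set \<Rightarrow> 'a set \<Rightarrow> 'a set" where
  "localization F D P = {a \<otimes>\<^bsub>F\<^esub> inv\<^bsub>F\<^esub> s | a s. a \<in> D \<and> s \<in> D - P}"

definition is_quotient_field :: "'a ring \<Rightarrow> 'a set \<Rightarrow> bool" where
  "is_quotient_field F D \<longleftrightarrow>
     field F \<and> subdomain D F \<and>
     carrier F = {a \<otimes>\<^bsub>F\<^esub> inv\<^bsub>F\<^esub> b | a b. a \<in> D \<and> b \<in> D - {\<zero>\<^bsub>F\<^esub>}}"

definition (in ring) integral_over :: "'a set \<Rightarrow> 'a \<Rightarrow> bool" where
  "integral_over D x \<longleftrightarrow>
     (\<exists>p \<in> carrier (D[X]). p \<noteq> [] \<and> lead_coeff p = \<one> \<and> eval p x = \<zero>)"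

text \<open>\<open>D\<close> is a Dedekind domain with quotient field \<open>F\<close>. The case \<open>D = F\<close> is not excluded.\<close>

definition dedekind_domain :: "'a ring \<Rightarrow> 'a set \<Rightarrow> bool" where
  "dedekind_domain F D \<longleftrightarrow>
     is_quotient_field F D \<and>
     noetherian_domain (F\<lparr>carrier := D\<rparr>) \<and>
     (\<forall>x \<in> carrier F. ring.integral_over F D x \<longrightarrow> x \<in> D) \<and>
     (\<forall>P. primeideal P (F\<lparr>carrier := D\<rparr>) \<and> P \<noteq> {\<zero>\<^bsub>F\<^esub>} \<longrightarrow>
          maximalideal P (F\<lparr>carrier := D\<rparr>))"

definition radical :: "'a ring \<Rightarrow> 'a set \<Rightarrow> 'a set" where
  "radical R J = {x \<in> carrier R. \<exists>k::nat. k > 0 \<and> x [^]\<^bsub>R\<^esub> k \<in> J}"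

section \<open>Separable extensions\<close>

text \<open>
  Polynomials are lists of coefficients, leading coefficient first. The list below runs through
  \<open>i = length p - 1, \<dots>, 1\<close>, and the entry for \<open>i\<close> is the coefficient of the monomial of
  degree \<open>i - 1\<close> in the derivative.
\<close>

definition (in ring) poly_derivative :: "'a list \<Rightarrow> 'a list" where
  "poly_derivative p =
     normalize (map (\<lambda>i. [i] \<cdot> coeff p i) (rev [1..<length p]))"

text \<open>A polynomial over the field \<open>K\<close> is separable if it generates the unit ideal of \<open>K[X]\<close>
  together with its derivative.\<close>

definition (in ring) separable_poly :: "'a set \<Rightarrow> 'a list \<Rightarrow> bool" where
  "separable_poly K p \<longleftrightarrow>
     (\<exists>a \<in> carrier (K[X]). \<exists>b \<in> carrier (K[X]).
        (a \<otimes>\<^bsub>K[X]\<^esub> p) \<oplus>\<^bsub>K[X]\<^esub> (b \<otimes>\<^bsub>K[X]\<^esub> poly_derivative p) = \<one>\<^bsub>K[X]\<^esub>)"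

definition separable_algebraic_extension :: "'a ring \<Rightarrow> 'b ring \<Rightarrow> ('a \<Rightarrow> 'b) \<Rightarrow> bool" where
  "separable_algebraic_extension F L h \<longleftrightarrow>
     field F \<and> field L \<and> h \<in> ring_hom F L \<and>
     (\<forall>x \<in> carrier L. ring.algebraic L (h ` carrier F) x \<and>
        ring.separable_poly L (h ` carrier F) (ring.Irr L (h ` carrier F) x))"

text \<open>\<open>[L : F] = m\<close>.\<close>

definition extension_degree :: "'a ring \<Rightarrow> 'b ring \<Rightarrow> ('a \<Rightarrow> 'b) \<Rightarrow> nat \<Rightarrow> bool" where
  "extension_degree F L h m \<longleftrightarrow> ring.dimension L m (h ` carrier F) (carrier L)"

text \<open>\<open>E\<close>, a domain with quotient field \<open>L\<close>, is a finite separable integral extension domain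
  of \<open>D\<close>, a domain with quotient field \<open>F\<close>. The \<open>D\<close>-module generated by \<open>u\<^sub>1, \<dots>, u\<^sub>r\<close> is
  \<open>Span D [u\<^sub>1, \<dots>, u\<^sub>r]\<close>.\<close>

definition finite_separable_integral_extension ::
    "'a ring \<Rightarrow> 'a set \<Rightarrow> 'b ring \<Rightarrow> ('a \<Rightarrow> 'b) \<Rightarrow> 'b set \<Rightarrow> bool" where
  "finite_separable_integral_extension F D L h E \<longleftrightarrow>
     is_quotient_field F D \<and> is_quotient_field L E \<and>
     h ` D \<subseteq> E \<and>
     (\<forall>x \<in> E. ring.integral_over L (h ` D) x) \<and>
     (\<exists>us. set us \<subseteq> E \<and> ring.Span L (h ` D) us = E) \<and>
     separable_algebraic_extension F L h \<and>
     (\<exists>m. extension_degree F L h m)"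

section \<open>Valuation rings\<close>

definition valuation_ring :: "'a ring \<Rightarrow> 'a set \<Rightarrow> bool" where
  "valuation_ring F V \<longleftrightarrow>
     field F \<and> subring V F \<and> (\<forall>x \<in> carrier F - {\<zero>\<^bsub>F\<^esub>}. x \<in> V \<or> inv\<^bsub>F\<^esub> x \<in> V)"

definition discrete_valuation :: "'a ring \<Rightarrow> ('a \<Rightarrow> int) \<Rightarrow> bool" where
  "discrete_valuation F v \<longleftrightarrow>
     (\<forall>x \<in> carrier F - {\<zero>\<^bsub>F\<^esub>}. \<forall>y \<in> carrier F - {\<zero>\<^bsub>F\<^esub>}.
        v (x \<otimes>\<^bsub>F\<^esub> y) = v x + v y \<and>
        (x \<oplus>\<^bsub>F\<^esub> y \<noteq> \<zero>\<^bsub>F\<^esub> \<longrightarrow> min (v x) (v y) \<le> v (x \<oplus>\<^bsub>F\<^esub> y))) \<and>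
     v ` (carrier F - {\<zero>\<^bsub>F\<^esub>}) = UNIV"

text \<open>\<open>V\<close> is a rank one discrete valuation ring with quotient field \<open>F\<close>.\<close>

definition dvr :: "'a ring \<Rightarrow> 'a set \<Rightarrow> bool" where
  "dvr F V \<longleftrightarrow>
     field F \<and>
     (\<exists>v. discrete_valuation F v \<and> V = {x \<in> carrier F. x = \<zero>\<^bsub>F\<^esub> \<or> 0 \<le> v x})"

text \<open>The maximal ideal of a local ring.\<close>

definition nonunits :: "'a ring \<Rightarrow> 'a set" where
  "nonunits R = carrier R - Units R"

definition residue_field :: "'a ring \<Rightarrow> 'a set ring" where
  "residue_field R = R Quot (nonunits R)"

text \<open>The extensions of the valuation ring \<open>V\<close> of \<open>F\<close> to valuation rings of \<open>L\<close>.\<close>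

definition valuation_extensions ::
    "'a ring \<Rightarrow> 'a set \<Rightarrow> 'b ring \<Rightarrow> ('a \<Rightarrow> 'b) \<Rightarrow> 'b set set" where
  "valuation_extensions F V L h =
     {W. valuation_ring L W \<and> W \<inter> h ` carrier F = h ` V}"

section \<open>Consistent systems and realizations\<close>

text \<open>
  A triple \<open>((K, \<iota>), f, e)\<close> consists of an extension field \<open>K\<close> of a residue field \<open>k = V/N\<close>,
  with its embedding \<open>\<iota>\<close> of \<open>k\<close> into \<open>K\<close>, and of the numbers \<open>f\<close> and \<open>e\<close>. A system assigns
  to each index \<open>i\<close> the finite family (a list) \<open>S i = S(V\<^sub>i)\<close> of such triples. Only the indices
  \<open>1, \<dots>, n\<close> are relevant; within the list \<open>S i\<close>, positions are counted from \<open>0\<close>.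
\<close>

type_synonym ('a, 'k) system =
  "nat \<Rightarrow> (('k ring \<times> ('a set \<Rightarrow> 'k)) \<times> nat \<times> nat) list"

definition simple_algebraic_field_extension ::
    "'a ring \<Rightarrow> 'k ring \<Rightarrow> ('a \<Rightarrow> 'k) \<Rightarrow> bool" where
  "simple_algebraic_field_extension k K \<iota> \<longleftrightarrow>
     field k \<and> field K \<and> \<iota> \<in> ring_hom k K \<and>
     (\<exists>\<theta> \<in> carrier K. ring.algebraic K (\<iota> ` carrier k) \<theta> \<and>
        carrier K = generate_field K (insert \<theta> (\<iota> ` carrier k)))"

definition consistent_system ::
    "'a ring \<Rightarrow> nat \<Rightarrow> (nat \<Rightarrow> 'a set) \<Rightarrow> nat \<Rightarrow> ('a, 'k) system \<Rightarrow> bool" where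
  "consistent_system F n V m S \<longleftrightarrow>
     (\<forall>i \<in> {1..n}. dvr F (V i)) \<and> inj_on V {1..n} \<and> m > 0 \<and>
     (\<forall>i \<in> {1..n}.
        S i \<noteq> [] \<and>
        (\<forall>((K, \<iota>), f, e) \<in> set (S i).
           simple_algebraic_field_extension (residue_field (F\<lparr>carrier := V i\<rparr>)) K \<iota> \<and>
           extension_degree (residue_field (F\<lparr>carrier := V i\<rparr>)) K \<iota> f \<and>
           e > 0) \<and>
        (\<Sum>(_, f, e) \<leftarrow> S i. e * f) = m)"

text \<open>For a local extension \<open>W\<close> of \<open>V\<close>: the residue field of \<open>W\<close> is isomorphic to \<open>(K, \<iota>)\<close>
  over the residue field of \<open>V\<close>.\<close>

definition residue_field_isomorphic ::
    "'a ring \<Rightarrow> 'a set \<Rightarrow> 'b ring \<Rightarrow> ('a \<Rightarrow> 'b) \<Rightarrow> 'b set \<Rightarrow> 'k ring \<Rightarrow> ('a set \<Rightarrow> 'k) \<Rightarrow> bool" where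
  "residue_field_isomorphic F V L h W K \<iota> \<longleftrightarrow>
     (let RV = F\<lparr>carrier := V\<rparr>; RW = L\<lparr>carrier := W\<rparr>
      in \<exists>\<psi> \<in> ring_iso (residue_field RW) K.
           \<forall>x \<in> V. \<psi> (nonunits RW +>\<^bsub>RW\<^esub> h x) = \<iota> (nonunits RV +>\<^bsub>RV\<^esub> x))"

definition has_ramification_index ::
    "'a ring \<Rightarrow> 'a set \<Rightarrow> 'b ring \<Rightarrow> ('a \<Rightarrow> 'b) \<Rightarrow> 'b set \<Rightarrow> nat \<Rightarrow> bool" where
  "has_ramification_index F V L h W e \<longleftrightarrow>
     (let RV = F\<lparr>carrier := V\<rparr>; RW = L\<lparr>carrier := W\<rparr>
      in Idl\<^bsub>RW\<^esub> (h ` nonunits RV) = nonunits RW [^]\<^bsub>ideals_set RW\<^esub> e)"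

definition is_realization ::
    "'a ring \<Rightarrow> nat \<Rightarrow> (nat \<Rightarrow> 'a set) \<Rightarrow> nat \<Rightarrow> ('a, 'k) system \<Rightarrow> 'b ring \<Rightarrow> ('a \<Rightarrow> 'b) \<Rightarrow> bool" where
  "is_realization F n V m S L h \<longleftrightarrow>
     separable_algebraic_extension F L h \<and>
     extension_degree F L h m \<and>
     (\<forall>i \<in> {1..n}. \<exists>W.
        bij_betw W {..<length (S i)} (valuation_extensions F (V i) L h) \<and>
        (\<forall>j < length (S i). case S i ! j of ((K, \<iota>), f, e) \<Rightarrow>
           residue_field_isomorphic F (V i) L h (W j) K \<iota> \<and>
           has_ramification_index F (V i) L h (W j) e))"

text \<open>
  HOL has no quantification over types, so the field \<open>L\<close> has to be sought on a fixed type. We take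
  the type of the library's algebraic closure of a field on \<open>'a\<close>. This is no restriction: every
  algebraic extension of \<open>F\<close> is isomorphic over \<open>F\<close> to a subfield of \<open>alg_closure F\<close>, and
  \<open>is_realization\<close> is invariant under isomorphism of \<open>L\<close>.
\<close>

type_synonym 'a closure_elem = "('a list \<times> nat) multiset \<Rightarrow> 'a"

definition realizable ::
    "'a ring \<Rightarrow> nat \<Rightarrow> (nat \<Rightarrow> 'a set) \<Rightarrow> nat \<Rightarrow> ('a, 'k) system \<Rightarrow> bool" where
  "realizable F n V m S \<longleftrightarrow>
     (\<exists>(L :: 'a closure_elem ring) h. is_realization F n V m S L h)"

end

theory Submission
 imports Defs
begin

text \<open>
All extension fields are taken inside an algebraic closure of F. There a tower F = L_0, L_1, ..., L_n with
[L_k : L_{k-1}] = e_k is built (lemma \<open>tower\<close>), together with the integral closures D_k of D,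
which are Dedekind domains. Up to step k - 1 there is only one prime above M_k; in step k it splits completely
into e_k primes, whereas every prime above another M_i is totally ramified of index e_k. All residue degrees
stay 1. Hence in the end there are e_i primes above M_i, each with ramification index the product of the e_l,
l \<noteq> i.

One step (\<open>extension_step\<close>) has a prime Q to split, a finite non-empty set of primes P to ramify,
and a degree e. Approximation gives q and \<pi> with v_Q(q) = 1, v_P(q) = 2, v_Q(\<pi>) = e^2 + 1, v_P(\<pi>)
= 1, and a root \<theta> of f = (X - q) (X - q^2) ... (X - q^e) + \<pi> is adjoined.

At each P the polynomial f is Eisenstein. So f is irreducible (\<open>eisenstein_degree\<close>), and P is
totally ramified (\<open>eisenstein_above\<close>), since the terms c_i \<theta>^i of an element of L have
distinct values.

At Q the polynomial f is a small perturbation of a product of linear factors. For each j some prime N_j above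
Q has v(\<theta> - q^j) > e v(q), where v is its valuation: otherwise s q^e / (\<theta> - q^j) would be
integral for some s \<notin> Q, and so would be its norm, up to sign (s q^e)^e / \<pi>, of value e^2 - (e^2 +
1) < 0. The N_j are distinct (\<open>totally_split\<close>). As there are as many of them as the degree, they
are all the primes above Q, and unramified of residue degree 1 (\<open>complete_splitting\<close>).

Complete splitting also yields separability, in every characteristic: elements that are units at one of the
N_j and vanish at the others form a basis, their p-th powers have the same property, and an extension spanned
by p-th powers for every p > 0 is separable (\<open>separable_of_power_span\<close>). Being spanned by p-th
powers passes up the tower.

The rest is translation. The valuation rings of L above D_{M_i} are the localizations E_N
(\<open>valuation_ring_is_localization\<close>), and a non-zero ideal of E is determined by its orders at the
primes (\<open>ideal_eq_of_ord\<close>). The order of IE is (m / e_i) e_i = m at the primes above the M_i and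
0 elsewhere, as for the m-th power of its radical (\<open>radical_power\<close>).
\<close>

abbreviation carrier_restriction (infixl "|:" 90) where
 "R |: D \<equiv> R\<lparr>carrier := D\<rparr>"

section \<open>Finitely generated modules over a subring\<close>

context cring
begin

declare Span.simps [simp del]

lemma Span_Nil: "Span D [] = {\<zero>}" by (simp add: Span.simps)

text \<open>D-submodules of the ambient ring. Applied to subsets of D these are the ideals of D; one notion serves for
ideals, for rings finite over D and for fractional ideals.\<close>

definition submod :: "'a set => 'a set => bool" where
 "submod D U \<longleftrightarrow> U \<subseteq> carrier R & \<zero> \<in> U & (\<forall>x\<in>U. \<forall>y\<in>U. x \<oplus> y \<in> U) & (\<forall>d\<in>D. \<forall>x\<in>U. d\<otimes>x \<in> U)"

lemma submodD:
 assumes "submod D U"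
 shows "U \<subseteq> carrier R" "x \<in> U ==> x \<in> carrier R" "\<zero> \<in> U" "x \<in> U ==> y \<in> U ==> x \<oplus> y \<in> U"
  "d \<in> D ==> x \<in> U ==> d\<otimes>x \<in> U" using assms unfolding submod_def by (simp_all add: subset_iff)

lemma submod_minus:
 assumes "subring D R" "submod D U" "x \<in> U"
 shows "\<ominus> x \<in> U"
proof -
 have "(\<ominus> \<one>)\<otimes>x \<in> U" using assms submodD(5) subringE(3,5) by metis
 thus ?thesis using submodD(2)[OF assms(2,3)] by (simp add: l_minus)
qed

lemma submod_diff:
 assumes "subring D R" "submod D U" "x \<in> U" "y \<in> U"
 shows "x \<ominus> y \<in> U" using submod_minus[OF assms(1,2,4)] submodD(4)[OF assms(2,3)] unfolding a_minus_def by blast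

lemma submod_subring: "subring E R ==> D \<subseteq> E ==> submod D E" unfolding submod_def by (auto dest: subringE)

lemma submod_mono: "submod E U ==> D \<subseteq> E ==> submod D U" unfolding submod_def by blast

lemma submod_inter: "submod D U ==> submod D V ==> submod D (U \<inter> V)" unfolding submod_def by blast

lemma Span_Cons_iff: "x \<in> Span D (u # us) \<longleftrightarrow> (\<exists>d\<in>D. \<exists>y\<in>Span D us. x = d\<otimes>u \<oplus> y)" by (simp add: Span.simps line_extension_mem_iff)

lemma submod_Span:
 assumes D: "subring D R" and "set us \<subseteq> carrier R"
 shows "submod D (Span D us)" using assms(2)
proof (induct us)
 case Nil
 show ?case using subringE[OF D] unfolding submod_def Span_Nil by auto
next
 case (Cons u us)
 note DE = subringE[OF D]
 have IH: "submod D (Span D us)" and u: "u \<in> carrier R" using Cons by auto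
 note S = submodD[OF IH]
 have Dc: "!!d. d \<in> D ==> d \<in> carrier R" using DE(1) by blast
 show ?case unfolding submod_def
 proof (intro conjI ballI)
  show "Span D (u # us) \<subseteq> carrier R" using Span_in_carrier[OF DE(1) Cons(2)] .
  have "\<zero> = \<zero>\<otimes>u \<oplus> \<zero>" using u by simp
  thus "\<zero> \<in> Span D (u # us)" unfolding Span_Cons_iff using DE(2) S(3) by blast
 next
  fix x y assume "x \<in> Span D (u # us)" "y \<in> Span D (u # us)"
  then obtain d x' e y' where d: "d \<in> D" "x' \<in> Span D us" "x = d\<otimes>u \<oplus> x'"
   and e: "e \<in> D" "y' \<in> Span D us" "y = e\<otimes>u \<oplus> y'" unfolding Span_Cons_iff by blast
  have "x \<oplus> y = (d \<oplus> e)\<otimes>u \<oplus> (x' \<oplus> y')" using d e u Dc S(2) by (simp add: l_distr a_ac)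
  thus "x \<oplus> y \<in> Span D (u # us)" unfolding Span_Cons_iff using d e DE(7) S(4) by blast
 next
  fix c x assume c: "c \<in> D" and "x \<in> Span D (u # us)"
  then obtain d x' where d: "d \<in> D" "x' \<in> Span D us" "x = d\<otimes>u \<oplus> x'" unfolding Span_Cons_iff by blast
  have "c\<otimes>x = (c\<otimes>d)\<otimes>u \<oplus> c\<otimes>x'" using c d u Dc S(2) by (simp add: r_distr m_assoc)
  thus "c\<otimes>x \<in> Span D (u # us)" unfolding Span_Cons_iff using d c DE(6) S(5) by blast
 qed
qed

lemma Span_least:
 assumes "submod D U" "set us \<subseteq> U"
 shows "Span D us \<subseteq> U" using assms(2)
proof (induct us)
 case Nil thus ?case using submodD(3)[OF assms(1)] unfolding Span_Nil by auto
next
 case (Cons u us)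
 show ?case
 proof
  fix x assume "x \<in> Span D (u # us)"
  then obtain d y where "d \<in> D" "y \<in> Span D us" "x = d\<otimes>u \<oplus> y" unfolding Span_Cons_iff by blast
  thus "x \<in> U" using Cons submodD[OF assms(1)] by auto
 qed
qed

lemma Span_gens:
 assumes D: "subring D R" and us: "set us \<subseteq> carrier R"
 shows "set us \<subseteq> Span D us" using us
proof (induct us)
 case (Cons u us)
 have u: "u \<in> carrier R" and IH: "set us \<subseteq> Span D us" using Cons by auto
 have S: "submod D (Span D us)" using submod_Span[OF D] Cons(2) by auto
 have "u = \<one>\<otimes>u \<oplus> \<zero>" using u by simp
 hence "u \<in> Span D (u # us)" unfolding Span_Cons_iff using subringE(3)[OF D] submodD(3)[OF S] by blast
 moreover have "x \<in> Span D (u # us)" if "x \<in> Span D us" for x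
 proof -
  have "x = \<zero>\<otimes>u \<oplus> x" using u submodD(2)[OF S that] by simp
  thus ?thesis unfolding Span_Cons_iff using subringE(2)[OF D] that by blast
 qed
 ultimately show ?case using IH by auto
qed simp

lemma Span_subset_SpanI:
 assumes "subring D R" "set vs \<subseteq> carrier R" "set us \<subseteq> Span D vs"
 shows "Span D us \<subseteq> Span D vs" using Span_least[OF submod_Span[OF assms(1,2)] assms(3)] .

definition noeth :: "'a set => bool" where
 "noeth D \<longleftrightarrow> (\<forall>J. submod D J & J \<subseteq> D --> (\<exists>us. set us \<subseteq> J & J = Span D us))"

text \<open>Induction on the generators: the coefficients of the first generator u in elements of U form an ideal of D,
finitely generated; subtracting suitable elements of U leaves a submodule of the span of the other generators.\<close>

lemma noeth_submod:
 assumes D: "subring D R" and N: "noeth D" and us: "set us \<subseteq> carrier R"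
  and U: "submod D U" "U \<subseteq> Span D us"
 shows "\<exists>vs. set vs \<subseteq> U & U = Span D vs" using us U
proof (induct us arbitrary: U)
 case Nil
 hence "U = Span D []" using submodD(3)[OF Nil(2)] unfolding Span_Nil by auto
 thus ?case by (intro exI[of _ "[]"]) simp
next
 case (Cons u us)
 note DE = subringE[OF D]
 have u: "u \<in> carrier R" and us: "set us \<subseteq> carrier R" using Cons by auto
 note S = submod_Span[OF D us]
 have Dc: "!!d. d \<in> D ==> d \<in> carrier R" using DE(1) by blast
 define J where "J W = {d \<in> D. \<exists>y \<in> Span D us. d\<otimes>u \<oplus> y \<in> W}" for W
 have J: "submod D (J W)" if W: "submod D W" for W unfolding submod_def
 proof (intro conjI ballI)
  show "J W \<subseteq> carrier R" using DE(1) unfolding J_def by blast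
  have "\<zero>\<otimes>u \<oplus> \<zero> \<in> W" using u submodD(3)[OF W] by simp
  thus "\<zero> \<in> J W" unfolding J_def using DE(2) submodD(3)[OF S] by blast
 next
  fix x y assume "x \<in> J W" "y \<in> J W"
  then obtain x' y' where x: "x \<in> D" "x' \<in> Span D us" "x\<otimes>u \<oplus> x' \<in> W"
   and y: "y \<in> D" "y' \<in> Span D us" "y\<otimes>u \<oplus> y' \<in> W" unfolding J_def by blast
  have "(x\<otimes>u \<oplus> x') \<oplus> (y\<otimes>u \<oplus> y') = (x \<oplus> y)\<otimes>u \<oplus> (x' \<oplus> y')" using x y u Dc submodD(2)[OF S] by (simp add: l_distr a_ac)
  thus "x \<oplus> y \<in> J W" unfolding J_def using x y DE(7) submodD(4)[OF S] submodD(4)[OF W x(3) y(3)] by auto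
 next
  fix c x assume c: "c \<in> D" and "x \<in> J W"
  then obtain x' where x: "x \<in> D" "x' \<in> Span D us" "x\<otimes>u \<oplus> x' \<in> W" unfolding J_def by blast
  have "c\<otimes>(x\<otimes>u \<oplus> x') = (c\<otimes>x)\<otimes>u \<oplus> c\<otimes>x'" using c x u Dc submodD(2)[OF S] by (simp add: r_distr m_assoc)
  thus "c\<otimes>x \<in> J W" unfolding J_def using x c DE(6) submodD(5)[OF S] submodD(5)[OF W c x(3)] by auto
 qed
 have "J U \<subseteq> D" unfolding J_def by blast
 then obtain ds where ds: "set ds \<subseteq> J U" "J U = Span D ds" using N J[OF Cons(3)] unfolding noeth_def by blast
 have "\<forall>d\<in>set ds. \<exists>w. w \<in> U & (\<exists>y\<in>Span D us. w = d\<otimes>u \<oplus> y)" using ds(1) unfolding J_def by blast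
 then obtain c where c: "!!d. d \<in> set ds ==> c d \<in> U & (\<exists>y\<in>Span D us. c d = d\<otimes>u \<oplus> y)" by metis
 let ?cs = "map c ds"
 have cs: "set ?cs \<subseteq> U" using c by auto
 hence csc: "set ?cs \<subseteq> carrier R" using submodD(1)[OF Cons(3)] by blast
 have W: "submod D (Span D ?cs)" using submod_Span[OF D csc] .
 have "Span D ds \<subseteq> J (Span D ?cs)"
 proof (rule Span_least[OF J[OF W]], rule subsetI)
  fix d assume d: "d \<in> set ds"
  hence "c d \<in> Span D ?cs" using Span_gens[OF D csc] by auto
  thus "d \<in> J (Span D ?cs)" unfolding J_def using c[OF d] ds(1) d J_def by auto
 qed
 hence JJ: "J U \<subseteq> J (Span D ?cs)" using ds(2) by blast
 have csU: "Span D ?cs \<subseteq> U" using Span_least[OF Cons(3) cs] .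
 have "submod D (U \<inter> Span D us)" using submod_inter[OF Cons(3) S] .
 then obtain vs where vs: "set vs \<subseteq> U \<inter> Span D us" "U \<inter> Span D us = Span D vs" using Cons(1)[OF us] by blast
 let ?ws = "?cs @ vs"
 have ws: "set ?ws \<subseteq> U" using cs vs(1) by auto
 hence wsc: "set ?ws \<subseteq> carrier R" using submodD(1)[OF Cons(3)] by blast
 have gw: "set ?ws \<subseteq> Span D ?ws" using Span_gens[OF D wsc] .
 have SW: "submod D (Span D ?ws)" using submod_Span[OF D wsc] .
 have "U \<subseteq> Span D ?ws"
 proof
  fix x assume x: "x \<in> U"
  then obtain d y where d: "d \<in> D" "y \<in> Span D us" "x = d\<otimes>u \<oplus> y"
   using Cons(4) unfolding Span_Cons_iff[symmetric] by (metis Span_Cons_iff subsetD)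
  have "d \<in> J U" using d x unfolding J_def by auto
  then obtain y' where y': "y' \<in> Span D us" "d\<otimes>u \<oplus> y' \<in> Span D ?cs" using JJ unfolding J_def by blast
  let ?z = "d\<otimes>u \<oplus> y'"
  have cc: "d \<in> carrier R" "y \<in> carrier R" "y' \<in> carrier R" using d(1,2) y' Dc submodD(2)[OF S] by auto
  have "x \<ominus> ?z = y \<ominus> y'" unfolding d(3) using cc u by algebra
  moreover have "x \<ominus> ?z \<in> U" using submod_diff[OF D Cons(3) x] y'(2) csU by blast
  moreover have "y \<ominus> y' \<in> Span D us" using submod_diff[OF D S d(2) y'(1)] .
  ultimately have "x \<ominus> ?z \<in> Span D vs" using vs(2) by auto
  hence 1: "x \<ominus> ?z \<in> Span D ?ws" using Span_subset_SpanI[OF D wsc, of vs] gw by auto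
  have 2: "?z \<in> Span D ?ws" using Span_subset_SpanI[OF D wsc, of ?cs] gw y'(2) by auto
  have "x = (x \<ominus> ?z) \<oplus> ?z" unfolding d(3) using cc u by algebra
  thus "x \<in> Span D ?ws" using submodD(4)[OF SW 1 2] by metis
 qed
 moreover have "Span D ?ws \<subseteq> U" using Span_least[OF Cons(3) ws] .
 ultimately show ?case using ws by blast
qed

text \<open>The union of a chain of submodules is finitely generated, so it is already one of them; Zorn's lemma applies.\<close>

lemma noeth_maximal:
 assumes D: "subring D R" and N: "noeth D" and us: "set us \<subseteq> carrier R"
  and F: "A ~= {}" "!!U. U \<in> A ==> submod D U & U \<subseteq> Span D us"
 shows "\<exists>U\<in>A. \<forall>V\<in>A. U \<subseteq> V --> V = U"
proof -
 have "\<Union>C \<in> A" if C: "C ~= {}" "subset.chain A C" for C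
 proof -
  have CA: "C \<subseteq> A" and ch: "!!U V. U \<in> C ==> V \<in> C ==> U \<subseteq> V \<or> V \<subseteq> U" using C(2) unfolding subset_chain_def by auto
  have CS: "!!U. U \<in> C ==> submod D U" "!!U. U \<in> C ==> U \<subseteq> Span D us" using CA F(2) by auto
  have "submod D (\<Union>C)" unfolding submod_def
  proof (intro conjI ballI)
   show "\<Union>C \<subseteq> carrier R" using CS submodD(1) by blast
   show "\<zero> \<in> \<Union>C" using C(1) CS submodD(3) by blast
  next
   fix x y assume "x \<in> \<Union>C" "y \<in> \<Union>C"
   then obtain U where "U \<in> C" "x \<in> U" "y \<in> U" using ch by blast
   thus "x \<oplus> y \<in> \<Union>C" using submodD(4)[OF CS(1)] by blast
  next
   fix d x assume "d \<in> D" "x \<in> \<Union>C"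
   thus "d\<otimes>x \<in> \<Union>C" using submodD(5)[OF CS(1)] by blast
  qed
  moreover have "\<Union>C \<subseteq> Span D us" using CS(2) by blast
  ultimately obtain vs where vs: "set vs \<subseteq> \<Union>C" "\<Union>C = Span D vs" using noeth_submod[OF D N us] by blast
  have "\<exists>U\<in>C. set vs \<subseteq> U" using vs(1)
  proof (induct vs)
   case Nil thus ?case using C(1) by auto
  next
   case (Cons v vs)
   then obtain U W where "U \<in> C" "set vs \<subseteq> U" "W \<in> C" "v \<in> W" by auto
   thus ?case using ch[of U W] by (metis insert_subset list.simps(15) subset_trans subsetD)
  qed
  then obtain U where U: "U \<in> C" "set vs \<subseteq> U" by blast
  have "\<Union>C \<subseteq> U" using vs(2) Span_least[OF CS(1)[OF U(1)] U(2)] by simp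
  hence "\<Union>C = U" using U by blast
  thus ?thesis using U CA by auto
 qed
 thus ?thesis using subset_Zorn_nonempty[OF F(1)] by blast
qed

lemma Span_one:
 assumes "subring D R" shows "Span D [\<one>] = D"
proof -
 have "x \<in> Span D [\<one>] \<longleftrightarrow> x \<in> D" for x
 proof -
  have "!!d. d \<in> D ==> d\<otimes>\<one> \<oplus> \<zero> = d" using subringE(1)[OF assms] by auto
  thus ?thesis unfolding Span_Cons_iff Span_Nil by auto
 qed
 thus ?thesis by blast
qed

lemma noeth_maximal_ideal:
 assumes "subring D R" "noeth D" "A ~= {}" "!!U. U \<in> A ==> submod D U & U \<subseteq> D"
 shows "\<exists>U\<in>A. \<forall>V\<in>A. U \<subseteq> V --> V = U"
proof (rule noeth_maximal[OF assms(1,2) _ assms(3)])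
 show "set [\<one>] \<subseteq> carrier R" by simp
 fix U assume "U \<in> A"
 thus "submod D U & U \<subseteq> Span D [\<one>]" unfolding Span_one[OF assms(1)] by (rule assms(4))
qed

definition span_prods :: "'a list => 'a list => 'a list" where
 "span_prods us vs = concat (map (\<lambda>v. map (\<lambda>u. u\<otimes>v) us) vs)"

lemma set_span_prods: "set (span_prods us vs) = {u\<otimes>v | u v. u \<in> set us & v \<in> set vs}" unfolding span_prods_def by auto

lemma Span_tower:
 assumes D: "subring D R" and E: "subring E R" "E = Span D us"
  and us: "set us \<subseteq> carrier R" and vs: "set vs \<subseteq> carrier R"
 shows "Span E vs = Span D (span_prods us vs)"
proof
 have DE: "D \<subseteq> E"
 proof
  fix d assume d: "d \<in> D"
  have "d\<otimes>\<one> \<in> E" using d submodD(5)[OF submod_Span[OF D us]] subringE(3)[OF E(1)] unfolding E(2) by blast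
  thus "d \<in> E" using d subringE(1)[OF D] by auto
 qed
 have usE: "set us \<subseteq> E" using Span_gens[OF D us] unfolding E(2) .
 have P: "set (span_prods us vs) \<subseteq> carrier R" using us vs unfolding set_span_prods by blast
 have SE: "submod E (Span E vs)" using submod_Span[OF E(1) vs] .
 have "set (span_prods us vs) \<subseteq> Span E vs"
 proof
  fix x assume "x \<in> set (span_prods us vs)"
  then obtain u v where "u \<in> set us" "v \<in> set vs" "x = u\<otimes>v" unfolding set_span_prods by blast
  thus "x \<in> Span E vs" using submodD(5)[OF SE] usE Span_gens[OF E(1) vs] by blast
 qed
 thus "Span D (span_prods us vs) \<subseteq> Span E vs" using Span_least[OF submod_mono[OF SE DE]] by blast
 have SP: "submod D (Span D (span_prods us vs))" using submod_Span[OF D P] .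
 have EP: "e\<otimes>v \<in> Span D (span_prods us vs)" if v: "v \<in> set vs" and e: "e \<in> E" for e v
 proof -
  have vc: "v \<in> carrier R" using v vs by blast
  have "submod D {e \<in> carrier R. e\<otimes>v \<in> Span D (span_prods us vs)}" unfolding submod_def
   using vc submodD[OF SP] subringE(1)[OF D] by (auto simp: l_distr m_assoc subset_iff)
  moreover have "set us \<subseteq> {e \<in> carrier R. e\<otimes>v \<in> Span D (span_prods us vs)}"
   using us Span_gens[OF D P] v unfolding set_span_prods by blast
  ultimately show ?thesis using Span_least e unfolding E(2) by blast
 qed
 have "submod E (Span D (span_prods us vs))" unfolding submod_def
 proof (intro conjI ballI)
  fix e x assume e: "e \<in> E" and x: "x \<in> Span D (span_prods us vs)"
  have ec: "e \<in> carrier R" using e subringE(1)[OF E(1)] by blast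
  have "submod D {x \<in> carrier R. e\<otimes>x \<in> Span D (span_prods us vs)}" unfolding submod_def
   using ec submodD[OF SP] subringE(1)[OF D] by (auto simp: r_distr m_lcomm subset_iff)
  moreover have "set (span_prods us vs) \<subseteq> {x \<in> carrier R. e\<otimes>x \<in> Span D (span_prods us vs)}"
  proof
   fix y assume "y \<in> set (span_prods us vs)"
   then obtain u v where uv: "u \<in> set us" "v \<in> set vs" "y = u\<otimes>v" unfolding set_span_prods by blast
   have "e\<otimes>y = (e\<otimes>u)\<otimes>v" using uv us vs ec by (simp add: m_assoc subset_iff)
   moreover have "e\<otimes>u \<in> E" using e uv usE subringE(6)[OF E(1)] by blast
   ultimately show "y \<in> {x \<in> carrier R. e\<otimes>x \<in> Span D (span_prods us vs)}" using EP[OF uv(2)] uv us vs by auto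
  qed
  ultimately show "e\<otimes>x \<in> Span D (span_prods us vs)" using Span_least x by blast
 qed (use submodD[OF SP] in auto)
 moreover have "set vs \<subseteq> Span D (span_prods us vs)"
 proof
  fix v assume v: "v \<in> set vs"
  show "v \<in> Span D (span_prods us vs)" using EP[OF v subringE(3)[OF E(1)]] v vs by auto
 qed
 ultimately show "Span E vs \<subseteq> Span D (span_prods us vs)" using Span_least by blast
qed

lemma noeth_extension:
 assumes D: "subring D R" "noeth D" and E: "subring E R" "E = Span D us" "set us \<subseteq> carrier R" "D \<subseteq> E"
 shows "noeth E" unfolding noeth_def
proof (intro allI impI)
 fix J assume J: "submod E J & J \<subseteq> E"
 then obtain vs where vs: "set vs \<subseteq> J" "J = Span D vs" using noeth_submod[OF D E(3)] submod_mono[OF _ E(4)] E(2) by blast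
 have vc: "set vs \<subseteq> carrier R" using J vs(1) submodD(1) by blast
 have "Span D vs \<subseteq> Span E vs" using Span_least[OF submod_mono[OF submod_Span[OF E(1) vc] E(4)] Span_gens[OF E(1) vc]] .
 moreover have "Span E vs \<subseteq> J" using Span_least J vs(1) by blast
 ultimately show "\<exists>us. set us \<subseteq> J & J = Span E us" using vs by blast
qed

section \<open>Integral elements\<close>

lemma eval_snoc: "set p \<subseteq> carrier R ==> b \<in> carrier R ==> a \<in> carrier R ==> eval (p @ [b]) a = (eval p a\<otimes>a) \<oplus> b"
 using eval_append_aux .

lemma eval_in_subring:
 assumes E: "subring E R" and "set p \<subseteq> E" "x \<in> E"
 shows "eval p x \<in> E" using assms(2)
proof (induct p)
 case Nil thus ?case using subringE(2)[OF E] by simp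
next
 case (Cons a p)
 have "x [^] n \<in> E" for n :: nat by (induct n) (use subringE(3,6)[OF E] assms(3) in auto)
 thus ?case using Cons subringE(6,7)[OF E] by auto
qed

definition pows :: "'a => nat => 'a list" where
 "pows x n = map (\<lambda>i. x [^] i) [0..<n]"

lemma set_pows: "set (pows x n) = {x [^] i | i. i < n}" unfolding pows_def by auto

lemma pows_closed: "x \<in> carrier R ==> set (pows x n) \<subseteq> carrier R" unfolding set_pows by auto

lemma eval_in_Span_pows:
 assumes D: "subring D R" and x: "x \<in> carrier R" and "set p \<subseteq> D" "length p \<le> n"
 shows "eval p x \<in> Span D (pows x n)" using assms(3,4)
proof (induct p)
 case Nil thus ?case using submodD(3)[OF submod_Span[OF D pows_closed[OF x]]] by simp
next
 case (Cons a p)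
 have "x [^] length p \<in> set (pows x n)" using Cons(3) unfolding set_pows by auto
 hence "x [^] length p \<in> Span D (pows x n)" using Span_gens[OF D pows_closed[OF x]] by blast
 thus ?case using Cons submodD(4,5)[OF submod_Span[OF D pows_closed[OF x]]] by auto
qed

lemma Span_pows_eval:
 assumes D: "subring D R" and x: "x \<in> carrier R" and "y \<in> Span D (pows x n)"
 shows "\<exists>p. set p \<subseteq> D & length p = n & y = eval p x" using assms(3)
proof (induct n arbitrary: y)
 case 0 thus ?case by (intro exI[of _ "[]"]) (simp add: pows_def Span_Nil)
next
 case (Suc n)
 let ?U = "{y \<in> carrier R. \<exists>p. set p \<subseteq> D & length p = Suc n & y = eval p x}"
 note DE = subringE[OF D]
 have ec: "set p \<subseteq> D ==> eval p x \<in> carrier R" for p using eval_in_carrier[of p x] x DE(1) by blast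
 have xn: "x [^] m \<in> carrier R" for m :: nat using x by simp
 have "submod D ?U" unfolding submod_def
 proof (intro conjI ballI)
  have "eval (replicate (Suc n) \<zero>) x = \<zero>" using eval_replicate[of "[]" x "Suc n"] x by simp
  thus "\<zero> \<in> ?U" using DE(2) by (auto intro!: exI[of _ "replicate (Suc n) \<zero>"])
 next
  fix y z assume "y \<in> ?U" "z \<in> ?U"
  then obtain p q where p: "set p \<subseteq> D" "length p = Suc n" "y = eval p x"
   and q: "set q \<subseteq> D" "length q = Suc n" "z = eval q x" by blast
  have "eval (map2 (\<oplus>) p q) x = eval p x \<oplus> eval q x" if "length p = length q" "set p \<subseteq> D" "set q \<subseteq> D" for p q using that
  proof (induct p arbitrary: q)
   case (Cons a p)
   then obtain b q' where q: "q = b # q'" by (cases q) auto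
   have IH: "eval (map2 (\<oplus>) p q') x = eval p x \<oplus> eval q' x" using Cons q by auto
   have "a \<in> carrier R" "b \<in> carrier R" "eval p x \<in> carrier R" "eval q' x \<in> carrier R"  using Cons(3,4) q DE(1) ec by auto
   moreover have "length p = length q'" using Cons q by auto
   ultimately show ?case unfolding q using IH xn[of "length q'"] by (simp add: l_distr a_ac)
  qed simp
  moreover have "set (map2 (\<oplus>) p q) \<subseteq> D" 
  proof
   fix s assume "s \<in> set (map2 (\<oplus>) p q)"
   then obtain a b where ab: "(a, b) \<in> set (zip p q)" "s = a \<oplus> b" by auto
   show "s \<in> D" using p(1) q(1) DE(7) set_zip_leftD[OF ab(1)] set_zip_rightD[OF ab(1)] ab(2) by auto
  qed
  ultimately show "y \<oplus> z \<in> ?U" using p q ec by (auto intro!: exI[of _ "map2 (\<oplus>) p q"])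
 next
  fix d y assume d: "d \<in> D" and "y \<in> ?U"
  then obtain p where p: "set p \<subseteq> D" "length p = Suc n" "y = eval p x" by blast
  have dc: "d \<in> carrier R" using d DE(1) by blast
  have "eval (map ((\<otimes>) d) p) x = d\<otimes>eval p x" if "set p \<subseteq> D" for p using that
  proof (induct p)
   case Nil thus ?case using dc by simp
  next
   case (Cons a p)
   have "a \<in> carrier R" "eval p x \<in> carrier R" using Cons(2) DE(1) ec by auto
   thus ?case using Cons dc xn[of "length p"] by (simp add: r_distr m_assoc)
  qed
  moreover have "set (map ((\<otimes>) d) p) \<subseteq> D" using p d DE(6) by auto
  ultimately show "d\<otimes>y \<in> ?U" using p dc ec by (auto intro!: exI[of _ "map ((\<otimes>) d) p"])
 qed auto
 moreover have "set (pows x (Suc n)) \<subseteq> ?U"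
 proof
  fix y assume "y \<in> set (pows x (Suc n))"
  then obtain i where i: "i < Suc n" "y = x [^] i" unfolding set_pows by blast
  let ?p = "replicate (n - i) \<zero> @ (\<one> # replicate i \<zero>)"
  have "eval ?p x = eval (\<one> # replicate i \<zero>) x" by (rule eval_replicate) (use x in auto)
  also have "\<dots> = x [^] i" using eval_replicate[of "[]" x i] x by simp
  finally have "eval ?p x = x [^] i" .
  moreover have "set ?p \<subseteq> D" "length ?p = Suc n" using DE(2,3) i by auto
  ultimately show "y \<in> ?U" using i x by (metis (mono_tags, lifting) mem_Collect_eq nat_pow_closed)
 qed
 ultimately show ?case using Suc(2) Span_least by blast
qed

text \<open>Integrality in its module form, which makes closure under sums and products easy: the powers of x lie in a
single finitely generated D-module. Over a noetherian D this is the usual notion, see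
\<open>monic_imp_intg\<close> and \<open>intg_imp_monic\<close>.\<close>

definition intg :: "'a set => 'a => bool" where
 "intg D x \<longleftrightarrow> x \<in> carrier R & (\<exists>us. set us \<subseteq> carrier R & (\<forall>n::nat. x [^] n \<in> Span D us))"

lemma monic_imp_intg:
 assumes D: "subring D R" and x: "x \<in> carrier R" and p: "set p \<subseteq> D" "eval (\<one> # p) x = \<zero>"
 shows "intg D x"
proof -
 let ?n = "length p"
 have S: "submod D (Span D (pows x ?n))" using submod_Span[OF D pows_closed[OF x]] .
 have pc: "eval p x \<in> carrier R" using eval_in_carrier p(1) subringE(1)[OF D] x by blast
 have "x [^] ?n \<oplus> eval p x = \<zero>" using p(2) x by simp
 hence "x [^] ?n = \<ominus> eval p x" using pc x by (simp add: minus_equality sum_zero_eq_neg)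
 hence xn: "x [^] ?n \<in> Span D (pows x ?n)" using submod_minus[OF D S eval_in_Span_pows[OF D x p(1)]] by simp
 have step: "x\<otimes>y \<in> Span D (pows x ?n)" if "y \<in> Span D (pows x ?n)" for y
 proof -
  have "submod D {y \<in> carrier R. x\<otimes>y \<in> Span D (pows x ?n)}" unfolding submod_def
   using x submodD[OF S] subringE(1)[OF D] by (auto simp: r_distr m_lcomm subset_iff)
  moreover have "set (pows x ?n) \<subseteq> {y \<in> carrier R. x\<otimes>y \<in> Span D (pows x ?n)}"
  proof
   fix y assume "y \<in> set (pows x ?n)"
   then obtain i where i: "i < ?n" "y = x [^] i" unfolding set_pows by blast
   have e: "x\<otimes>y = x [^] Suc i" using i x by (metis nat_pow_Suc2)
   have "x [^] Suc i \<in> Span D (pows x ?n)"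
   proof (cases "Suc i = ?n")
    case True thus ?thesis using xn by metis
   next
    case False
    hence "x [^] Suc i \<in> set (pows x ?n)" using i unfolding set_pows by (metis (mono_tags, lifting) Suc_lessI mem_Collect_eq)
    thus ?thesis using Span_gens[OF D pows_closed[OF x]] by blast
   qed
   thus "y \<in> {y \<in> carrier R. x\<otimes>y \<in> Span D (pows x ?n)}" using e i x by auto
  qed
  ultimately show ?thesis using Span_least that by blast
 qed
 have "x [^] m \<in> Span D (pows x ?n)" for m :: nat
 proof (induct m)
  case 0
  show ?case
  proof (cases "?n = 0")
   case True thus ?thesis using xn by simp
  next
   case False
   hence "x [^] (0::nat) \<in> set (pows x ?n)" unfolding set_pows by blast
   thus ?thesis using Span_gens[OF D pows_closed[OF x]] by blast
  qed
 next
  case (Suc m) thus ?case using step x by (metis nat_pow_Suc2)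
 qed
 thus ?thesis unfolding intg_def using x pows_closed[OF x] by blast
qed

text \<open>The spans of 1, x, ..., x^{n-1} increase inside a finitely generated module, so they become stationary; then
x^n is a combination of lower powers.\<close>

lemma intg_imp_monic:
 assumes D: "subring D R" and N: "noeth D" and x: "intg D x"
 shows "\<exists>p. set p \<subseteq> D & eval (\<one> # p) x = \<zero>"
proof -
 obtain us where us: "set us \<subseteq> carrier R" "!!n::nat. x [^] n \<in> Span D us" and xc: "x \<in> carrier R" using x unfolding intg_def by blast
 let ?f = "\<lambda>n. Span D (pows x n)"
 have "?f n \<subseteq> Span D us" for n using Span_subset_SpanI[OF D us(1), of "pows x n"] us(2) unfolding set_pows by blast
 hence "\<exists>U\<in>range ?f. \<forall>V\<in>range ?f. U \<subseteq> V --> V = U"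
 proof (intro noeth_maximal[OF D N us(1)])
  fix U assume "U \<in> range ?f"
  then obtain n where U: "U = ?f n" by (elim rangeE)
  show "submod D U & U \<subseteq> Span D us" unfolding U using \<open>!!n. ?f n \<subseteq> Span D us\<close> submod_Span[OF D pows_closed[OF xc]] by (intro conjI)
 qed (rule range_eqI[THEN ex_in_conv[THEN iffD1, OF exI], OF refl])
 hence "\<exists>n. \<forall>m. ?f n \<subseteq> ?f m --> ?f m = ?f n" by simp
 then obtain n where n: "!!m. ?f n \<subseteq> ?f m ==> ?f m = ?f n" by iprover
 have "set (pows x n) \<subseteq> set (pows x (Suc n))" unfolding set_pows by auto
 hence "?f n \<subseteq> ?f (Suc n)" using Span_subset_SpanI[OF D pows_closed[OF xc]] Span_gens[OF D pows_closed[OF xc]] by (meson subset_trans)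
 hence "?f (Suc n) = ?f n" by (rule n)
 moreover have "x [^] n \<in> ?f (Suc n)" using Span_gens[OF D pows_closed[OF xc], of "Suc n"] unfolding set_pows by blast
 ultimately have "\<ominus> (x [^] n) \<in> ?f n" using submod_minus[OF D submod_Span[OF D pows_closed[OF xc]]] by metis
 then obtain p where p: "set p \<subseteq> D" "length p = n" "\<ominus> (x [^] n) = eval p x" using Span_pows_eval[OF D xc] by blast
 have "eval (\<one> # p) x = \<zero>" using p(2) p(3)[symmetric] xc by (simp add: r_neg)
 thus ?thesis using p by blast
qed

lemma intg_base:
 assumes D: "subring D R" and x: "x \<in> D" shows "intg D x"
proof -
 have xc: "x \<in> carrier R" using x subringE(1)[OF D] by blast
 show ?thesis using monic_imp_intg[OF D xc, of "[\<ominus> x]"] x xc subringE(5)[OF D] by (simp add: r_neg)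
qed

lemma intg_two:
 assumes D: "subring D R" and x: "intg D x" and y: "intg D y"
 shows "\<exists>ws. set ws \<subseteq> carrier R & (\<forall>(i::nat) (j::nat). x [^] i\<otimes>y [^] j \<in> Span D ws)"
proof -
 obtain us where us: "set us \<subseteq> carrier R" "!!n::nat. x [^] n \<in> Span D us" and xc: "x \<in> carrier R" using x unfolding intg_def by blast
 obtain vs where vs: "set vs \<subseteq> carrier R" "!!n::nat. y [^] n \<in> Span D vs" and yc: "y \<in> carrier R" using y unfolding intg_def by blast
 let ?ws = "span_prods us vs"
 have ws: "set ?ws \<subseteq> carrier R" using us vs unfolding set_span_prods by blast
 note S = submod_Span[OF D ws]
 have 1: "a\<otimes>v \<in> Span D ?ws" if v: "v \<in> set vs" and a: "a \<in> Span D us" for a v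
 proof -
  have vc: "v \<in> carrier R" using v vs by blast
  have "submod D {a \<in> carrier R. a\<otimes>v \<in> Span D ?ws}" unfolding submod_def
   using vc submodD[OF S] subringE(1)[OF D] by (auto simp: l_distr m_assoc subset_iff)
  moreover have "set us \<subseteq> {a \<in> carrier R. a\<otimes>v \<in> Span D ?ws}" using us Span_gens[OF D ws] v unfolding set_span_prods by blast
  ultimately show ?thesis using Span_least a by blast
 qed
 have 2: "a\<otimes>b \<in> Span D ?ws" if a: "a \<in> Span D us" and b: "b \<in> Span D vs" for a b
 proof -
  have ac: "a \<in> carrier R" using a submodD(2)[OF submod_Span[OF D us(1)]] by blast
  have "submod D {b \<in> carrier R. a\<otimes>b \<in> Span D ?ws}" unfolding submod_def
   using ac submodD[OF S] subringE(1)[OF D] by (auto simp: r_distr m_lcomm subset_iff)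
  moreover have "set vs \<subseteq> {b \<in> carrier R. a\<otimes>b \<in> Span D ?ws}" using vs 1[OF _ a] by blast
  ultimately show ?thesis using Span_least b by blast
 qed
 show ?thesis using ws 2[OF us(2) vs(2)] by blast
qed

lemma intg_mult:
 assumes D: "subring D R" and x: "intg D x" and y: "intg D y"
 shows "intg D (x\<otimes>y)"
proof -
 obtain ws where ws: "set ws \<subseteq> carrier R" "!!(i::nat) (j::nat). x [^] i\<otimes>y [^] j \<in> Span D ws" using intg_two[OF assms] by blast
 have "x \<in> carrier R" "y \<in> carrier R" using x y unfolding intg_def by auto
 thus ?thesis unfolding intg_def using ws by (auto simp: nat_pow_distrib)
qed

lemma intg_add:
 assumes D: "subring D R" and x: "intg D x" and y: "intg D y"
 shows "intg D (x \<oplus> y)"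
proof -
 obtain ws where ws: "set ws \<subseteq> carrier R" "!!(i::nat) (j::nat). x [^] i\<otimes>y [^] j \<in> Span D ws" using intg_two[OF assms] by blast
 have xy: "x \<in> carrier R" "y \<in> carrier R" using x y unfolding intg_def by auto
 note S = submod_Span[OF D ws(1)]
 have "(x \<oplus> y) [^] n\<otimes>(x [^] i\<otimes>y [^] j) \<in> Span D ws" for n i j :: nat
 proof (induct n arbitrary: i j)
  case 0 thus ?case using ws(2) xy by simp
 next
  case (Suc n)
  have cl: "(x \<oplus> y) [^] n \<in> carrier R" "x [^] i \<in> carrier R" "y [^] j \<in> carrier R" using xy by auto
  have "(x \<oplus> y) [^] Suc n\<otimes>(x [^] i\<otimes>y [^] j) =
   (x \<oplus> y) [^] n\<otimes>((x [^] i\<otimes>x)\<otimes>y [^] j) \<oplus> (x \<oplus> y) [^] n\<otimes>(x [^] i\<otimes>(y [^] j\<otimes>y))"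
   using xy cl unfolding nat_pow_Suc by algebra
  also have "\<dots> = (x \<oplus> y) [^] n\<otimes>(x [^] Suc i\<otimes>y [^] j) \<oplus> (x \<oplus> y) [^] n\<otimes>(x [^] i\<otimes>y [^] Suc j)" by simp
  finally show ?case using submodD(4)[OF S Suc Suc, of "Suc i" j i "Suc j"] by simp
 qed
 from this[of _ 0 0] have "(x \<oplus> y) [^] n \<in> Span D ws" for n :: nat using xy by simp
 thus ?thesis unfolding intg_def using ws(1) xy by auto
qed

lemma intg_subring:
 assumes D: "subring D R" shows "subring {x. intg D x} R"
proof (rule subringI)
 show "{x. intg D x} \<subseteq> carrier R" unfolding intg_def by blast
 show "\<one> \<in> {x. intg D x}" using intg_base[OF D subringE(3)[OF D]] by simp
 fix x y assume x: "x \<in> {x. intg D x}" and y: "y \<in> {x. intg D x}"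
 show "x\<otimes>y \<in> {x. intg D x}" "x \<oplus> y \<in> {x. intg D x}" using x y intg_mult[OF D] intg_add[OF D] by auto
 have "x \<in> carrier R" using x unfolding intg_def by blast
 hence "\<ominus> x = (\<ominus> \<one>)\<otimes>x" by (simp add: l_minus)
 thus "\<ominus> x \<in> {x. intg D x}" using x intg_mult[OF D intg_base[OF D], of "\<ominus> \<one>" x] subringE(3,5)[OF D] by auto
qed

lemma intg_of_finite:
 assumes "subring E R" "E = Span D us" "set us \<subseteq> carrier R" "x \<in> E"
 shows "intg D x"
proof -
 have "x [^] n \<in> E" for n :: nat by (induct n) (use subringE(3,6)[OF assms(1)] assms(4) in auto)
 thus ?thesis unfolding intg_def using assms subringE(1)[OF assms(1)] by blast
qed

lemma intg_trans:
 assumes "subring D R" "subring E R" "E = Span D us" "set us \<subseteq> carrier R" "intg E x"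
 shows "intg D x"
proof -
 obtain vs where vs: "set vs \<subseteq> carrier R" "!!n::nat. x [^] n \<in> Span E vs" "x \<in> carrier R" using assms(5) unfolding intg_def by blast
 have "set (span_prods us vs) \<subseteq> carrier R" using assms(4) vs unfolding set_span_prods by blast
 thus ?thesis unfolding intg_def using Span_tower[OF assms(1-4) vs(1)] vs by auto
qed

end

section \<open>Dedekind domains inside a field and their discrete valuations\<close>

context cring
begin

definition pri :: "'a set => 'a set => bool" where
 "pri D P \<longleftrightarrow> submod D P & P \<subseteq> D & \<one> \<notin> P & (\<forall>x\<in>D. \<forall>y\<in>D. x\<otimes>y \<in> P --> x \<in> P \<or> y \<in> P)"

text \<open>Primes and maximal ideals are described by elements rather than through the ring \<open>R |: D\<close>. In
\<open>mx\<close> maximality says that every x \<notin> M is invertible modulo M.\<close>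

definition mx :: "'a set => 'a set => bool" where
 "mx D M \<longleftrightarrow> submod D M & M \<subseteq> D & \<one> \<notin> M & (\<forall>x\<in>D - M. \<exists>d\<in>D. \<one> \<ominus> d\<otimes>x \<in> M)"

text \<open>v is the normalized valuation of K with valuation ring D_M; its value at 0 is left open, so it is only ever
used on non-zero elements. The last clause says that the valuation ring is contained in D_M.\<close>

definition place :: "'a set => 'a set => 'a set => ('a => int) => bool" where
 "place K D M v \<longleftrightarrow>
   (\<forall>x\<in>K - {\<zero>}. \<forall>y\<in>K - {\<zero>}. v (x\<otimes>y) = v x + v y) &
   (\<forall>x\<in>K - {\<zero>}. \<forall>y\<in>K - {\<zero>}. x \<oplus> y ~= \<zero> --> min (v x) (v y) \<le> v (x \<oplus> y)) &
   (\<exists>t\<in>D - {\<zero>}. v t = 1) &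
   (\<forall>x\<in>D - {\<zero>}. 0 \<le> v x & (x \<in> M \<longleftrightarrow> 0 < v x)) &
   (\<forall>x\<in>K - {\<zero>}. 0 \<le> v x --> (\<exists>s\<in>D - M. s\<otimes>x \<in> D))"

end

text \<open>D is a Dedekind domain with quotient field K, both inside a field R. As the ambient field is kept fixed,
towers of extensions are chains of subsets.\<close>

locale dedekind = field R for R (structure) +
 fixes K D
 assumes K: "subfield K R"
  and D: "subring D R"
  and D_K: "x \<in> D ==> x \<in> K"
  and frac: "x \<in> K ==> \<exists>a\<in>D. \<exists>b\<in>D. b ~= \<zero> & b\<otimes>x = a"
  and noeth: "noeth D"
  and normal: "x \<in> K ==> intg D x ==> x \<in> D"
  and dim1: "pri D P ==> P ~= {\<zero>} ==> mx D P"
begin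

lemma D_carr [simp]: "x \<in> D ==> x \<in> carrier R" using subringE(1)[OF D] by auto

lemma D_closed [simp]: "\<zero> \<in> D" "\<one> \<in> D" "x \<in> D ==> \<ominus> x \<in> D" "x \<in> D ==> y \<in> D ==> x\<otimes>y \<in> D"
 "x \<in> D ==> y \<in> D ==> x \<oplus> y \<in> D" "x \<in> D ==> y \<in> D ==> x \<ominus> y \<in> D" using subringE[OF D] by (auto simp: a_minus_def)

lemma D_pow [simp]: "x \<in> D ==> x [^] (n::nat) \<in> D" by (induct n) auto

lemma K_carr [simp]: "x \<in> K ==> x \<in> carrier R" using subfieldE(3)[OF K] by auto

lemma K_closed [simp]: "\<zero> \<in> K" "\<one> \<in> K" "x \<in> K ==> \<ominus> x \<in> K" "x \<in> K ==> y \<in> K ==> x\<otimes>y \<in> K"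
 "x \<in> K ==> y \<in> K ==> x \<oplus> y \<in> K" "x \<in> K ==> y \<in> K ==> x \<ominus> y \<in> K" using subringE[OF subfieldE(1)[OF K]] by (auto simp: a_minus_def)

lemma K_pow [simp]: "x \<in> K ==> x [^] (n::nat) \<in> K" by (induct n) auto

lemma K_inv [simp]: "x \<in> K ==> x ~= \<zero> ==> inv x \<in> K" using subfield_m_inv(1)[OF K] by auto

lemma cinv [simp]: "x \<in> carrier R ==> x ~= \<zero> ==> inv x \<in> carrier R"
 "x \<in> carrier R ==> x ~= \<zero> ==> x\<otimes>inv x = \<one>" "x \<in> carrier R ==> x ~= \<zero> ==> inv x\<otimes>x = \<one>" using field_Units by auto

lemma pow_nonzero [simp]: "x \<in> carrier R ==> x ~= \<zero> ==> x [^] (n::nat) ~= \<zero>" by (induct n) (auto simp: integral_iff)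

context
 fixes M assumes M: "mx D M"
begin

lemma M_sub: "submod D M" and M_D: "x \<in> M ==> x \<in> D" and M_one: "\<one> \<notin> M"
 and M_max: "x \<in> D ==> x \<notin> M ==> \<exists>d\<in>D. \<one> \<ominus> d\<otimes>x \<in> M" using M unfolding mx_def by auto

lemma M_closed: "\<zero> \<in> M" "x \<in> M ==> y \<in> M ==> x \<oplus> y \<in> M" "d \<in> D ==> x \<in> M ==> d\<otimes>x \<in> M"
 "d \<in> D ==> x \<in> M ==> x\<otimes>d \<in> M"
proof -
 show *: "d \<in> D ==> x \<in> M ==> d\<otimes>x \<in> M" by (rule submodD(5)[OF M_sub])
 show "d \<in> D ==> x \<in> M ==> x\<otimes>d \<in> M" using * m_comm[of d x] D_carr[of d] submodD(2)[OF M_sub] by simp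
qed (use submodD[OF M_sub] in simp_all)

lemma M_prime: "x \<in> D ==> y \<in> D ==> x\<otimes>y \<in> M ==> x \<notin> M ==> y \<in> M"
proof -
 assume a: "x \<in> D" "y \<in> D" "x\<otimes>y \<in> M" "x \<notin> M"
 obtain d where d: "d \<in> D" "\<one> \<ominus> d\<otimes>x \<in> M" using M_max a by blast
 have "(\<one> \<ominus> d\<otimes>x)\<otimes>y \<oplus> d\<otimes>(x\<otimes>y) \<in> M" using M_closed d a by auto
 moreover have "(\<one> \<ominus> d\<otimes>x)\<otimes>y \<oplus> d\<otimes>(x\<otimes>y) = y"
 proof -
  have c: "d \<in> carrier R" "x \<in> carrier R" "y \<in> carrier R" using a d by auto
  thus ?thesis by algebra
 qed
 ultimately show "y \<in> M" by simp
qed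

lemma DM_mult: "x \<in> D - M ==> y \<in> D - M ==> x\<otimes>y \<in> D - M" using M_prime by auto

lemma DM_nonzero: "x \<in> D - M ==> x ~= \<zero>" using M_closed(1) by auto

text \<open>For 0 \<noteq> a \<in> M take a maximal colon ideal (aD : b) among those contained in M. It is prime and not
zero, hence equal to M, and z = b / a serves.\<close>

lemma colon_element:
 assumes ne: "M ~= {\<zero>}"
 shows "\<exists>z\<in>K. z \<notin> D & (\<forall>x\<in>M. z\<otimes>x \<in> D)"
proof -
 obtain a where a: "a \<in> M" "a ~= \<zero>" using ne M_closed(1) by auto
 have aD: "a \<in> D" using a M_D by auto
 define col where "col b = {d \<in> D. \<exists>c\<in>D. d\<otimes>b = a\<otimes>c}" for b
 have col: "submod D (col b)" if b: "b \<in> D" for b unfolding submod_def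
 proof (intro conjI ballI)
  show "col b \<subseteq> carrier R" unfolding col_def by auto
  show "\<zero> \<in> col b" unfolding col_def using b aD by (auto intro!: bexI[of _ \<zero>])
 next
  fix x y assume "x \<in> col b" "y \<in> col b"
  then obtain c c' where "x \<in> D" "y \<in> D" "c \<in> D" "c' \<in> D" "x\<otimes>b = a\<otimes>c" "y\<otimes>b = a\<otimes>c'" unfolding col_def by auto
  thus "x \<oplus> y \<in> col b" unfolding col_def using b aD by (auto simp: l_distr r_distr intro!: bexI[of _ "c \<oplus> c'"])
 next
  fix d x assume "d \<in> D" "x \<in> col b"
  then obtain c where "d \<in> D" "x \<in> D" "c \<in> D" "x\<otimes>b = a\<otimes>c" unfolding col_def by auto
  thus "d\<otimes>x \<in> col b" unfolding col_def using b aD by (auto simp: m_assoc m_lcomm intro!: bexI[of _ "d\<otimes>c"])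
 qed
 define A where "A = {col b | b. b \<in> D & col b \<subseteq> M}"
 have "col \<one> \<subseteq> M" unfolding col_def using a M_closed(4) by auto
 hence "col \<one> \<in> A" unfolding A_def using D_closed(2) by blast
 hence "A ~= {}" by auto
 hence "\<exists>U\<in>A. \<forall>V\<in>A. U \<subseteq> V --> V = U"
 proof (rule noeth_maximal_ideal[OF D noeth])
  fix U assume "U \<in> A"
  then obtain b where "b \<in> D" "U = col b" unfolding A_def by auto
  thus "submod D U & U \<subseteq> D" using col unfolding col_def by auto
 qed
 then obtain U where U: "U \<in> A" "\<forall>V\<in>A. U \<subseteq> V --> V = U" by (rule bexE)
 obtain b where b0: "U = col b" and b: "b \<in> D" "col b \<subseteq> M" using U(1) unfolding A_def by auto
 have mxb: "col c = col b" if "c \<in> D" "col c \<subseteq> M" "col b \<subseteq> col c" for c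
 proof -
  have "col c \<in> A" unfolding A_def using that(1,2) by auto
  thus ?thesis using U(2) that(3) b0 by simp
 qed
 have one: "\<one> \<notin> col b" using b M_one by auto
 have mono: "col b \<subseteq> col (y\<otimes>b)" if y: "y \<in> D" for y
 proof
  fix x assume "x \<in> col b"
  then obtain c where "x \<in> D" "c \<in> D" "x\<otimes>b = a\<otimes>c" unfolding col_def by auto
  moreover from this have "x\<otimes>(y\<otimes>b) = a\<otimes>(y\<otimes>c)" using y b aD by (simp add: m_lcomm[of x y b] m_lcomm[of a y c])
  ultimately show "x \<in> col (y\<otimes>b)" unfolding col_def using y by (intro CollectI conjI bexI[of _ "y\<otimes>c"]) auto
 qed
 have "pri D (col b)" unfolding pri_def
 proof (intro conjI ballI impI)
  show "submod D (col b)" using col b by auto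
  show "col b \<subseteq> D" unfolding col_def by auto
  show "\<one> \<notin> col b" by (rule one)
  fix x y assume x: "x \<in> D" and y: "y \<in> D" and xy: "x\<otimes>y \<in> col b"
  show "x \<in> col b \<or> y \<in> col b"
  proof (cases "col (y\<otimes>b) \<subseteq> M")
   case True
   hence "col (y\<otimes>b) = col b" using mxb mono y b by auto
   moreover have "x \<in> col (y\<otimes>b)" using xy x y b unfolding col_def by (auto simp: m_assoc)
   ultimately show ?thesis by auto
  next
   case False
   then obtain s where s: "s \<in> D" "s \<notin> M" "s \<in> col (y\<otimes>b)" unfolding col_def by auto
   have "col (s\<otimes>b) \<subseteq> M"
   proof
    fix r assume r: "r \<in> col (s\<otimes>b)"
    hence "r\<otimes>s \<in> col b" using s b unfolding col_def by (auto simp: m_assoc)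
    hence "r\<otimes>s \<in> M" using b by auto
    moreover have "r \<in> D" using r unfolding col_def by auto
    ultimately show "r \<in> M" using M_prime[of s r] s m_comm[of r s] by auto
   qed
   hence "col (s\<otimes>b) = col b" using mxb mono s b by auto
   moreover have "y \<in> col (s\<otimes>b)" using s x y b unfolding col_def by (auto simp: m_lcomm)
   ultimately show ?thesis by auto
  qed
 qed
 moreover have "a \<in> col b" unfolding col_def using aD b by auto
 ultimately have mxP: "mx D (col b)" using dim1 a(2) by auto
 have PM: "col b = M"
 proof (rule equalityI[OF b(2)], rule subsetI, rule ccontr)
  fix x assume x: "x \<in> M" "x \<notin> col b"
  hence "x \<in> D - col b" using M_D by simp
  moreover have "\<forall>x\<in>D - col b. \<exists>d\<in>D. \<one> \<ominus> d\<otimes>x \<in> col b" using mxP unfolding mx_def by simp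
  ultimately obtain d where d: "d \<in> D" "\<one> \<ominus> d\<otimes>x \<in> col b" by blast
  have "(\<one> \<ominus> d\<otimes>x) \<oplus> d\<otimes>x \<in> M" using d x b(2) M_closed by auto
  moreover have "(\<one> \<ominus> d\<otimes>x) \<oplus> d\<otimes>x = \<one>"
  proof -
   have c: "d \<in> carrier R" "x \<in> carrier R" using d x M_D by auto
   thus ?thesis by algebra
  qed
  ultimately show False using M_one by simp
 qed
 let ?z = "b\<otimes>inv a"
 have ac: "a \<in> carrier R" "b \<in> carrier R" using aD b by auto
 have az: "a\<otimes>?z = b" using ac a(2) by (simp add: m_lcomm[of a b "inv a"])
 show ?thesis
 proof (intro bexI conjI ballI)
  show "?z \<in> K" using D_K b(1) aD a(2) by auto
  show "?z \<notin> D"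
  proof
   assume "?z \<in> D"
   hence "\<one> \<in> col b" unfolding col_def using az ac by (auto intro!: bexI[of _ ?z])
   thus False using one by simp
  qed
  fix x assume "x \<in> M"
  then obtain c where c: "x \<in> D" "c \<in> D" "x\<otimes>b = a\<otimes>c" using PM unfolding col_def by auto
  have "?z\<otimes>x = inv a\<otimes>(x\<otimes>b)" using ac a(2) c(1) by (simp add: m_ac)
  also have "\<dots> = c" unfolding c(3) using ac a(2) c by (simp add: m_assoc[symmetric])
  finally show "?z\<otimes>x \<in> D" using c by simp
 qed
qed

text \<open>The z of the previous lemma cannot map M into itself, otherwise it would be integral. So zm \<notin> M for
some m \<in> M, and m generates M locally, by (zm) x = m (zx).\<close>

lemma uniformizer:
 assumes ne: "M ~= {\<zero>}"
 shows "\<exists>t\<in>M. t ~= \<zero> & (\<forall>x\<in>M. \<exists>s\<in>D - M. \<exists>y\<in>D. s\<otimes>x = t\<otimes>y)"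
proof -
 obtain a where a: "a \<in> M" "a ~= \<zero>" using ne M_closed(1) by auto
 have ac: "a \<in> carrier R" using a M_D by auto
 obtain z where z: "z \<in> K" "z \<notin> D" "!!x. x \<in> M ==> z\<otimes>x \<in> D" using colon_element[OF ne] by auto
 have "\<exists>m\<in>M. z\<otimes>m \<notin> M"
 proof (rule ccontr)
  assume "\<not> ?thesis"
  hence zM: "!!m. m \<in> M ==> z\<otimes>m \<in> M" by auto
  have "z [^] n\<otimes>a \<in> M" for n :: nat
  proof (induct n)
   case (Suc n)
   have "z [^] Suc n\<otimes>a = z\<otimes>(z [^] n\<otimes>a)" using z(1) ac by (simp add: m_ac)
   thus ?case using zM Suc by simp
  qed (use a ac in simp)
  hence "z [^] n \<in> Span D [inv a]" for n :: nat
  proof -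
   have "z [^] n = (z [^] n\<otimes>a)\<otimes>inv a \<oplus> \<zero>" using z(1) ac a(2) by (simp add: m_assoc)
   thus ?thesis unfolding Span_Cons_iff Span_Nil using \<open>!!n::nat. z [^] n\<otimes>a \<in> M\<close> M_D by blast
  qed
  hence "intg D z" unfolding intg_def using z(1) ac a(2) by (auto intro!: exI[of _ "[inv a]"])
  thus False using normal z by auto
 qed
 then obtain m where m: "m \<in> M" "z\<otimes>m \<notin> M" by auto
 show ?thesis
 proof (rule bexI[of _ m], intro conjI ballI)
  show "m \<in> M" by (rule m)
  show "m ~= \<zero>" using m z(1) M_closed(1) by auto
  fix x assume x: "x \<in> M"
  have "(z\<otimes>m)\<otimes>x = m\<otimes>(z\<otimes>x)" using z(1) m x M_D by (simp add: m_ac)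
  thus "\<exists>s\<in>D - M. \<exists>y\<in>D. s\<otimes>x = m\<otimes>y" using z(3) m x by auto
 qed
qed

text \<open>Otherwise choose a counterexample y with maximal principal local ideal. Then y \<in> M, so locally y = t z,
and z is again a counterexample; its ideal is larger because t is not a unit.\<close>

lemma order_exists:
 assumes t: "t \<in> M" "t ~= \<zero>" and u: "!!x. x \<in> M ==> \<exists>s\<in>D - M. \<exists>y\<in>D. s\<otimes>x = t\<otimes>y"
  and x: "x \<in> D" "x ~= \<zero>"
 shows "\<exists>n::nat. \<exists>s\<in>D - M. \<exists>w\<in>D - M. s\<otimes>x = w\<otimes>t [^] n"
proof (rule ccontr)
 define good where "good x \<longleftrightarrow> (\<exists>n::nat. \<exists>s\<in>D - M. \<exists>w\<in>D - M. s\<otimes>x = w\<otimes>t [^] n)" for x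
 assume "\<not> ?thesis"
 hence bad: "\<not> good x" unfolding good_def .
 have tD: "t \<in> D" using t M_D by auto
 define I where "I y = {d \<in> D. \<exists>s\<in>D - M. \<exists>c\<in>D. s\<otimes>d = c\<otimes>y}" for y
 have I: "submod D (I y)" if y: "y \<in> D" for y unfolding submod_def
 proof (intro conjI ballI)
  show "I y \<subseteq> carrier R" unfolding I_def by auto
  have "\<exists>s\<in>D - M. \<exists>c\<in>D. s\<otimes>\<zero> = c\<otimes>y" by (rule bexI[of _ \<one>], rule bexI[of _ \<zero>]) (use y M_one in auto)
  thus "\<zero> \<in> I y" unfolding I_def by simp
 next
  fix p q assume "p \<in> I y" "q \<in> I y"
  then obtain s s' c c' where *: "p \<in> D" "q \<in> D" "s \<in> D - M" "s' \<in> D - M" "c \<in> D" "c' \<in> D"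
   "s\<otimes>p = c\<otimes>y" "s'\<otimes>q = c'\<otimes>y" unfolding I_def by auto
  have cc: "p \<in> carrier R" "q \<in> carrier R" "s \<in> carrier R" "s' \<in> carrier R" "c \<in> carrier R" "c' \<in> carrier R" "y \<in> carrier R"
   using * y by auto
  have "(s\<otimes>s')\<otimes>(p \<oplus> q) = s'\<otimes>(s\<otimes>p) \<oplus> s\<otimes>(s'\<otimes>q)" using cc by algebra
  also have "\<dots> = (s'\<otimes>c \<oplus> s\<otimes>c')\<otimes>y" unfolding *(7,8) using cc by algebra
  finally show "p \<oplus> q \<in> I y" unfolding I_def using * DM_mult[OF *(3,4)]
   by (intro CollectI conjI bexI[of _ "s\<otimes>s'"] bexI[of _ "s'\<otimes>c \<oplus> s\<otimes>c'"]) auto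
 next
  fix d p assume d: "d \<in> D" and "p \<in> I y"
  then obtain s c where *: "p \<in> D" "s \<in> D - M" "c \<in> D" "s\<otimes>p = c\<otimes>y" unfolding I_def by auto
  have cc: "p \<in> carrier R" "d \<in> carrier R" "s \<in> carrier R" "c \<in> carrier R" "y \<in> carrier R" using * y d by auto
  have "s\<otimes>(d\<otimes>p) = d\<otimes>(s\<otimes>p)" using cc by algebra
  also have "\<dots> = (d\<otimes>c)\<otimes>y" unfolding * using cc by algebra
  finally show "d\<otimes>p \<in> I y" unfolding I_def using * d by (intro CollectI conjI bexI[of _ s] bexI[of _ "d\<otimes>c"]) auto
 qed
 define A where "A = {I y | y. y \<in> D & y ~= \<zero> & \<not> good y}"
 have "A ~= {}" unfolding A_def using x bad by auto
 hence "\<exists>U\<in>A. \<forall>V\<in>A. U \<subseteq> V --> V = U"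
 proof (rule noeth_maximal_ideal[OF D noeth])
  fix U assume "U \<in> A"
  then obtain b where "b \<in> D" "U = I b" unfolding A_def by auto
  thus "submod D U & U \<subseteq> D" using I unfolding I_def by auto
 qed
 then obtain U where U: "U \<in> A" "\<forall>V\<in>A. U \<subseteq> V --> V = U" by (rule bexE)
 obtain y where y0: "U = I y" and y: "y \<in> D" "y ~= \<zero>" "\<not> good y" using U(1) unfolding A_def by auto
 have mxy: "I z = I y" if "z \<in> D" "z ~= \<zero>" "\<not> good z" "I y \<subseteq> I z" for z
 proof -
  have "I z \<in> A" unfolding A_def using that(1,2,3) by auto
  thus ?thesis using U(2) that(4) y0 by simp
 qed
 have "y \<in> M"
 proof (rule ccontr)
  assume "y \<notin> M"
  hence "good y" unfolding good_def using y M_one by (intro exI[of _ 0] bexI[of _ \<one>] bexI[of _ y]) auto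
  thus False using y by simp
 qed
 then obtain s z where s: "s \<in> D - M" "z \<in> D" "s\<otimes>y = t\<otimes>z" using u[OF \<open>y \<in> M\<close>] by blast
 have sc: "s \<in> carrier R" "z \<in> carrier R" "y \<in> carrier R" "t \<in> carrier R" using s y tD by auto
 have z0: "z ~= \<zero>" using s y sc DM_nonzero[OF s(1)] integral_iff[of s y] by auto
 have "\<not> good z"
 proof
  assume "good z"
  then obtain n :: nat and s' w where w: "s' \<in> D - M" "w \<in> D - M" "s'\<otimes>z = w\<otimes>t [^] n" unfolding good_def by auto
  have c: "s' \<in> carrier R" "w \<in> carrier R" "t [^] n \<in> carrier R" using w sc by auto
  have "(s'\<otimes>s)\<otimes>y = s'\<otimes>(s\<otimes>y)" using sc c by (simp add: m_assoc)
  also have "\<dots> = t\<otimes>(s'\<otimes>z)" unfolding s(3) using sc c by (simp add: m_lcomm)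
  also have "\<dots> = w\<otimes>t [^] Suc n" unfolding w(3) using sc c by (simp add: m_ac)
  finally have "good y" unfolding good_def using DM_mult[OF w(1) s(1)] w(2)
   by (intro exI[of _ "Suc n"] bexI[of _ "s'\<otimes>s"] bexI[of _ w]) auto
  thus False using y by simp
 qed
 moreover have "I y \<subseteq> I z"
 proof
  fix d assume "d \<in> I y"
  then obtain r c where *: "d \<in> D" "r \<in> D - M" "c \<in> D" "r\<otimes>d = c\<otimes>y" unfolding I_def by auto
  have cc: "r \<in> carrier R" "c \<in> carrier R" "d \<in> carrier R" using * by auto
  have "(s\<otimes>r)\<otimes>d = s\<otimes>(r\<otimes>d)" using sc cc by (simp add: m_assoc)
  also have "\<dots> = c\<otimes>(s\<otimes>y)" unfolding *(4) using sc cc by (simp add: m_lcomm)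
  also have "\<dots> = (c\<otimes>t)\<otimes>z" unfolding s(3) using sc cc by (simp add: m_assoc)
  finally show "d \<in> I z" unfolding I_def using * DM_mult[OF s(1) *(2)] tD
   by (intro CollectI conjI bexI[of _ "s\<otimes>r"] bexI[of _ "c\<otimes>t"]) auto
 qed
 ultimately have "I z = I y" using mxy s(2) z0 by auto
 moreover have "z \<in> I z" unfolding I_def using s(2) M_one by (intro CollectI conjI bexI[of _ \<one>] bexI[of _ \<one>]) auto
 ultimately obtain r c where *: "r \<in> D - M" "c \<in> D" "r\<otimes>z = c\<otimes>y" unfolding I_def by auto
 have cc: "r \<in> carrier R" "c \<in> carrier R" using * by auto
 have "(s\<otimes>r)\<otimes>z = s\<otimes>(r\<otimes>z)" using sc cc by (simp add: m_assoc)
 also have "\<dots> = c\<otimes>(s\<otimes>y)" unfolding *(3) using sc cc by (simp add: m_lcomm)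
 also have "\<dots> = (c\<otimes>t)\<otimes>z" unfolding s(3) using sc cc by (simp add: m_assoc)
 finally have "s\<otimes>r = c\<otimes>t" using m_rcancel[OF z0] sc cc by auto
 moreover have "c\<otimes>t \<in> M" using M_closed *(2) t by auto
 ultimately show False using DM_mult[OF s(1) *(1)] by auto
qed

text \<open>Every non-zero x \<in> K is t^{n-m} times a quotient of elements outside M; \<open>rel x n m\<close> records
this, and the value is n - m.\<close>

lemma place_exists:
 assumes ne: "M ~= {\<zero>}"
 shows "\<exists>v. place K D M v"
proof -
 obtain t where t: "t \<in> M" "t ~= \<zero>" and u: "!!x. x \<in> M ==> \<exists>s\<in>D - M. \<exists>y\<in>D. s\<otimes>x = t\<otimes>y" using uniformizer[OF ne] by auto
 have tD: "t \<in> D" and tc: "t \<in> carrier R" using t M_D by auto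
 have tpM: "t [^] n \<in> M" if "n > 0" for n :: nat using that by (cases n) (auto simp: M_closed(3) tD t)
 define rel where "rel x n m \<longleftrightarrow> (\<exists>s\<in>D - M. \<exists>w\<in>D - M. (s\<otimes>x)\<otimes>t [^] m = w\<otimes>t [^] n)" for x and n m :: nat
 have uniq: "a = b" if ab: "p \<in> D - M" "q \<in> D - M" "p\<otimes>t [^] a = q\<otimes>t [^] b" for p q and a b :: nat
 proof -
  have *: "\<not> a < b" if ab: "p \<in> D - M" "q \<in> D - M" "p\<otimes>t [^] a = q\<otimes>t [^] b" for p q and a b :: nat
  proof
   assume "a < b"
   then obtain k where k: "b = k + a" "k > 0" by (metis add.commute less_imp_add_positive)
   have c: "p \<in> carrier R" "q \<in> carrier R" using ab by auto
   have "p\<otimes>t [^] a = (q\<otimes>t [^] k)\<otimes>t [^] a" using ab(3) k c tc by (simp add: nat_pow_mult[symmetric] m_assoc)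
   hence "p = q\<otimes>t [^] k" using m_rcancel[of "t [^] a" p "q\<otimes>t [^] k"] c tc t(2) by auto
   moreover have "q\<otimes>t [^] k \<in> M" using M_closed ab tpM[OF k(2)] by auto
   ultimately show False using ab by auto
  qed
  show ?thesis using *[OF ab] *[OF ab(2,1) ab(3)[symmetric]] by simp
 qed
 have well: "int n - int m = int n' - int m'" if r: "rel x n m" "rel x n' m'" and x: "x \<in> carrier R" for x n m n' m'
 proof -
  obtain s w where 1: "s \<in> D - M" "w \<in> D - M" "(s\<otimes>x)\<otimes>t [^] m = w\<otimes>t [^] n" using r(1) unfolding rel_def by auto
  obtain s' w' where 2: "s' \<in> D - M" "w' \<in> D - M" "(s'\<otimes>x)\<otimes>t [^] m' = w'\<otimes>t [^] n'" using r(2) unfolding rel_def by auto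
  have c: "s \<in> carrier R" "s' \<in> carrier R" "w \<in> carrier R" "w' \<in> carrier R" "t [^] m \<in> carrier R" "t [^] m' \<in> carrier R"
    "t [^] n \<in> carrier R" "t [^] n' \<in> carrier R" using 1 2 tc by auto
  have "(s'\<otimes>w)\<otimes>(t [^] n\<otimes>t [^] m') = (s'\<otimes>t [^] m')\<otimes>(w\<otimes>t [^] n)" using c by algebra
  also have "\<dots> = (s\<otimes>t [^] m)\<otimes>((s'\<otimes>x)\<otimes>t [^] m')" unfolding 1(3)[symmetric] using c x by algebra
  also have "\<dots> = (s\<otimes>w')\<otimes>(t [^] n'\<otimes>t [^] m)" unfolding 2(3) using c by algebra
  finally have "(s'\<otimes>w)\<otimes>t [^] (n + m') = (s\<otimes>w')\<otimes>t [^] (n' + m)" using tc by (simp add: nat_pow_mult)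
  hence "n + m' = n' + m" using uniq[OF DM_mult[OF 2(1) 1(2)] DM_mult[OF 1(1) 2(2)]] by simp
  thus ?thesis by simp
 qed
 have ex: "\<exists>n m. rel x n m" if x: "x \<in> K" "x ~= \<zero>" for x
 proof -
  obtain a b where ab: "a \<in> D" "b \<in> D" "b ~= \<zero>" "b\<otimes>x = a" using frac x by blast
  have a0: "a ~= \<zero>" using ab x integral_iff[of b x] by auto
  obtain n :: nat and s w where 1: "s \<in> D - M" "w \<in> D - M" "s\<otimes>a = w\<otimes>t [^] n" using order_exists[OF t u ab(1) a0] by blast
  obtain m :: nat and s' w' where 2: "s' \<in> D - M" "w' \<in> D - M" "s'\<otimes>b = w'\<otimes>t [^] m" using order_exists[OF t u ab(2,3)] by blast
  have c: "s \<in> carrier R" "s' \<in> carrier R" "w \<in> carrier R" "w' \<in> carrier R" "t [^] m \<in> carrier R" 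
    "t [^] n \<in> carrier R" "a \<in> carrier R" "b \<in> carrier R" "x \<in> carrier R" using 1 2 tc ab x by auto
  have "((s\<otimes>w')\<otimes>x)\<otimes>t [^] m = (s\<otimes>x)\<otimes>(s'\<otimes>b)" unfolding 2(3) using c by algebra
  also have "\<dots> = s'\<otimes>(s\<otimes>(b\<otimes>x))" using c by algebra
  also have "\<dots> = (s'\<otimes>w)\<otimes>t [^] n" unfolding ab(4) 1(3) using c by algebra
  finally show ?thesis unfolding rel_def using DM_mult[OF 1(1) 2(2)] DM_mult[OF 2(1) 1(2)] by blast
 qed
 define v where "v x = (SOME k. \<exists>n m. rel x n m & k = int n - int m)" for x
 have v: "v x = int n - int m" if "rel x n m" "x \<in> carrier R" for x n m
 proof -
  have "\<exists>n' m'. rel x n' m' & v x = int n' - int m'" unfolding v_def using that(1) by (rule_tac someI_ex) blast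
  thus ?thesis using well[OF that(1) _ that(2)] by auto
 qed
 have "place K D M v" unfolding place_def
 proof (intro conjI ballI impI)
  fix x y assume xy: "x \<in> K - {\<zero>}" "y \<in> K - {\<zero>}"
  obtain n m where r: "rel x n m" using ex xy by blast
  obtain n' m' where r': "rel y n' m'" using ex xy by blast
  obtain s w where 1: "s \<in> D - M" "w \<in> D - M" "(s\<otimes>x)\<otimes>t [^] m = w\<otimes>t [^] n" using r unfolding rel_def by auto
  obtain s' w' where 2: "s' \<in> D - M" "w' \<in> D - M" "(s'\<otimes>y)\<otimes>t [^] m' = w'\<otimes>t [^] n'" using r' unfolding rel_def by auto
  have c: "s \<in> carrier R" "s' \<in> carrier R" "w \<in> carrier R" "w' \<in> carrier R" "t [^] m \<in> carrier R" "t [^] m' \<in> carrier R"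
    "t [^] n \<in> carrier R" "t [^] n' \<in> carrier R" "x \<in> carrier R" "y \<in> carrier R" using 1 2 tc xy by auto
  have vx: "v x = int n - int m" "v y = int n' - int m'" using v r r' c by auto
  have "((s\<otimes>s')\<otimes>(x\<otimes>y))\<otimes>(t [^] m\<otimes>t [^] m') = ((s\<otimes>x)\<otimes>t [^] m)\<otimes>((s'\<otimes>y)\<otimes>t [^] m')" using c by algebra
  also have "\<dots> = (w\<otimes>w')\<otimes>(t [^] n\<otimes>t [^] n')" unfolding 1 2 using c by algebra
  finally have "rel (x\<otimes>y) (n + n') (m + m')" unfolding rel_def using DM_mult[OF 1(1) 2(1)] DM_mult[OF 1(2) 2(2)] tc
   by (intro bexI[of _ "s\<otimes>s'"] bexI[of _ "w\<otimes>w'"]) (simp_all add: nat_pow_mult)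
  thus "v (x\<otimes>y) = v x + v y" using v[of "x\<otimes>y"] c vx by auto
  have cmp: "min (v x) (v y) \<le> v (x \<oplus> y)" if *: "n + m' \<le> n' + m" "x \<oplus> y ~= \<zero>"
    "s \<in> D - M" "w \<in> D - M" "(s\<otimes>x)\<otimes>t [^] m = w\<otimes>t [^] n" 
    "s' \<in> D - M" "w' \<in> D - M" "(s'\<otimes>y)\<otimes>t [^] m' = w'\<otimes>t [^] n'"
    "v x = int n - int m" "v y = int n' - int m'" "x \<in> carrier R" "y \<in> carrier R"
   for x y n m s w n' m' s' w'
  proof -
   obtain k where k: "n' + m = k + (n + m')" using *(1) by (metis add.commute le_Suc_ex)
   have c: "s \<in> carrier R" "s' \<in> carrier R" "w \<in> carrier R" "w' \<in> carrier R" "t [^] m \<in> carrier R" "t [^] m' \<in> carrier R"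
    "t [^] n \<in> carrier R" "t [^] n' \<in> carrier R" "t [^] k \<in> carrier R" using * tc by auto
   have "((s\<otimes>s')\<otimes>(x \<oplus> y))\<otimes>t [^] (m + m') = ((s\<otimes>s')\<otimes>(x \<oplus> y))\<otimes>(t [^] m\<otimes>t [^] m')" using tc by (simp add: nat_pow_mult)
   also have "\<dots> = (s'\<otimes>t [^] m')\<otimes>((s\<otimes>x)\<otimes>t [^] m) \<oplus> (s\<otimes>t [^] m)\<otimes>((s'\<otimes>y)\<otimes>t [^] m')" using c *(11,12) by algebra
   also have "\<dots> = (s'\<otimes>w)\<otimes>(t [^] n\<otimes>t [^] m') \<oplus> (s\<otimes>w')\<otimes>(t [^] n'\<otimes>t [^] m)" unfolding *(5,8) using c by algebra
   also have "\<dots> = (s'\<otimes>w)\<otimes>t [^] (n + m') \<oplus> (s\<otimes>w')\<otimes>(t [^] k\<otimes>t [^] (n + m'))" using tc k by (simp add: nat_pow_mult)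
   also have "\<dots> = (s'\<otimes>w \<oplus> s\<otimes>w'\<otimes>t [^] k)\<otimes>t [^] (n + m')" using c tc by (simp add: l_distr m_assoc)
   finally have eq: "((s\<otimes>s')\<otimes>(x \<oplus> y))\<otimes>t [^] (m + m') = (s'\<otimes>w \<oplus> s\<otimes>w'\<otimes>t [^] k)\<otimes>t [^] (n + m')" .
   let ?b = "s'\<otimes>w \<oplus> s\<otimes>w'\<otimes>t [^] k"
   have bD: "?b \<in> D" using * tD by auto
   have ss: "s ~= \<zero>" "s' ~= \<zero>" using DM_nonzero[OF *(3)] DM_nonzero[OF *(6)] by auto
   have "((s\<otimes>s')\<otimes>(x \<oplus> y))\<otimes>t [^] (m + m') ~= \<zero>" using ss *(2,11,12) c tc t(2) by (simp add: integral_iff)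
   hence b0: "?b ~= \<zero>" using eq tc by auto
   obtain l :: nat and p q where pq: "p \<in> D - M" "q \<in> D - M" "p\<otimes>?b = q\<otimes>t [^] l" using order_exists[OF t u bD b0] by blast
   have pc: "p \<in> carrier R" "q \<in> carrier R" "?b \<in> carrier R" "x \<oplus> y \<in> carrier R" using pq bD *(11,12) by auto
   have "((p\<otimes>(s\<otimes>s'))\<otimes>(x \<oplus> y))\<otimes>t [^] (m + m') = p\<otimes>(((s\<otimes>s')\<otimes>(x \<oplus> y))\<otimes>t [^] (m + m'))"
    using pc c tc by (simp add: m_assoc)
   also have "\<dots> = (p\<otimes>?b)\<otimes>t [^] (n + m')" unfolding eq using pc tc by (simp add: m_assoc)
   also have "\<dots> = q\<otimes>t [^] (l + (n + m'))" unfolding pq(3) using pc tc by (simp add: m_assoc nat_pow_mult)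
   finally have "rel (x \<oplus> y) (l + (n + m')) (m + m')" unfolding rel_def
    using DM_mult[OF pq(1) DM_mult[OF *(3,6)]] pq(2) by (intro bexI)
   hence "v (x \<oplus> y) = int (l + (n + m')) - int (m + m')" using v pc(4) by simp
   thus ?thesis using *(9,10) by simp
  qed
  assume nz: "x \<oplus> y ~= \<zero>"
  show "min (v x) (v y) \<le> v (x \<oplus> y)"
  proof (cases "n + m' \<le> n' + m")
   case True thus ?thesis using cmp[OF True nz 1 2 vx c(9,10)] by simp
  next
   case False
   hence "n' + m \<le> n + m'" by simp
   from cmp[OF this _ 2 1 vx(2,1) c(10,9)] nz show ?thesis using c by (simp add: a_comm min.commute)
  qed
 next
  have "rel t 1 0" unfolding rel_def using M_one tc by (intro bexI[of _ \<one>]) auto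
  hence "v t = 1" using v tc by auto
  thus "\<exists>t\<in>D - {\<zero>}. v t = 1" using tD t by auto
 next
  fix x assume x: "x \<in> D - {\<zero>}"
  then obtain n :: nat and s w where 1: "s \<in> D - M" "w \<in> D - M" "s\<otimes>x = w\<otimes>t [^] n" using order_exists[OF t u] by blast
  hence "rel x n 0" unfolding rel_def using x tc by (rule_tac bexI[of _ s], rule_tac bexI[of _ w]) auto
  hence vx: "v x = int n" using v x by auto
  thus "0 \<le> v x" by simp
  show "x \<in> M \<longleftrightarrow> 0 < v x"
  proof
   assume "x \<in> M"
   hence "w\<otimes>t [^] n \<in> M" using 1 M_closed(3)[of s x] by auto
   hence "n ~= 0" using 1 by (cases n) auto
   thus "0 < v x" using vx by simp
  next
   assume "0 < v x"
   hence "t [^] n \<in> M" using vx tpM by simp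
   hence "s\<otimes>x \<in> M" using 1 M_closed(3) by auto
   thus "x \<in> M" using M_prime 1(1) x by auto
  qed
 next
  fix x assume x: "x \<in> K - {\<zero>}" and v0: "0 \<le> v x"
  obtain n m where r: "rel x n m" using ex x by blast
  obtain s w where 1: "s \<in> D - M" "w \<in> D - M" "(s\<otimes>x)\<otimes>t [^] m = w\<otimes>t [^] n" using r unfolding rel_def by auto
  have "n \<ge> m" using v[OF r] v0 x by simp
  then obtain k where k: "n = k + m" by (metis add.commute le_Suc_ex)
  have c: "s \<in> carrier R" "w \<in> carrier R" "x \<in> carrier R" using 1 x by auto
  have "(s\<otimes>x)\<otimes>t [^] m = (w\<otimes>t [^] k)\<otimes>t [^] m" using 1(3) k c tc by (simp add: nat_pow_mult[symmetric] m_assoc)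
  hence "s\<otimes>x = w\<otimes>t [^] k" using m_rcancel[of "t [^] m"] c tc t(2) by auto
  moreover have "w\<otimes>t [^] k \<in> D" using 1 tD by auto
  ultimately show "\<exists>s\<in>D - M. s\<otimes>x \<in> D" using 1(1) by (intro bexI[of _ s]) auto
 qed
 thus ?thesis by blast
qed

end

end

section \<open>Calculus of valuations, approximation, and local comparison of ideals\<close>

text \<open>The relation v(x) \<ge> k with the convention v(0) = \<infinity>.\<close>

definition (in cring) vge :: "('a => int) => 'a => int => bool" where
 "vge v x k \<longleftrightarrow> x = \<zero> \<or> k \<le> v x"

context dedekind
begin

context
 fixes M v assumes v: "place K D M v"
begin

lemma v_mult: "x \<in> K ==> x ~= \<zero> ==> y \<in> K ==> y ~= \<zero> ==> v (x\<otimes>y) = v x + v y" using v unfolding place_def by simp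

lemma v_add: "x \<in> K ==> x ~= \<zero> ==> y \<in> K ==> y ~= \<zero> ==> x \<oplus> y ~= \<zero> ==> min (v x) (v y) \<le> v (x \<oplus> y)" using v unfolding place_def by simp

lemma v_uniformizer: "\<exists>t\<in>D. t ~= \<zero> & v t = 1" using v unfolding place_def by auto

lemma v_D: "x \<in> D ==> x ~= \<zero> ==> 0 \<le> v x" using v unfolding place_def by simp

lemma v_M: "x \<in> D ==> x ~= \<zero> ==> x \<in> M \<longleftrightarrow> 0 < v x" using v unfolding place_def by simp

lemma v_loc: "x \<in> K ==> x ~= \<zero> ==> 0 \<le> v x ==> \<exists>s\<in>D - M. s\<otimes>x \<in> D" using v unfolding place_def by simp

lemma v_unit: "x \<in> D ==> x ~= \<zero> ==> x \<notin> M ==> v x = 0" using v_D[of x] v_M[of x] by simp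

lemma v_one: "v \<one> = 0" using v_mult[of \<one> \<one>] by simp

lemma v_minus: "x \<in> K ==> v (\<ominus> x) = v x"
proof (cases "x = \<zero>")
 case False
 assume x: "x \<in> K"
 have m: "\<ominus> \<one> ~= \<zero>" using one_not_zero by (metis local.minus_zero minus_minus one_closed)
 have "(\<ominus> \<one>)\<otimes>(\<ominus> \<one>) = \<one>" by (simp add: l_minus)
 hence "v (\<ominus> \<one>) + v (\<ominus> \<one>) = 0" using v_mult[of "\<ominus> \<one>" "\<ominus> \<one>"] m v_one by simp
 moreover have "v ((\<ominus> \<one>)\<otimes>x) = v (\<ominus> \<one>) + v x" using v_mult[of "\<ominus> \<one>" x] m x False by simp
 moreover have "(\<ominus> \<one>)\<otimes>x = \<ominus> x" using x by (simp add: l_minus)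
 ultimately show ?thesis by simp
qed simp

lemma v_inv: "x \<in> K ==> x ~= \<zero> ==> v (inv x) = - v x"
proof -
 assume x: "x \<in> K" "x ~= \<zero>"
 have "inv x ~= \<zero>"
 proof
  assume "inv x = \<zero>"
  hence "x\<otimes>\<zero> = \<one>" using cinv(2)[of x] x by simp
  thus False using x by simp
 qed
 hence "v (x\<otimes>inv x) = v x + v (inv x)" using v_mult[of x "inv x"] x by (simp del: cinv)
 thus ?thesis using x v_one by simp
qed

lemma v_pow: "x \<in> K ==> x ~= \<zero> ==> v (x [^] (n::nat)) = int n * v x" by (induct n) (simp_all add: v_one v_mult algebra_simps)

lemma vge_zero: "vge v \<zero> k" unfolding vge_def by simp

lemma vge_mono: "vge v x k ==> l \<le> k ==> vge v x l" unfolding vge_def by auto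

lemma vge_D: "x \<in> D ==> vge v x 0" unfolding vge_def using v_D by auto

lemma vge_add:
 assumes "x \<in> K" "y \<in> K" "vge v x k" "vge v y k"
 shows "vge v (x \<oplus> y) k"
proof (cases "x = \<zero> \<or> y = \<zero> \<or> x \<oplus> y = \<zero>")
 case True thus ?thesis using assms unfolding vge_def by auto
next
 case False thus ?thesis using assms v_add[of x y] unfolding vge_def by auto
qed

lemma vge_minus: "x \<in> K ==> vge v x k ==> vge v (\<ominus> x) k" unfolding vge_def using v_minus by auto

lemma vge_diff: "x \<in> K ==> y \<in> K ==> vge v x k ==> vge v y k ==> vge v (x \<ominus> y) k" unfolding a_minus_def using vge_add vge_minus by simp

lemma vge_mult:
 assumes "x \<in> K" "y \<in> K" "vge v x k" "vge v y l"
 shows "vge v (x\<otimes>y) (k + l)"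
proof (cases "x = \<zero> \<or> y = \<zero>")
 case True thus ?thesis using assms unfolding vge_def by auto
next
 case False thus ?thesis using assms v_mult[of x y] unfolding vge_def by auto
qed

lemma v_add_eq:
 assumes x: "x \<in> K" "x ~= \<zero>" and y: "y \<in> K" "vge v y (v x + 1)"
 shows "x \<oplus> y ~= \<zero>" "v (x \<oplus> y) = v x"
proof -
 have e: "x = (x \<oplus> y) \<ominus> y" using x(1) y(1) by (simp add: a_minus_def a_assoc r_neg)
 have small: "\<not> vge v (x \<oplus> y) (v x + 1)"
 proof
  assume "vge v (x \<oplus> y) (v x + 1)"
  hence "vge v x (v x + 1)" using vge_diff[of "x \<oplus> y" y "v x + 1"] x y e by simp
  thus False using x unfolding vge_def by simp
 qed
 thus "x \<oplus> y ~= \<zero>" unfolding vge_def by auto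
 have "vge v (x \<oplus> y) (v x)" using vge_add[of x y "v x"] vge_mono[OF y(2)] x y unfolding vge_def by simp
 thus "v (x \<oplus> y) = v x" using small \<open>x \<oplus> y ~= \<zero>\<close> unfolding vge_def by simp
qed

lemma M_vge:
 assumes "mx D M" "x \<in> D" shows "x \<in> M \<longleftrightarrow> vge v x 1"
 using v_M[of x] assms M_closed(1)[OF assms(1)] unfolding vge_def by (cases "x = \<zero>") auto

end

definition vl :: "'a set => 'a => int" where
 "vl M = (SOME v. place K D M v)"

abbreviation mxn :: "'a set => bool" where "mxn M \<equiv> mx D M & M ~= {\<zero>}"

lemma place_vl: "mxn M ==> place K D M (vl M)" unfolding vl_def using place_exists someI_ex[of "place K D M"] by simp

lemma mx_incl_eq:
 assumes "mx D M" "mx D P" "!!x. x \<in> M ==> x \<in> P" shows "M = P"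
proof (rule equalityI; rule subsetI)
 fix x assume x: "x \<in> P"
 show "x \<in> M"
 proof (rule ccontr)
  assume "x \<notin> M"
  then obtain d where d: "d \<in> D" "\<one> \<ominus> d\<otimes>x \<in> M" using M_max[OF assms(1)] M_D[OF assms(2) x] by blast
  hence "(\<one> \<ominus> d\<otimes>x) \<oplus> d\<otimes>x \<in> P" using assms(3) M_closed[OF assms(2)] x by simp
  moreover have "(\<one> \<ominus> d\<otimes>x) \<oplus> d\<otimes>x = \<one>"
  proof -
   have c: "d \<in> carrier R" "x \<in> carrier R" using d M_D[OF assms(2) x] by auto
   thus ?thesis by algebra
  qed
  ultimately show False using M_one[OF assms(2)] by simp
 qed
qed (rule assms(3))

text \<open>A product of c-th powers of elements of M - P, one for each M \<in> A.\<close>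

lemma avoiding_element:
 assumes "finite A" "!!M. M \<in> A ==> mxn M" "mx D P" "P \<notin> A"
 shows "\<exists>z\<in>D - P. \<forall>M\<in>A. int c \<le> vl M z" using assms
proof (induct A rule: finite_induct)
 case empty thus ?case using M_one by (intro bexI[of _ \<one>]) auto
next
 case (insert M A)
 then obtain z where z: "z \<in> D - P" "!!M. M \<in> A ==> int c \<le> vl M z" by auto
 have M: "mxn M" and P: "mx D P" using insert by auto
 have "\<exists>y. y \<in> M & y \<notin> P"
 proof (rule ccontr)
  assume "\<not> ?thesis"
  hence "M = P" using mx_incl_eq M P by simp
  thus False using insert by simp
 qed
 then obtain y where y: "y \<in> M" "y \<notin> P" by auto
 have yD: "y \<in> D - P" using y M_D M by auto
 have y0: "y ~= \<zero>" using DM_nonzero[OF P yD] .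
 have ypow: "y [^] n \<in> D - P" for n :: nat by (induct n) (use DM_mult[OF P _ yD] M_one[OF P] in simp_all)
 have z0: "z ~= \<zero>" using DM_nonzero[OF P z(1)] .
 have zy: "vl N (z\<otimes>y [^] c) = vl N z + int c * vl N y" if "mxn N" for N
  using v_mult[OF place_vl[OF that]] v_pow[OF place_vl[OF that]] z z0 yD y0 D_K by simp
 show ?case
 proof (rule bexI[of _ "z\<otimes>y [^] c"], rule ballI)
  show "z\<otimes>y [^] c \<in> D - P" using DM_mult[OF P z(1) ypow] .
  fix N assume N: "N \<in> insert M A"
  hence mN: "mxn N" using insert(4) by simp
  note pN = place_vl[OF mN]
  show "int c \<le> vl N (z\<otimes>y [^] c)"
  proof (cases "N = M")
   case True
   have "1 \<le> vl N y" using v_M[OF pN, of y] y yD y0 True by simp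
   hence "int c \<le> int c * vl N y" using mult_left_mono[of 1 "vl N y" "int c"] by simp
   moreover have "0 \<le> vl N z" using v_D[OF pN] z z0 by simp
   ultimately show ?thesis using zy[OF mN] by simp
  next
   case False
   have "int c \<le> vl N z" using z(2) N False by simp
   moreover have "0 \<le> int c * vl N y" using v_D[OF pN] yD y0 by simp
   ultimately show ?thesis using zy[OF mN] by simp
  qed
 qed
qed

text \<open>One summand for each prime P: it has the prescribed value at P and larger values than prescribed at the
others.\<close>

lemma approximation:
 assumes A: "finite A" "A ~= {}" "!!M. M \<in> A ==> mxn M"
 shows "\<exists>x\<in>D. x ~= \<zero> & (\<forall>M\<in>A. vl M x = int (k M))"
proof -
 define c where "c = Suc (\<Sum>M\<in>A. k M)"
 have kc: "k M < c" if "M \<in> A" for M unfolding c_def using member_le_sum[OF that, of k] A(1) by simp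
 have single: "\<exists>x\<in>D. x ~= \<zero> & vl P x = int (k P) & (\<forall>M\<in>A - {P}. int (k M) + 1 \<le> vl M x)" if P: "P \<in> A" for P
 proof -
  have mP: "mxn P" using A P by simp
  note pP = place_vl[OF mP]
  obtain t where t: "t \<in> D" "t ~= \<zero>" "vl P t = 1" using v_uniformizer[OF pP] by auto
  obtain z where z: "z \<in> D - P" "!!M. M \<in> A - {P} ==> int c \<le> vl M z" using avoiding_element[of "A - {P}" P c] A mP by auto
  have z0: "z ~= \<zero>" using DM_nonzero z(1) mP by blast
  have e: "vl M (t [^] k P\<otimes>z) = int (k P) * vl M t + vl M z" if "mxn M" for M
   using v_mult[OF place_vl[OF that]] v_pow[OF place_vl[OF that]] z(1) z0 t D_K by simp
  show ?thesis
  proof (rule bexI[of _ "t [^] k P\<otimes>z"], intro conjI ballI)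
   show "t [^] k P\<otimes>z \<in> D" using t z(1) by simp
   show "t [^] k P\<otimes>z ~= \<zero>" using t z(1) z0 by (simp add: integral_iff)
   show "vl P (t [^] k P\<otimes>z) = int (k P)" using e[OF mP] t v_unit[OF pP, of z] z(1) z0 by simp
   fix M assume M: "M \<in> A - {P}"
   have "0 \<le> int (k P) * vl M t" using v_D[OF place_vl] A(3) M t by simp
   moreover have "int (k M) + 1 \<le> int c" using kc[of M] M by simp
   ultimately show "int (k M) + 1 \<le> vl M (t [^] k P\<otimes>z)" using e[of M] A(3) M z(2)[OF M] by simp
  qed
 qed
 have "\<exists>x\<in>D. (\<forall>M\<in>B. x ~= \<zero> & vl M x = int (k M)) & (\<forall>M\<in>A - B. vge (vl M) x (int (k M) + 1))"
  if "finite B" "B \<subseteq> A" for B using that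
 proof (induct B rule: finite_induct)
  case empty thus ?case by (intro bexI[of _ \<zero>]) (auto simp: vge_def)
 next
  case (insert P B)
  then obtain x where x: "x \<in> D" "!!M. M \<in> B ==> x ~= \<zero> & vl M x = int (k M)"
   "!!M. M \<in> A - B ==> vge (vl M) x (int (k M) + 1)" by auto
  obtain y where y: "y \<in> D" "y ~= \<zero>" "vl P y = int (k P)" "!!M. M \<in> A - {P} ==> int (k M) + 1 \<le> vl M y"
   using single[of P] insert by auto
  have K: "x \<in> K" "y \<in> K" using x y D_K by auto
  show ?case
  proof (rule bexI[of _ "y \<oplus> x"], rule conjI)
   show "y \<oplus> x \<in> D" using x y by simp
  next
   show "\<forall>M\<in>insert P B. y \<oplus> x ~= \<zero> & vl M (y \<oplus> x) = int (k M)"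
   proof (rule ballI)
   fix M assume M: "M \<in> insert P B"
   show "y \<oplus> x ~= \<zero> & vl M (y \<oplus> x) = int (k M)"
   proof (cases "M = P")
    case True
    thus ?thesis using v_add_eq[OF place_vl, of P y x] A(3) insert K y x by auto
   next
    case False
    hence MB: "M \<in> B" "M \<in> A - {P}" using M insert by auto
    have "vge (vl M) y (vl M x + 1)" using y(4)[OF MB(2)] x(2)[OF MB(1)] unfolding vge_def by simp
    hence "x \<oplus> y ~= \<zero> & vl M (x \<oplus> y) = vl M x" using v_add_eq[OF place_vl, of M x y] A(3) MB K x(2)[OF MB(1)] by auto
    thus ?thesis using x(2)[OF MB(1)] a_comm[of x y] K by simp
   qed
   qed
  next
   show "\<forall>M\<in>A - insert P B. vge (vl M) (y \<oplus> x) (int (k M) + 1)"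
   proof (rule ballI)
   fix M assume M: "M \<in> A - insert P B"
   show "vge (vl M) (y \<oplus> x) (int (k M) + 1)"
    using vge_add[OF place_vl, of M y x] A(3) M K x(3)[of M] y(4)[of M] unfolding vge_def by auto
   qed
  qed
 qed
 from this[OF A(1) order_refl] show ?thesis using A(2) by auto
qed

lemma submod_add_multiples:
 assumes P: "submod D P" "!!x. x \<in> P ==> x \<in> D" and x: "x \<in> D"
 shows "submod D {p \<oplus> d\<otimes>x | p d. p \<in> P & d \<in> D}" (is "submod D ?Q")
  "P \<subseteq> {p \<oplus> d\<otimes>x | p d. p \<in> P & d \<in> D}" "x \<in> {p \<oplus> d\<otimes>x | p d. p \<in> P & d \<in> D}"
proof -
 note S = submodD[OF P(1)]
 show "submod D ?Q" unfolding submod_def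
 proof (intro conjI ballI)
  show "?Q \<subseteq> carrier R" using P(2) x by auto
  have "\<zero> \<oplus> \<zero>\<otimes>x = \<zero>" using x by simp
  thus "\<zero> \<in> ?Q" using S(3) D_closed(1) by (metis (mono_tags, lifting) mem_Collect_eq)
 next
  fix y z assume "y \<in> ?Q" "z \<in> ?Q"
  then obtain p d q e where *: "p \<in> P" "d \<in> D" "y = p \<oplus> d\<otimes>x" "q \<in> P" "e \<in> D" "z = q \<oplus> e\<otimes>x" by auto
  have c: "p \<in> carrier R" "q \<in> carrier R" "d \<in> carrier R" "e \<in> carrier R" "x \<in> carrier R" using * P(2) x by auto
  have "y \<oplus> z = (p \<oplus> q) \<oplus> (d \<oplus> e)\<otimes>x" unfolding * using c by algebra
  thus "y \<oplus> z \<in> ?Q" using S(4)[OF *(1,4)] *(2,5) D_closed(5) by blast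
 next
  fix r y assume r: "r \<in> D" and "y \<in> ?Q"
  then obtain p d where *: "p \<in> P" "d \<in> D" "y = p \<oplus> d\<otimes>x" by auto
  have c: "p \<in> carrier R" "r \<in> carrier R" "d \<in> carrier R" "x \<in> carrier R" using * r P(2) x by auto
  have "r\<otimes>y = r\<otimes>p \<oplus> (r\<otimes>d)\<otimes>x" unfolding * using c by algebra
  thus "r\<otimes>y \<in> ?Q" using S(5)[OF r *(1)] *(2) r D_closed(4) by blast
 qed
 show "P \<subseteq> ?Q"
 proof
  fix p assume p: "p \<in> P"
  have "p = p \<oplus> \<zero>\<otimes>x" using p P(2) x by simp
  thus "p \<in> ?Q" using p D_closed(1) by blast
 qed
 have "x = \<zero> \<oplus> \<one>\<otimes>x" using x by simp
 thus "x \<in> ?Q" using S(3) D_closed(2) by blast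
qed

text \<open>An ideal maximal among those that contain A and avoid S is prime; noetherianity provides it.\<close>

lemma prime_avoiding:
 assumes A: "submod D A" "!!x. x \<in> A ==> x \<in> D"
  and S: "\<one> \<in> S" "!!x y. x \<in> S ==> y \<in> S ==> x\<otimes>y \<in> S" "!!x. x \<in> S ==> x \<in> D" "!!x. x \<in> S ==> x \<notin> A"
 shows "\<exists>P. pri D P & A \<subseteq> P & (\<forall>x\<in>S. x \<notin> P)"
proof -
 define F where "F = {P. submod D P & P \<subseteq> D & A \<subseteq> P & (\<forall>x\<in>S. x \<notin> P)}"
 have "A \<in> F" unfolding F_def using A S(4) by auto
 hence "F ~= {}" by auto
 hence "\<exists>U\<in>F. \<forall>V\<in>F. U \<subseteq> V --> V = U" by (rule noeth_maximal_ideal[OF D noeth]) (simp add: F_def)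
 then obtain P where P: "P \<in> F" "\<forall>V\<in>F. P \<subseteq> V --> V = P" by (rule bexE)
 have PF: "submod D P" "P \<subseteq> D" "A \<subseteq> P" "!!x. x \<in> S ==> x \<notin> P" using P(1) unfolding F_def by auto
 have PD: "!!x. x \<in> P ==> x \<in> D" using PF(2) by auto
 have meet: "\<exists>p\<in>P. \<exists>d\<in>D. p \<oplus> d\<otimes>x \<in> S" if x: "x \<in> D" "x \<notin> P" for x
 proof (rule ccontr)
  assume none: "\<not> ?thesis"
  let ?Q = "{p \<oplus> d\<otimes>x | p d. p \<in> P & d \<in> D}"
  note Q = submod_add_multiples[OF PF(1) PD x(1)]
  have "?Q \<subseteq> D" using PD x(1) by auto
  hence "?Q \<in> F" unfolding F_def using Q(1,2) PF(3) none by auto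
  hence "?Q = P" using P(2) Q(2) by simp
  thus False using Q(3) x(2) by simp
 qed
 have "pri D P" unfolding pri_def
 proof (intro conjI ballI impI)
  show "\<one> \<notin> P" using PF(4) S(1) by simp
  fix x y assume x: "x \<in> D" and y: "y \<in> D" and xy: "x\<otimes>y \<in> P"
  show "x \<in> P \<or> y \<in> P"
  proof (rule ccontr)
   assume "\<not> ?thesis"
   then obtain p d q e where *: "p \<in> P" "d \<in> D" "p \<oplus> d\<otimes>x \<in> S" "q \<in> P" "e \<in> D" "q \<oplus> e\<otimes>y \<in> S" using meet[OF x] meet[OF y] by blast
   have c: "p \<in> carrier R" "q \<in> carrier R" "d \<in> carrier R" "e \<in> carrier R" "x \<in> carrier R" "y \<in> carrier R" using * PD x y by auto
   have "(p \<oplus> d\<otimes>x)\<otimes>(q \<oplus> e\<otimes>y) = (q \<oplus> e\<otimes>y)\<otimes>p \<oplus> ((d\<otimes>x)\<otimes>q \<oplus> (d\<otimes>e)\<otimes>(x\<otimes>y))" using c by algebra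
   also have "\<dots> \<in> P" using submodD(4,5)[OF PF(1)] * x y xy PD by simp
   finally show False using S(2)[OF *(3,6)] PF(4) by simp
  qed
 qed (use PF in auto)
 thus ?thesis using PF(3,4) by blast
qed

text \<open>Otherwise the ideal of the d with dx \<in> J is proper, so contained in a prime P; but the local condition at
P gives such a d outside P.\<close>

lemma local_global:
 assumes J: "submod D J" "!!x. x \<in> J ==> x \<in> D" "J ~= {\<zero>}" and x: "x \<in> K" "x ~= \<zero>"
  and loc: "!!M. mxn M ==> \<exists>b\<in>J. b ~= \<zero> & vl M b \<le> vl M x"
 shows "x \<in> J"
proof (rule ccontr)
 assume xJ: "x \<notin> J"
 note S = submodD[OF J(1)]
 let ?A = "{d \<in> D. d\<otimes>x \<in> J}"
 have A: "submod D ?A" unfolding submod_def using S x(1) by (auto simp: l_distr m_assoc)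
 obtain b where b: "b \<in> J" "b ~= \<zero>" using J(3) S(3) by auto
 obtain a s where as: "a \<in> D" "s \<in> D" "s ~= \<zero>" "s\<otimes>x = a" using frac[OF x(1)] by blast
 have "(b\<otimes>s)\<otimes>x = a\<otimes>b" using as b x J(2)[OF b(1)] by (simp add: m_assoc m_comm[of b a])
 hence bs: "b\<otimes>s \<in> ?A" using S(5)[OF as(1) b(1)] as J(2)[OF b(1)] by simp
 have bs0: "b\<otimes>s ~= \<zero>" using as b J(2)[OF b(1)] by (simp add: integral_iff)
 have "\<exists>P. pri D P & ?A \<subseteq> P & (\<forall>x\<in>{\<one>}. x \<notin> P)" by (rule prime_avoiding[OF A]) (use xJ x in auto)
 then obtain P where P: "pri D P" "?A \<subseteq> P" by blast
 have Pne: "P ~= {\<zero>}" using P(2) bs bs0 by auto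
 hence mP: "mxn P" using dim1 P(1) by simp
 obtain c where c: "c \<in> J" "c ~= \<zero>" "vl P c \<le> vl P x" using loc[OF mP] by blast
 have cD: "c \<in> D" "c \<in> K" "c \<in> carrier R" using c J(2) D_K by auto
 let ?y = "x\<otimes>inv c"
 have yK: "?y \<in> K" using x cD c by simp
 have ic0: "inv c ~= \<zero>"
 proof
  assume "inv c = \<zero>"
  hence "c\<otimes>\<zero> = \<one>" using cinv(2)[OF cD(3) c(2)] by simp
  thus False using cD by simp
 qed
 have y0: "?y ~= \<zero>" using ic0 x c cD by (simp add: integral_iff)
 have "0 \<le> vl P ?y" using v_mult[OF place_vl[OF mP]] v_inv[OF place_vl[OF mP]] x c cD ic0 by simp
 then obtain s where s: "s \<in> D - P" "s\<otimes>?y \<in> D" using v_loc[OF place_vl[OF mP] yK y0] by blast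
 have "s\<otimes>x = (s\<otimes>?y)\<otimes>c" using s x c cD by (simp add: m_assoc)
 hence "s\<otimes>x \<in> J" using S(5)[OF s(2) c(1)] by simp
 hence "s \<in> P" using P(2) s by auto
 thus False using s by simp
qed

text \<open>The constant term of a shortest monic relation for x is non-zero and a multiple of x.\<close>

lemma integral_multiple_in_base:
 assumes x: "intg D x" "x ~= \<zero>"
 shows "\<exists>d\<in>D. d ~= \<zero> & (\<exists>y. intg D y & x\<otimes>y = d & (\<forall>E. subring E R --> D \<subseteq> E --> x \<in> E --> y \<in> E))"
proof -
 have xc: "x \<in> carrier R" using x unfolding intg_def by simp
 obtain p where "set p \<subseteq> D" "eval (\<one> # p) x = \<zero>" using intg_imp_monic[OF D noeth x(1)] by blast
 thus ?thesis
 proof (induct p rule: rev_induct)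
  case Nil thus ?case by simp
 next
  case (snoc c p)
  have cD: "c \<in> D" and pD: "set p \<subseteq> D" using snoc by auto
  have pc: "set (\<one> # p) \<subseteq> carrier R" using pD by auto
  let ?y = "eval (\<one> # p) x"
  have yc: "?y \<in> carrier R" using eval_in_carrier[OF pc xc] .
  have eq: "?y\<otimes>x \<oplus> c = \<zero>" using snoc(3) eval_snoc[OF pc, of c x] cD xc by simp
  show ?case
  proof (cases "c = \<zero>")
   case True
   hence "?y = \<zero>" using eq yc xc x(2) by (simp add: integral_iff)
   thus ?thesis using snoc(1) pD by simp
  next
   case False
   have E: "\<ominus> ?y \<in> E" if "subring E R" "D \<subseteq> E" "x \<in> E" for E
    using eval_in_subring[OF that(1), of "\<one> # p" x] subringE(5)[OF that(1)] subringE(3)[OF that(1)] pD that(2,3) by auto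
   have "D \<subseteq> {x. intg D x}" using intg_base[OF D] by auto
   hence 1: "intg D (\<ominus> ?y)" using E[OF intg_subring[OF D]] x(1) by simp
   have "x\<otimes>(\<ominus> ?y) = \<ominus> (?y\<otimes>x)" using xc yc by (simp add: r_minus m_comm)
   also have "\<dots> = c" using eq xc yc cD by (metis D_carr a_comm m_closed minus_equality)
   finally show ?thesis using 1 E cD False by blast
  qed
 qed
qed

text \<open>Dimension one is inherited by finite extensions: N meets D in a non-zero prime, which is maximal, and modulo N
an element x \<notin> N satisfies a monic relation over the field D / (N \<inter> D); the shortest one has an
invertible constant term.\<close>

lemma finite_extension_dim1:
 assumes E: "subring E R" "E = Span D ws" "set ws \<subseteq> carrier R" "!!x. x \<in> D ==> x \<in> E"
  and N: "pri E N" "N ~= {\<zero>}"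
 shows "mx E N" "mx D (N \<inter> D)" "N \<inter> D ~= {\<zero>}"
proof -
 have DE: "D \<subseteq> E" using E(4) by blast
 have NE: "submod E N" "!!x. x \<in> N ==> x \<in> E" "\<one> \<notin> N"
  "!!x y. x \<in> E ==> y \<in> E ==> x\<otimes>y \<in> N ==> x \<in> N \<or> y \<in> N" using N(1) unfolding pri_def by auto
 note S = submodD[OF NE(1)]
 note EE = subringE[OF E(1)]
 obtain x where x: "x \<in> N" "x ~= \<zero>" using N(2) S(3) by auto
 have ig: "!!x. x \<in> E ==> intg D x" using intg_of_finite[OF E(1-3)] .
 obtain d y where dy: "d \<in> D" "d ~= \<zero>" "x\<otimes>y = d" "y \<in> E"
  using integral_multiple_in_base[OF ig[OF NE(2)[OF x(1)]] x(2)] E(1) DE NE(2)[OF x(1)] by blast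
 have yc: "y \<in> carrier R" using dy(4) EE(1) by auto
 have "y\<otimes>x = d" using dy(3) S(2)[OF x(1)] yc m_comm by simp
 hence dN: "d \<in> N \<inter> D" using S(5)[OF dy(4) x(1)] dy(1) by simp
 thus ne: "N \<inter> D ~= {\<zero>}" using dy(2) by auto
 have "pri D (N \<inter> D)" unfolding pri_def
 proof (intro conjI ballI impI)
  show "submod D (N \<inter> D)" using submod_inter[OF submod_mono[OF NE(1) DE] submod_subring[OF D order_refl]] .
  fix x y assume "x \<in> D" "y \<in> D" "x\<otimes>y \<in> N \<inter> D"
  thus "x \<in> N \<inter> D \<or> y \<in> N \<inter> D" using NE(4)[of x y] E(4) by simp
 qed (use NE in auto)
 thus mP: "mx D (N \<inter> D)" using dim1 ne by simp
 have "\<exists>d\<in>E. \<one> \<ominus> d\<otimes>x \<in> N" if x: "x \<in> E - N" for x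
 proof -
  have xc: "x \<in> carrier R" using x EE(1) by auto
  obtain p where p: "set p \<subseteq> D" "eval (\<one> # p) x = \<zero>" using intg_imp_monic[OF D noeth ig] x by blast
  have "eval (\<one> # p) x \<in> N" using p S(3) by simp
  with p(1) show ?thesis
  proof (induct p rule: rev_induct)
   case Nil thus ?case using NE(3) by simp
  next
   case (snoc c p)
   have cD: "c \<in> D" and pD: "set p \<subseteq> D" using snoc by auto
   have pc: "set (\<one> # p) \<subseteq> carrier R" using pD by auto
   let ?y = "eval (\<one> # p) x"
   have yE: "?y \<in> E" using eval_in_subring[OF E(1), of "\<one> # p" x] pD DE EE(3) x by auto
   have cc: "?y \<in> carrier R" "c \<in> carrier R" using yE EE(1) cD by auto
   have eq: "?y\<otimes>x \<oplus> c \<in> N" using snoc(3) eval_snoc[OF pc, of c x] cD xc by simp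
   show ?case
   proof (cases "c \<in> N")
    case True
    have "(?y\<otimes>x \<oplus> c) \<ominus> c \<in> N" using submod_diff[OF E(1) NE(1) eq True] .
    moreover have "(?y\<otimes>x \<oplus> c) \<ominus> c = ?y\<otimes>x" using cc xc by algebra
    ultimately have "?y \<in> N" using NE(4)[OF yE, of x] x by auto
    thus ?thesis using snoc(1) pD by simp
   next
    case False
    then obtain u where u: "u \<in> D" "\<one> \<ominus> u\<otimes>c \<in> N \<inter> D" using M_max[OF mP cD] by auto
    have uc: "u \<in> carrier R" using u by simp
    have "(\<one> \<ominus> u\<otimes>c) \<oplus> u\<otimes>(?y\<otimes>x \<oplus> c) \<in> N" using S(4,5) u eq E(4) by simp
    moreover have "(\<one> \<ominus> u\<otimes>c) \<oplus> u\<otimes>(?y\<otimes>x \<oplus> c) = \<one> \<ominus> (\<ominus> (u\<otimes>?y))\<otimes>x" using uc cc xc by algebra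
    moreover have "\<ominus> (u\<otimes>?y) \<in> E" using EE(5,6) u(1) E(4) yE by simp
    ultimately show ?thesis by auto
   qed
  qed
 qed
 thus "mx E N" unfolding mx_def using NE by auto
qed

end

section \<open>Finite extensions of Dedekind domains\<close>

context dedekind
begin

lemma mx_imp_pri: "mx D M ==> pri D M"
proof -
 assume M: "mx D M"
 have "\<forall>x\<in>D. \<forall>y\<in>D. x\<otimes>y \<in> M --> x \<in> M \<or> y \<in> M" using M_prime[OF M] by blast
 thus "pri D M" using M unfolding pri_def mx_def by simp
qed

lemma vge_finsum:
 assumes v: "place K D M v" and "finite A" "!!i. i \<in> A ==> f i \<in> K" "!!i. i \<in> A ==> vge v (f i) k"
 shows "finsum R f A \<in> K & vge v (finsum R f A) k" using assms(2-)
proof (induct A rule: finite_induct)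
 case empty thus ?case by (simp add: vge_def)
next
 case (insert i A)
 have "f \<in> A \<rightarrow> carrier R" "f i \<in> carrier R" using insert(4) by auto
 hence "finsum R f (insert i A) = f i \<oplus> finsum R f A" using insert(1,2) by simp
 thus ?case using insert vge_add[OF v, of "f i" "finsum R f A" k] by auto
qed

text \<open>D and D_M have the same residue field.\<close>

lemma residue_representative:
 assumes M: "mx D M" and v: "place K D M v" and x: "x \<in> K" "vge v x 0"
 shows "\<exists>d\<in>D. vge v (x \<ominus> d) 1"
proof (cases "x = \<zero>")
 case True thus ?thesis by (intro bexI[of _ \<zero>]) (auto simp: vge_def a_minus_def)
next
 case False
 then obtain s where s: "s \<in> D - M" "s\<otimes>x \<in> D" using v_loc[OF v] x unfolding vge_def by blast
 obtain u where u: "u \<in> D" "\<one> \<ominus> u\<otimes>s \<in> M" using M_max[OF M, of s] s by blast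
 have c: "u \<in> carrier R" "s \<in> carrier R" "x \<in> carrier R" using u s x by auto
 have "vge v (\<one> \<ominus> u\<otimes>s) 1" using M_vge[OF v M] u s by auto
 hence "vge v (x\<otimes>(\<one> \<ominus> u\<otimes>s)) (0 + 1)" using vge_mult[OF v x(1) _ x(2)] u s D_K by simp
 moreover have "x\<otimes>(\<one> \<ominus> u\<otimes>s) = x \<ominus> u\<otimes>(s\<otimes>x)" using c by algebra
 moreover have "u\<otimes>(s\<otimes>x) \<in> D" using u s by simp
 ultimately show ?thesis by auto
qed

end

lemma (in cring) combine_eq_finsum:
 assumes "length ks = length us" "set ks \<subseteq> carrier R" "set us \<subseteq> carrier R"
 shows "combine ks us = (\<Oplus>i\<in>{..<length us}. ks ! i\<otimes>us ! i)" using assms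
proof (induct ks us rule: rev_induct2)
 case (4 k ks u us)
 have cl: "(\<lambda>i. ks ! i\<otimes>us ! i) \<in> {..<length us} \<rightarrow> carrier R" using 4(2-) by (auto simp: subset_iff)
 have "combine (ks @ [k]) (us @ [u]) = combine ks us \<oplus> combine [k] [u]" using combine_append[of ks us "[k]" "[u]"] 4(2-) by simp
 also have "\<dots> = (\<Oplus>i\<in>{..<length us}. ks ! i\<otimes>us ! i) \<oplus> k\<otimes>u" using 4 by simp
 also have "(\<Oplus>i\<in>{..<length us}. ks ! i\<otimes>us ! i) = (\<Oplus>i\<in>{..<length us}. (ks @ [k]) ! i\<otimes>(us @ [u]) ! i)"
  using 4(2) cl by (intro finsum_cong') (auto simp: nth_append)
 also have "\<dots> \<oplus> k\<otimes>u = (\<Oplus>i\<in>{..<length (us @ [u])}. (ks @ [k]) ! i\<otimes>(us @ [u]) ! i)"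
 proof -
  have "(\<lambda>i. (ks @ [k]) ! i\<otimes>(us @ [u]) ! i) \<in> {..<length us} \<rightarrow> carrier R" using 4(2-) by (auto simp: nth_append subset_iff)
  moreover have "(ks @ [k]) ! length us\<otimes>(us @ [u]) ! length us = k\<otimes>u" using 4(2) by (simp add: nth_append)
  ultimately show ?thesis using 4(2-) by (simp add: lessThan_Suc a_comm)
 qed
 finally show ?case .
qed simp_all

locale dedekind_ext = dedekind R K D + E: dedekind R L E
 for R (structure) and K D L E +
 assumes D_E: "x \<in> D ==> x \<in> E"
  and fin: "\<exists>ws. set ws \<subseteq> carrier R & E = Span D ws"
begin

lemma K_L: "x \<in> K ==> x \<in> L"
proof -
 assume x: "x \<in> K"
 obtain a b where ab: "a \<in> D" "b \<in> D" "b ~= \<zero>" "b\<otimes>x = a" using frac[OF x] by blast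
 have "inv b\<otimes>(b\<otimes>x) = x" using ab(2,3) x by (simp add: m_assoc[symmetric])
 hence "x = inv b\<otimes>a" unfolding ab(4) by simp
 moreover have "a \<in> L" "b \<in> L" using ab D_E E.D_K by auto
 ultimately show "x \<in> L" using ab by simp
qed

lemma E_intg: "x \<in> E ==> intg D x"
proof -
 assume x: "x \<in> E"
 obtain ws where ws: "set ws \<subseteq> carrier R" "E = Span D ws" using fin by (elim exE conjE)
 show "intg D x" by (rule intg_of_finite[OF E.D ws(2,1) x])
qed

lemma E_inter_K: "x \<in> E ==> x \<in> K ==> x \<in> D" using normal E_intg by simp

lemma contraction:
 assumes "E.mxn N" shows "mxn (N \<inter> D)"
proof -
 obtain ws where ws: "set ws \<subseteq> carrier R" "E = Span D ws" using fin by (elim exE conjE)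
 show ?thesis using finite_extension_dim1(2,3)[OF E.D ws(2,1) D_E E.mx_imp_pri] assms by simp
qed

text \<open>A prime of E containing A that avoids D - M contracts to a prime inside M, which by dimension one is M.\<close>

lemma lying_over_ideal:
 assumes M: "mxn M" and A: "submod E A" "!!x. x \<in> A ==> x \<in> E" "A ~= {\<zero>}" "!!x. x \<in> A ==> x \<in> D ==> x \<in> M"
 shows "\<exists>N. E.mxn N & A \<subseteq> N & N \<inter> D = M"
proof -
 have mM: "mx D M" using M by simp
 have "\<exists>P. pri E P & A \<subseteq> P & (\<forall>x\<in>D - M. x \<notin> P)"
  by (rule E.prime_avoiding[OF A(1,2)]) (use M_one[OF mM] DM_mult[OF mM] D_E A(4) in auto)
 then obtain P where P: "pri E P" "A \<subseteq> P" "!!x. x \<in> D - M ==> x \<notin> P" by blast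
 have "P ~= {\<zero>}" using P(2) A(3) submodD(3)[OF A(1)] by auto
 hence mP: "E.mxn P" using E.dim1 P(1) by simp
 hence "mx D (P \<inter> D)" using contraction by simp
 hence "P \<inter> D = M" by (rule mx_incl_eq[OF _ mM]) (use P(3) in auto)
 thus ?thesis using mP P(2) by blast
qed

lemma lying_over:
 assumes M: "mxn M" shows "\<exists>N. E.mxn N & N \<inter> D = M"
proof -
 have mM: "mx D M" using M by simp
 obtain a where a: "a \<in> M" "a ~= \<zero>" using M M_closed(1) by auto
 have aD: "a \<in> D" using M_D[OF mM a(1)] .
 let ?A = "{a\<otimes>x | x. x \<in> E}"
 have "\<exists>N. E.mxn N & ?A \<subseteq> N & N \<inter> D = M"
 proof (rule lying_over_ideal[OF M])
  show "submod E ?A" unfolding submod_def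
  proof (intro conjI ballI)
   show "?A \<subseteq> carrier R" using aD by auto
   have "\<zero> = a\<otimes>\<zero>" using aD by simp
   thus "\<zero> \<in> ?A" using E.D_closed(1) by blast
  next
   fix x y assume "x \<in> ?A" "y \<in> ?A"
   then obtain x' y' where *: "x' \<in> E" "y' \<in> E" "x = a\<otimes>x'" "y = a\<otimes>y'" by auto
   have "x \<oplus> y = a\<otimes>(x' \<oplus> y')" unfolding * using * aD by (simp add: r_distr)
   thus "x \<oplus> y \<in> ?A" using * E.D_closed(5) by blast
  next
   fix d x assume d: "d \<in> E" and "x \<in> ?A"
   then obtain x' where *: "x' \<in> E" "x = a\<otimes>x'" by auto
   have "d\<otimes>x = a\<otimes>(d\<otimes>x')" unfolding * using * d aD by (simp add: m_lcomm)
   thus "d\<otimes>x \<in> ?A" using * d E.D_closed(4) by blast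
  qed
  show "!!x. x \<in> ?A ==> x \<in> E" using aD D_E by auto
  have "a = a\<otimes>\<one>" using aD by simp
  hence "a \<in> ?A" using E.D_closed(2) by blast
  thus "?A ~= {\<zero>}" using a(2) by auto
  fix x assume "x \<in> ?A" "x \<in> D"
  then obtain y where y: "y \<in> E" "x = a\<otimes>y" by auto
  have "y = inv a\<otimes>x" unfolding y(2) using y(1) aD a(2) by (simp add: m_assoc[symmetric])
  hence "y \<in> K" using aD a(2) \<open>x \<in> D\<close> D_K by simp
  hence "y \<in> D" using E_inter_K y by simp
  thus "x \<in> M" using M_closed(4)[OF mM _ a(1)] y(2) by simp
 qed
 thus ?thesis by blast
qed

text \<open>An element of value 0 for v is a quotient of elements outside M and thus has value 0 for w; hence w is w(t)
times v, where v(t) = 1.\<close>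

lemma ramification:
 assumes M: "mx D M" and v: "place K D M v" and w: "place L E N w" and NM: "N \<inter> D = M"
 shows "\<exists>r>0. \<forall>x\<in>K. x ~= \<zero> --> w x = r * v x"
proof -
 obtain t where t: "t \<in> D" "t ~= \<zero>" "v t = 1" using v_uniformizer[OF v] by auto
 have tM: "t \<in> M" using v_M[OF v] t by simp
 define r where "r = w t"
 have r: "r > 0" unfolding r_def using E.v_M[OF w, of t] t tM NM D_E by auto
 have 0: "w x = 0" if x: "x \<in> K" "x ~= \<zero>" "v x = 0" for x
 proof -
  obtain s where s: "s \<in> D - M" "s\<otimes>x \<in> D" using v_loc[OF v x(1,2)] x(3) by auto
  have s0: "s ~= \<zero>" using DM_nonzero[OF M s(1)] .
  have sx0: "s\<otimes>x ~= \<zero>" using s s0 x by (simp add: integral_iff)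
  have "v (s\<otimes>x) = 0" using v_mult[OF v, of s x] x s s0 v_unit[OF v, of s] D_K by simp
  hence "s\<otimes>x \<notin> M" using v_M[OF v s(2) sx0] by simp
  hence "w (s\<otimes>x) = 0" using E.v_unit[OF w, of "s\<otimes>x"] s sx0 NM D_E by auto
  moreover have "w s = 0" using E.v_unit[OF w, of s] s s0 NM D_E by auto
  moreover have "w (s\<otimes>x) = w s + w x" using E.v_mult[OF w, of s x] s s0 x K_L D_K by simp
  ultimately show ?thesis by simp
 qed
 have pos: "w x = r * v x" if x: "x \<in> K" "x ~= \<zero>" "v x \<ge> 0" for x
 proof -
  let ?n = "nat (v x)"
  let ?y = "x\<otimes>inv (t [^] ?n)"
  have tn: "t [^] ?n \<in> K" "t [^] ?n ~= \<zero>" using t D_K by auto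
  have yK: "?y \<in> K" using tn x by simp
  have e: "x = ?y\<otimes>t [^] ?n" using tn x by (simp add: m_assoc)
  have y0: "?y ~= \<zero>" using e x tn by auto
  have "v x = v ?y + int ?n * v t" using v_mult[OF v yK y0 tn] v_pow[OF v, of t ?n] e t D_K by simp
  hence "w ?y = 0" using 0[OF yK y0] t x by simp
  moreover have "w x = w ?y + int ?n * w t"
   using E.v_mult[OF w K_L[OF yK] y0 K_L[OF tn(1)] tn(2)] E.v_pow[OF w, of t ?n] e t D_K K_L by simp
  ultimately show ?thesis using x r_def by (simp add: mult.commute)
 qed
 have "w x = r * v x" if x: "x \<in> K" "x ~= \<zero>" for x
 proof (cases "v x \<ge> 0")
  case False
  have i0: "inv x ~= \<zero>" using x by (metis K_carr cinv(2) r_null one_not_zero)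
  have "w (inv x) = r * v (inv x)" using pos[of "inv x"] x i0 v_inv[OF v x] False by simp
  thus ?thesis using v_inv[OF v x] E.v_inv[OF w, of x] x K_L by simp
 qed (use pos x in simp)
 thus ?thesis using r by blast
qed

definition above :: "'a set => 'a set set" where
 "above M = {N. E.mxn N & N \<inter> D = M}"

text \<open>The denominators of y form an ideal of E. If it avoided D - M, some prime N above M would contain it, although
y lies in E_N.\<close>

lemma local_integral:
 assumes M: "mxn M" and y: "y \<in> L" "y ~= \<zero>" and pos: "!!N. N \<in> above M ==> 0 \<le> E.vl N y"
 shows "\<exists>s\<in>D - M. s\<otimes>y \<in> E"
proof (rule ccontr)
 assume none: "\<not> ?thesis"
 let ?A = "{t \<in> E. t\<otimes>y \<in> E}"
 have A: "submod E ?A" unfolding submod_def using y(1) by (auto simp: l_distr m_assoc)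
 obtain a b where ab: "a \<in> E" "b \<in> E" "b ~= \<zero>" "b\<otimes>y = a" using E.frac[OF y(1)] by blast
 have "b \<in> ?A" using ab by simp
 hence "?A ~= {\<zero>}" using ab(3) by blast
 then obtain N where N: "E.mxn N" "?A \<subseteq> N" "N \<inter> D = M" using lying_over_ideal[OF M A] none by blast
 hence "0 \<le> E.vl N y" using pos unfolding above_def by simp
 then obtain s where "s \<in> E - N" "s\<otimes>y \<in> E" using E.v_loc[OF E.place_vl[OF N(1)] y] by blast
 thus False using N(2) by blast
qed

text \<open>If c_j has the least value among the coefficients, then at N_j the term c_j x_j has smaller value than all
others.\<close>

lemma dominant_term:
 fixes n :: nat
 assumes Q: "mxn Q" and N: "!!i. i < n ==> N i \<in> above Q"
  and x: "!!i. i < n ==> x i \<in> E" "!!i. i < n ==> x i ~= \<zero>" "!!i. i < n ==> E.vl (N i) (x i) = 0"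
   "!!i j. i < n ==> j < n ==> i ~= j ==> 1 \<le> E.vl (N i) (x j)"
  and c: "!!i. i < n ==> c i \<in> K" and j: "j < n" "c j ~= \<zero>" "!!i. i < n ==> vge (vl Q) (c i) (vl Q (c j))"
 shows "(\<Oplus>i\<in>{..<n}. c i\<otimes>x i) ~= \<zero>" "E.vl (N j) (\<Oplus>i\<in>{..<n}. c i\<otimes>x i) = E.vl (N j) (c j)"
proof -
 have mN: "E.mxn (N j)" and ND: "N j \<inter> D = Q" using N[OF j(1)] unfolding above_def by auto
 note w = E.place_vl[OF mN] and v = place_vl[OF Q]
 obtain r where r: "r > 0" "!!x. x \<in> K ==> x ~= \<zero> ==> E.vl (N j) x = r * vl Q x" using ramification[OF _ v w ND] Q by blast
 have cx: "c i\<otimes>x i \<in> L" if "i < n" for i using c[OF that] x(1)[OF that] K_L E.D_K by simp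
 have s: "(\<Oplus>i\<in>{..<n}. c i\<otimes>x i) = c j\<otimes>x j \<oplus> (\<Oplus>i\<in>{..<n} - {j}. c i\<otimes>x i)"
 proof -
  have "{..<n} = insert j ({..<n} - {j})" using j(1) by auto
  moreover have "finsum R (\<lambda>i. c i\<otimes>x i) (insert j ({..<n} - {j})) = c j\<otimes>x j \<oplus> (\<Oplus>i\<in>{..<n} - {j}. c i\<otimes>x i)"
   using cx j(1) by (intro finsum_insert) auto
  ultimately show ?thesis by simp
 qed
 have wj: "E.vl (N j) (c j\<otimes>x j) = r * vl Q (c j)" using E.v_mult[OF w, of "c j" "x j"] c x j r(2) K_L E.D_K by simp
 have rest: "vge (E.vl (N j)) (c i\<otimes>x i) (r * vl Q (c j) + 1)" if i: "i \<in> {..<n} - {j}" for i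
 proof -
  have "vge (E.vl (N j)) (c i) (r * vl Q (c j))"
  proof (cases "c i = \<zero>")
   case False
   hence "vl Q (c j) \<le> vl Q (c i)" using j(3)[of i] i unfolding vge_def by simp
   hence "r * vl Q (c j) \<le> r * vl Q (c i)" using r(1) by simp
   thus ?thesis using r(2)[of "c i"] c[of i] i False unfolding vge_def by simp
  qed (simp add: vge_def)
  moreover have "vge (E.vl (N j)) (x i) 1" using x(4)[of j i] i j(1) unfolding vge_def by auto
  ultimately show ?thesis using E.vge_mult[OF w, of "c i" "x i"] c x(1) i K_L E.D_K by simp
 qed
 have R: "(\<Oplus>i\<in>{..<n} - {j}. c i\<otimes>x i) \<in> L" "vge (E.vl (N j)) (\<Oplus>i\<in>{..<n} - {j}. c i\<otimes>x i) (r * vl Q (c j) + 1)"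
  using E.vge_finsum[OF w, of "{..<n} - {j}" "\<lambda>i. c i\<otimes>x i"] rest cx by auto
 have ne: "c j\<otimes>x j ~= \<zero>" using j x(1,2) c by (simp add: integral_iff)
 show "(\<Oplus>i\<in>{..<n}. c i\<otimes>x i) ~= \<zero>" "E.vl (N j) (\<Oplus>i\<in>{..<n}. c i\<otimes>x i) = E.vl (N j) (c j)"
  unfolding s using E.v_add_eq[OF w cx[OF j(1)] ne R(1)] R(2) wj r(2)[of "c j"] c j by auto
qed

lemma min_coefficient:
 fixes n :: nat
 assumes "\<exists>i<n. c i ~= \<zero>"
 shows "\<exists>j<n. c j ~= \<zero> & (\<forall>i<n. vge f (c i) (f (c j)))"
proof -
 let ?S = "{i. i < n & c i ~= \<zero>}"
 have S: "finite ?S" "?S ~= {}" using assms by auto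
 obtain j where "j \<in> ?S" "\<forall>i\<in>?S. f (c j) \<le> f (c i)" using arg_min_if_finite[OF S, of "\<lambda>i. f (c i)"] by (meson not_le)
 thus ?thesis unfolding vge_def by auto
qed

lemma separated_independent:
 fixes n :: nat
 assumes Q: "mxn Q" and N: "!!i. i < n ==> N i \<in> above Q"
  and x: "!!i. i < n ==> x i \<in> E" "!!i. i < n ==> x i ~= \<zero>" "!!i. i < n ==> E.vl (N i) (x i) = 0"
   "!!i j. i < n ==> j < n ==> i ~= j ==> 1 \<le> E.vl (N i) (x j)"
 shows "independent K (map x [0..<n])"
proof (rule trivial_combine_imp_independent[OF K])
 show us: "set (map x [0..<n]) \<subseteq> carrier R" using x(1) by auto
 fix Ks assume Ks: "set Ks \<subseteq> K" "combine Ks (map x [0..<n]) = \<zero>"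
 have Kc: "set Ks \<subseteq> carrier R" using Ks(1) by auto
 obtain Ks' where Ks': "set (take (length (map x [0..<n])) Ks) \<subseteq> set Ks'"
   "set Ks' \<subseteq> set (take (length (map x [0..<n])) Ks) \<union> {\<zero>}" "length Ks' = length (map x [0..<n])"
   "combine Ks' (map x [0..<n]) = \<zero>" using combine_normalize[OF Kc us Ks(2)] by blast
 have K'K: "set Ks' \<subseteq> K" using Ks'(2) Ks(1) K_closed(1) set_take_subset[of "length (map x [0..<n])" Ks] by blast
 have len: "length Ks' = n" using Ks'(3) by simp
 have ck: "Ks' ! i \<in> K" if "i < n" for i using K'K len that nth_mem by blast
 have "\<zero> = (\<Oplus>i\<in>{..<length (map x [0..<n])}. Ks' ! i\<otimes>(map x [0..<n]) ! i)"
 proof -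
  have "set Ks' \<subseteq> carrier R" using K'K by auto
  from combine_eq_finsum[OF Ks'(3) this us] show ?thesis using Ks'(4) by simp
 qed
 also have "\<dots> = (\<Oplus>i\<in>{..<n}. Ks' ! i\<otimes>x i)" using ck x(1) by (intro finsum_cong') auto
 finally have sum0: "(\<Oplus>i\<in>{..<n}. Ks' ! i\<otimes>x i) = \<zero>" by simp
 have "\<forall>i<n. Ks' ! i = \<zero>"
 proof (rule ccontr)
  assume "\<not> ?thesis"
  then obtain j where j: "j < n" "Ks' ! j ~= \<zero>" "\<forall>i<n. vge (vl Q) (Ks' ! i) (vl Q (Ks' ! j))"
   using min_coefficient[of n "\<lambda>i. Ks' ! i" "vl Q"] by blast
  thus False using dominant_term(1)[where c = "\<lambda>i. Ks' ! i" and x = x and N = N, OF Q N x ck j(1,2)] sum0 by simp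
 qed
 hence "set Ks' \<subseteq> {\<zero>}" using len by (auto simp: set_conv_nth)
 thus "set (take (length (map x [0..<n])) Ks) \<subseteq> {\<zero>}" using Ks'(1) by blast
qed

lemma separating_elements:
 fixes n :: nat
 assumes N: "!!i. i < n ==> E.mxn (N i)" "inj_on N {..<n}"
 shows "\<exists>x. \<forall>j<n. x j \<in> E & x j ~= \<zero> & E.vl (N j) (x j) = 0 & (\<forall>i<n. i ~= j --> 1 \<le> E.vl (N i) (x j))"
proof -
 have "\<exists>x. x \<in> E & x ~= \<zero> & E.vl (N j) x = 0 & (\<forall>i<n. i ~= j --> 1 \<le> E.vl (N i) x)" if j: "j < n" for j
 proof -
  obtain x where x: "x \<in> E" "x ~= \<zero>" "!!P. P \<in> N ` {..<n} ==> E.vl P x = int (if P = N j then 0 else 1)"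
  proof -
   have "\<exists>x\<in>E. x ~= \<zero> & (\<forall>P\<in>N ` {..<n}. E.vl P x = int (if P = N j then 0 else 1))" by (rule E.approximation) (use N(1) j in auto)
   thus ?thesis using that by blast
  qed
  have "N i ~= N j" if "i < n" "i ~= j" for i using N(2) that j unfolding inj_on_def by auto
  thus ?thesis using x j by (intro exI[of _ x]) auto
 qed
 thus ?thesis by metis
qed

text \<open>Let x_i be a unit at N_i and vanish at the other N_j. By \<open>separated_independent\<close> the x_i form a
basis of L over K, as do their powers, since these vanish and do not vanish at the same primes. One more prime
above Q would give one more independent element.

For y \<in> E the coefficients of y x_i in this basis are integral at Q, because the dominant term is, and
those of x_j with j \<noteq> i vanish at Q, because y x_i vanishes at N_j. At N_i this leaves y \<equiv> c
with c \<in> K, modulo elements of value greater than the ramification index r. So residue classes have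
representatives in D; and for y of value 1 it gives r v_Q(c) = 1, so r = 1.\<close>

lemma complete_splitting:
 fixes n :: nat
 assumes Q: "mxn Q" and dm: "dimension n K L"
  and N: "!!i. i < n ==> N i \<in> above Q" "inj_on N {..<n}"
 shows "above Q = N ` {..<n}"
  and "!!i y. i < n ==> y \<in> E ==> \<exists>d\<in>D. y \<ominus> d \<in> N i"
  and "!!i x. i < n ==> x \<in> K ==> x ~= \<zero> ==> E.vl (N i) x = vl Q x"
  and "!!p::nat. p > 0 ==> \<exists>us. set us \<subseteq> L & L = Span K (map (\<lambda>u. u [^] p) us)"
proof -
 have Nm: "!!i. i < n ==> E.mxn (N i)" using N(1) unfolding above_def by simp
 obtain x where "\<forall>j<n. x j \<in> E & x j ~= \<zero> & E.vl (N j) (x j) = 0 & (\<forall>i<n. i ~= j --> 1 \<le> E.vl (N i) (x j))"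
  using separating_elements[OF Nm N(2)] by blast
 hence x: "!!j. j < n ==> x j \<in> E" "!!j. j < n ==> x j ~= \<zero>" "!!j. j < n ==> E.vl (N j) (x j) = 0"
   "!!i j. i < n ==> j < n ==> i ~= j ==> 1 \<le> E.vl (N i) (x j)" by auto
 have basis: "Span K (map y [0..<n]) = L" if "independent K (map y [0..<n])" "!!j. j < n ==> y j \<in> E" for y
 proof -
  have "set (map y [0..<n]) \<subseteq> L" using E.D_K that(2) by auto
  thus ?thesis using independent_length_eq_dimension[OF K dm that(1)] by simp
 qed
 show "above Q = N ` {..<n}"
 proof (rule ccontr)
  assume "above Q ~= N ` {..<n}"
  then obtain N' where N': "N' \<in> above Q" "N' \<notin> N ` {..<n}" using N(1) by auto
  define N2 where "N2 i = (if i < n then N i else N')" for i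
  have i2: "inj_on N2 {..<Suc n}" using N(2) N'(2) unfolding inj_on_def N2_def by (auto simp: less_Suc_eq)
  have o2: "!!i. i < Suc n ==> N2 i \<in> above Q" unfolding N2_def using N(1) N'(1) by auto
  hence m2: "!!i. i < Suc n ==> E.mxn (N2 i)" unfolding above_def by simp
  obtain z where "\<forall>j<Suc n. z j \<in> E & z j ~= \<zero> & E.vl (N2 j) (z j) = 0 & (\<forall>i<Suc n. i ~= j --> 1 \<le> E.vl (N2 i) (z j))"
   using separating_elements[OF m2 i2] by blast
  hence z: "!!j. j < Suc n ==> z j \<in> E" "!!j. j < Suc n ==> z j ~= \<zero>" "!!j. j < Suc n ==> E.vl (N2 j) (z j) = 0"
   "!!i j. i < Suc n ==> j < Suc n ==> i ~= j ==> 1 \<le> E.vl (N2 i) (z j)" by auto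
  have "independent K (map z [0..<Suc n])" by (rule separated_independent[OF Q o2 z])
  moreover have "set (map z [0..<Suc n]) \<subseteq> L" using z(1) E.D_K by auto
  ultimately have "length (map z [0..<Suc n]) \<le> n" using independent_length_le_dimension[OF K dm] by blast
  thus False by simp
 qed
 show "\<exists>us. set us \<subseteq> L & L = Span K (map (\<lambda>u. u [^] p) us)" if p: "p > 0" for p :: nat
 proof -
  have "independent K (map (\<lambda>j. x j [^] (Suc p)) [0..<n])" for p
  proof (rule separated_independent[OF Q N(1)])
   fix i j assume ij: "i < n" "j < n" "i ~= j"
   have "E.vl (N i) (x j [^] Suc p) = int (Suc p) * E.vl (N i) (x j)"
    using E.v_pow[OF E.place_vl[OF Nm[OF ij(1)]] E.D_K[OF x(1)[OF ij(2)]] x(2)[OF ij(2)]] .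
   moreover have "1 * 1 \<le> int (Suc p) * E.vl (N i) (x j)" using x(4)[OF ij] by (intro mult_mono) auto
   ultimately show "1 \<le> E.vl (N i) (x j [^] Suc p)" by simp
  next
   fix i assume i: "i < n"
   have "E.vl (N i) (x i [^] Suc p) = int (Suc p) * E.vl (N i) (x i)"
    using E.v_pow[OF E.place_vl[OF Nm[OF i]] E.D_K[OF x(1)[OF i]] x(2)[OF i]] .
   thus "E.vl (N i) (x i [^] Suc p) = 0" using x(3)[OF i] by simp
   show "x i [^] Suc p \<in> E" using x(1)[OF i] E.D_pow by blast
   show "x i [^] Suc p ~= \<zero>" using E.pow_nonzero[OF _ x(2)[OF i]] x(1)[OF i] E.D_carr by blast
  qed
  hence "Span K (map (\<lambda>j. x j [^] Suc p) [0..<n]) = L" for p using basis[of "\<lambda>j. x j [^] Suc p"] x(1) E.D_pow by blast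
  from this[of "p - 1"] have "L = Span K (map (\<lambda>u. u [^] p) (map x [0..<n]))" using p by (simp add: comp_def)
  moreover have "set (map x [0..<n]) \<subseteq> L" using x(1) E.D_K by auto
  ultimately show ?thesis by blast
 qed
 have key: "\<exists>c r. c \<in> K & vge (vl Q) c 0 & r > 0 & (\<forall>z\<in>K. z ~= \<zero> --> E.vl (N i) z = r * vl Q z) & vge (E.vl (N i)) (y \<ominus> c) (r + 1)"
  if i: "i < n" and y: "y \<in> E" for i y
 proof -
  have ND: "N j \<inter> D = Q" if "j < n" for j using N(1)[OF that] unfolding above_def by simp
  note w = E.place_vl[OF Nm]
  obtain r where r: "r > 0" "!!z. z \<in> K ==> z ~= \<zero> ==> E.vl (N i) z = r * vl Q z"
   using ramification[OF _ place_vl[OF Q] w[OF i] ND[OF i]] Q by blast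
  have us: "set (map x [0..<n]) \<subseteq> carrier R" using x(1) by auto
  have "y\<otimes>x i \<in> Span K (map x [0..<n])" using basis[OF separated_independent[OF Q N(1) x] x(1)] y x(1)[OF i] E.D_K by simp
  then obtain Ks where Ks: "set Ks \<subseteq> K" "length Ks = n" "y\<otimes>x i = combine Ks (map x [0..<n])"
   using Span_mem_iff_length_version[OF K us] by auto
  define c where "c j = Ks ! j" for j
  have ck: "c j \<in> K" if "j < n" for j unfolding c_def using Ks(1,2) that nth_mem by blast
  have cx: "c j\<otimes>x j \<in> L" if "j < n" for j using ck[OF that] x(1)[OF that] K_L E.D_K by simp
  have "y\<otimes>x i = (\<Oplus>j\<in>{..<length (map x [0..<n])}. Ks ! j\<otimes>(map x [0..<n]) ! j)"
  proof -
   have "set Ks \<subseteq> carrier R" using Ks(1) by auto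
   from combine_eq_finsum[OF _ this us] show ?thesis using Ks(2,3) by simp
  qed
  also have "\<dots> = (\<Oplus>j\<in>{..<n}. c j\<otimes>x j)" using ck x(1) unfolding c_def by (intro finsum_cong') auto
  finally have sum: "y\<otimes>x i = (\<Oplus>j\<in>{..<n}. c j\<otimes>x j)" .
  have c0: "vge (vl Q) (c j) 0" if j: "j < n" for j
  proof (rule ccontr)
   assume neg: "\<not> vge (vl Q) (c j) 0"
   hence "\<exists>j<n. c j ~= \<zero>" using j unfolding vge_def by auto
   then obtain k where k: "k < n" "c k ~= \<zero>" "!!l. l < n ==> vge (vl Q) (c l) (vl Q (c k))"
    using min_coefficient[of n c "vl Q"] by blast
   have "vl Q (c k) < 0" using k(3)[OF j] neg unfolding vge_def by auto
   moreover obtain r' where "r' > 0" "E.vl (N k) (c k) = r' * vl Q (c k)"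
    using ramification[OF _ place_vl[OF Q] w[OF k(1)] ND[OF k(1)]] Q ck[OF k(1)] k(2) by blast
   ultimately have "E.vl (N k) (c k) < 0" by (simp add: mult_pos_neg)
   moreover have "y\<otimes>x i \<in> E" using y x(1)[OF i] by simp
   hence "0 \<le> E.vl (N k) (y\<otimes>x i)"
    unfolding sum using E.v_D[OF w[OF k(1)]] dominant_term(1)[where c = c and x = x and N = N, OF Q N(1) x ck k] by blast
   ultimately show False using dominant_term(2)[where c = c and x = x and N = N, OF Q N(1) x ck k] sum by simp
  qed
  have c1: "vge (vl Q) (c j) 1" if j: "j < n" "j ~= i" for j
  proof (rule ccontr)
   assume neg: "\<not> vge (vl Q) (c j) 1"
   hence z: "c j ~= \<zero>" "vl Q (c j) = 0" using c0[OF j(1)] unfolding vge_def by auto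
   have mn: "!!l. l < n ==> vge (vl Q) (c l) (vl Q (c j))" using c0 z by simp
   note dt = dominant_term[where c = c and x = x and N = N, OF Q N(1) x ck j(1) z(1) mn]
   obtain r' where "r' > 0" "E.vl (N j) (c j) = r' * vl Q (c j)"
    using ramification[OF _ place_vl[OF Q] w[OF j(1)] ND[OF j(1)]] Q ck[OF j(1)] z by blast
   hence "E.vl (N j) (y\<otimes>x i) = 0" using z dt(2) sum by simp
   moreover have "y ~= \<zero>" using dt(1) sum x(1)[OF i] by auto
   moreover have "E.vl (N j) (y\<otimes>x i) = E.vl (N j) y + E.vl (N j) (x i)"
    using E.v_mult[OF w[OF j(1)]] y \<open>y ~= \<zero>\<close> x(1,2)[OF i] E.D_K by simp
   moreover have "0 \<le> E.vl (N j) y" using E.v_D[OF w[OF j(1)] y \<open>y ~= \<zero>\<close>] .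
   ultimately show False using x(4)[OF j(1) i j(2)] by simp
  qed
  have "(\<Oplus>j\<in>{..<n}. c j\<otimes>x j) = c i\<otimes>x i \<oplus> (\<Oplus>j\<in>{..<n} - {i}. c j\<otimes>x j)"
  proof -
   have "{..<n} = insert i ({..<n} - {i})" using i by auto
   moreover have "finsum R (\<lambda>j. c j\<otimes>x j) (insert i ({..<n} - {i})) = c i\<otimes>x i \<oplus> (\<Oplus>j\<in>{..<n} - {i}. c j\<otimes>x j)"
    using cx i by (intro finsum_insert) auto
   ultimately show ?thesis by simp
  qed
  moreover have rest: "vge (E.vl (N i)) (c j\<otimes>x j) (r + 1)" if j: "j \<in> {..<n} - {i}" for j
  proof -
   have "vge (E.vl (N i)) (c j) r"
   proof (cases "c j = \<zero>")
    case False
    hence "1 \<le> vl Q (c j)" using c1[of j] j unfolding vge_def by simp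
    hence "r * 1 \<le> r * vl Q (c j)" using r(1) by simp
    thus ?thesis using r(2)[of "c j"] ck[of j] j False unfolding vge_def by simp
   qed (simp add: vge_def)
   moreover have "vge (E.vl (N i)) (x j) 1" using x(4)[of i j] i j unfolding vge_def by auto
   ultimately show ?thesis using E.vge_mult[OF w[OF i], of "c j" "x j"] ck x(1) j K_L E.D_K by simp
  qed
  moreover define S where "S = (\<Oplus>j\<in>{..<n} - {i}. c j\<otimes>x j)"
  ultimately have S: "y\<otimes>x i = c i\<otimes>x i \<oplus> S" using sum by simp
  have SL: "S \<in> L" "vge (E.vl (N i)) S (r + 1)"
   using E.vge_finsum[OF w[OF i], of "{..<n} - {i}" "\<lambda>i. c i\<otimes>x i"] rest cx unfolding S_def by auto
  have cc: "y \<in> carrier R" "x i \<in> carrier R" "c i \<in> carrier R" "S \<in> carrier R" using y x(1)[OF i] ck[OF i] SL by auto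
  have "(y \<ominus> c i)\<otimes>x i = y\<otimes>x i \<ominus> c i\<otimes>x i" using cc by algebra
  also have "\<dots> = S" unfolding S using cc by algebra
  finally have yS: "(y \<ominus> c i)\<otimes>x i = S" .
  have ycL: "y \<ominus> c i \<in> L" using y ck[OF i] K_L E.D_K by simp
  have "vge (E.vl (N i)) (y \<ominus> c i) (r + 1)"
  proof (cases "y \<ominus> c i = \<zero>")
   case False
   have "E.vl (N i) S = E.vl (N i) (y \<ominus> c i)"
    using E.v_mult[OF w[OF i] ycL False E.D_K[OF x(1)[OF i]] x(2)[OF i]] x(3)[OF i] yS by simp
   moreover have "S ~= \<zero>" using yS False x(2)[OF i] cc by (metis integral minus_closed)
   ultimately show ?thesis using SL(2) unfolding vge_def by simp
  qed (simp add: vge_def)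
  thus ?thesis using ck[OF i] c0[OF i] r by blast
 qed
 show "\<exists>d\<in>D. y \<ominus> d \<in> N i" if i: "i < n" and y: "y \<in> E" for i y
 proof -
  obtain c r where c: "c \<in> K" "vge (vl Q) c 0" "r > 0" "!!z. z \<in> K ==> z ~= \<zero> ==> E.vl (N i) z = r * vl Q z"
   "vge (E.vl (N i)) (y \<ominus> c) (r + 1)" using key[OF i y] by blast
  obtain d where d: "d \<in> D" "vge (vl Q) (c \<ominus> d) 1" using residue_representative[OF _ place_vl[OF Q] c(1,2)] Q by blast
  note w = E.place_vl[OF Nm[OF i]]
  have dK: "d \<in> K" using d D_K by simp
  have "vge (E.vl (N i)) (c \<ominus> d) 1"
  proof (cases "c \<ominus> d = \<zero>")
   case False
   hence "1 \<le> vl Q (c \<ominus> d)" using d(2) unfolding vge_def by simp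
   hence "1 \<le> r * vl Q (c \<ominus> d)" using c(3) mult_mono[of 1 r 1 "vl Q (c \<ominus> d)"] by simp
   thus ?thesis using c(4)[of "c \<ominus> d"] c(1,3) dK False unfolding vge_def by simp
  qed (simp add: vge_def)
  moreover have "vge (E.vl (N i)) (y \<ominus> c) 1" using c(5,3) unfolding vge_def by auto
  ultimately have "vge (E.vl (N i)) ((y \<ominus> c) \<oplus> (c \<ominus> d)) 1" using E.vge_add[OF w] y c(1) dK K_L E.D_K by simp
  moreover have "(y \<ominus> c) \<oplus> (c \<ominus> d) = y \<ominus> d"
  proof -
   have cc: "y \<in> carrier R" "c \<in> carrier R" "d \<in> carrier R" using y c(1) d(1) by auto
   thus ?thesis by algebra
  qed
  moreover have "y \<ominus> d \<in> E" using y d(1) D_E by simp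
  ultimately show ?thesis using E.M_vge[OF w, of "y \<ominus> d"] Nm[OF i] d(1) by auto
 qed
 show "E.vl (N i) z = vl Q z" if i: "i < n" and z: "z \<in> K" "z ~= \<zero>" for i z
 proof -
  note w = E.place_vl[OF Nm[OF i]]
  obtain y where y: "y \<in> E" "y ~= \<zero>" "E.vl (N i) y = 1" using E.v_uniformizer[OF w] by blast
  obtain c r where c: "c \<in> K" "vge (vl Q) c 0" "r > 0" "!!z. z \<in> K ==> z ~= \<zero> ==> E.vl (N i) z = r * vl Q z"
   "vge (E.vl (N i)) (y \<ominus> c) (r + 1)" using key[OF i y(1)] by blast
  have cL: "c \<in> L" "y \<in> L" using c(1) K_L y(1) E.D_K by auto
  have "vge (E.vl (N i)) (\<ominus> (y \<ominus> c)) (E.vl (N i) y + 1)" using E.vge_mono[OF w E.vge_minus[OF w _ c(5)], of 2] c(3) y(3) cL by simp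
  hence "y \<oplus> \<ominus> (y \<ominus> c) ~= \<zero>" "E.vl (N i) (y \<oplus> \<ominus> (y \<ominus> c)) = 1" using E.v_add_eq[OF w cL(2) y(2), of "\<ominus> (y \<ominus> c)"] cL y(3) by auto
  moreover have "y \<oplus> \<ominus> (y \<ominus> c) = c"
  proof -
   have cc: "y \<in> carrier R" "c \<in> carrier R" using cL by auto
   thus ?thesis by algebra
  qed
  ultimately have "r * vl Q c = 1" using c(4)[OF c(1)] by simp
  hence "r = 1" using c(3) by (metis pos_zmult_eq_1_iff)
  thus ?thesis using c(4)[OF z] by simp
 qed
qed

end

section \<open>Polynomial functions\<close>

context cring
begin

text \<open>Polynomials are used through their functions: an identity of polynomials over K that holds at an algebraic
element then transfers to its conjugates without arithmetic of coefficient lists.\<close>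

definition polyfun :: "'a set => ('a => 'a) => bool" where
 "polyfun S \<phi> \<longleftrightarrow> (\<exists>p. set p \<subseteq> S & (\<forall>x\<in>carrier R. \<phi> x = eval p x))"

lemma polyfun_const: "k \<in> S ==> k \<in> carrier R ==> polyfun S (\<lambda>x. k)" unfolding polyfun_def by (intro exI[of _ "[k]"]) simp

lemma polyfun_eval: "set p \<subseteq> S ==> polyfun S (\<lambda>x. eval p x)" unfolding polyfun_def by blast

lemma polyfun_id: "subring S R ==> polyfun S (\<lambda>x. x)" unfolding polyfun_def by (intro exI[of _ "[\<one>, \<zero>]"]) (simp add: subringE(2,3))

lemma map2_eval:
 assumes "length p = length q" "set p \<subseteq> carrier R" "set q \<subseteq> carrier R" "x \<in> carrier R" "a \<in> carrier R"
 shows "eval (map2 (\<lambda>u w. u \<ominus> a\<otimes>w) p q) x = eval p x \<ominus> a\<otimes>eval q x" using assms(1-3)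
proof (induct p q rule: list_induct2)
 case Nil thus ?case using assms by (simp add: a_minus_def)
next
 case (Cons u p w q)
 have c: "u \<in> carrier R" "w \<in> carrier R" "x [^] length q \<in> carrier R" "eval p x \<in> carrier R" "eval q x \<in> carrier R"
  using Cons assms(4) eval_in_carrier by auto
 have "(u \<ominus> a\<otimes>w)\<otimes>x [^] length q \<oplus> (eval p x \<ominus> a\<otimes>eval q x) =
  (u\<otimes>x [^] length q \<oplus> eval p x) \<ominus> a\<otimes>(w\<otimes>x [^] length q \<oplus> eval q x)" using c assms(5) by algebra
 thus ?case using Cons by simp
qed

lemma polyfun_add:
 assumes S: "subring S R" and "polyfun S \<phi>" "polyfun S \<psi>"
 shows "polyfun S (\<lambda>x. \<phi> x \<oplus> \<psi> x)"
proof -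
 obtain p q where p: "set p \<subseteq> S" "!!x. x \<in> carrier R ==> \<phi> x = eval p x"
  and q: "set q \<subseteq> S" "!!x. x \<in> carrier R ==> \<psi> x = eval q x" using assms(2,3) unfolding polyfun_def by metis
 have c: "set p \<subseteq> carrier R" "set q \<subseteq> carrier R" using p(1) q(1) subringE(1)[OF S] by auto
 define n where "n = max (length p) (length q)"
 define p' where "p' = replicate (n - length p) \<zero> @ p"
 define q' where "q' = replicate (n - length q) \<zero> @ q"
 have l: "length p' = length q'" unfolding p'_def q'_def n_def by simp
 have s: "set p' \<subseteq> S" "set q' \<subseteq> S" unfolding p'_def q'_def using p(1) q(1) subringE(2)[OF S] by auto
 have cs: "set p' \<subseteq> carrier R" "set q' \<subseteq> carrier R" using s subringE(1)[OF S] by auto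
 let ?r = "map2 (\<lambda>u w. u \<ominus> (\<ominus> \<one>)\<otimes>w) p' q'"
 have "set ?r \<subseteq> S"
 proof
  fix z assume "z \<in> set ?r"
  then obtain u w where uw: "(u, w) \<in> set (zip p' q')" "z = u \<ominus> (\<ominus> \<one>)\<otimes>w" by auto
  have "u \<in> S" "w \<in> S" using s set_zip_leftD[OF uw(1)] set_zip_rightD[OF uw(1)] by auto
  thus "z \<in> S" unfolding uw(2) a_minus_def using subringE(3,5,6,7)[OF S] by simp
 qed
 moreover have "\<phi> x \<oplus> \<psi> x = eval ?r x" if x: "x \<in> carrier R" for x
 proof -
  have "eval ?r x = eval p' x \<ominus> (\<ominus> \<one>)\<otimes>eval q' x" using map2_eval[OF l cs x] by simp
  also have "\<dots> = eval p' x \<oplus> eval q' x"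
   using eval_in_carrier[OF cs(1) x] eval_in_carrier[OF cs(2) x] by (simp add: a_minus_def l_minus)
  also have "\<dots> = eval p x \<oplus> eval q x" unfolding p'_def q'_def using eval_replicate[OF c(1) x] eval_replicate[OF c(2) x] by simp
  finally show ?thesis using p(2)[OF x] q(2)[OF x] by simp
 qed
 ultimately show ?thesis unfolding polyfun_def by blast
qed

lemma polyfun_mult_eval:
 assumes S: "subring S R" and \<psi>: "polyfun S \<psi>" and p: "set p \<subseteq> S"
 shows "polyfun S (\<lambda>x. eval p x\<otimes>\<psi> x)" using p
proof (induct p rule: rev_induct)
 obtain q where q: "set q \<subseteq> S" "!!x. x \<in> carrier R ==> \<psi> x = eval q x" using \<psi> unfolding polyfun_def by metis
 have qc: "set q \<subseteq> carrier R" using q(1) subringE(1)[OF S] by auto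
 {
  case Nil
  have "polyfun S (\<lambda>x. \<zero>)" using polyfun_const[of \<zero> S] subringE(2)[OF S] by simp
  moreover have "eval [] x\<otimes>\<psi> x = \<zero>" if "x \<in> carrier R" for x using q(2)[OF that] eval_in_carrier[OF qc that] by simp
  ultimately show ?case unfolding polyfun_def by simp
 next
  case (snoc c p)
  have cS: "c \<in> S" "c \<in> carrier R" and pS: "set p \<subseteq> S" "set p \<subseteq> carrier R" using snoc(2) subringE(1)[OF S] by auto
  obtain r where r: "set r \<subseteq> S" "!!x. x \<in> carrier R ==> eval p x\<otimes>\<psi> x = eval r x"
   using snoc(1)[OF pS(1)] unfolding polyfun_def by metis
  have rc: "set r \<subseteq> carrier R" using r(1) subringE(1)[OF S] by auto
  have 1: "polyfun S (\<lambda>x. eval (r @ [\<zero>]) x)" using r(1) subringE(2)[OF S] by (intro polyfun_eval) simp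
  have "polyfun S (\<lambda>x. eval (map ((\<otimes>) c) q) x)" using q(1) cS subringE(6)[OF S] by (intro polyfun_eval) auto
  note 2 = polyfun_add[OF S 1 this]
  have "eval (p @ [c]) x\<otimes>\<psi> x = eval (r @ [\<zero>]) x \<oplus> eval (map ((\<otimes>) c) q) x" if x: "x \<in> carrier R" for x
  proof -
   have m: "eval (map ((\<otimes>) c) q) x = c\<otimes>eval q x" if "set q \<subseteq> carrier R" for q using that
   proof (induct q)
    case (Cons a q)
    hence "a \<in> carrier R" "eval q x \<in> carrier R" "x [^] length q \<in> carrier R" using x eval_in_carrier by auto
    thus ?case using Cons cS(2) by (simp add: r_distr m_assoc)
   qed (use cS in simp)
   have cc: "eval p x \<in> carrier R" "eval q x \<in> carrier R" "eval r x \<in> carrier R" using eval_in_carrier pS rc qc x by auto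
   have "eval (p @ [c]) x\<otimes>\<psi> x = (eval p x\<otimes>x \<oplus> c)\<otimes>eval q x" using eval_snoc[OF pS(2) cS(2) x] q(2)[OF x] by simp
   also have "\<dots> = (eval p x\<otimes>eval q x)\<otimes>x \<oplus> c\<otimes>eval q x" using cc cS x by algebra
   also have "\<dots> = eval r x\<otimes>x \<oplus> c\<otimes>eval q x" using r(2)[OF x] q(2)[OF x] by simp
   finally show ?thesis using eval_snoc[OF rc zero_closed x] m[OF qc] cc x by simp
  qed
  thus ?case using 2 unfolding polyfun_def by simp
 }
qed

lemma polyfun_mult:
 assumes S: "subring S R" and \<phi>: "polyfun S \<phi>" and \<psi>: "polyfun S \<psi>"
 shows "polyfun S (\<lambda>x. \<phi> x\<otimes>\<psi> x)"
proof -
 obtain p where p: "set p \<subseteq> S" "!!x. x \<in> carrier R ==> \<phi> x = eval p x" using \<phi> unfolding polyfun_def by metis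
 show ?thesis using polyfun_mult_eval[OF S \<psi> p(1)] p(2) unfolding polyfun_def by simp
qed

lemma polyfun_closed: "subring S R ==> polyfun S \<phi> ==> x \<in> carrier R ==> \<phi> x \<in> carrier R"
proof -
 assume S: "subring S R" and "polyfun S \<phi>" and x: "x \<in> carrier R"
 then obtain p where p: "set p \<subseteq> S" "\<phi> x = eval p x" unfolding polyfun_def by blast
 have "set p \<subseteq> carrier R" using p(1) subringE(1)[OF S] by (rule subset_trans)
 thus "\<phi> x \<in> carrier R" unfolding p(2) using eval_in_carrier x by simp
qed

lemma polyfun_minus:
 assumes S: "subring S R" and \<phi>: "polyfun S \<phi>" and \<psi>: "polyfun S \<psi>"
 shows "polyfun S (\<lambda>x. \<phi> x \<ominus> \<psi> x)"
proof -
 have "polyfun S (\<lambda>x. \<ominus> \<one>)" using polyfun_const[of "\<ominus> \<one>" S] subringE(3,5)[OF S] by simp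
 from polyfun_add[OF S \<phi> polyfun_mult[OF S this \<psi>]]
 have "polyfun S (\<lambda>x. \<phi> x \<oplus> (\<ominus> \<one>)\<otimes>\<psi> x)" .
 moreover have "\<phi> x \<oplus> (\<ominus> \<one>)\<otimes>\<psi> x = \<phi> x \<ominus> \<psi> x" if "x \<in> carrier R" for x
  using polyfun_closed[OF S \<psi> that] by (simp add: a_minus_def l_minus)
 ultimately show ?thesis unfolding polyfun_def by simp
qed

lemma polyfun_pow:
 assumes S: "subring S R" and \<phi>: "polyfun S \<phi>"
 shows "polyfun S (\<lambda>x. \<phi> x [^] (n::nat))"
proof (induct n)
 case 0 thus ?case using polyfun_const[of \<one> S] subringE(3)[OF S] by simp
next
 case (Suc n) thus ?case using polyfun_mult[OF S Suc \<phi>] by simp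
qed

lemma polyfun_compose:
 assumes S: "subring S R" and \<phi>: "polyfun S \<phi>" and q: "set q \<subseteq> S"
 shows "polyfun S (\<lambda>x. eval q (\<phi> x))" using q
proof (induct q)
 case Nil thus ?case using polyfun_const[of \<zero> S] subringE(2)[OF S] by simp
next
 case (Cons a q)
 have a: "a \<in> S" "a \<in> carrier R" using Cons(2) subringE(1)[OF S] by auto
 have "polyfun S (\<lambda>x. a\<otimes>\<phi> x [^] length q \<oplus> eval q (\<phi> x))"
  using polyfun_add[OF S polyfun_mult[OF S polyfun_const[OF a] polyfun_pow[OF S \<phi>]]] Cons by simp
 thus ?case by simp
qed

fun rootprod :: "'a list => 'a => 'a" where
 "rootprod [] x = \<one>"
| "rootprod (r # rs) x = (x \<ominus> r)\<otimes>rootprod rs x"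

text \<open>The difference quotient (p(x) - p(r)) / (x - r) of \<open>p = rootprod as\<close> as a polynomial in x; it
makes sense for x = r, where it is the derivative.\<close>

fun rootprod_diff :: "'a list => 'a => 'a => 'a" where
 "rootprod_diff [] r x = \<zero>"
| "rootprod_diff (a # as) r x = rootprod as x \<oplus> (r \<ominus> a)\<otimes>rootprod_diff as r x"

lemma rootprod_closed: "set rs \<subseteq> carrier R ==> x \<in> carrier R ==> rootprod rs x \<in> carrier R" by (induct rs) auto

lemma rootprod_diff_closed:
 "set as \<subseteq> carrier R ==> r \<in> carrier R ==> x \<in> carrier R ==> rootprod_diff as r x \<in> carrier R"
 by (induct as) (auto simp: rootprod_closed)

lemma rootprod_append:
 "set rs \<subseteq> carrier R ==> set ss \<subseteq> carrier R ==> x \<in> carrier R ==>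
  rootprod (rs @ ss) x = rootprod rs x\<otimes>rootprod ss x" by (induct rs) (auto simp: rootprod_closed m_assoc)

lemma rootprod_diff:
 assumes "set as \<subseteq> carrier R" "r \<in> carrier R" "x \<in> carrier R"
 shows "rootprod as x \<ominus> rootprod as r = (x \<ominus> r)\<otimes>rootprod_diff as r x" using assms(1)
proof (induct as)
 case Nil thus ?case using assms by (simp add: a_minus_def r_neg)
next
 case (Cons a as)
 have c: "a \<in> carrier R" "rootprod as x \<in> carrier R" "rootprod as r \<in> carrier R" "rootprod_diff as r x \<in> carrier R"
  using Cons(2) assms(2,3) rootprod_closed rootprod_diff_closed by auto
 have "rootprod (a # as) x \<ominus> rootprod (a # as) r =
  (x \<ominus> r)\<otimes>rootprod as x \<oplus> (r \<ominus> a)\<otimes>(rootprod as x \<ominus> rootprod as r)" unfolding rootprod.simps using c assms(2,3) by algebra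
 also have "\<dots> = (x \<ominus> r)\<otimes>rootprod as x \<oplus> (r \<ominus> a)\<otimes>((x \<ominus> r)\<otimes>rootprod_diff as r x)" using Cons by simp
 also have "\<dots> = (x \<ominus> r)\<otimes>rootprod_diff (a # as) r x" unfolding rootprod_diff.simps using c assms(2,3) by algebra
 finally show ?case .
qed

lemma polyfun_rootprod:
 assumes S: "subring S R" and "set rs \<subseteq> S"
 shows "polyfun S (\<lambda>x. rootprod rs x)" using assms(2)
proof (induct rs)
 case Nil thus ?case using polyfun_const[of \<one> S] subringE(3)[OF S] by simp
next
 case (Cons r rs)
 have r: "r \<in> S" "r \<in> carrier R" using Cons(2) subringE(1)[OF S] by auto
 show ?case using polyfun_mult[OF S polyfun_minus[OF S polyfun_id[OF S] polyfun_const[OF r]]] Cons by simp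
qed

lemma polyfun_rootprod_diff:
 assumes S: "subring S R" and "set as \<subseteq> S" "r \<in> S"
 shows "polyfun S (\<lambda>x. rootprod_diff as r x)" using assms(2)
proof (induct as)
 case Nil thus ?case using polyfun_const[of \<zero> S] subringE(2)[OF S] by simp
next
 case (Cons a as)
 have "r \<ominus> a \<in> S" using Cons(2) assms(3) subringE(5,7)[OF S] by (simp add: a_minus_def)
 hence "polyfun S (\<lambda>x. r \<ominus> a)" using polyfun_const subringE(1)[OF S] by blast
 from polyfun_add[OF S polyfun_rootprod[OF S, of as] polyfun_mult[OF S this Cons(1)]] Cons(2)
 show ?case by simp
qed

lemma rootprod_coefficients:
 assumes J: "submod S J" "J \<subseteq> S" and S: "subring S R" and as: "set as \<subseteq> J"
 shows "\<exists>p. set p \<subseteq> J & length p = length as & (\<forall>x\<in>carrier R. eval (\<one> # p) x = rootprod as x)" using as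
proof (induct as)
 case Nil thus ?case by (intro exI[of _ "[]"]) simp
next
 case (Cons a as)
 note SJ = submodD[OF J(1)]
 then obtain p where p: "set p \<subseteq> J" "length p = length as" "!!x. x \<in> carrier R ==> eval (\<one> # p) x = rootprod as x" using Cons by auto
 have a: "a \<in> J" "a \<in> S" "a \<in> carrier R" using Cons(2) J(2) SJ(2) by auto
 have pc: "set p \<subseteq> carrier R" using p(1) SJ(1) by auto
 let ?u = "(\<one> # p) @ [\<zero>]" and ?w = "\<zero> # \<one> # p"
 let ?q = "map2 (\<lambda>u w. u \<ominus> a\<otimes>w) (p @ [\<zero>]) (\<one> # p)"
 have cu: "set ?u \<subseteq> carrier R" "set ?w \<subseteq> carrier R" using pc by auto
 have q: "map2 (\<lambda>u w. u \<ominus> a\<otimes>w) ?u ?w = \<one> # ?q" using a by (simp add: a_minus_def)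
 have "set ?q \<subseteq> J"
 proof
  fix z assume "z \<in> set ?q"
  then obtain u w where uw: "(u, w) \<in> set (zip (p @ [\<zero>]) (\<one> # p))" "z = u \<ominus> a\<otimes>w" by auto
  have u: "u \<in> J" using p(1) set_zip_leftD[OF uw(1)] SJ(3) by auto
  have w: "w \<in> S" using p(1) J(2) set_zip_rightD[OF uw(1)] subringE(3)[OF S] by auto
  have "a\<otimes>w = w\<otimes>a" using a w subringE(1)[OF S] by (auto intro: m_comm)
  hence "a\<otimes>w \<in> J" using SJ(5)[OF w a(1)] by simp
  thus "z \<in> J" unfolding uw(2) using submod_diff[OF S J(1) u] by simp
 qed
 moreover have "length ?q = length (a # as)" using p(2) by simp
 moreover have "eval (\<one> # ?q) x = rootprod (a # as) x" if x: "x \<in> carrier R" for x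
 proof -
  have r: "rootprod as x \<in> carrier R" using rootprod_closed[of as x] Cons(2) SJ(1) x by auto
  have "eval (\<one> # ?q) x = eval ?u x \<ominus> a\<otimes>eval ?w x" unfolding q[symmetric] by (rule map2_eval[OF _ cu x a(3)]) simp
  also have "eval ?u x = rootprod as x\<otimes>x" using eval_snoc[of "\<one> # p" \<zero> x] pc x p(3)[OF x] r by simp
  also have "eval ?w x = eval (\<one> # p) x" using x eval_in_carrier[of "\<one> # p" x] pc by (simp del: eval.simps add: eval.simps(2)[of \<zero>])
  also have "\<dots> = rootprod as x" by (rule p(3)[OF x])
  also have "rootprod as x\<otimes>x \<ominus> a\<otimes>rootprod as x = (x \<ominus> a)\<otimes>rootprod as x" using r x a by algebra
  finally show ?thesis by simp
 qed
 ultimately show ?case by blast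
qed

fun rootprod_deriv :: "'a list => 'a => 'a" where
 "rootprod_deriv [] x = \<zero>"
| "rootprod_deriv (a # as) x = rootprod as x \<oplus> (x \<ominus> a)\<otimes>rootprod_deriv as x"

lemma rootprod_diff_diagonal: "rootprod_diff as r r = rootprod_deriv as r" by (induct as) auto

lemma rootprod_deriv_coefficients:
 assumes S: "subring S R" and as: "set as \<subseteq> S"
 shows "\<exists>g. set g \<subseteq> S & length g = length as & (\<forall>x\<in>carrier R. eval g x = rootprod_deriv as x)" using as
proof (induct as)
 case Nil thus ?case by (intro exI[of _ "[]"]) simp
next
 case (Cons a as)
 then obtain g where g: "set g \<subseteq> S" "length g = length as" "!!x. x \<in> carrier R ==> eval g x = rootprod_deriv as x" by auto
 have aS: "a \<in> S" "a \<in> carrier R" using Cons(2) subringE(1)[OF S] by auto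
 have SS: "submod S S" by (rule submod_subring[OF S order_refl])
 obtain p where p: "set p \<subseteq> S" "length p = length as" "!!x. x \<in> carrier R ==> eval (\<one> # p) x = rootprod as x"
  using rootprod_coefficients[OF SS order_refl S, of as] Cons(2) by auto
 have c: "set g \<subseteq> carrier R" "set p \<subseteq> carrier R" using g(1) p(1) subringE(1)[OF S] by auto
 let ?h = "map2 (\<lambda>u w. u \<ominus> a\<otimes>w) (g @ [\<zero>]) (\<zero> # g)"
 let ?r = "map2 (\<lambda>u w. u \<ominus> (\<ominus> \<one>)\<otimes>w) (\<one> # p) ?h"
 have ch: "set ?h \<subseteq> S"
 proof
  fix z assume "z \<in> set ?h"
  then obtain u w where uw: "(u, w) \<in> set (zip (g @ [\<zero>]) (\<zero> # g))" "z = u \<ominus> a\<otimes>w" by auto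
  have "u \<in> S" "w \<in> S" using g(1) set_zip_leftD[OF uw(1)] set_zip_rightD[OF uw(1)] subringE(2)[OF S] by auto
  thus "z \<in> S" unfolding uw(2) a_minus_def using aS subringE(5,6,7)[OF S] by simp
 qed
 have chc: "set ?h \<subseteq> carrier R" using ch subringE(1)[OF S] by auto
 have "set ?r \<subseteq> S"
 proof
  fix z assume "z \<in> set ?r"
  then obtain u w where uw: "(u, w) \<in> set (zip (\<one> # p) ?h)" "z = u \<ominus> (\<ominus> \<one>)\<otimes>w" by auto
  have "u \<in> S" "w \<in> S" using p(1) set_zip_leftD[OF uw(1)] set_zip_rightD[OF uw(1)] subringE(3)[OF S] ch by auto
  thus "z \<in> S" unfolding uw(2) a_minus_def using subringE(3,5,6,7)[OF S] by simp
 qed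
 moreover have "length ?r = length (a # as)" using p(2) g(2) by simp
 moreover have "eval ?r x = rootprod_deriv (a # as) x" if x: "x \<in> carrier R" for x
 proof -
  have l: "length (\<one> # p) = length ?h" using p(2) g(2) by simp
  have gc: "eval g x \<in> carrier R" using eval_in_carrier[OF c(1) x] .
  have hx: "eval ?h x = eval (g @ [\<zero>]) x \<ominus> a\<otimes>eval (\<zero> # g) x" by (rule map2_eval) (use c x aS in auto)
  have hx: "eval ?h x = (x \<ominus> a)\<otimes>eval g x"
  proof -
   have "eval (g @ [\<zero>]) x = eval g x\<otimes>x" using eval_snoc[OF c(1) zero_closed x] gc x by simp
   moreover have "eval (\<zero> # g) x = eval g x" using x gc by simp
   moreover have "eval g x\<otimes>x \<ominus> a\<otimes>eval g x = (x \<ominus> a)\<otimes>eval g x" using gc x aS by algebra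
   ultimately show ?thesis using hx by simp
  qed
  have rc: "eval (\<one> # p) x \<in> carrier R" using eval_in_carrier[of "\<one> # p" x] c x by simp
  have "eval ?r x = eval (\<one> # p) x \<ominus> (\<ominus> \<one>)\<otimes>eval ?h x" by (rule map2_eval[OF l _ chc x]) (use c in auto)
  also have "\<dots> = eval (\<one> # p) x \<oplus> eval ?h x" using rc eval_in_carrier[OF chc x] by (simp add: a_minus_def l_minus del: eval.simps)
  finally show ?thesis unfolding hx using p(3)[OF x] g(3)[OF x] by simp
 qed
 ultimately show ?case by blast
qed

text \<open>Horner's scheme. The last clause recovers the coefficients of the dividend from those of the quotient and the
remainder.\<close>

lemma synthetic_division:
 assumes r: "r \<in> carrier R" and "g ~= []" "set g \<subseteq> carrier R"
 shows "\<exists>h. Suc (length h) = length g & set h \<subseteq> carrier R &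
  (\<forall>x\<in>carrier R. eval g x = (x \<ominus> r)\<otimes>eval h x \<oplus> eval g r) &
  (\<forall>S J. subring S R --> submod S J --> r \<in> S --> set h \<subseteq> J --> eval g r \<in> J --> set g \<subseteq> J)" using assms(2,3)
proof (induct g rule: rev_induct)
 case (snoc c g)
 have c: "c \<in> carrier R" and g: "set g \<subseteq> carrier R" using snoc(3) by auto
 show ?case
 proof (cases "g = []")
  case True
  thus ?thesis using c r by (intro exI[of _ "[]"]) simp
 next
  case False
  then obtain h where h: "Suc (length h) = length g" "set h \<subseteq> carrier R"
   "!!x. x \<in> carrier R ==> eval g x = (x \<ominus> r)\<otimes>eval h x \<oplus> eval g r"
   "!!S J. subring S R ==> submod S J ==> r \<in> S ==> set h \<subseteq> J ==> eval g r \<in> J ==> set g \<subseteq> J" using snoc(1)[OF False g] by blast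
  have gr: "eval g r \<in> carrier R" using eval_in_carrier[OF g r] .
  show ?thesis
  proof (intro exI[of _ "h @ [eval g r]"] conjI ballI allI impI)
   show "Suc (length (h @ [eval g r])) = length (g @ [c])" using h(1) by simp
   show "set (h @ [eval g r]) \<subseteq> carrier R" using h(2) gr by simp
   fix x assume x: "x \<in> carrier R"
   have hx: "eval h x \<in> carrier R" using eval_in_carrier[OF h(2) x] .
   have "eval (g @ [c]) x = eval g x\<otimes>x \<oplus> c" by (rule eval_snoc[OF g c x])
   also have "\<dots> = ((x \<ominus> r)\<otimes>eval h x \<oplus> eval g r)\<otimes>x \<oplus> c" using h(3)[OF x] by simp
   also have "\<dots> = (x \<ominus> r)\<otimes>(eval h x\<otimes>x \<oplus> eval g r) \<oplus> (eval g r\<otimes>r \<oplus> c)" using hx gr x r c by algebra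
   finally show "eval (g @ [c]) x = (x \<ominus> r)\<otimes>eval (h @ [eval g r]) x \<oplus> eval (g @ [c]) r"
    using eval_snoc[OF g c r] eval_snoc[OF h(2) gr x] by simp
  next
   fix S J assume S: "subring S R" and J: "submod S J" and rS: "r \<in> S"
    and hJ: "set (h @ [eval g r]) \<subseteq> J" and gJ: "eval (g @ [c]) r \<in> J"
   have g1: "set g \<subseteq> J" using h(4)[OF S J rS] hJ by simp
   have "r\<otimes>eval g r \<in> J" using submodD(5)[OF J rS] hJ by simp
   hence "eval (g @ [c]) r \<ominus> r\<otimes>eval g r \<in> J" using submod_diff[OF S J gJ] by simp
   moreover have "eval (g @ [c]) r \<ominus> r\<otimes>eval g r = c"
   proof -
    have "eval (g @ [c]) r = eval g r\<otimes>r \<oplus> c" by (rule eval_snoc[OF g c r])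
    moreover have "(eval g r\<otimes>r \<oplus> c) \<ominus> r\<otimes>eval g r = c" using gr r c by algebra
    ultimately show ?thesis by simp
   qed
   ultimately show "set (g @ [c]) \<subseteq> J" using g1 by simp
  qed
 qed
qed simp

end

context field
begin

lemma monic_splits:
 assumes "!!p. p \<in> carrier (poly_ring R) ==> splitted p"
  and "p \<in> carrier (poly_ring R)" "p ~= []" "lead_coeff p = \<one>"
 shows "\<exists>rs. length rs = degree p & set rs \<subseteq> carrier R & (\<forall>x\<in>carrier R. eval p x = rootprod rs x)" using assms(2-)
proof (induct "degree p" arbitrary: p)
 case 0
 then obtain a where "p = [a]" by (cases p) auto
 thus ?case using 0 by (intro exI[of _ "[]"]) simp
next
 case (Suc n)
 have "size (roots p) = Suc n" using assms(1)[OF Suc(3)] Suc(2) unfolding splitted_def by simp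
 hence "roots p ~= {#}" by auto
 then obtain r where r: "r \<in> carrier R" "[\<one>, \<ominus> r] \<in> carrier (poly_ring R)" "[\<one>, \<ominus> r] pdivides p"
  using not_empty_rootsE[OF Suc(3)] by blast
 obtain q where q: "q \<in> carrier (poly_ring R)" "p = [\<one>, \<ominus> r] \<otimes>\<^bsub>poly_ring R\<^esub> q" using r(3) unfolding pdivides_def factor_def by auto
 have pq: "polynomial (carrier R) q" "polynomial (carrier R) [\<one>, \<ominus> r]" using q(1) r(2) unfolding univ_poly_carrier by auto
 have pm: "p = poly_mult [\<one>, \<ominus> r] q" using q(2) unfolding univ_poly_mult .
 have q0: "q ~= []"
 proof
  assume "q = []"
  hence "p = []" using pm poly_mult_zero(2)[of "[\<one>, \<ominus> r]"] r(1) by simp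
  thus False using Suc by simp
 qed
 have lc: "lead_coeff q = \<one>"
 proof -
  have "lead_coeff p = lead_coeff [\<one>, \<ominus> r]\<otimes>lead_coeff q"
   unfolding pm by (rule poly_mult_lead_coeff[OF carrier_is_subring pq(2,1)]) (use q0 in auto)
  moreover have "lead_coeff q \<in> carrier R" using q0 pq(1) polynomial_in_carrier[OF carrier_is_subring] by (metis list.set_sel(1) subsetD)
  ultimately show ?thesis using Suc(5) by simp
 qed
 have "degree p = degree [\<one>, \<ominus> r] + degree q" unfolding pm using poly_mult_degree_eq[OF carrier_is_subring pq(2,1)] q0 by simp
 hence dq: "degree q = n" using Suc(2) by simp
 obtain rs where rs: "length rs = n" "set rs \<subseteq> carrier R" "!!x. x \<in> carrier R ==> eval q x = rootprod rs x"
  using Suc(1)[OF dq[symmetric] q(1) q0 lc] dq by auto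
 have "eval p x = rootprod (r # rs) x" if x: "x \<in> carrier R" for x
 proof -
  have "eval p x = eval [\<one>, \<ominus> r] x\<otimes>eval q x"
   unfolding pm using r(1) polynomial_in_carrier[OF carrier_is_subring pq(1)] x by (intro eval_poly_mult) auto
  thus ?thesis using rs(3)[OF x] x r(1) by (simp add: a_minus_def)
 qed
 thus ?case using rs r(1) Suc(2) by (intro exI[of _ "r # rs"]) simp
qed

lemma polyfun_zero_extends:
 assumes inf: "infinite (carrier R)" and \<phi>: "polyfun (carrier R) \<phi>"
  and z: "!!x. x \<in> carrier R ==> x ~= r ==> \<phi> x = \<zero>" and r: "r \<in> carrier R"
 shows "\<phi> r = \<zero>"
proof -
 obtain p where p: "set p \<subseteq> carrier R" "!!x. x \<in> carrier R ==> \<phi> x = eval p x" using \<phi> unfolding polyfun_def by metis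
 let ?q = "normalize p"
 have q: "?q \<in> carrier (poly_ring R)" using normalize_gives_polynomial[OF p(1)] unfolding univ_poly_carrier .
 have e: "eval ?q x = \<phi> x" if "x \<in> carrier R" for x using eval_normalize[OF p(1) that] p(2)[OF that] by simp
 have "?q = []"
 proof (rule ccontr)
  assume "?q ~= []"
  hence "carrier R - {r} \<subseteq> {x. is_root ?q x}" using e z unfolding is_root_def by auto
  hence "finite (carrier R - {r})" using finite_number_of_roots[OF q] finite_subset by blast
  thus False using inf by simp
 qed
 thus ?thesis using e[OF r] by simp
qed

text \<open>A list of at most \<open>degree (Irr K x)\<close> coefficients is a polynomial of smaller degree than the
minimal polynomial.\<close>

lemma Irr_small_zero:
 assumes K: "subfield K R" and x: "x \<in> carrier R" "algebraic K x"
  and g: "set g \<subseteq> K" "length g \<le> degree (Irr K x)" "eval g x = \<zero>" and y: "y \<in> carrier R"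
 shows "eval g y = \<zero>"
proof -
 have gc: "set g \<subseteq> carrier R" using g(1) subfieldE(3)[OF K] by auto
 let ?q = "normalize g"
 have q: "?q \<in> carrier (K[X])" using normalize_gives_polynomial[OF g(1)] unfolding univ_poly_carrier .
 have e: "eval ?q z = eval g z" if "z \<in> carrier R" for z using eval_normalize[OF gc that] .
 have "?q = []"
 proof (rule ccontr)
  assume q0: "?q ~= []"
  have x': "((algebraic over K) x)" using x(2) unfolding over_def .
  have "Irr K x pdivides ?q" using Irr_minimal[OF K x(1) x' q] e[OF x(1)] g(3) by simp
  hence "degree (Irr K x) \<le> degree ?q" using pdivides_imp_degree_le[OF subfieldE(1)[OF K] IrrE(1)[OF K x(1) x'] q q0] by simp
  moreover have "length ?q \<le> length g" by (rule normalize_length_le)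
  moreover have "degree (Irr K x) \<ge> 1" using pirreducible_degree[OF K IrrE(1,2)[OF K x(1) x']] .
  ultimately show False using g(2) q0 by (cases ?q) auto
 qed
 thus ?thesis using e[OF y] by simp
qed

lemma Irr_conjugate:
 assumes K: "subfield K R" and x: "x \<in> carrier R" "algebraic K x"
  and p: "set p \<subseteq> K" "eval p x = \<zero>" and y: "y \<in> carrier R" "eval (Irr K x) y = \<zero>"
 shows "eval p y = \<zero>"
proof -
 have pc: "set p \<subseteq> carrier R" using p(1) subfieldE(3)[OF K] by auto
 let ?q = "normalize p"
 have q: "?q \<in> carrier (K[X])" using normalize_gives_polynomial[OF p(1)] unfolding univ_poly_carrier .
 have e: "eval ?q z = eval p z" if "z \<in> carrier R" for z using eval_normalize[OF pc that] .
 have x': "((algebraic over K) x)" using x(2) unfolding over_def .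
 have "Irr K x pdivides ?q" using Irr_minimal[OF K x(1) x' q] e[OF x(1)] p(2) by simp
 moreover have "Irr K x \<in> carrier (poly_ring R)" using IrrE(1)[OF K x(1) x'] carrier_polynomial_shell[OF subfieldE(1)[OF K]] by simp
 ultimately have "eval ?q y = \<zero>" using pdivides_imp_root_sharing[of "Irr K x" ?q y] y by simp
 thus ?thesis using e[OF y(1)] by simp
qed

end

section \<open>One step of the tower\<close>

text \<open>The minimum of e v(c_i) + i over the non-zero coefficients c_i, with None for the zero polynomial. This is the
value of the polynomial at an element of value 1 if e is the ramification index: for at most e coefficients
these numbers are distinct modulo e.\<close>

primrec gval :: "'a => ('a => int) => int => 'a list => int option" where
 "gval z v e [] = None"
| "gval z v e (a # p) = (if a = z then gval z v e p else
   (case gval z v e p of None => Some (e * v a + int (length p))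
   | Some m => Some (min m (e * v a + int (length p)))))"

lemma gval_index: "gval z v e g = Some m ==> \<exists>i<length g. \<exists>k. m = e * k + int i"
proof (induct g arbitrary: m)
 case (Cons a p)
 show ?case
 proof (cases "gval z v e p = Some m")
  case True thus ?thesis using Cons(1) by (metis length_Cons less_SucI)
 next
  case False
  hence "m = e * v a + int (length p)" using Cons(2) by (auto split: if_splits option.splits simp: min_def)
  thus ?thesis by auto
 qed
qed simp

lemma gval_less: "gval z v e g = Some m ==> c \<in> set g ==> c ~= z ==> m < e * v c + int (length g)"
proof (induct g arbitrary: m)
 case (Cons a p)
 show ?case
 proof (cases "gval z v e p")
  case None
  have "set p \<subseteq> {z}" using None by (induct p) (auto split: if_splits option.splits)
  hence "c = a" using Cons(3,4) by auto
  thus ?thesis using Cons(2,4) None by auto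
 next
  case (Some l)
  show ?thesis
  proof (cases "c \<in> set p")
   case True
   hence "l < e * v c + int (length p)" using Cons(1)[OF Some] Cons(4) by simp
   moreover have "m \<le> l" using Cons(2) Some by (auto split: if_splits)
   ultimately show ?thesis by simp
  next
   case False
   hence "c = a" using Cons(3) by auto
   thus ?thesis using Cons(2,4) Some by (auto split: if_splits)
  qed
 qed
qed simp

lemma gval_None: "gval z v e g = None ==> set g \<subseteq> {z}" by (induct g) (auto split: if_splits option.splits)

locale dedekind_closed = dedekind R K D + algebraically_closed R for R (structure) and K D
begin

lemma infinite_carrier:
 assumes Q: "mxn Q" shows "infinite (carrier R)"
proof -
 note v = place_vl[OF Q]
 obtain t where t: "t \<in> D" "t ~= \<zero>" "vl Q t = 1" using v_uniformizer[OF v] by auto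
 have "vl Q (t [^] n) = int n" for n :: nat using v_pow[OF v, of t n] t D_K by simp
 hence "inj (\<lambda>n::nat. t [^] n)" by (metis injI of_nat_eq_iff)
 moreover have "range (\<lambda>n::nat. t [^] n) \<subseteq> carrier R" using t by auto
 ultimately show ?thesis using finite_subset infinite_UNIV_nat finite_imageD by blast
qed

lemma rootprod_nonzero: "set rs \<subseteq> carrier R ==> x \<in> carrier R ==> x \<notin> set rs ==> rootprod rs x ~= \<zero>"
 by (induct rs) (auto simp: integral_iff rootprod_closed)

lemma rootprod_root: "set rs \<subseteq> carrier R ==> x \<in> carrier R ==> x \<in> set rs ==> rootprod rs x = \<zero>"
 by (induct rs) (auto simp: integral_iff rootprod_closed)

lemma rootprod_factor:
 assumes S: "subring S R" "set rs \<subseteq> S" "x \<in> S" "s \<in> set rs"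
 shows "\<exists>w\<in>S. rootprod rs x = (x \<ominus> s)\<otimes>w" using assms(2,4)
proof (induct rs)
 case (Cons r rs)
 have SC: "!!x. x \<in> S ==> x \<in> carrier R" using subringE(1)[OF S(1)] by auto
 have rp: "rootprod rs x \<in> S" using Cons(2) S(3)
 proof -
  have "set rs \<subseteq> S" using Cons(2) by simp
  thus ?thesis by (induct rs) (use S(3) subringE(3,5,6,7)[OF S(1)] in \<open>auto simp: a_minus_def\<close>)
 qed
 show ?case
 proof (cases "s = r")
  case True thus ?thesis using rp by (intro bexI[of _ "rootprod rs x"]) auto
 next
  case False
  then obtain w where w: "w \<in> S" "rootprod rs x = (x \<ominus> s)\<otimes>w" using Cons by auto
  have "(x \<ominus> r)\<otimes>rootprod rs x = (x \<ominus> s)\<otimes>((x \<ominus> r)\<otimes>w)"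
  proof -
   have "r \<in> carrier R" "s \<in> carrier R" using Cons(2,3) SC by auto
   thus ?thesis unfolding w(2) using SC[OF w(1)] SC[OF S(3)] by (simp add: m_lcomm[of "x \<ominus> r" "x \<ominus> s" w])
  qed
  moreover have "(x \<ominus> r)\<otimes>w \<in> S" using w(1) S(3) Cons(2) subringE(5,6,7)[OF S(1)] by (simp add: a_minus_def)
  ultimately show ?thesis by auto
 qed
qed simp

abbreviation "Rint \<equiv> {x. intg D x}"

lemma Rint_carr: "intg D x ==> x \<in> carrier R" unfolding intg_def by simp

lemma Rint_closed: "intg D \<zero>" "intg D \<one>" "intg D x ==> intg D (\<ominus> x)" "intg D x ==> intg D y ==> intg D (x\<otimes>y)"
 "intg D x ==> intg D y ==> intg D (x \<oplus> y)" "intg D x ==> intg D y ==> intg D (x \<ominus> y)" "x \<in> D ==> intg D x"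
 using subringE[OF intg_subring[OF D]] intg_base[OF D] by (auto simp: a_minus_def)

lemma Rint_pow: "intg D x ==> intg D (x [^] (n::nat))" by (induct n) (auto simp: Rint_closed)

text \<open>Newton interpolation: a polynomial is recovered from its values at distinct nodes by dividing by differences
of nodes, so a product \<Delta> of such differences is a common denominator.\<close>

lemma interpolation_bound:
 assumes "set rs \<subseteq> Rint" "distinct rs"
 shows "\<exists>\<Delta>. intg D \<Delta> & \<Delta> ~= \<zero> & (\<forall>g. set g \<subseteq> carrier R --> length g = length rs -->
  (\<forall>r\<in>set rs. intg D (eval g r)) --> (\<forall>c\<in>set g. intg D (\<Delta>\<otimes>c)))" using assms
proof (induct rs)
 case Nil thus ?case using Rint_closed(2) by (intro exI[of _ \<one>]) auto
next
 case (Cons r rs)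
 then obtain \<Delta> where d: "intg D \<Delta>" "\<Delta> ~= \<zero>"
  "!!g. set g \<subseteq> carrier R ==> length g = length rs ==> (!!r. r \<in> set rs ==> intg D (eval g r)) ==> (\<forall>c\<in>set g. intg D (\<Delta>\<otimes>c))" by auto
 have r: "intg D r" "r \<in> carrier R" and rs: "set rs \<subseteq> Rint" "set rs \<subseteq> carrier R" "r \<notin> set rs" using Cons(2,3) Rint_carr by auto
 let ?u = "rootprod rs r"
 have u0: "?u ~= \<zero>" using rootprod_nonzero rs r by simp
 have uI: "intg D ?u" using rs(1) by (induct rs) (auto simp: Rint_closed r(1))
 have uc: "?u \<in> carrier R" "\<Delta> \<in> carrier R" using uI d(1) Rint_carr by auto
 show ?case
 proof (intro exI[of _ "\<Delta>\<otimes>?u"] conjI allI impI)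
  show "intg D (\<Delta>\<otimes>?u)" using Rint_closed(4)[OF d(1) uI] .
  show "\<Delta>\<otimes>?u ~= \<zero>" using d(2) u0 uc by (simp add: integral_iff)
  fix g assume g: "set g \<subseteq> carrier R" "length g = length (r # rs)" "\<forall>r\<in>set (r # rs). intg D (eval g r)"
  have "g ~= []" using g(2) by auto
  then obtain h where h: "Suc (length h) = length g" "set h \<subseteq> carrier R"
   "!!x. x \<in> carrier R ==> eval g x = (x \<ominus> r)\<otimes>eval h x \<oplus> eval g r"
   "!!S J. subring S R ==> submod S J ==> r \<in> S ==> set h \<subseteq> J ==> eval g r \<in> J ==> set g \<subseteq> J"
   using synthetic_division[OF r(2) _ g(1)] by blast
  let ?h = "map ((\<otimes>) ?u) h"
  have ev: "eval ?h s = ?u\<otimes>eval h s" if s: "s \<in> carrier R" for s using h(2)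
  proof (induct h)
   case (Cons a q)
   hence "a \<in> carrier R" "eval q s \<in> carrier R" "s [^] length q \<in> carrier R" using s eval_in_carrier by auto
   thus ?case using Cons uc by (simp add: r_distr m_assoc)
  qed (use uc in simp)
  have val: "intg D (eval ?h s)" if s: "s \<in> set rs" for s
  proof -
   have sI: "intg D s" "s \<in> carrier R" using rs s by auto
   obtain w where w: "intg D w" "?u = (r \<ominus> s)\<otimes>w" using rootprod_factor[OF intg_subring[OF D] rs(1) _ s, of r] r(1) by auto
   have c: "w \<in> carrier R" "eval h s \<in> carrier R" "eval g r \<in> carrier R" 
    using w(1) Rint_carr eval_in_carrier h(2) g(1) sI r by auto
   have "eval g s \<ominus> eval g r = (s \<ominus> r)\<otimes>eval h s" unfolding h(3)[OF sI(2)] using c sI r by algebra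
   moreover have "intg D (eval g s \<ominus> eval g r)" using g(3) s Rint_closed(6) by simp
   ultimately have "intg D ((\<ominus> w)\<otimes>((s \<ominus> r)\<otimes>eval h s))" using w(1) Rint_closed by simp
   moreover have "(\<ominus> w)\<otimes>((s \<ominus> r)\<otimes>eval h s) = ?u\<otimes>eval h s" unfolding w(2) using c sI r by algebra
   ultimately show ?thesis using ev[OF sI(2)] by simp
  qed
  have hc: "set ?h \<subseteq> carrier R" using h(2) uc by auto
  have lh: "length ?h = length rs" using h(1) g(2) by simp
  have hI: "\<forall>c\<in>set ?h. intg D (\<Delta>\<otimes>c)" by (rule d(3)[OF hc lh val])
  let ?J = "{c \<in> carrier R. intg D ((\<Delta>\<otimes>?u)\<otimes>c)}"
  have J: "submod Rint ?J" unfolding submod_def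
  proof (intro conjI ballI)
   show "\<zero> \<in> ?J" using uc Rint_closed(1) by simp
  next
   fix x y assume xy: "x \<in> ?J" "y \<in> ?J"
   have "(\<Delta>\<otimes>?u)\<otimes>(x \<oplus> y) = (\<Delta>\<otimes>?u)\<otimes>x \<oplus> (\<Delta>\<otimes>?u)\<otimes>y" using xy uc by (simp add: r_distr)
   thus "x \<oplus> y \<in> ?J" using xy Rint_closed(5) by simp
  next
   fix a x assume ax: "a \<in> Rint" "x \<in> ?J"
   have "(\<Delta>\<otimes>?u)\<otimes>(a\<otimes>x) = a\<otimes>((\<Delta>\<otimes>?u)\<otimes>x)" using ax uc Rint_carr by (simp add: m_lcomm)
   thus "a\<otimes>x \<in> ?J" using ax Rint_closed(4) Rint_carr by simp
  qed auto
  have "set h \<subseteq> ?J" using hI h(2) uc by (auto simp: m_assoc subset_iff)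
  moreover have "eval g r \<in> ?J" using g r uc \<open>intg D (\<Delta>\<otimes>?u)\<close> Rint_closed(4) eval_in_carrier by simp
  ultimately have "set g \<subseteq> ?J" using h(4)[OF intg_subring[OF D] J] r(1) by simp
  thus "\<forall>c\<in>set g. intg D (\<Delta>\<otimes>?u\<otimes>c)" by auto
 qed
qed

text \<open>A double root y would be a root of the derivative of F, which is that of \<open>rootprod as\<close>. As a
polynomial over K with at most \<open>degree (Irr K y)\<close> coefficients, the derivative would vanish
everywhere; but at the first element \<open>a\<close> of \<open>as\<close> it is the product of the non-zero
differences a - b.\<close>

lemma distinct_roots:
 assumes inf: "infinite (carrier R)" and as: "distinct as" "as ~= []" "set as \<subseteq> D" and \<pi>: "\<pi> \<in> D"
  and F: "!!x. x \<in> carrier R ==> eval F x = rootprod as x \<oplus> \<pi>"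
  and rs: "set rs \<subseteq> carrier R" "!!x. x \<in> carrier R ==> eval F x = rootprod rs x"
  and deg: "!!r. r \<in> set rs ==> algebraic K r & degree (Irr K r) = length as"
 shows "distinct rs"
proof (rule ccontr)
 assume "\<not> distinct rs"
 then obtain xs ys zs y where dec: "rs = xs @ [y] @ ys @ [y] @ zs" using not_distinct_decomp by blast
 have c: "set xs \<subseteq> carrier R" "set ys \<subseteq> carrier R" "set zs \<subseteq> carrier R" "y \<in> carrier R" using rs(1) dec by auto
 have asc: "set as \<subseteq> carrier R" using as(3) by auto
 define h where "h x = rootprod (xs @ ys @ zs) x" for x
 have hx: "h x \<in> carrier R" if "x \<in> carrier R" for x unfolding h_def using rootprod_closed c that by simp
 have split: "rootprod rs x = (x \<ominus> y)\<otimes>((x \<ominus> y)\<otimes>h x)" if x: "x \<in> carrier R" for x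
 proof -
  have cc: "rootprod xs x \<in> carrier R" "rootprod ys x \<in> carrier R" "rootprod zs x \<in> carrier R" using rootprod_closed c x by auto
  have "rootprod rs x = rootprod xs x\<otimes>((x \<ominus> y)\<otimes>(rootprod ys x\<otimes>((x \<ominus> y)\<otimes>rootprod zs x)))"
   unfolding dec using c x by (simp add: rootprod_append rootprod_closed)
  also have "\<dots> = (x \<ominus> y)\<otimes>((x \<ominus> y)\<otimes>(rootprod xs x\<otimes>(rootprod ys x\<otimes>rootprod zs x)))" using cc c x by algebra
  finally show ?thesis unfolding h_def using c x by (simp add: rootprod_append rootprod_closed)
 qed
 \<comment> \<open>By F(y) = 0 the two terms agree for x \<noteq> y; being polynomial functions they agree at y too, where the first is the derivative and the second is zero.\<close>
 define \<phi> where "\<phi> x = rootprod_diff as y x \<ominus> (x \<ominus> y)\<otimes>h x" for x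
 note CS = carrier_is_subring
 have "polyfun (carrier R) \<phi>" unfolding \<phi>_def h_def
  using polyfun_minus[OF CS polyfun_rootprod_diff[OF CS asc c(4)] polyfun_mult[OF CS polyfun_minus[OF CS polyfun_id[OF CS] polyfun_const[OF c(4) c(4)]] polyfun_rootprod[OF CS, of "xs @ ys @ zs"]]] c
  by simp
 moreover have "\<phi> x = \<zero>" if x: "x \<in> carrier R" "x ~= y" for x
 proof -
  have dx: "rootprod_diff as y x \<in> carrier R" using rootprod_diff_closed asc c(4) x by simp
  have pc: "rootprod as x \<in> carrier R" "rootprod as y \<in> carrier R" using rootprod_closed asc c(4) x by auto
  have "eval F y = \<zero>" using rs(2)[OF c(4)] rootprod_root[OF rs(1) c(4)] dec by simp
  hence "rootprod as y \<oplus> \<pi> = \<zero>" using F[OF c(4)] by simp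
  hence "rootprod as x \<ominus> rootprod as y = (rootprod as x \<oplus> \<pi>) \<ominus> \<zero>"
   using pc \<pi> by (metis D_carr a_minus_def a_assoc a_comm minus_equality minus_minus minus_zero r_zero a_closed)
  hence "(x \<ominus> y)\<otimes>rootprod_diff as y x = eval F x" using rootprod_diff[OF asc c(4) x(1)] F[OF x(1)] pc \<pi> by (simp add: a_minus_def)
  also have "\<dots> = (x \<ominus> y)\<otimes>((x \<ominus> y)\<otimes>h x)" using rs(2)[OF x(1)] split[OF x(1)] by simp
  finally have "rootprod_diff as y x = (x \<ominus> y)\<otimes>h x"
   using m_lcancel[of "x \<ominus> y" "rootprod_diff as y x" "(x \<ominus> y)\<otimes>h x"] x c(4) dx hx[OF x(1)] by simp
  thus ?thesis unfolding \<phi>_def using x c(4) hx[OF x(1)] by (simp add: a_minus_def r_neg)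
 qed
 ultimately have "\<phi> y = \<zero>" using polyfun_zero_extends[OF inf _ _ c(4)] by blast
 hence d0: "rootprod_deriv as y = \<zero>" unfolding \<phi>_def using c(4) hx[OF c(4)] rootprod_diff_closed[OF asc c(4) c(4)]
  by (simp add: a_minus_def r_neg rootprod_diff_diagonal)
 obtain g where g: "set g \<subseteq> D" "length g = length as" "!!x. x \<in> carrier R ==> eval g x = rootprod_deriv as x"
  using rootprod_deriv_coefficients[OF D as(3)] by blast
 obtain a bs where ab: "as = a # bs" using as(2) by (cases as) auto
 have ac: "a \<in> carrier R" "set bs \<subseteq> carrier R" using asc ab by auto
 have gK: "set g \<subseteq> K" using g(1) D_K by auto
 have "y \<in> set rs" using dec by simp
 hence "eval g a = \<zero>" using Irr_small_zero[OF K c(4) _ gK _ _ ac(1)] deg g(2) g(3)[OF c(4)] d0 by simp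
 moreover have "rootprod_deriv as a = rootprod bs a"
 proof -
  have "rootprod_deriv bs a \<in> carrier R" using ac(2) by (induct bs) (auto simp: rootprod_closed ac(1))
  moreover have "a \<ominus> a = \<zero>" using ac by (simp add: a_minus_def r_neg)
  ultimately show ?thesis using ab rootprod_closed[OF ac(2,1)] by simp
 qed
 ultimately have "rootprod bs a = \<zero>" using g(3)[OF ac(1)] by simp
 thus False using rootprod_nonzero[OF ac(2,1)] as(1) ab by simp
qed

text \<open>Coefficients of positive value are divisible by t in D_P; s clears the denominators of the quotients
simultaneously.\<close>

lemma uniform_divisor:
 assumes P: "mxn P" and t: "t \<in> D" "t ~= \<zero>" "vl P t = 1" and p: "set p \<subseteq> D" "!!c. c \<in> set p ==> vge (vl P) c 1"
 shows "\<exists>s\<in>D - P. \<forall>c\<in>set p. \<exists>b\<in>D. s\<otimes>c = t\<otimes>b" using p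
proof (induct p)
 case Nil
 have "\<one> \<in> D - P" using M_one P by simp
 thus ?case by (intro bexI[of _ \<one>]) auto
next
 case (Cons c p)
 have mP: "mx D P" using P by simp
 note v = place_vl[OF P]
 obtain s where s: "s \<in> D - P" "!!c. c \<in> set p ==> \<exists>b\<in>D. s\<otimes>c = t\<otimes>b" using Cons by auto
 have cD: "c \<in> D" using Cons(2) by simp
 have "\<exists>s'\<in>D - P. \<exists>b\<in>D. s'\<otimes>c = t\<otimes>b"
 proof (cases "c = \<zero>")
  case True
  have "s\<otimes>c = t\<otimes>\<zero>" using True s(1) t by simp
  thus ?thesis using s(1) D_closed(1) by blast
 next
  case False
  let ?y = "c\<otimes>inv t"
  have tK: "t \<in> K" "t \<in> carrier R" using t D_K by auto
  have it0: "inv t ~= \<zero>" using t tK by (metis cinv(2) r_null one_not_zero)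
  have y: "?y \<in> K" "?y ~= \<zero>" using cD D_K t it0 tK False by (auto simp: integral_iff)
  have "1 \<le> vl P c" using Cons(3)[of c] False unfolding vge_def by simp
  hence "0 \<le> vl P ?y" using v_mult[OF v, of c "inv t"] v_inv[OF v, of t] cD D_K t it0 tK False by simp
  then obtain s' where s': "s' \<in> D - P" "s'\<otimes>?y \<in> D" using v_loc[OF v y] by blast
  have "s'\<otimes>c = t\<otimes>(s'\<otimes>?y)"
  proof -
   have cc: "s' \<in> carrier R" "c \<in> carrier R" "inv t \<in> carrier R" using s' cD t tK by auto
   have "t\<otimes>(s'\<otimes>?y) = (s'\<otimes>c)\<otimes>(t\<otimes>inv t)" using cc tK by algebra
   thus ?thesis using t tK cc by simp
  qed
  thus ?thesis using s' by blast
 qed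
 then obtain s' b where s': "s' \<in> D - P" "b \<in> D" "s'\<otimes>c = t\<otimes>b" by blast
 have "\<exists>b\<in>D. (s\<otimes>s')\<otimes>c' = t\<otimes>b" if c': "c' \<in> set (c # p)" for c'
 proof (cases "c' = c")
  case True
  have "(s\<otimes>s')\<otimes>c = s\<otimes>(s'\<otimes>c)" using s(1) s'(1) cD by (simp add: m_assoc)
  also have "\<dots> = t\<otimes>(s\<otimes>b)" unfolding s'(3) using s(1) s'(2) t by (simp add: m_lcomm)
  finally show ?thesis using True s(1) s'(2) by auto
 next
  case False
  then obtain b' where b': "b' \<in> D" "s\<otimes>c' = t\<otimes>b'" using s(2) c' by auto
  have c'D: "c' \<in> D" using c' Cons(2) by auto
  have "(s\<otimes>s')\<otimes>c' = s'\<otimes>(s\<otimes>c')" using s(1) s'(1) c'D by (simp add: m_ac)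
  also have "\<dots> = t\<otimes>(s'\<otimes>b')" unfolding b'(2) using s'(1) b'(1) t by (simp add: m_lcomm)
  finally show ?thesis using s'(1) b'(1) by auto
 qed
 thus ?case using DM_mult[OF mP s(1) s'(1)] by blast
qed

text \<open>The roots r of a monic factor q are roots of the Eisenstein polynomial, so s r^e is t times an integral
element. Up to sign the constant term of q is the product of its roots, so its e-th power is locally divisible
by t.\<close>

lemma eisenstein_constant:
 assumes P: "mxn P" and p: "set p \<subseteq> D" "p ~= []" "!!c. c \<in> set p ==> vge (vl P) c 1"
  and q: "q \<in> carrier (K[X])" "lead_coeff q = \<one>" "degree q \<ge> 1"
  and roots: "!!r. r \<in> carrier R ==> eval q r = \<zero> ==> eval (\<one> # p) r = \<zero>"
  and nz: "eval q \<zero> ~= \<zero>"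
 shows "eval q \<zero> \<in> K" "1 \<le> vl P (eval q \<zero>)"
proof -
 note v = place_vl[OF P]
 have mP: "mx D P" using P by simp
 have q0: "q ~= []" using q(3) by auto
 have qK: "set q \<subseteq> K" using q(1) unfolding univ_poly_carrier[symmetric] polynomial_def by auto
 show AK: "eval q \<zero> \<in> K" using eval_in_subring[OF subfieldE(1)[OF K] qK K_closed(1)] .
 have "q \<in> carrier (poly_ring R)" using q(1) carrier_polynomial_shell[OF subfieldE(1)[OF K]] by simp
 then obtain rs where rs: "length rs = degree q" "set rs \<subseteq> carrier R" "!!x. x \<in> carrier R ==> eval q x = rootprod rs x"
  using monic_splits[OF roots_over_carrier _ q0 q(2)] by blast
 obtain t where t: "t \<in> D" "t ~= \<zero>" "vl P t = 1" using v_uniformizer[OF v] by auto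
 obtain s where s: "s \<in> D - P" "!!c. c \<in> set p ==> \<exists>b\<in>D. s\<otimes>c = t\<otimes>b" using uniform_divisor[OF P t p(1,3)] by blast
 have sc: "s \<in> carrier R" "t \<in> carrier R" using s t by auto
 let ?e = "length p"
 have pc: "set p \<subseteq> carrier R" using p(1) by auto
 have one: "\<exists>\<rho>. intg D \<rho> & s\<otimes>(\<zero> \<ominus> r) [^] ?e = t\<otimes>\<rho>" if r: "r \<in> set rs" for r
 proof -
  have rc: "r \<in> carrier R" using r rs(2) by auto
  have "eval q r = \<zero>" using rs(3)[OF rc] rootprod_root[OF rs(2) rc r] by simp
  hence F: "eval (\<one> # p) r = \<zero>" using roots rc by simp
  have rI: "intg D r" using monic_imp_intg[OF D rc p(1) F] .
  have pe: "eval p r \<in> carrier R" using eval_in_carrier[OF pc rc] .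
  have "r [^] ?e \<oplus> eval p r = \<zero>" using F rc by simp
  hence re: "r [^] ?e = \<ominus> eval p r" using pe rc by (simp add: sum_zero_eq_neg)
  have "\<exists>\<rho>. intg D \<rho> & s\<otimes>eval p r = t\<otimes>\<rho>" using s(2) pc
  proof (induct p)
   case Nil thus ?case using sc Rint_closed(1) by (intro exI[of _ \<zero>]) simp
  next
   case (Cons c p)
   obtain b where b: "b \<in> D" "s\<otimes>c = t\<otimes>b" using Cons(2) by auto
   obtain \<rho> where \<rho>: "intg D \<rho>" "s\<otimes>eval p r = t\<otimes>\<rho>" using Cons by auto
   have cc: "c \<in> carrier R" "b \<in> carrier R" "\<rho> \<in> carrier R" "eval p r \<in> carrier R" "r [^] length p \<in> carrier R"
    using Cons(3) b(1) \<rho>(1) Rint_carr eval_in_carrier rc by auto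
   have "s\<otimes>eval (c # p) r = (s\<otimes>c)\<otimes>r [^] length p \<oplus> s\<otimes>eval p r" using cc sc by (simp add: r_distr m_assoc)
   also have "\<dots> = t\<otimes>(b\<otimes>r [^] length p \<oplus> \<rho>)" unfolding b(2) \<rho>(2) using cc sc by (simp add: r_distr m_assoc)
   finally show ?case using Rint_closed(5)[OF Rint_closed(4)[OF Rint_closed(7)[OF b(1)] Rint_pow[OF rI]] \<rho>(1)] by (intro exI conjI)
  qed
  then obtain \<rho> where \<rho>: "intg D \<rho>" "s\<otimes>eval p r = t\<otimes>\<rho>" by blast
  have \<rho>c: "\<rho> \<in> carrier R" using \<rho>(1) Rint_carr by simp
  have "\<zero> \<ominus> r = (\<ominus> \<one>)\<otimes>r" using rc by (simp add: a_minus_def l_minus)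
  hence "s\<otimes>(\<zero> \<ominus> r) [^] ?e = (\<ominus> \<one>) [^] ?e\<otimes>(s\<otimes>r [^] ?e)" using rc sc by (simp add: nat_pow_distrib m_lcomm)
  also have "\<dots> = (\<ominus> \<one>) [^] ?e\<otimes>(\<ominus> (s\<otimes>eval p r))" unfolding re using sc pe by (simp add: r_minus)
  also have "\<dots> = t\<otimes>((\<ominus> \<one>) [^] ?e\<otimes>(\<ominus> \<rho>))" unfolding \<rho>(2) using sc \<rho>c by (simp add: r_minus m_lcomm)
  finally show ?thesis
   using Rint_closed(4)[OF Rint_pow[OF Rint_closed(3)[OF Rint_closed(2)]] Rint_closed(3)[OF \<rho>(1)]] by (intro exI conjI)
 qed
 have "\<exists>\<rho>. intg D \<rho> & s [^] length rs\<otimes>rootprod rs \<zero> [^] ?e = t [^] length rs\<otimes>\<rho>" using one rs(2)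
 proof (induct rs)
  case Nil thus ?case using Rint_closed(2) by (intro exI[of _ \<one>]) simp
 next
  case (Cons r rs)
  obtain \<rho> where \<rho>: "intg D \<rho>" "s\<otimes>(\<zero> \<ominus> r) [^] ?e = t\<otimes>\<rho>" using Cons(2) by auto
  obtain \<rho>' where \<rho>': "intg D \<rho>'" "s [^] length rs\<otimes>rootprod rs \<zero> [^] ?e = t [^] length rs\<otimes>\<rho>'" using Cons by auto
  have cc: "r \<in> carrier R" "rootprod rs \<zero> \<in> carrier R" "\<rho> \<in> carrier R" "\<rho>' \<in> carrier R" 
   "s [^] length rs \<in> carrier R" "t [^] length rs \<in> carrier R" using Cons(3) \<rho>(1) \<rho>'(1) Rint_carr rootprod_closed sc by auto
  have c2: "(\<zero> \<ominus> r) [^] ?e \<in> carrier R" "rootprod rs \<zero> [^] ?e \<in> carrier R" using cc by auto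
  have "s [^] length (r # rs)\<otimes>rootprod (r # rs) \<zero> [^] ?e =
   (s [^] length rs\<otimes>s)\<otimes>((\<zero> \<ominus> r) [^] ?e\<otimes>rootprod rs \<zero> [^] ?e)" using cc by (simp add: nat_pow_distrib)
  also have "\<dots> = (s\<otimes>(\<zero> \<ominus> r) [^] ?e)\<otimes>(s [^] length rs\<otimes>rootprod rs \<zero> [^] ?e)" using cc c2 sc by algebra
  also have "\<dots> = (t [^] length rs\<otimes>t)\<otimes>(\<rho>\<otimes>\<rho>')" unfolding \<rho>(2) \<rho>'(2) using cc sc by algebra
  finally show ?case using \<rho>(1) \<rho>'(1) Rint_closed(4) by (intro exI[of _ "\<rho>\<otimes>\<rho>'"]) simp
 qed
 then obtain \<rho> where \<rho>: "intg D \<rho>" "s [^] length rs\<otimes>eval q \<zero> [^] ?e = t [^] length rs\<otimes>\<rho>" using rs(3)[OF zero_closed] by auto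
 let ?n = "length rs" and ?A = "eval q \<zero>"
 have s0: "s ~= \<zero>" using DM_nonzero[OF mP s(1)] .
 have \<rho>c: "\<rho> \<in> carrier R" using \<rho>(1) Rint_carr by simp
 have tn: "t [^] ?n \<in> K" "t [^] ?n ~= \<zero>" using t D_K by auto
 have lhs: "s [^] ?n\<otimes>?A [^] ?e \<in> K" "s [^] ?n\<otimes>?A [^] ?e ~= \<zero>" using s(1) s0 AK nz D_K by (auto simp: integral_iff)
 have "inv (t [^] ?n)\<otimes>(t [^] ?n\<otimes>\<rho>) = \<rho>" using tn \<rho>c by (simp add: m_assoc[symmetric])
 moreover have "inv (t [^] ?n)\<otimes>(t [^] ?n\<otimes>\<rho>) \<in> K" using lhs(1) tn unfolding \<rho>(2)[symmetric] by simp
 ultimately have \<rho>D: "\<rho> \<in> D" using normal \<rho>(1) by simp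
 have \<rho>0: "\<rho> ~= \<zero>" using lhs(2) unfolding \<rho>(2) using tn(1) by auto
 have "vl P (s [^] ?n\<otimes>?A [^] ?e) = int ?e * vl P ?A"
  using v_mult[OF v, of "s [^] ?n" "?A [^] ?e"] v_pow[OF v, of s ?n] v_pow[OF v AK nz, of ?e] v_unit[OF v, of s]
   s s0 AK nz D_K by simp
 moreover have "vl P (t [^] ?n\<otimes>\<rho>) = int ?n + vl P \<rho>" using v_mult[OF v tn D_K[OF \<rho>D] \<rho>0] v_pow[OF v, of t ?n] t D_K by simp
 moreover have "0 \<le> vl P \<rho>" using v_D[OF v \<rho>D \<rho>0] .
 moreover have "1 \<le> ?n" using rs(1) q(3) by simp
 ultimately have "0 < int ?e * vl P ?A" using \<rho>(2) by simp
 hence "0 < vl P ?A" by (simp add: zero_less_mult_iff)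
 thus "1 \<le> vl P ?A" by simp
qed

text \<open>In a proper factorization both constant terms would have value at least 1, but their product has value 1.\<close>

lemma eisenstein_degree:
 assumes P: "mxn P" and p: "set p \<subseteq> D" "p ~= []" "!!c. c \<in> set p ==> vge (vl P) c 1"
  and c: "last p ~= \<zero>" "vl P (last p) = 1" and r: "r \<in> carrier R" "eval (\<one> # p) r = \<zero>"
 shows "algebraic K r & degree (Irr K r) = length p"
proof -
 let ?F = "\<one> # p"
 note v = place_vl[OF P]
 note KS = subfieldE(1)[OF K]
 have FK: "?F \<in> carrier (K[X])" using p(1) D_K unfolding univ_poly_carrier[symmetric] polynomial_def by auto
 have alg: "algebraic K r" using algebraicI[OF FK _ r(2)] unfolding over_def by simp
 hence alg': "((algebraic over K) r)" unfolding over_def .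
 note I = IrrE[OF K r(1) alg']
 have "Irr K r pdivides ?F" using Irr_minimal[OF K r(1) alg' FK r(2)] .
 hence "Irr K r divides\<^bsub>K[X]\<^esub> ?F" using pdivides_iff_shell[OF K I(1) FK] by simp
 then obtain h where h: "h \<in> carrier (K[X])" "?F = Irr K r \<otimes>\<^bsub>K[X]\<^esub> h" unfolding factor_def by blast
 have pm: "?F = poly_mult (Irr K r) h" using h(2) unfolding univ_poly_mult .
 have polys: "polynomial K (Irr K r)" "polynomial K h" using I(1) h(1) unfolding univ_poly_carrier by auto
 have dI: "degree (Irr K r) \<ge> 1" using pirreducible_degree[OF K I(1,2)] .
 have sets: "set (Irr K r) \<subseteq> carrier R" "set h \<subseteq> carrier R" using polynomial_in_carrier[OF KS] polys by auto
 have ne: "Irr K r ~= []" "h ~= []"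
 proof -
  show "Irr K r ~= []" using dI by auto
  show "h ~= []"
  proof
   assume "h = []"
   hence "?F = []" using pm poly_mult_zero(2)[OF sets(1)] by simp
   thus False by simp
  qed
 qed
 have ev: "eval ?F x = eval (Irr K r) x\<otimes>eval h x" if "x \<in> carrier R" for x unfolding pm by (rule eval_poly_mult[OF sets that])
 have "degree ?F = degree (Irr K r) + degree h" unfolding pm using poly_mult_degree_eq[OF KS polys] ne by simp
 hence dg: "length p = degree (Irr K r) + degree h" by simp
 have lh: "lead_coeff h = \<one>"
 proof -
  have "lead_coeff ?F = lead_coeff (Irr K r)\<otimes>lead_coeff h" unfolding pm by (rule poly_mult_lead_coeff[OF KS polys ne])
  moreover have "lead_coeff h \<in> carrier R" using ne(2) sets(2) by (metis list.set_sel(1) subsetD)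
  ultimately show ?thesis using I(3) by simp
 qed
 obtain p0 where p0: "p = p0 @ [last p]" using p(2) by (metis append_butlast_last_id)
 have lc: "last p \<in> D" using p(1,2) by auto
 have F0: "eval ?F \<zero> = last p"
 proof -
  have s: "set (\<one> # p0) \<subseteq> carrier R" using p(1) p0 by (metis D_carr insert_subset le_sup_iff list.simps(15) one_closed set_append subsetI subset_eq)
  have "eval ?F \<zero> = eval ((\<one> # p0) @ [last p]) \<zero>" using p0 by simp
  also have "\<dots> = eval (\<one> # p0) \<zero>\<otimes>\<zero> \<oplus> last p" by (rule eval_snoc[OF s]) (use lc in auto)
  also have "\<dots> = last p" using eval_in_carrier[OF s zero_closed] lc by (simp del: eval.simps)
  finally show ?thesis .
 qed
 have "degree h = 0"
 proof (rule ccontr)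
  assume "degree h ~= 0"
  hence dh: "degree h \<ge> 1" by simp
  have eh: "eval h x \<in> carrier R" "eval (Irr K r) x \<in> carrier R" if "x \<in> carrier R" for x using eval_in_carrier sets that by auto
  have prod: "eval (Irr K r) \<zero>\<otimes>eval h \<zero> = last p" using ev[OF zero_closed] F0 by simp
  have nz: "eval (Irr K r) \<zero> ~= \<zero>" "eval h \<zero> ~= \<zero>" using prod c(1) eh[OF zero_closed] by auto
  note A = eisenstein_constant[OF P p I(1,3) dI _ nz(1)]
  note B = eisenstein_constant[OF P p h(1) lh dh _ nz(2)]
  have 1: "eval (Irr K r) \<zero> \<in> K" "1 \<le> vl P (eval (Irr K r) \<zero>)" using A ev eh by (auto simp del: eval.simps)
  have 2: "eval h \<zero> \<in> K" "1 \<le> vl P (eval h \<zero>)" using B ev eh by (auto simp del: eval.simps)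
  show False using v_mult[OF v 1(1) nz(1) 2(1) nz(2)] 1(2) 2(2) c(2) prod by simp
 qed
 thus ?thesis using dg alg by simp
qed

end

text \<open>L = K(\<theta>), where \<theta> is a root of an irreducible monic polynomial (\<one> # p) over D with distinct
roots \<open>rs\<close>, and E is the integral closure of D in L.\<close>

locale monic_root = dedekind_closed R K D for R (structure) and K D +
 fixes p \<theta> rs
 assumes p: "set p \<subseteq> D" "p ~= []"
  and rs: "set rs \<subseteq> carrier R" "length rs = length p" "distinct rs"
  and splits: "x \<in> carrier R ==> eval (\<one> # p) x = rootprod rs x"
  and \<theta>: "\<theta> \<in> set rs" and alg: "algebraic K \<theta>" and deg: "degree (Irr K \<theta>) = length p"
begin

definition L where "L = simple_extension K \<theta>"
definition E where "E = {x \<in> L. intg D x}"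

lemma \<theta>_carr: "\<theta> \<in> carrier R" using \<theta> rs by auto

lemma alg': "((algebraic over K) \<theta>)" using alg unfolding over_def .

lemma p_carr: "set p \<subseteq> carrier R" "set (\<one> # p) \<subseteq> carrier R" using p by auto

lemma root: "r \<in> set rs ==> eval (\<one> # p) r = \<zero>"
proof -
 assume r: "r \<in> set rs"
 hence rc: "r \<in> carrier R" using rs(1) by auto
 show "eval (\<one> # p) r = \<zero>" unfolding splits[OF rc] by (rule rootprod_root[OF rs(1) rc r])
qed

lemma root_intg: "r \<in> set rs ==> intg D r"
proof -
 assume r: "r \<in> set rs"
 hence rc: "r \<in> carrier R" using rs(1) by auto
 show "intg D r" by (rule monic_imp_intg[OF D rc p(1) root[OF r]])
qed

text \<open>The factor \<open>Irr K \<theta>\<close> has the degree of the whole polynomial \<one> # p, so both have the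
same roots.\<close>

lemma conjugate_root:
 assumes r: "r \<in> set rs" shows "eval (Irr K \<theta>) r = \<zero>"
proof -
 note I = IrrE[OF K \<theta>_carr alg']
 have "degree (Irr K \<theta>) \<ge> 1" using pirreducible_degree[OF K I(1,2)] .
 then obtain i where i: "Irr K \<theta> = \<one> # i" using I(3) by (cases "Irr K \<theta>") auto
 have li: "length p = length i" using deg i by simp
 have iK: "set i \<subseteq> K" using I(1) i unfolding univ_poly_carrier[symmetric] polynomial_def by auto
 have ic: "set i \<subseteq> carrier R" using iK by auto
 let ?g = "map2 (\<lambda>u w. u \<ominus> \<one>\<otimes>w) p i"
 have gK: "set ?g \<subseteq> K"
 proof
  fix z assume "z \<in> set ?g"
  then obtain u w where uw: "(u, w) \<in> set (zip p i)" "z = u \<ominus> \<one>\<otimes>w" by auto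
  have "u \<in> K" "w \<in> K" using p(1) iK D_K set_zip_leftD[OF uw(1)] set_zip_rightD[OF uw(1)] by auto
  thus "z \<in> K" unfolding uw(2) by simp
 qed
 have ev: "eval (\<one> # p) x \<ominus> eval (Irr K \<theta>) x = eval ?g x" if x: "x \<in> carrier R" for x
 proof -
  have c: "eval p x \<in> carrier R" "eval i x \<in> carrier R" "x [^] length i \<in> carrier R" using eval_in_carrier p_carr ic x by auto
  have "eval ?g x = eval p x \<ominus> \<one>\<otimes>eval i x" by (rule map2_eval[OF li p_carr(1) ic x one_closed])
  moreover have "(\<one>\<otimes>x [^] length i \<oplus> eval p x) \<ominus> (\<one>\<otimes>x [^] length i \<oplus> eval i x) = eval p x \<ominus> \<one>\<otimes>eval i x" using c by algebra
  ultimately show ?thesis unfolding i using li by simp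
 qed
 have rc: "r \<in> carrier R" using r rs(1) by auto
 have "eval ?g \<theta> = \<zero> \<ominus> \<zero>" using ev[OF \<theta>_carr] unfolding root[OF \<theta>] I(4) by (rule sym)
 hence "eval ?g \<theta> = \<zero>" by (simp add: a_minus_def)
 hence gr: "eval ?g r = \<zero>" using Irr_small_zero[OF K \<theta>_carr alg gK _ _ rc] deg li by simp
 have Ic: "eval (Irr K \<theta>) r \<in> carrier R" unfolding i by (rule eval_in_carrier) (use ic rc in auto)
 have "\<zero> \<ominus> eval (Irr K \<theta>) r = \<zero>" using ev[OF rc] unfolding root[OF r] gr .
 hence "\<ominus> eval (Irr K \<theta>) r = \<zero>" using Ic by (simp add: a_minus_def)
 thus ?thesis using Ic by (metis minus_minus minus_zero)
qed

lemma conjugate_zero: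
 assumes "r \<in> set rs" "set u \<subseteq> K" "eval u \<theta> = \<zero>" shows "eval u r = \<zero>"
proof -
 have "r \<in> carrier R" using assms(1) rs(1) by auto
 thus ?thesis by (rule Irr_conjugate[OF K \<theta>_carr alg assms(2,3) _ conjugate_root[OF assms(1)]])
qed

lemma conjugate_polyfun:
 assumes r: "r \<in> set rs" and \<phi>: "polyfun K \<phi>" and z: "\<phi> \<theta> = \<zero>" shows "\<phi> r = \<zero>"
proof -
 obtain u where u: "set u \<subseteq> K" "!!x. x \<in> carrier R ==> \<phi> x = eval u x" using \<phi> unfolding polyfun_def by metis
 have rc: "r \<in> carrier R" using r rs(1) by auto
 have "eval u \<theta> = \<zero>" using u(2)[OF \<theta>_carr] z by simp
 thus ?thesis using conjugate_zero[OF r u(1)] u(2)[OF rc] by simp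
qed

lemma conjugate_intg:
 assumes r: "r \<in> set rs" and u: "set u \<subseteq> K" "intg D (eval u \<theta>)" shows "intg D (eval u r)"
proof -
 obtain q where q: "set q \<subseteq> D" "eval (\<one> # q) (eval u \<theta>) = \<zero>" using intg_imp_monic[OF D noeth u(2)] by blast
 have "polyfun K (\<lambda>x. eval (\<one> # q) (eval u x))"
  using polyfun_compose[OF subfieldE(1)[OF K] polyfun_eval[OF u(1)], of "\<one> # q"] q(1) D_K by auto
 hence "eval (\<one> # q) (eval u r) = \<zero>" using conjugate_polyfun[OF r] q(2) by simp
 moreover have "set u \<subseteq> carrier R" "r \<in> carrier R" using u(1) r rs(1) by auto
 hence "eval u r \<in> carrier R" by (rule eval_in_carrier)
 ultimately show ?thesis using monic_imp_intg[OF D _ q(1)] by simp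
qed

lemma L_subfield: "subfield L R" unfolding L_def using simple_extension_is_subfield[OF K \<theta>_carr] alg' by simp

lemma L_dimension: "dimension (length p) K L" unfolding L_def using dimension_simple_extension[OF K \<theta>_carr alg'] deg by simp

lemma K_L: "x \<in> K ==> x \<in> L" unfolding L_def using simple_extension_incl[OF subfieldE(3)[OF K] \<theta>_carr] by auto

lemma \<theta>_L: "\<theta> \<in> L" unfolding L_def using simple_extension_mem[OF subfieldE(1)[OF K] \<theta>_carr] .

lemma \<theta>_E: "\<theta> \<in> E" unfolding E_def using \<theta>_L root_intg[OF \<theta>] by simp

lemma L_eval: "set g \<subseteq> K ==> eval g \<theta> \<in> L"
proof -
 assume g: "set g \<subseteq> K"
 show "eval g \<theta> \<in> L" by (rule eval_in_subring[OF subfieldE(1)[OF L_subfield] _ \<theta>_L]) (use g K_L in auto)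
qed

lemma L_rep:
 assumes "x \<in> L" shows "\<exists>g. set g \<subseteq> K & length g = length p & x = eval g \<theta>"
proof -
 have "x \<in> Span K (exp_base \<theta> (length p))" using assms Span_exp_base[OF K \<theta>_carr alg'] deg unfolding L_def by simp
 then obtain Ks where Ks: "set Ks \<subseteq> K" "length Ks = length (exp_base \<theta> (length p))" "x = combine Ks (exp_base \<theta> (length p))"
  using Span_mem_iff_length_version[OF K exp_base_closed[OF \<theta>_carr]] by auto
 have "length Ks = length p" using Ks(2) by (simp add: exp_base_def)
 thus ?thesis using Ks combine_eq_eval[of Ks \<theta>] by (intro exI[of _ Ks]) simp
qed

lemma D_E: "x \<in> D ==> x \<in> E" unfolding E_def using K_L D_K Rint_closed(7) by simp

lemma E_subring: "subring E R"
proof -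
 have "subring (L \<inter> Rint) R" by (rule subring_inter[OF subfieldE(1)[OF L_subfield] intg_subring[OF D]])
 moreover have "L \<inter> Rint = E" unfolding E_def by auto
 ultimately show ?thesis by simp
qed

lemma map_mult_eval:
 assumes "set g \<subseteq> carrier R" "x \<in> carrier R" "d \<in> carrier R"
 shows "eval (map ((\<otimes>) d) g) x = d\<otimes>eval g x" using assms(1)
proof (induct g)
 case (Cons a q)
 hence "a \<in> carrier R" "eval q x \<in> carrier R" "x [^] length q \<in> carrier R" using assms eval_in_carrier by auto
 thus ?case using Cons assms by (simp add: r_distr m_assoc)
qed (use assms in simp)

text \<open>If g(\<theta>) is integral, so are its conjugates g(r). By \<open>interpolation_bound\<close> a fixed
\<Delta>, which may be replaced by a multiple d \<in> D, makes the coefficients of g integral. So dE lies in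
the span of the powers of \<theta>, and is finitely generated since D is noetherian.\<close>

lemma E_finite: "\<exists>ws. set ws \<subseteq> carrier R & E = Span D ws"
proof -
 have rsI: "set rs \<subseteq> Rint" using root_intg by auto
 obtain \<Delta> where \<Delta>: "intg D \<Delta>" "\<Delta> ~= \<zero>" "!!g. set g \<subseteq> carrier R ==> length g = length rs ==>
  (!!r. r \<in> set rs ==> intg D (eval g r)) ==> (\<forall>c\<in>set g. intg D (\<Delta>\<otimes>c))" using interpolation_bound[OF rsI rs(3)] by blast
 obtain d y where d: "d \<in> D" "d ~= \<zero>" "intg D y" "\<Delta>\<otimes>y = d" using integral_multiple_in_base[OF \<Delta>(1,2)] by blast
 have dc: "d \<in> carrier R" "inv d \<in> carrier R" "inv d \<in> K" using d D_K by auto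
 let ?U = "{x \<in> carrier R. inv d\<otimes>x \<in> E}"
 have ES: "submod D E" using submod_subring[OF E_subring] D_E by blast
 have U: "submod D ?U" unfolding submod_def using submodD[OF ES] dc by (auto simp: r_distr m_lcomm)
 have "?U \<subseteq> Span D (pows \<theta> (length p))"
 proof
  fix x assume x: "x \<in> ?U"
  let ?z = "inv d\<otimes>x"
  have z: "?z \<in> L" "intg D ?z" using x unfolding E_def by auto
  obtain g where g: "set g \<subseteq> K" "length g = length p" "?z = eval g \<theta>" using L_rep[OF z(1)] by blast
  have gc: "set g \<subseteq> carrier R" using g(1) by auto
  have "\<forall>c\<in>set g. intg D (\<Delta>\<otimes>c)" by (rule \<Delta>(3)[OF gc]) (use g rs(2) conjugate_intg z(2) in auto)
  hence "d\<otimes>c \<in> D" if c: "c \<in> set g" for c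
  proof -
   have cK: "c \<in> K" using g(1) c by auto
   have "y\<otimes>(\<Delta>\<otimes>c) = d\<otimes>c" using d(4) Rint_carr[OF d(3)] Rint_carr[OF \<Delta>(1)] cK by (metis K_carr m_assoc m_comm)
   moreover have "intg D (y\<otimes>(\<Delta>\<otimes>c))" using Rint_closed(4)[OF d(3)] \<open>\<forall>c\<in>set g. intg D (\<Delta>\<otimes>c)\<close> c by simp
   moreover have "d\<otimes>c \<in> K" using D_K[OF d(1)] cK by simp
   ultimately show ?thesis using normal by simp
  qed
  hence "set (map ((\<otimes>) d) g) \<subseteq> D" by auto
  hence "eval (map ((\<otimes>) d) g) \<theta> \<in> Span D (pows \<theta> (length p))" using eval_in_Span_pows[OF D \<theta>_carr] g(2) by simp
  moreover have "eval (map ((\<otimes>) d) g) \<theta> = x"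
   using map_mult_eval[OF gc \<theta>_carr dc(1)] g(3)[symmetric] x dc d by (simp add: m_assoc[symmetric])
  ultimately show "x \<in> Span D (pows \<theta> (length p))" by simp
 qed
 then obtain vs where vs: "set vs \<subseteq> ?U" "?U = Span D vs" using noeth_submod[OF D noeth pows_closed[OF \<theta>_carr] U] by blast
 let ?ws = "map ((\<otimes>) (inv d)) vs"
 have wsE: "set ?ws \<subseteq> E" using vs(1) by auto
 have wsc: "set ?ws \<subseteq> carrier R" using wsE subringE(1)[OF E_subring] by blast
 have "E \<subseteq> Span D ?ws"
 proof
  fix x assume x: "x \<in> E"
  have xc: "x \<in> carrier R" using x subringE(1)[OF E_subring] by auto
  have "inv d\<otimes>(d\<otimes>x) = x" using xc dc d by (simp add: m_assoc[symmetric])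
  hence "d\<otimes>x \<in> ?U" using x xc dc by simp
  hence "d\<otimes>x \<in> Span D vs" unfolding vs(2) .
  moreover have "submod D {z \<in> carrier R. inv d\<otimes>z \<in> Span D ?ws}" unfolding submod_def
   using submodD[OF submod_Span[OF D wsc]] dc by (auto simp: r_distr m_lcomm)
  moreover have "set vs \<subseteq> {z \<in> carrier R. inv d\<otimes>z \<in> Span D ?ws}" using Span_gens[OF D wsc] vs(1) by auto
  hence "Span D vs \<subseteq> {z \<in> carrier R. inv d\<otimes>z \<in> Span D ?ws}" by (rule Span_least[rotated]) fact
  ultimately have "inv d\<otimes>(d\<otimes>x) \<in> Span D ?ws" by auto
  thus "x \<in> Span D ?ws" using \<open>inv d\<otimes>(d\<otimes>x) = x\<close> by simp
 qed
 moreover have "Span D ?ws \<subseteq> E" using Span_least[OF ES wsE] .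
 ultimately show ?thesis using wsc by blast
qed

lemma common_denominator:
 assumes "set g \<subseteq> K" shows "\<exists>b\<in>D. b ~= \<zero> & (\<forall>c\<in>set g. b\<otimes>c \<in> D)" using assms
proof (induct g)
 case Nil thus ?case using D_closed(2) one_not_zero by (intro bexI[of _ \<one>]) auto
next
 case (Cons a g)
 obtain b where b: "b \<in> D" "b ~= \<zero>" "!!c. c \<in> set g ==> b\<otimes>c \<in> D" using Cons by auto
 obtain b' where b': "b' \<in> D" "b' ~= \<zero>" "b'\<otimes>a \<in> D" using frac[of a] Cons(2) by auto
 have "(b'\<otimes>b)\<otimes>c \<in> D" if "c \<in> set (a # g)" for c
 proof (cases "c = a")
  case True
  have "(b'\<otimes>b)\<otimes>a = b\<otimes>(b'\<otimes>a)" using b b' Cons(2) by (simp add: m_ac)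
  thus ?thesis using True b b' by simp
 next
  case False
  hence "c \<in> set g" "c \<in> carrier R" using that Cons(2) by auto
  thus ?thesis using b b' by (simp add: m_assoc)
 qed
 moreover have "b'\<otimes>b ~= \<zero>" using b b' by (simp add: integral_iff)
 ultimately show ?case using b b' by (intro bexI[of _ "b'\<otimes>b"]) auto
qed

lemma ext: "dedekind_ext R K D L E"
proof -
 obtain ws where ws: "set ws \<subseteq> carrier R" "E = Span D ws" using E_finite by (elim exE conjE)
 have DE: "D \<subseteq> E" using D_E by blast
 have frac': "\<exists>a\<in>E. \<exists>b\<in>E. b ~= \<zero> & b\<otimes>x = a" if x: "x \<in> L" for x
 proof -
  obtain g where g: "set g \<subseteq> K" "x = eval g \<theta>" using L_rep[OF x] by blast
  obtain b where b: "b \<in> D" "b ~= \<zero>" "!!c. c \<in> set g ==> b\<otimes>c \<in> D" using common_denominator[OF g(1)] by blast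
  have gc: "set g \<subseteq> carrier R" using g(1) by auto
  have "b\<otimes>x = eval (map ((\<otimes>) b) g) \<theta>" using map_mult_eval[OF gc \<theta>_carr] b(1) g(2) by simp
  moreover have "set (map ((\<otimes>) b) g) \<subseteq> E" using b(3) D_E by auto
  hence "eval (map ((\<otimes>) b) g) \<theta> \<in> E" by (rule eval_in_subring[OF E_subring _ \<theta>_E])
  ultimately show ?thesis using D_E[OF b(1)] b(2) by auto
 qed
 have normal': "x \<in> E" if x: "x \<in> L" "intg E x" for x unfolding E_def using x(1) intg_trans[OF D E_subring ws(2,1) x(2)] by simp
 have dim1': "mx E P" if "pri E P" "P ~= {\<zero>}" for P by (rule finite_extension_dim1(1)[OF E_subring ws(2,1) D_E that])
 have "dedekind R L E"
 proof (rule dedekind.intro[OF field_axioms], rule dedekind_axioms.intro)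
  show "subfield L R" by (rule L_subfield)
  show "subring E R" by (rule E_subring)
  show "!!x. x \<in> E ==> x \<in> L" unfolding E_def by simp
  show "noeth E" by (rule noeth_extension[OF D noeth E_subring ws(2,1) DE])
 qed (rule frac' normal' dim1'; assumption)+
 thus ?thesis by (intro dedekind_ext.intro dedekind_axioms dedekind_ext_axioms.intro D_E E_finite)
qed

text \<open>At a prime N above P the equation \<theta>^e = - p(\<theta>) forces the ramification index to be e times the
value of \<theta>. Hence the value of any element of L is given by \<open>gval\<close>, up to the factor k =
v(\<theta>), which is 1 because 1 is a value. As \<open>gval\<close> does not depend on N, there is only one
N. An element of E has coefficients of non-negative value, so modulo N it is congruent to its constant
coefficient, and so to an element of D.\<close>

lemma eisenstein_above:
 assumes P: "mxn P" and c: "!!c. c \<in> set p ==> vge (vl P) c 1" "last p ~= \<zero>" "vl P (last p) = 1"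
 shows "\<exists>N. dedekind_ext.above R D E P = {N} & (\<forall>y\<in>E. \<exists>d\<in>D. y \<ominus> d \<in> N) &
  (\<forall>x\<in>K. x ~= \<zero> --> dedekind.vl R L E N x = int (length p) * vl P x)"
proof -
 interpret X: dedekind_ext R K D L E by (rule ext)
 note v = place_vl[OF P]
 have mP: "mx D P" using P by simp
 define e where "e = length p"
 have e1: "e \<ge> 1" using p(2) unfolding e_def by (cases p) auto
 obtain p0 where p0: "p = p0 @ [last p]" using p(2) by (metis append_butlast_last_id)
 have p0D: "set p0 \<subseteq> D" using p(1) p0 by (metis le_sup_iff set_append)
 have lD: "last p \<in> D" using p by auto
 have \<theta>0: "\<theta> ~= \<zero>"
 proof
  assume z: "\<theta> = \<zero>"
  have "eval ((\<one> # p0) @ [last p]) \<theta> = eval (\<one> # p0) \<theta>\<otimes>\<theta> \<oplus> last p" by (rule eval_snoc) (use p0D lD \<theta>_carr in auto)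
  moreover have "eval (\<one> # p0) \<theta> \<in> carrier R" by (rule eval_in_carrier) (use p0D \<theta>_carr in auto)
  ultimately have "eval (\<one> # p) \<theta> = last p" using z lD p0 by (simp del: eval.simps)
  thus False using root[OF \<theta>] c(2) by simp
 qed
 have val: "\<exists>k>0. (\<forall>x\<in>K. x ~= \<zero> --> X.E.vl N x = k * (int e * vl P x)) & X.E.vl N \<theta> = k &
   (\<forall>g. set g \<subseteq> K --> length g \<le> e --> (case gval \<zero> (vl P) (int e) g of None => eval g \<theta> = \<zero>
     | Some m => eval g \<theta> ~= \<zero> & X.E.vl N (eval g \<theta>) = k * m))"
  if N: "N \<in> X.above P" for N
 proof -
  have mN: "X.E.mxn N" "N \<inter> D = P" using N unfolding X.above_def by auto
  have mN1: "mx E N" using mN by simp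
  note w = X.E.place_vl[OF mN(1)]
  obtain r where r: "r > 0" "!!x. x \<in> K ==> x ~= \<zero> ==> X.E.vl N x = r * vl P x" using X.ramification[OF mP v w mN(2)] by blast
  define k where "k = X.E.vl N \<theta>"
  have vc: "vge (X.E.vl N) c r" if "c \<in> set p" for c
  proof (cases "c = \<zero>")
   case False
   hence "1 \<le> vl P c" using c(1)[OF that] unfolding vge_def by simp
   hence "r * 1 \<le> r * vl P c" using r(1) by simp
   thus ?thesis using r(2)[of c] False that p(1) D_K unfolding vge_def by auto
  qed (simp add: vge_def)
  have pL: "set p \<subseteq> L" using p(1) D_K K_L by auto
  have ge: "q ~= [] \<or> q = [] ==> set q \<subseteq> set p ==> eval q \<theta> \<in> L & vge (X.E.vl N) (eval q \<theta>) r" for q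
  proof (induct q)
   case (Cons a q)
   have a: "a \<in> set p" "a \<in> L" using Cons(3) pL by auto
   have "vge (X.E.vl N) (\<theta> [^] length q) 0" using X.E.vge_D[OF w] \<theta>_E by simp
   hence "vge (X.E.vl N) (a\<otimes>\<theta> [^] length q) r" using X.E.vge_mult[OF w a(2) _ vc[OF a(1)], of "\<theta> [^] length q" 0] \<theta>_L by simp
   thus ?case using X.E.vge_add[OF w, of "a\<otimes>\<theta> [^] length q" "eval q \<theta>" r] Cons a \<theta>_L by simp
  qed (simp add: vge_def)
  have pe: "eval p \<theta> \<in> L" "vge (X.E.vl N) (eval p \<theta>) r" using ge[of p] by auto
  have "\<theta> [^] e \<oplus> eval p \<theta> = \<zero>" using root[OF \<theta>] \<theta>_carr unfolding e_def by simp
  hence te: "\<theta> [^] e = \<ominus> eval p \<theta>" using pe(1) \<theta>_carr by (simp add: sum_zero_eq_neg)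
  have te0: "\<theta> [^] e ~= \<zero>" using \<theta>0 \<theta>_carr by simp
  have pow: "X.E.vl N (\<theta> [^] n) = int n * k" for n :: nat unfolding k_def using X.E.v_pow[OF w \<theta>_L \<theta>0] .
  have "r \<le> X.E.vl N (\<theta> [^] e)" using pe X.E.vge_minus[OF w pe] te te0 unfolding vge_def by auto
  hence "0 < int e * k" using pow r(1) by simp
  hence k0: "k > 0" by (simp add: zero_less_mult_iff)
  have lr: "X.E.vl N (last p) = r" using r(2)[of "last p"] c(2,3) lD D_K by simp
  have s0: "eval p0 \<theta> \<in> L" "vge (X.E.vl N) (eval p0 \<theta>) r" using ge[of p0] p0 by (metis (no_types) append_Nil Un_upper1 set_append)+
  have "vge (X.E.vl N) (eval p0 \<theta>\<otimes>\<theta>) (r + k)" by (rule X.E.vge_mult[OF w s0(1) \<theta>_L s0(2)]) (simp add: vge_def k_def)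
  hence sm: "vge (X.E.vl N) (eval p0 \<theta>\<otimes>\<theta>) (X.E.vl N (last p) + 1)" using X.E.vge_mono[OF w] k0 lr by simp
  have "eval p \<theta> = eval p0 \<theta>\<otimes>\<theta> \<oplus> last p" by (subst p0, rule eval_snoc) (use p0D lD \<theta>_carr in auto)
  hence "eval p \<theta> = last p \<oplus> eval p0 \<theta>\<otimes>\<theta>" using s0(1) lD \<theta>_carr by (simp add: a_comm)
  hence "X.E.vl N (eval p \<theta>) = r" using X.E.v_add_eq(2)[OF w _ c(2) _ sm] lD D_K K_L s0(1) \<theta>_L lr by simp
  hence "X.E.vl N (\<theta> [^] e) = r" using X.E.v_minus[OF w pe(1)] te by simp
  hence rk: "r = int e * k" using pow by simp
  have gv: "case gval \<zero> (vl P) (int e) g of None => eval g \<theta> = \<zero>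
     | Some m => eval g \<theta> ~= \<zero> & X.E.vl N (eval g \<theta>) = k * m"
   if "set g \<subseteq> K" "length g \<le> e" for g using that
  proof (induct g)
   case (Cons a g)
   have aK: "a \<in> K" and gK: "set g \<subseteq> K" "length g \<le> e" using Cons(2,3) by auto
   have gL: "eval g \<theta> \<in> L" using L_eval gK by simp
   have tl: "\<theta> [^] length g \<in> L" "\<theta> [^] length g ~= \<zero>" using \<theta>_L \<theta>0 \<theta>_carr by auto
   show ?case
   proof (cases "a = \<zero>")
    case True
    hence 1: "eval (a # g) \<theta> = eval g \<theta>" using gL tl by simp
    have 2: "gval \<zero> (vl P) (int e) (a # g) = gval \<zero> (vl P) (int e) g" using True by simp
    show ?thesis unfolding 1 2 by (rule Cons(1)[OF gK])
   next
    case False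
    let ?h = "a\<otimes>\<theta> [^] length g" and ?m = "int e * vl P a + int (length g)"
    have h: "?h \<in> L" "?h ~= \<zero>" using aK K_L tl False by (auto simp: integral_iff)
    have vh: "X.E.vl N ?h = k * ?m"
     using X.E.v_mult[OF w K_L[OF aK] False tl] r(2)[OF aK False] pow rk by (simp add: algebra_simps)
    show ?thesis
    proof (cases "gval \<zero> (vl P) (int e) g")
     case None
     hence "eval g \<theta> = \<zero>" using Cons(1)[OF gK] by simp
     thus ?thesis using None False h vh by simp
    next
     case (Some m)
     hence ih: "eval g \<theta> ~= \<zero>" "X.E.vl N (eval g \<theta>) = k * m" using Cons(1)[OF gK] by auto
     obtain i l where il: "i < length g" "m = int e * l + int i" using gval_index[OF Some] by blast
     \<comment> \<open>The new term has exponent \<open>length g\<close>, larger than all previous ones and less than e, so the values differ modulo e.\<close>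
     have neq: "m ~= ?m"
     proof
      assume "m = ?m"
      hence "(int e * l + int i) mod int e = (int e * vl P a + int (length g)) mod int e" using il by simp
      hence "int i mod int e = int (length g) mod int e" by simp
      moreover have "length g < e" using Cons(3) by simp
      ultimately show False using il(1) by simp
     qed
     show ?thesis
     proof (cases "m < ?m")
      case True
      hence "k * m < k * ?m" using k0 by simp
      hence "vge (X.E.vl N) ?h (X.E.vl N (eval g \<theta>) + 1)" unfolding vge_def using vh ih by linarith
      from X.E.v_add_eq[OF w gL ih(1) h(1) this]
      have "?h \<oplus> eval g \<theta> ~= \<zero>" "X.E.vl N (?h \<oplus> eval g \<theta>) = k * m" using ih(2) h(1) gL by (auto simp: a_comm)
      thus ?thesis using Some False True by simp
     next
      case False
      hence "?m < m" using neq by simp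
      hence "k * ?m < k * m" using k0 by simp
      hence "vge (X.E.vl N) (eval g \<theta>) (X.E.vl N ?h + 1)" unfolding vge_def using vh ih by linarith
      from X.E.v_add_eq[OF w h gL this]
      have "?h \<oplus> eval g \<theta> ~= \<zero>" "X.E.vl N (?h \<oplus> eval g \<theta>) = k * ?m" using vh by auto
      thus ?thesis using Some \<open>a ~= \<zero>\<close> \<open>?m < m\<close> by simp
     qed
    qed
   qed
  qed simp
  show ?thesis using k0 r(2) rk gv k_def by (intro exI[of _ k]) (simp add: mult.commute mult.left_commute)
 qed
 have val': "(\<forall>x\<in>K. x ~= \<zero> --> X.E.vl N x = int e * vl P x) & X.E.vl N \<theta> = 1 &
   (\<forall>g. set g \<subseteq> K --> length g \<le> e --> (case gval \<zero> (vl P) (int e) g of None => eval g \<theta> = \<zero>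
     | Some m => eval g \<theta> ~= \<zero> & X.E.vl N (eval g \<theta>) = m))"
  if N: "N \<in> X.above P" for N
 proof -
  obtain k where k: "k > 0" "\<forall>x\<in>K. x ~= \<zero> --> X.E.vl N x = k * (int e * vl P x)" "X.E.vl N \<theta> = k"
   "\<forall>g. set g \<subseteq> K --> length g \<le> e --> (case gval \<zero> (vl P) (int e) g of None => eval g \<theta> = \<zero>
     | Some m => eval g \<theta> ~= \<zero> & X.E.vl N (eval g \<theta>) = k * m)" using val[OF N] by blast
  have "X.E.mxn N" using N unfolding X.above_def by simp
  then obtain y where y: "y \<in> E" "y ~= \<zero>" "X.E.vl N y = 1" using X.E.v_uniformizer[OF X.E.place_vl] by blast
  obtain g where g: "set g \<subseteq> K" "length g = e" "y = eval g \<theta>" using L_rep[OF X.E.D_K[OF y(1)]] unfolding e_def by blast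
  have "\<exists>m. k * m = 1" using k(4)[rule_format, OF g(1)] g(2,3) y by (auto split: option.splits)
  hence "k = 1" using k(1) by (metis pos_zmult_eq_1_iff)
  from k(2-4)[unfolded this mult_1] show ?thesis by (intro conjI)
 qed
 have gvE: "x = \<zero> & gval \<zero> (vl P) (int e) g = None \<or> (\<exists>m. gval \<zero> (vl P) (int e) g = Some m & x ~= \<zero> & X.E.vl N x = m)"
  if N: "N \<in> X.above P" and g: "set g \<subseteq> K" "length g \<le> e" "x = eval g \<theta>" for N g x using val'[OF N] g by (auto split: option.splits)
 obtain N where N: "N \<in> X.above P" using X.lying_over[OF P] unfolding X.above_def by blast
 have above_mx: "X.E.mxn N" if "N \<in> X.above P" for N using that unfolding X.above_def by simp
 have mem: "x \<in> N \<longleftrightarrow> vge (X.E.vl N) x 1" if "N \<in> X.above P" "x \<in> E" for N x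
  using X.E.M_vge[OF X.E.place_vl[OF above_mx[OF that(1)]]] above_mx[OF that(1)] that(2) by simp
 have sub: "x \<in> N'" if N': "N' \<in> X.above P" and N: "N \<in> X.above P" and x: "x \<in> N" for N N' x
 proof -
  have "mx E N" using above_mx[OF N] by simp
  hence xE: "x \<in> E" using x X.E.M_D by blast
  obtain g where g: "set g \<subseteq> K" "length g \<le> e" "x = eval g \<theta>" using L_rep[OF X.E.D_K[OF xE]] unfolding e_def by auto
  show ?thesis using gvE[OF N g] gvE[OF N' g] mem[OF N xE] mem[OF N' xE] x unfolding vge_def by auto
 qed
 have "X.above P = {N}" using sub N by blast
 moreover have "\<forall>x\<in>K. x ~= \<zero> --> X.E.vl N x = int e * vl P x" using val'[OF N] by simp
 moreover have "\<exists>d\<in>D. y \<ominus> d \<in> N" if y: "y \<in> E" for y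
 proof -
  note w = X.E.place_vl[OF above_mx[OF N]]
  obtain g where g: "set g \<subseteq> K" "length g = e" "y = eval g \<theta>" using L_rep[OF X.E.D_K[OF y]] unfolding e_def by blast
  have coef: "vge (vl P) c 0" if "c \<in> set g" for c
  proof (cases "c = \<zero>")
   case False
   have "gval \<zero> (vl P) (int e) g ~= None"
   proof
    assume "gval \<zero> (vl P) (int e) g = None"
    hence "set g \<subseteq> {\<zero>}" by (rule gval_None)
    thus False using that False by blast
   qed
   then obtain m where m: "gval \<zero> (vl P) (int e) g = Some m" "y ~= \<zero>" "X.E.vl N y = m" using gvE[OF N g(1) _ g(3)] g(2) by auto
   have "0 \<le> m" using X.E.v_D[OF w y m(2)] m(3) by simp
   hence "0 < int e * vl P c + int e" using gval_less[OF m(1) that False] g(2) by simp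
   hence "0 < int e * (vl P c + 1)" by (simp add: algebra_simps)
   hence "0 < vl P c + 1" by (simp add: zero_less_mult_iff)
   thus ?thesis unfolding vge_def by simp
  qed (simp add: vge_def)
  have "g ~= []" using g(2) e1 by auto
  then obtain g0 c0 where g0: "g = g0 @ [c0]" by (metis append_butlast_last_id)
  have gK: "set g0 \<subseteq> K" "c0 \<in> K" using g(1) g0 by auto
  have gc: "set g0 \<subseteq> carrier R" using gK(1) by auto
  have vK: "vge (X.E.vl N) c 0" if "c \<in> K" "vge (vl P) c 0" for c using val'[OF N] that unfolding vge_def by auto
  have ge: "set q \<subseteq> set g ==> eval q \<theta> \<in> L & vge (X.E.vl N) (eval q \<theta>) 0" for q
  proof (induct q)
   case (Cons a q)
   have a: "a \<in> set g" "a \<in> K" "a \<in> L" using Cons(2) g(1) K_L by auto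
   have "vge (X.E.vl N) (\<theta> [^] length q) 0" using X.E.vge_D[OF w] \<theta>_E by simp
   hence "vge (X.E.vl N) (a\<otimes>\<theta> [^] length q) 0"
    using X.E.vge_mult[OF w a(3) _ vK[OF a(2) coef[OF a(1)]], of "\<theta> [^] length q" 0] \<theta>_L by simp
   thus ?case using X.E.vge_add[OF w, of "a\<otimes>\<theta> [^] length q" "eval q \<theta>" 0] Cons a \<theta>_L by simp
  qed (simp add: vge_def)
  have g0L: "eval g0 \<theta> \<in> L" "vge (X.E.vl N) (eval g0 \<theta>) 0" using ge[of g0] g0 by auto
  have "vge (X.E.vl N) (eval g0 \<theta>\<otimes>\<theta>) (0 + 1)"
   by (rule X.E.vge_mult[OF w g0L(1) \<theta>_L g0L(2)]) (use val'[OF N] in \<open>simp add: vge_def\<close>)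
  hence 1: "vge (X.E.vl N) (eval g0 \<theta>\<otimes>\<theta>) 1" by simp
  have "c0 \<in> set g" using g0 by simp
  then obtain d where d: "d \<in> D" "vge (vl P) (c0 \<ominus> d) 1" using residue_representative[OF mP v gK(2) coef] by blast
  have dK: "c0 \<ominus> d \<in> K" using gK(2) D_K[OF d(1)] by simp
  have 2: "vge (X.E.vl N) (c0 \<ominus> d) 1"
  proof (cases "c0 \<ominus> d = \<zero>")
   case False
   hence "1 \<le> vl P (c0 \<ominus> d)" using d(2) unfolding vge_def by simp
   hence "1 \<le> int e * vl P (c0 \<ominus> d)" using e1 mult_mono[of 1 "int e" 1 "vl P (c0 \<ominus> d)"] by simp
   moreover have "X.E.vl N (c0 \<ominus> d) = int e * vl P (c0 \<ominus> d)" using val'[OF N] dK False by blast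
   ultimately show ?thesis unfolding vge_def by simp
  qed (simp add: vge_def)
  have "y = eval g0 \<theta>\<otimes>\<theta> \<oplus> c0" unfolding g(3) g0 by (rule eval_snoc[OF gc]) (use gK \<theta>_carr in auto)
  moreover have "(eval g0 \<theta>\<otimes>\<theta> \<oplus> c0) \<ominus> d = eval g0 \<theta>\<otimes>\<theta> \<oplus> (c0 \<ominus> d)"
  proof -
   have "eval g0 \<theta> \<in> carrier R" "c0 \<in> carrier R" "d \<in> carrier R" using g0L(1) gK d(1) by auto
   thus ?thesis using \<theta>_carr by algebra
  qed
  moreover have "vge (X.E.vl N) (eval g0 \<theta>\<otimes>\<theta> \<oplus> (c0 \<ominus> d)) 1" using X.E.vge_add[OF w _ _ 1 2] g0L(1) \<theta>_L K_L[OF dK] by simp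
  ultimately have "vge (X.E.vl N) (y \<ominus> d) 1" by simp
  moreover have "y \<ominus> d \<in> E" using y D_E[OF d(1)] by simp
  ultimately have "y \<ominus> d \<in> N" using mem[OF N] by simp
  thus ?thesis using d(1) by blast
 qed
 ultimately show ?thesis unfolding e_def by (intro exI[of _ N]) simp
qed

text \<open>A prime N belongs to j if \<theta> is closer to a_j = q^{j+1} at N than q^e is to 0. No prime belongs to two
indices, as the differences of the a_j have value at most that of q^e.\<close>

lemma totally_split:
 assumes Q: "mxn Q" and q: "q \<in> D" "q ~= \<zero>" "vl Q q = 1"
  and \<pi>: "\<pi> \<in> D" "\<pi> ~= \<zero>" "vl Q \<pi> = int (length p * length p + 1)"
  and F: "!!x. x \<in> carrier R ==> eval (\<one> # p) x = rootprod (map (\<lambda>j. q [^] Suc j) [0..<length p]) x \<oplus> \<pi>"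
 shows "\<exists>N. (\<forall>i<length p. N i \<in> dedekind_ext.above R D E Q) & inj_on N {..<length p}"
proof -
 interpret X: dedekind_ext R K D L E by (rule ext)
 define e where "e = length p"
 note v = place_vl[OF Q]
 have mQ: "mx D Q" using Q by simp
 define a where "a j = q [^] Suc j" for j
 have a: "a j \<in> D" "a j ~= \<zero>" "vl Q (a j) = int (Suc j)" for j
 proof -
  show "a j \<in> D" unfolding a_def using D_pow[OF q(1)] .
  show "a j ~= \<zero>" unfolding a_def using pow_nonzero[OF D_carr[OF q(1)] q(2)] .
  show "vl Q (a j) = int (Suc j)" unfolding a_def using v_pow[OF v D_K[OF q(1)] q(2), of "Suc j"] q(3) by simp
 qed
 have Fa: "eval (\<one> # p) (a j) = \<pi>" if "j < e" for j
 proof -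
  have "a j \<in> set (map (\<lambda>j. q [^] Suc j) [0..<length p])" using that unfolding a_def e_def by auto
  moreover have "set (map (\<lambda>j. q [^] Suc j) [0..<length p]) \<subseteq> carrier R" using q(1) by auto
  ultimately have "rootprod (map (\<lambda>j. q [^] Suc j) [0..<length p]) (a j) = \<zero>" using rootprod_root a(1) by blast
  thus ?thesis using F[of "a j"] a(1)[of j] \<pi>(1) by (simp del: eval.simps)
 qed
 have ram: "\<exists>r>0. \<forall>x\<in>K. x ~= \<zero> --> X.E.vl N x = r * vl Q x" if "N \<in> X.above Q" for N
  using X.ramification[OF mQ v X.E.place_vl] that unfolding X.above_def by blast
 have ex: "\<exists>N. N \<in> X.above Q & (\<exists>r>0. (\<forall>x\<in>K. x ~= \<zero> --> X.E.vl N x = r * vl Q x) & vge (X.E.vl N) (\<theta> \<ominus> a j) (int e * r + 1))"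
  if j: "j < e" for j
 proof (rule ccontr)
  assume none: "\<not> ?thesis"
  let ?b = "\<theta> \<ominus> a j"
  have b0: "?b ~= \<zero>"
  proof
   assume "?b = \<zero>"
   hence "\<theta> = a j" using \<theta>_carr a(1) by simp
   thus False using Fa[OF j] root[OF \<theta>] \<pi>(2) by simp
  qed
  have bL: "?b \<in> L" using \<theta>_L K_L D_K a(1) by simp
  have bi: "inv ?b \<in> L" "inv ?b ~= \<zero>"
  proof -
   show "inv ?b \<in> L" using bL b0 by simp
   show "inv ?b ~= \<zero>" using b0 bL by (metis X.E.K_carr cinv(2) r_null one_not_zero)
  qed
  define y where "y = q [^] e\<otimes>inv ?b"
  have qe: "q [^] e \<in> K" "q [^] e ~= \<zero>" "q [^] e \<in> L" using q D_K K_L by auto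
  have y: "y \<in> L" "y ~= \<zero>" unfolding y_def using qe bi by (auto simp: integral_iff)
  have "0 \<le> X.E.vl N y" if N: "N \<in> X.above Q" for N
  proof -
   have w: "place L E N (X.E.vl N)" using X.E.place_vl N unfolding X.above_def by simp
   obtain r where r: "r > 0" "\<forall>x\<in>K. x ~= \<zero> --> X.E.vl N x = r * vl Q x" using ram[OF N] by blast
   have "\<not> vge (X.E.vl N) ?b (int e * r + 1)" using none N r by blast
   hence "X.E.vl N ?b \<le> int e * r" using b0 unfolding vge_def by simp
   moreover have "X.E.vl N (q [^] e) = r * int e" using r(2) qe v_pow[OF v D_K[OF q(1)] q(2), of e] q(3) by simp
   ultimately show ?thesis unfolding y_def using X.E.v_mult[OF w qe(3,2) bi] X.E.v_inv[OF w bL b0] by (simp add: mult.commute)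
  qed
  \<comment> \<open>All values of y above Q are non-negative, so y is integral up to a factor outside Q.\<close>
  then obtain s where s: "s \<in> D - Q" "s\<otimes>y \<in> E" using X.local_integral[OF Q y] by blast
  have s0: "s ~= \<zero>" using DM_nonzero[OF mQ s(1)] .
  have sE: "s\<otimes>y \<in> L" "intg D (s\<otimes>y)" using s(2) unfolding E_def by auto
  obtain u where u: "set u \<subseteq> K" "s\<otimes>y = eval u \<theta>" using L_rep[OF sE(1)] by blast
  let ?z = "s\<otimes>q [^] e"
  have zK: "?z \<in> K" "?z ~= \<zero>" "?z \<in> carrier R" using s(1) s0 qe D_K by (auto simp: integral_iff)
  have prod\<theta>: "eval u \<theta>\<otimes>(\<theta> \<ominus> a j) = ?z"
  proof -
   have "eval u \<theta>\<otimes>?b = (s\<otimes>q [^] e)\<otimes>(inv ?b\<otimes>?b)" unfolding u(2)[symmetric] y_def using s(1) qe bi bL by (simp add: m_assoc)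
   thus ?thesis using b0 bL zK by simp
  qed
  note KS = subfieldE(1)[OF K]
  have "polyfun K (\<lambda>x. eval u x\<otimes>(x \<ominus> a j) \<ominus> ?z)"
   by (intro polyfun_minus[OF KS] polyfun_mult[OF KS] polyfun_eval[OF u(1)] polyfun_id[OF KS] polyfun_const)
    (use a(1) D_K zK in auto)
  hence conj: "eval u r\<otimes>(r \<ominus> a j) = ?z" if r: "r \<in> set rs" for r
  proof -
   assume pf: "polyfun K (\<lambda>x. eval u x\<otimes>(x \<ominus> a j) \<ominus> ?z)"
   have "eval u r\<otimes>(r \<ominus> a j) \<ominus> ?z = \<zero>" by (rule conjugate_polyfun[OF r pf]) (use prod\<theta> zK in \<open>simp add: a_minus_def r_neg\<close>)
   moreover have "set u \<subseteq> carrier R" "r \<in> carrier R" using u(1) r rs(1) by auto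
   ultimately show ?thesis using zK a(1) eval_in_carrier[of u r] by simp
  qed
  have uI: "intg D (eval u r)" if "r \<in> set rs" for r using conjugate_intg[OF that u(1)] sE(2) u(2) by simp
  have "\<exists>\<rho>. intg D \<rho> & \<rho>\<otimes>rootprod xs (a j) = ?z [^] length xs" if "set xs \<subseteq> set rs" for xs using that
  proof (induct xs)
   case Nil thus ?case using Rint_closed(2) by (intro exI[of _ \<one>]) simp
  next
   case (Cons r xs)
   then obtain \<rho> where \<rho>: "intg D \<rho>" "\<rho>\<otimes>rootprod xs (a j) = ?z [^] length xs" by auto
   have r: "r \<in> set rs" "r \<in> carrier R" "set xs \<subseteq> carrier R" using Cons(2) rs(1) by auto
   have cc: "eval u r \<in> carrier R" "\<rho> \<in> carrier R" "rootprod xs (a j) \<in> carrier R" "a j \<in> carrier R"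
    using uI[OF r(1)] \<rho>(1) Rint_carr rootprod_closed[OF r(3)] a(1)[of j] by auto
   have "((\<ominus> eval u r)\<otimes>\<rho>)\<otimes>rootprod (r # xs) (a j) = (eval u r\<otimes>(r \<ominus> a j))\<otimes>(\<rho>\<otimes>rootprod xs (a j))"
    unfolding rootprod.simps using cc r(2) by algebra
   also have "\<dots> = ?z [^] length (r # xs)" unfolding conj[OF r(1)] \<rho>(2) using zK by (simp add: m_comm)
   finally show ?case using Rint_closed(4)[OF Rint_closed(3)[OF uI[OF r(1)]] \<rho>(1)] by (intro exI conjI)
  qed
  \<comment> \<open>Over all conjugates the product of the r - a j is \<pi> up to sign, so \<rho> is (s q^e)^e / \<pi>, an integral element of K.\<close>
  from this[OF order_refl] obtain \<rho> where \<rho>: "intg D \<rho>" "\<rho>\<otimes>rootprod rs (a j) = ?z [^] e" using rs(2) unfolding e_def by auto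
  have "rootprod rs (a j) = \<pi>" using splits[of "a j"] Fa[OF j] a(1) by simp
  hence eq: "\<rho>\<otimes>\<pi> = ?z [^] e" using \<rho>(2) by simp
  have \<rho>c: "\<rho> \<in> carrier R" using Rint_carr \<rho>(1) by simp
  have "(\<rho>\<otimes>\<pi>)\<otimes>inv \<pi> = \<rho>" using \<rho>c \<pi> by (simp add: m_assoc)
  moreover have "(\<rho>\<otimes>\<pi>)\<otimes>inv \<pi> \<in> K" unfolding eq using zK \<pi> D_K by simp
  ultimately have \<rho>D: "\<rho> \<in> D" using normal \<rho>(1) by simp
  have \<rho>0: "\<rho> ~= \<zero>" using eq zK \<pi>(1) by (metis D_carr l_null pow_nonzero)
  have "vl Q (?z [^] e) = int e * int e" using v_pow[OF v zK(1,2), of e] v_mult[OF v, of s "q [^] e"] v_unit[OF v, of s] s s0 qe D_K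
    v_pow[OF v D_K[OF q(1)] q(2), of e] q(3) by simp
  moreover have "vl Q (\<rho>\<otimes>\<pi>) = vl Q \<rho> + (int e * int e + 1)"
   using v_mult[OF v D_K[OF \<rho>D] \<rho>0 D_K[OF \<pi>(1)] \<pi>(2)] \<pi>(3) unfolding e_def by simp
  moreover have "0 \<le> vl Q \<rho>" using v_D[OF v \<rho>D \<rho>0] .
  ultimately show False using eq by simp
 qed
 then obtain N where N: "!!j. j < e ==> N j \<in> X.above Q & (\<exists>r>0. (\<forall>x\<in>K. x ~= \<zero> --> X.E.vl (N j) x = r * vl Q x) & vge (X.E.vl (N j)) (\<theta> \<ominus> a j) (int e * r + 1))"
  by metis
 have ne: "N i ~= N j" if ij: "i < j" "j < e" for i j
 proof
  assume eq: "N i = N j"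
  have i: "i < e" using ij by simp
  have w: "place L E (N j) (X.E.vl (N j))" using X.E.place_vl N[OF ij(2)] unfolding X.above_def by simp
  obtain r where r: "r > 0" "\<forall>x\<in>K. x ~= \<zero> --> X.E.vl (N j) x = r * vl Q x" "vge (X.E.vl (N j)) (\<theta> \<ominus> a j) (int e * r + 1)"
   using N[OF ij(2)] by blast
  obtain r' where r': "r' > 0" "\<forall>x\<in>K. x ~= \<zero> --> X.E.vl (N j) x = r' * vl Q x" "vge (X.E.vl (N j)) (\<theta> \<ominus> a i) (int e * r' + 1)"
   using N[OF i] eq by auto
  have "X.E.vl (N j) q = r * 1" "X.E.vl (N j) q = r' * 1" using r(2) r'(2) q D_K by auto
  hence rr: "r' = r" by simp
  have aL: "a i \<in> L" "a j \<in> L" using a(1) D_K K_L by auto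
  have "vge (X.E.vl (N j)) ((\<theta> \<ominus> a j) \<ominus> (\<theta> \<ominus> a i)) (int e * r + 1)" using X.E.vge_diff[OF w _ _ r(3)] r'(3) rr \<theta>_L aL by simp
  moreover have "(\<theta> \<ominus> a j) \<ominus> (\<theta> \<ominus> a i) = a i \<oplus> \<ominus> a j"
  proof -
   have "a i \<in> carrier R" "a j \<in> carrier R" using a(1) by auto
   thus ?thesis using \<theta>_carr by algebra
  qed
  moreover have "X.E.vl (N j) (a i \<oplus> \<ominus> a j) = X.E.vl (N j) (a i)" "a i \<oplus> \<ominus> a j ~= \<zero>"
  proof -
   have "X.E.vl (N j) (a i) = r * int (Suc i)" "X.E.vl (N j) (a j) = r * int (Suc j)" using r(2) a D_K by auto
   moreover have "r * int (Suc i) < r * int (Suc j)" using r(1) ij by simp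
   ultimately have "vge (X.E.vl (N j)) (\<ominus> a j) (X.E.vl (N j) (a i) + 1)" using X.E.v_minus[OF w aL(2)] unfolding vge_def by simp
   thus "X.E.vl (N j) (a i \<oplus> \<ominus> a j) = X.E.vl (N j) (a i)" "a i \<oplus> \<ominus> a j ~= \<zero>"
    using X.E.v_add_eq[OF w aL(1) a(2), of "\<ominus> a j"] aL by auto
  qed
  ultimately have "int e * r + 1 \<le> r * int (Suc i)" using r(2) a[of i] D_K unfolding vge_def by auto
  moreover have "r * int (Suc i) \<le> r * int e" using r(1) i by simp
  ultimately show False by (simp add: mult.commute)
 qed
 have "inj_on N {..<e}" unfolding inj_on_def using ne by (metis lessThan_iff linorder_neqE_nat)
 thus ?thesis using N unfolding e_def by blast
qed

end

context dedekind_closed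
begin

text \<open>The value 2 of q at P makes all coefficients of f but the leading one lie in P and leaves the value 1 of \<pi>
to the constant one. The exponent e^2 + 1 of \<pi> at Q is what the norm argument in
\<open>totally_split\<close> requires.\<close>

theorem extension_step:
 assumes Q: "mxn Q" and A: "finite A" "A ~= {}" "!!P. P \<in> A ==> mxn P" "Q \<notin> A" and e: "e > 0"
 shows "\<exists>L E. dedekind_ext R K D L E & dimension e K L &
  (\<forall>p::nat. p > 0 --> (\<exists>us. set us \<subseteq> L & L = Span K (map (\<lambda>u. u [^] p) us))) &
  (\<forall>P\<in>A. card (dedekind_ext.above R D E P) = 1 & (\<forall>N\<in>dedekind_ext.above R D E P. (\<forall>y\<in>E. \<exists>d\<in>D. y \<ominus> d \<in> N) &
    (\<forall>x\<in>K. x ~= \<zero> --> dedekind.vl R L E N x = int e * vl P x))) &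
  card (dedekind_ext.above R D E Q) = e & (\<forall>N\<in>dedekind_ext.above R D E Q. (\<forall>y\<in>E. \<exists>d\<in>D. y \<ominus> d \<in> N) &
    (\<forall>x\<in>K. x ~= \<zero> --> dedekind.vl R L E N x = vl Q x))"
proof -
 have mA: "M \<in> insert Q A ==> mxn M" for M using Q A(3) by auto
 have fin: "finite (insert Q A)" "insert Q A ~= {}" using A(1) by auto
 obtain q where q: "q \<in> D" "q ~= \<zero>" "\<forall>M\<in>insert Q A. vl M q = int (if M = Q then 1 else 2)"
  using approximation[OF fin mA, of "\<lambda>M. if M = Q then 1 else 2"] by blast
 obtain \<pi> where \<pi>: "\<pi> \<in> D" "\<pi> ~= \<zero>" "\<forall>M\<in>insert Q A. vl M \<pi> = int (if M = Q then e * e + 1 else 1)"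
  using approximation[OF fin mA, of "\<lambda>M. if M = Q then e * e + 1 else 1"] by blast
 let ?as = "map (\<lambda>j. q [^] Suc j) [0..<e]"
 have qj: "q [^] Suc j \<in> D" "q [^] Suc j ~= \<zero>" for j using D_pow[OF q(1)] pow_nonzero[OF D_carr[OF q(1)] q(2)] by blast+
 have qv: "vl M (q [^] Suc j) = int (Suc j) * vl M q" if "M \<in> insert Q A" for M j
  using v_pow[OF place_vl[OF mA[OF that]] D_K[OF q(1)] q(2)] .
 have asD: "set ?as \<subseteq> D" using qj(1) by auto
 \<comment> \<open>All non-leading coefficients of \<open>rootprod ?as\<close> lie in the ideal generated by its roots, hence in J.\<close>
 define J where "J = {x \<in> D. \<forall>P\<in>A. vge (vl P) x 2}"
 have J: "submod D J" unfolding submod_def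
 proof (intro conjI ballI)
  show "J \<subseteq> carrier R" unfolding J_def by auto
  show "\<zero> \<in> J" unfolding J_def vge_def by simp
 next
  fix x y assume "x \<in> J" "y \<in> J"
  thus "x \<oplus> y \<in> J" unfolding J_def using vge_add[OF place_vl[OF A(3)]] D_K by simp
 next
  fix d x assume d: "d \<in> D" and x: "x \<in> J"
  have "vge (vl P) (d\<otimes>x) (0 + 2)" if P: "P \<in> A" for P
   by (rule vge_mult[OF place_vl[OF A(3)[OF P]]]) (use d x P D_K vge_D[OF place_vl[OF A(3)[OF P]]] in \<open>auto simp: J_def\<close>)
  thus "d\<otimes>x \<in> J" unfolding J_def using d x by (simp add: J_def)
 qed
 have JD: "J \<subseteq> D" unfolding J_def by auto
 have "q [^] Suc j \<in> J" for j
 proof -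
  have "2 \<le> vl P (q [^] Suc j)" if P: "P \<in> A" for P
  proof -
   have "P ~= Q" using P A(4) by auto
   hence "vl P q = 2" using q(3) P by simp
   thus ?thesis using qv[of P j] P by simp
  qed
  thus ?thesis unfolding J_def vge_def using qj(1) by simp
 qed
 hence asJ: "set ?as \<subseteq> J" by auto
 obtain p where p: "set p \<subseteq> J" "length p = length ?as" "\<forall>x\<in>carrier R. eval (\<one> # p) x = rootprod ?as x"
  using rootprod_coefficients[OF J JD D asJ] by (elim exE conjE)
 have lp: "length p = e" using p(2) by simp
 have "p ~= []" using lp e by auto
 then obtain p0 c where p0: "p = p0 @ [c]" by (metis append_butlast_last_id)
 have p0J: "set p0 \<subseteq> J" "c \<in> J" using p(1) p0 by auto
 have pD: "set p0 \<subseteq> D" "c \<in> D" using p0J JD by auto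
 let ?p = "p0 @ [c \<oplus> \<pi>]"
 have pp: "set ?p \<subseteq> D" "?p ~= []" "length ?p = e" using pD \<pi>(1) lp p0 by auto
 have ev: "eval (\<one> # ?p) x = rootprod ?as x \<oplus> \<pi>" if x: "x \<in> carrier R" for x
 proof -
  have s: "set (\<one> # p0) \<subseteq> carrier R" using pD by auto
  have c1: "eval (\<one> # p0) x \<in> carrier R" using eval_in_carrier[OF s x] .
  have "eval (\<one> # ?p) x = eval ((\<one> # p0) @ [c \<oplus> \<pi>]) x" by simp
  also have "\<dots> = eval (\<one> # p0) x\<otimes>x \<oplus> (c \<oplus> \<pi>)" by (rule eval_snoc[OF s]) (use pD \<pi> x in auto)
  also have "\<dots> = (eval (\<one> # p0) x\<otimes>x \<oplus> c) \<oplus> \<pi>" using c1 pD \<pi>(1) x by (simp add: a_assoc del: eval.simps)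
  also have "eval (\<one> # p0) x\<otimes>x \<oplus> c = eval ((\<one> # p0) @ [c]) x" by (rule eval_snoc[OF s, symmetric]) (use pD x in auto)
  also have "(\<one> # p0) @ [c] = \<one> # p" using p0 by simp
  finally show ?thesis using bspec[OF p(3) x] by simp
 qed
 have vP: "(\<forall>c\<in>set ?p. vge (vl P) c 1) & last ?p ~= \<zero> & vl P (last ?p) = 1" if P: "P \<in> A" for P
 proof -
  note v = place_vl[OF A(3)[OF P]]
  have "P ~= Q" using P A(4) by auto
  hence \<pi>v: "vl P \<pi> = 1" using \<pi>(3) P by simp
  have cv: "vge (vl P) c (vl P \<pi> + 1)" using p0J(2) P \<pi>v unfolding J_def by auto
  have l: "\<pi> \<oplus> c ~= \<zero>" "vl P (\<pi> \<oplus> c) = 1" using v_add_eq[OF v D_K[OF \<pi>(1)] \<pi>(2) D_K[OF pD(2)] cv] \<pi>v by auto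
  have cp: "c \<oplus> \<pi> = \<pi> \<oplus> c" using pD(2) \<pi>(1) by (simp add: a_comm)
  have "vge (vl P) x 1" if "x \<in> set p0" for x
  proof -
   have "x \<in> J" using p0J(1) that by (rule subsetD)
   hence "vge (vl P) x 2" using P unfolding J_def by simp
   thus ?thesis using vge_mono[OF v] by simp
  qed
  thus ?thesis using l cp unfolding vge_def by auto
 qed
 obtain P0 where P0: "P0 \<in> A" using A(2) by auto
 have polyc: "\<one> # ?p \<in> carrier (poly_ring R)" using pp(1) unfolding univ_poly_carrier[symmetric] polynomial_def by auto
 have "\<exists>rs. length rs = degree (\<one> # ?p) & set rs \<subseteq> carrier R & (\<forall>x\<in>carrier R. eval (\<one> # ?p) x = rootprod rs x)"
  by (rule monic_splits[OF roots_over_carrier polyc]) auto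
 then obtain rs where rs: "length rs = length ?p" "set rs \<subseteq> carrier R" "!!x. x \<in> carrier R ==> eval (\<one> # ?p) x = rootprod rs x" by auto
 have irr: "algebraic K r & degree (Irr K r) = length ?p" if "r \<in> set rs" for r
 proof -
  have rc: "r \<in> carrier R" using that rs(2) by auto
  have z: "eval (\<one> # ?p) r = \<zero>" using rs(3)[OF rc] rootprod_root[OF rs(2) rc that] by simp
  show ?thesis using eisenstein_degree[OF A(3)[OF P0] pp(1,2) _ _ _ rc z] vP[OF P0] by blast
 qed
 have vq: "vl Q q = 1" using q(3) by simp
 have "inj (\<lambda>j. q [^] Suc j)"
 proof (rule injI)
  fix i j assume "q [^] Suc i = q [^] Suc j"
  hence "int (Suc i) * vl Q q = int (Suc j) * vl Q q" using qv[of Q i] qv[of Q j] by simp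
  thus "i = j" using vq by simp
 qed
 hence das: "distinct ?as" by (auto simp: distinct_map inj_on_def inj_def)
 have drs: "distinct rs" by (rule distinct_roots[OF infinite_carrier[OF Q] das _ asD \<pi>(1) ev rs(2,3)]) (use e irr pp(3) in auto)
 have "rs ~= []" using rs(1) by auto
 then obtain \<theta> where \<theta>: "\<theta> \<in> set rs" by (cases rs) auto
 interpret Y: monic_root R K D ?p \<theta> rs by unfold_locales (use pp rs drs \<theta> irr in auto)
 interpret X: dedekind_ext R K D Y.L Y.E by (rule Y.ext)
 have dimn: "dimension e K Y.L" using Y.L_dimension pp(3) by simp
 have F: "eval (\<one> # ?p) x = rootprod (map (\<lambda>j. q [^] Suc j) [0..<length ?p]) x \<oplus> \<pi>" if "x \<in> carrier R" for x
  using ev[OF that] unfolding pp(3) .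
 have \<pi>Q: "vl Q \<pi> = int (length ?p * length ?p + 1)" using \<pi>(3) pp(3) by simp
 obtain N where N: "!!i. i < e ==> N i \<in> X.above Q" "inj_on N {..<e}"
  using Y.totally_split[OF Q q(1,2) vq \<pi>(1,2) \<pi>Q F] unfolding pp(3) by blast
 have CS1: "X.above Q = N ` {..<e}" by (rule X.complete_splitting(1)[OF Q dimn _ N(2)]) (rule N(1))
 have CS2: "\<exists>d\<in>D. y \<ominus> d \<in> N i" if "i < e" "y \<in> Y.E" for i y by (rule X.complete_splitting(2)[OF Q dimn _ N(2) that]) (rule N(1))
 have CS3: "X.E.vl (N i) x = vl Q x" if "i < e" "x \<in> K" "x ~= \<zero>" for i x
  by (rule X.complete_splitting(3)[OF Q dimn _ N(2) that]) (rule N(1))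
 have CS4: "\<exists>us. set us \<subseteq> Y.L & Y.L = Span K (map (\<lambda>u. u [^] p) us)" if "p > 0" for p :: nat
  by (rule X.complete_splitting(4)[OF Q dimn _ N(2) that]) (rule N(1))
 have cardQ: "card (X.above Q) = e" unfolding CS1 using card_image[OF N(2)] by simp
 have Qs: "(\<forall>y\<in>Y.E. \<exists>d\<in>D. y \<ominus> d \<in> M) & (\<forall>x\<in>K. x ~= \<zero> --> X.E.vl M x = vl Q x)" if M: "M \<in> X.above Q" for M
 proof -
  obtain i where i: "i < e" "M = N i" using M unfolding CS1 by auto
  show ?thesis using CS2[OF i(1)] CS3[OF i(1)] unfolding i(2) by blast
 qed
 have Ps: "card (X.above P) = 1 & (\<forall>M\<in>X.above P. (\<forall>y\<in>Y.E. \<exists>d\<in>D. y \<ominus> d \<in> M) & (\<forall>x\<in>K. x ~= \<zero> --> X.E.vl M x = int e * vl P x))"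
  if P: "P \<in> A" for P
 proof -
  obtain M where "X.above P = {M}" "\<forall>y\<in>Y.E. \<exists>d\<in>D. y \<ominus> d \<in> M" "\<forall>x\<in>K. x ~= \<zero> --> X.E.vl M x = int (length ?p) * vl P x"
   using Y.eisenstein_above[OF A(3)[OF P]] vP[OF P] by blast
  thus ?thesis unfolding pp(3) by simp
 qed
 show ?thesis
 proof (rule exI[of _ Y.L], rule exI[of _ Y.E], intro conjI)
  show "dedekind_ext R K D Y.L Y.E" by (rule Y.ext)
  show "dimension e K Y.L" by (rule dimn)
  show "card (X.above Q) = e" by (rule cardQ)
  show "\<forall>p::nat. p > 0 --> (\<exists>us. set us \<subseteq> Y.L & Y.L = Span K (map (\<lambda>u. u [^] p) us))" by (intro allI impI) (rule CS4)
 qed (rule ballI, (rule Ps Qs), assumption)+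
qed

end

section \<open>Separability\<close>

context cring
begin

lemma natc_mult: "a \<in> carrier R ==> [(n::nat)] \<cdot> a = ([n] \<cdot> \<one>)\<otimes>a" using add_pow_ldistr[of \<one> a n] by simp

lemma natc_hom: "[((m * n)::nat)] \<cdot> \<one> = ([m] \<cdot> \<one>)\<otimes>([n] \<cdot> \<one>)" "[((m + n)::nat)] \<cdot> \<one> = ([m] \<cdot> \<one>) \<oplus> ([n] \<cdot> \<one>)"
proof -
 show "[((m + n)::nat)] \<cdot> \<one> = ([m] \<cdot> \<one>) \<oplus> ([n] \<cdot> \<one>)" using add.nat_pow_mult[of \<one> m n] by simp
 have "[((m * n)::nat)] \<cdot> \<one> = [m] \<cdot> ([n] \<cdot> \<one>)" using add.nat_pow_pow[of \<one> m n, OF one_closed] by (simp only: mult.commute[of m n])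
 thus "[((m * n)::nat)] \<cdot> \<one> = ([m] \<cdot> \<one>)\<otimes>([n] \<cdot> \<one>)" using natc_mult[of "[n] \<cdot> \<one>" m] by simp
qed

lemma binomial_theorem:
 assumes x: "x \<in> carrier R" and y: "y \<in> carrier R"
 shows "(x \<oplus> y) [^] n = (\<Oplus>k\<in>{..n}. ([(n choose k)] \<cdot> \<one>)\<otimes>(x [^] k\<otimes>y [^] (n - k)))"
proof (induct n)
 case 0 thus ?case by simp
next
 case (Suc n)
 let ?c = "\<lambda>n k. [((n choose k)::nat)] \<cdot> \<one>"
 let ?t = "\<lambda>k. ?c n k\<otimes>(x [^] k\<otimes>y [^] (n - k))"
 let ?g = "\<lambda>k. ?c (Suc n) k\<otimes>(x [^] k\<otimes>y [^] (Suc n - k))"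
 have cl: "!!n k. ?c n k \<in> carrier R" "!!k::nat. x [^] k \<in> carrier R" "!!k::nat. y [^] k \<in> carrier R" using x y by auto
 have tc: "?t \<in> A \<rightarrow> carrier R" "?g \<in> A \<rightarrow> carrier R" for A using cl by auto
 let ?u = "\<lambda>k. ?c n k\<otimes>(x [^] Suc k\<otimes>y [^] (n - k))"
 let ?w = "\<lambda>k. ?c n k\<otimes>(x [^] k\<otimes>y [^] (Suc n - k))"
 have uc: "?u \<in> A \<rightarrow> carrier R" "?w \<in> A \<rightarrow> carrier R" for A using cl x by (auto simp del: nat_pow_Suc)
 have 1: "finsum R ?t {..n}\<otimes>x = finsum R ?u {..n}"
 proof -
  have "finsum R ?t {..n}\<otimes>x = (\<Oplus>k\<in>{..n}. ?t k\<otimes>x)" by (rule finsum_ldistr[OF _ x tc(1)]) simp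
  also have "\<dots> = finsum R ?u {..n}" by (rule finsum_cong') (use cl x in \<open>auto simp: m_ac\<close>)
  finally show ?thesis .
 qed
 have 2: "finsum R ?t {..n}\<otimes>y = finsum R ?w {..n}"
 proof -
  have "finsum R ?t {..n}\<otimes>y = (\<Oplus>k\<in>{..n}. ?t k\<otimes>y)" by (rule finsum_ldistr[OF _ y tc(1)]) simp
  also have "\<dots> = finsum R ?w {..n}" by (rule finsum_cong') (use cl y in \<open>auto simp: m_ac Suc_diff_le\<close>)
  finally show ?thesis .
 qed
 have 3: "finsum R ?w {..n} = finsum R ?w {..Suc n}"
 proof -
  have "?w (Suc n) = \<zero>" using l_null[OF m_closed[OF cl(2)[of "Suc n"] cl(3)[of "Suc n - Suc n"]]] by (simp add: binomial_eq_0 del: nat_pow_Suc)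
  thus ?thesis using finsum_Suc[OF uc(2), of n] finsum_closed[OF uc(2), of "{..n}"] by (simp only: l_zero)
 qed
 have 4: "finsum R ?w {..Suc n} = finsum R (\<lambda>k. ?w (Suc k)) {..n} \<oplus> ?w 0" by (rule finsum_Suc2[OF uc(2)])
 have 5: "finsum R ?g {..Suc n} = finsum R (\<lambda>k. ?g (Suc k)) {..n} \<oplus> ?g 0" by (rule finsum_Suc2[OF tc(2)])
 have 6: "finsum R (\<lambda>k. ?g (Suc k)) {..n} = finsum R (\<lambda>k. ?u k \<oplus> ?w (Suc k)) {..n}"
 proof (rule finsum_cong')
  fix k assume "k \<in> {..n}"
  have "?c (Suc n) (Suc k) = ?c n k \<oplus> ?c n (Suc k)" using natc_hom(2)[of "n choose k" "n choose Suc k"] by simp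
  thus "?g (Suc k) = ?u k \<oplus> ?w (Suc k)" using cl x by (simp add: l_distr del: nat_pow_Suc add_pow_def)
 next
  have "?u k \<oplus> ?w (Suc k) \<in> carrier R" for k using uc[of UNIV] by (intro a_closed) (rule funcset_mem, assumption, simp)+
  thus "(\<lambda>k. ?u k \<oplus> ?w (Suc k)) \<in> {..n} \<rightarrow> carrier R" by blast
 qed simp
 have 7: "finsum R (\<lambda>k. ?u k \<oplus> ?w (Suc k)) {..n} = finsum R ?u {..n} \<oplus> finsum R (\<lambda>k. ?w (Suc k)) {..n}"
  by (rule finsum_addf[OF uc(1)]) (use uc(2)[of UNIV] in blast)
 have g0: "?g 0 = ?w 0" by simp
 have fc: "finsum R ?u {..n} \<in> carrier R" "finsum R (\<lambda>k. ?w (Suc k)) {..n} \<in> carrier R" "?w 0 \<in> carrier R"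
  "finsum R ?t {..n} \<in> carrier R"
 proof -
  have "?w k \<in> carrier R" for k using uc(2)[of UNIV] by blast
  thus "?w 0 \<in> carrier R" "finsum R (\<lambda>k. ?w (Suc k)) {..n} \<in> carrier R" by (blast intro: finsum_closed)+
 qed (rule finsum_closed[OF uc(1)], rule finsum_closed[OF tc(1)])
 have "(x \<oplus> y) [^] Suc n = finsum R ?t {..n}\<otimes>(x \<oplus> y)" using Suc x y by simp
 also have "\<dots> = finsum R ?u {..n} \<oplus> finsum R ?w {..n}" using 1 2 fc x y by (simp add: r_distr)
 also have "\<dots> = finsum R ?g {..Suc n}" unfolding 3 4 5 6 7 g0 using fc by (simp add: a_assoc)
 finally show ?case .
qed

lemma add_pow_subring: "subring K R ==> a \<in> K ==> [(n::nat)] \<cdot> a \<in> K" by (induct n) (auto simp: subringE(2,7))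

lemma eval_in_submod:
 assumes U: "submod K U" and p: "set p \<subseteq> K" and i: "!!i. i < length p ==> coeff p i ~= \<zero> ==> x [^] i \<in> U"
  and Kc: "K \<subseteq> carrier R" and x: "x \<in> carrier R"
 shows "eval p x \<in> U" using p i
proof (induct p)
 case Nil thus ?case using submodD(3)[OF U] by simp
next
 case (Cons a p)
 have "coeff p i = coeff (a # p) i" if "i < length p" for i using that by simp
 hence IH: "eval p x \<in> U" using Cons(1) Cons(2) Cons(3) by (metis length_Cons less_SucI list.set_intros(2) subset_iff)
 have "a\<otimes>x [^] length p \<in> U"
 proof (cases "a = \<zero>")
  case True thus ?thesis using submodD(3)[OF U] x by simp
 next
  case False
  hence "x [^] length p \<in> U" using Cons(3)[of "length p"] by simp
  thus ?thesis using submodD(5)[OF U] Cons(2) by simp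
 qed
 thus ?case using submodD(4)[OF U _ IH] by simp
qed

end

lemma (in ring) normalize_eq_Nil: "normalize l = [] ==> set l \<subseteq> {\<zero>}" by (induct l) (auto split: if_splits)

context field
begin

text \<open>For 0 < k < q the multiple k (q choose k) = q (q - 1 choose k - 1) of the binomial coefficient is zero in the
field, and k is not.\<close>

lemma frobenius_add:
 assumes q: "q > 1" "[(q::nat)] \<cdot> \<one> = \<zero>" "!!k::nat. 0 < k ==> k < q ==> [k] \<cdot> \<one> ~= \<zero>"
  and x: "x \<in> carrier R" and y: "y \<in> carrier R"
 shows "(x \<oplus> y) [^] q = x [^] q \<oplus> y [^] q"
proof -
 let ?g = "\<lambda>k. ([(q choose k)] \<cdot> \<one>)\<otimes>(x [^] k\<otimes>y [^] (q - k))"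
 note q1 = q(1)
 have gc: "?g \<in> A \<rightarrow> carrier R" for A using x y by auto
 have z: "?g k = \<zero>" if k: "0 < k" "k < q" for k
 proof -
  have "([k] \<cdot> \<one>)\<otimes>([(q choose k)] \<cdot> \<one>) = [(k * (q choose k))] \<cdot> \<one>" using natc_hom(1) by simp
  also have "k * (q choose k) = q * (q - 1 choose (k - 1))" using times_binomial_minus1_eq[of k q] k by simp
  also have "[(q * (q - 1 choose (k - 1)))] \<cdot> \<one> = \<zero>" using natc_hom(1) q(2) by simp
  finally have "[(q choose k)] \<cdot> \<one> = \<zero>" using q(3)[OF k] integral[of "[k] \<cdot> \<one>" "[(q choose k)] \<cdot> \<one>"] by simp
  thus ?thesis using x y by simp
 qed
 have "{..q} = insert 0 (insert q {0<..<q})" using q1 by auto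
 moreover have "finsum R ?g (insert 0 (insert q {0<..<q})) = ?g 0 \<oplus> (?g q \<oplus> finsum R ?g {0<..<q})"
 proof -
  have gc0: "?g k \<in> carrier R" for k using gc[of UNIV] by (rule funcset_mem) simp
  have "finsum R ?g (insert 0 (insert q {0<..<q})) = ?g 0 \<oplus> finsum R ?g (insert q {0<..<q})"
   by (rule finsum_insert) (use gc gc0[of 0] q1 in simp_all)
  also have "finsum R ?g (insert q {0<..<q}) = ?g q \<oplus> finsum R ?g {0<..<q}" by (rule finsum_insert) (use gc gc0[of q] q1 in simp_all)
  finally show ?thesis .
 qed
 moreover have "finsum R ?g {0<..<q} = \<zero>" using finsum_cong'[of "{0<..<q}" "{0<..<q}" "\<lambda>k. \<zero>" ?g] z by simp
 ultimately have "finsum R ?g {..q} = y [^] q \<oplus> x [^] q" using x y by simp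
 thus ?thesis using binomial_theorem[OF x y, of q] x y by (simp add: a_comm)
qed

lemma characteristic_exists:
 assumes "n > 0" "[(n::nat)] \<cdot> \<one> = \<zero>"
 shows "\<exists>q::nat. q > 1 & [q] \<cdot> \<one> = \<zero> & (\<forall>k. 0 < k --> k < q --> [k] \<cdot> \<one> ~= \<zero>) & (\<forall>i::nat. [i] \<cdot> \<one> = \<zero> --> q dvd i)"
proof -
 define q where "q = (LEAST n::nat. n > 0 & [n] \<cdot> \<one> = \<zero>)"
 have q: "q > 0" "[q] \<cdot> \<one> = \<zero>" using LeastI[of "\<lambda>n::nat. n > 0 & [n] \<cdot> \<one> = \<zero>" n] assms unfolding q_def by auto
 have least: "q \<le> i" if "i > 0" "[(i::nat)] \<cdot> \<one> = \<zero>" for i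
  unfolding q_def using Least_le[of "\<lambda>n::nat. n > 0 & [n] \<cdot> \<one> = \<zero>" i] that by simp
 have dv: "q dvd i" if "[(i::nat)] \<cdot> \<one> = \<zero>" for i
 proof (rule ccontr)
  assume "\<not> q dvd i"
  hence r: "i mod q > 0" by (simp add: mod_greater_zero_iff_not_dvd)
  have "[i] \<cdot> \<one> = [(q * (i div q))] \<cdot> \<one> \<oplus> [(i mod q)] \<cdot> \<one>" using natc_hom(2)[of "q * (i div q)" "i mod q"] by simp
  also have "[(q * (i div q))] \<cdot> \<one> = \<zero>" using natc_hom(1)[of q "i div q"] q(2) by simp
  finally have "[(i mod q)] \<cdot> \<one> = \<zero>" using that by simp
  hence "q \<le> i mod q" using least r by simp
  thus False using q(1) by (meson mod_less_divisor not_le)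
 qed
 have q1: "q ~= 1" using q(2) by auto
 have "q > 1" using q(1) q1 by simp
 moreover have "[k] \<cdot> \<one> ~= \<zero>" if "0 < k" "k < q" for k using least[of k] that by auto
 ultimately show ?thesis using q(2) dv by blast
qed

lemma spanning_length:
 assumes K: "subfield K R" and us: "set us \<subseteq> carrier R" and dm: "dimension m K (Span K us)"
 shows "m \<le> length us"
proof -
 have "\<exists>vs. independent K vs & Span K vs = Span K us & length vs \<le> length us" using us
 proof (induct us)
  case Nil
  show ?case by (rule exI[of _ "[]"]) simp
 next
  case (Cons u us)
  then obtain vs where vs: "independent K vs" "Span K vs = Span K us" "length vs \<le> length us" by auto
  show ?case
  proof (cases "u \<in> Span K us")
   case True
   note KS = subfieldE(1)[OF K]
   have c: "set us \<subseteq> carrier R" "set (u # us) \<subseteq> carrier R" using Cons(2) by auto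
   have "Span K (u # us) \<subseteq> Span K us" by (rule Span_subset_SpanI[OF KS c(1)]) (use True Span_gens[OF KS c(1)] in simp)
   moreover have "Span K us \<subseteq> Span K (u # us)" by (rule Span_subset_SpanI[OF KS c(2)]) (use Span_gens[OF KS c(2)] in simp)
   ultimately have "Span K (u # us) = Span K us" by (rule equalityI)
   thus ?thesis using vs by (intro exI[of _ vs]) simp
  next
   case False
   hence "independent K (u # vs)" using vs(1,2) Cons(2) by (intro li_Cons) auto
   moreover have "Span K (u # vs) = Span K (u # us)" using vs(2) by (simp add: Span.simps)
   ultimately show ?thesis using vs(3) by (intro exI[of _ "u # vs"]) simp
  qed
 qed
 then obtain vs where vs: "independent K vs" "Span K vs = Span K us" "length vs \<le> length us" by (elim exE conjE)
 have "length vs = m" using dimension_is_inj[OF K dimension_independent[OF vs(1)]] dm vs(2) by simp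
 thus ?thesis using vs(3) by simp
qed

text \<open>If \<open>p = Irr K x\<close> is coprime to its derivative, it is separable. Otherwise the derivative is zero,
and with q the characteristic, p is a polynomial in X^q of degree d = h q. Extend 1, x, ..., x^{d-1} to a
basis. Since x^{hq} = x^d is a combination of the q-th powers of 1, ..., x^{h-1}, the q-th powers of the basis
elements other than x^h already have the same span as all q-th powers. By assumption this is the whole field,
of dimension m, but there are only m - 1 of them.\<close>

lemma separable_of_power_span:
 assumes K: "subfield K R" and dm: "dimension m K (carrier R)"
  and ps: "!!p::nat. p > 0 ==> \<exists>us. set us \<subseteq> carrier R & carrier R = Span K (map (\<lambda>u. u [^] p) us)"
  and x: "x \<in> carrier R"
 shows "algebraic K x & separable_poly K (Irr K x)"
proof -
 note KS = subfieldE(1)[OF K]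
 have KC: "K \<subseteq> carrier R" using subfieldE(3)[OF K] .
 have alg': "((algebraic over K) x)" using finite_dimension_imp_algebraic[OF K carrier_is_subring] finite_dimensionI[OF dm] x by simp
 hence alg: "algebraic K x" unfolding over_def .
 note I = IrrE[OF K x alg']
 let ?p = "Irr K x" and ?d = "degree (Irr K x)"
 have d1: "?d \<ge> 1" using pirreducible_degree[OF K I(1,2)] .
 have lp: "length ?p = Suc ?d" using d1 by simp
 have pK: "set ?p \<subseteq> K" using I(1) unfolding univ_poly_carrier[symmetric] polynomial_def by auto
 have pC: "set ?p \<subseteq> carrier R" using pK KC by auto
 let ?l = "map (\<lambda>i. [i] \<cdot> coeff ?p i) (rev [1..<length ?p])"
 let ?D = "poly_derivative ?p"
 have cK: "coeff ?p i \<in> K" for i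
 proof (cases "i < length ?p")
  case True thus ?thesis using coeff_img_restrict[of ?p] pK by blast
 next
  case False thus ?thesis using coeff_length[of ?p i] subringE(2)[OF KS] by simp
 qed
 have lK: "set ?l \<subseteq> K" using add_pow_subring[OF KS cK] by auto
 have Dd: "?D = normalize ?l" unfolding poly_derivative_def ..
 have DK: "?D \<in> carrier (K[X])" unfolding Dd univ_poly_carrier[symmetric] using normalize_gives_polynomial[OF lK] .
 have lD: "length ?D \<le> ?d" unfolding Dd using normalize_length_le[of ?l] by simp
 interpret U: domain "K[X]" using univ_poly_is_domain[OF KS] .
 interpret ev: ring_hom_ring "K[X]" R "\<lambda>p. eval p x" using eval_ring_hom[OF KS x] .
 show ?thesis
 proof (cases "eval ?D x = \<zero>")
  case False
  have Sf: "subfield (simple_extension K x) R" using simple_extension_is_subfield[OF K x] alg' by simp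
  have Sim: "simple_extension K x = (\<lambda>p. eval p x) ` carrier (K[X])" by (rule simple_extension_as_eval_img[OF KC x])
  have "eval ?D x \<in> simple_extension K x - {\<zero>}" using Sim DK False by blast
  hence iv: "inv (eval ?D x) \<in> simple_extension K x" "inv (eval ?D x)\<otimes>eval ?D x = \<one>" using subfield_m_inv[OF Sf] by auto
  then obtain b where b: "b \<in> carrier (K[X])" "eval b x = inv (eval ?D x)" unfolding Sim by auto
  let ?r = "b \<otimes>\<^bsub>K[X]\<^esub> ?D \<ominus>\<^bsub>K[X]\<^esub> \<one>\<^bsub>K[X]\<^esub>"
  have rc: "?r \<in> carrier (K[X])" using b DK by simp
  have "eval ?r x = eval b x\<otimes>eval ?D x \<ominus> \<one>" using b DK unfolding U.minus_eq by (simp add: a_minus_def)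
  hence "eval ?r x = \<zero>" using b(2) iv(2) by (simp add: a_minus_def r_neg)
  hence "?p pdivides ?r" using Irr_minimal[OF K x alg' rc] by simp
  hence "?p divides\<^bsub>K[X]\<^esub> ?r" using pdivides_iff_shell[OF K I(1) rc] by simp
  then obtain c where c: "c \<in> carrier (K[X])" "?r = ?p \<otimes>\<^bsub>K[X]\<^esub> c" unfolding factor_def by blast
  have "(\<ominus>\<^bsub>K[X]\<^esub> c) \<otimes>\<^bsub>K[X]\<^esub> ?p \<oplus>\<^bsub>K[X]\<^esub> b \<otimes>\<^bsub>K[X]\<^esub> ?D = \<ominus>\<^bsub>K[X]\<^esub> (?p \<otimes>\<^bsub>K[X]\<^esub> c) \<oplus>\<^bsub>K[X]\<^esub> b \<otimes>\<^bsub>K[X]\<^esub> ?D"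
   using U.l_minus[OF c(1) I(1)] U.m_comm[OF c(1) I(1)] by simp
  also have "\<dots> = \<ominus>\<^bsub>K[X]\<^esub> ?r \<oplus>\<^bsub>K[X]\<^esub> b \<otimes>\<^bsub>K[X]\<^esub> ?D" unfolding c(2)[symmetric] ..
  also have "\<dots> = \<one>\<^bsub>K[X]\<^esub>"
  proof -
   have bd: "b \<otimes>\<^bsub>K[X]\<^esub> ?D \<in> carrier (K[X])" "\<one>\<^bsub>K[X]\<^esub> \<in> carrier (K[X])" using b DK by auto
   thus ?thesis by (simp add: U.minus_eq U.minus_add U.a_ac U.l_neg U.r_neg)
  qed
  finally have "(\<ominus>\<^bsub>K[X]\<^esub> c) \<otimes>\<^bsub>K[X]\<^esub> ?p \<oplus>\<^bsub>K[X]\<^esub> b \<otimes>\<^bsub>K[X]\<^esub> ?D = \<one>\<^bsub>K[X]\<^esub>" .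
  hence "separable_poly K ?p" unfolding separable_poly_def using b(1) c(1) U.a_inv_closed by blast
  thus ?thesis using alg by simp
 next
  case True
  have "?D = []"
  proof (rule ccontr)
   assume D0: "?D ~= []"
   have "?p pdivides ?D" using Irr_minimal[OF K x alg' DK True] .
   hence "?d \<le> degree ?D" using pdivides_imp_degree_le[OF KS I(1) DK D0] by simp
   thus False using lD D0 d1 by (cases ?D) auto
  qed
  hence "set ?l \<subseteq> {\<zero>}" using normalize_eq_Nil[of ?l] Dd by simp
  hence zero: "[i] \<cdot> coeff ?p i = \<zero>" if "1 \<le> i" "i \<le> ?d" for i
  proof -
   have "i \<in> set (rev [1..<length ?p])" using that lp by (simp del: One_nat_def)
   hence "[i] \<cdot> coeff ?p i \<in> set ?l" unfolding set_map by (rule imageI)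
   thus ?thesis using \<open>set ?l \<subseteq> {\<zero>}\<close> by auto
  qed
  have "coeff ?p ?d = \<one>" using lead_coeff_simp[of ?p] I(3) lp by fastforce
  hence "[?d] \<cdot> \<one> = \<zero>" using zero[of ?d] d1 by simp
  then obtain q :: nat where q: "q > 1" "[q] \<cdot> \<one> = \<zero>" "!!k. 0 < k ==> k < q ==> [k] \<cdot> \<one> ~= \<zero>" "!!i::nat. [i] \<cdot> \<one> = \<zero> ==> q dvd i"
   using characteristic_exists[OF _ \<open>[?d] \<cdot> \<one> = \<zero>\<close>] d1 by (metis One_nat_def Suc_le_lessD)
  note q1 = q(1)
  have dvq: "q dvd i" if "i \<le> ?d" "coeff ?p i ~= \<zero>" for i
  proof (cases "i = 0")
   case False
   have "([i] \<cdot> \<one>)\<otimes>coeff ?p i = \<zero>" using natc_mult[of "coeff ?p i" i] zero[of i] that False coeff_in_carrier[OF pC] by simp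
   hence "[i] \<cdot> \<one> = \<zero>" using that(2) coeff_in_carrier[OF pC] integral[of "[i] \<cdot> \<one>" "coeff ?p i"] by simp
   thus ?thesis by (rule q(4))
  qed simp
  define h where "h = ?d div q"
  have hq: "?d = h * q" using dvq[of ?d] \<open>coeff ?p ?d = \<one>\<close> unfolding h_def by simp
  have hd: "h < ?d"
  proof -
   have "h > 0" using hq d1 by (cases h) auto
   hence "h * 1 < h * q" using q1 by (intro mult_strict_left_mono)
   thus ?thesis using hq by simp
  qed
  let ?B = "exp_base x h" and ?A = "map (\<lambda>i. x [^] i) (rev [Suc h..<?d])"
  have eb: "exp_base x ?d = ?A @ [x [^] h] @ ?B"
  proof -
   have "[0..<?d] = [0..<h] @ [h..<?d]" using upt_add_eq_append[of 0 h "?d - h"] hd by simp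
   also have "[h..<?d] = [h] @ [Suc h..<?d]" using upt_conv_Cons[OF hd] by simp
   finally have "[0..<?d] = [0..<h] @ [h] @ [Suc h..<?d]" .
   thus ?thesis unfolding exp_base_def by simp
  qed
  have ind: "independent K (exp_base x ?d)" by (rule exp_base_independent[OF K x alg'])
  have ebc: "set (exp_base x ?d) \<subseteq> carrier R" by (rule exp_base_closed[OF x])
  obtain Vs where Vs: "length (Vs @ exp_base x ?d) = m" "independent K (Vs @ exp_base x ?d)" "Span K (Vs @ exp_base x ?d) = carrier R"
   using complete_base[OF K dm ind ebc] by blast
  have VC: "set (Vs @ exp_base x ?d) \<subseteq> carrier R" using independent_in_carrier[OF Vs(2)] .
  let ?W = "map (\<lambda>u. u [^] q) (Vs @ ?A @ ?B)"
  have WC: "set ?W \<subseteq> carrier R" using VC unfolding eb by auto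
  have SW: "submod K (Span K ?W)" using submod_Span[OF KS WC] .
  have gW: "set ?W \<subseteq> Span K ?W" using Span_gens[OF KS WC] .
  have xh: "(x [^] h) [^] q \<in> Span K ?W"
  proof -
   obtain p' where p': "?p = \<one> # p'" using I(3) lp by (cases ?p) auto
   have lp': "length p' = ?d" using p' by simp
   have ev0: "x [^] ?d \<oplus> eval p' x = \<zero>" using I(4) x unfolding p' by simp
   have p'K: "set p' \<subseteq> K" "set p' \<subseteq> carrier R" using pK pC p' by auto
   have "eval p' x \<in> Span K ?W"
   proof (rule eval_in_submod[OF SW p'K(1) _ KC x])
    fix i assume i: "i < length p'" "coeff p' i ~= \<zero>"
    have "coeff ?p i = coeff p' i" unfolding p' using i(1) by simp
    hence "q dvd i" using dvq[of i] i lp' by simp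
    then obtain j where j: "i = j * q" by (metis dvdE mult.commute)
    have "j < h" using j i(1) lp' hq q1 by simp
    hence "x [^] j \<in> set ?B" unfolding exp_base_def by auto
    hence "(x [^] j) [^] q \<in> set ?W" by auto
    moreover have "(x [^] j) [^] q = x [^] i" using x j by (simp add: nat_pow_pow)
    ultimately show "x [^] i \<in> Span K ?W" using gW by auto
   qed
   hence "\<ominus> eval p' x \<in> Span K ?W" by (rule submod_minus[OF KS SW])
   moreover have "(x [^] h) [^] q = \<ominus> eval p' x"
   proof -
    have "eval p' x \<in> carrier R" using eval_in_carrier[OF p'K(2) x] .
    hence "x [^] ?d = \<ominus> eval p' x" using ev0 x by (simp add: sum_zero_eq_neg)
    thus ?thesis using x hq by (simp add: nat_pow_pow)
   qed
   ultimately show ?thesis by simp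
  qed
  let ?U = "{u \<in> carrier R. u [^] q \<in> Span K ?W}"
  have "submod K ?U" unfolding submod_def
  proof (intro conjI ballI)
   have "\<zero> [^] q = \<zero>" using q1 by (simp add: nat_pow_zero)
   thus "\<zero> \<in> ?U" using submodD(3)[OF SW] by simp
  next
   fix u v assume "u \<in> ?U" "v \<in> ?U"
   thus "u \<oplus> v \<in> ?U" using frobenius_add[OF q(1,2,3), of u v] submodD(4)[OF SW] by simp
  next
   fix k u assume k: "k \<in> K" and u: "u \<in> ?U"
   have kc: "k \<in> carrier R" using k KC by auto
   have kq: "k [^] n \<in> K" for n :: nat by (induct n) (use k subringE(3,6)[OF KS] in auto)
   have "(k\<otimes>u) [^] q = k [^] q\<otimes>u [^] q" using kc u by (simp add: nat_pow_distrib)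
   thus "k\<otimes>u \<in> ?U" using kc u submodD(5)[OF SW kq] by simp
  qed auto
  moreover have "set (Vs @ exp_base x ?d) \<subseteq> ?U" using VC xh gW unfolding eb by auto
  ultimately have "Span K (Vs @ exp_base x ?d) \<subseteq> ?U" by (rule Span_least)
  hence all: "u [^] q \<in> Span K ?W" if "u \<in> carrier R" for u using Vs(3) that by auto
  obtain us where us: "set us \<subseteq> carrier R" "carrier R = Span K (map (\<lambda>u. u [^] q) us)" using ps[of q] q1 by auto
  have "set (map (\<lambda>u. u [^] q) us) \<subseteq> Span K ?W" using us(1) all by auto
  hence "carrier R \<subseteq> Span K ?W" using Span_subset_SpanI[OF KS WC] us(2) by simp
  hence "Span K ?W = carrier R" using submodD(1)[OF SW] by auto
  hence "m \<le> length ?W" using spanning_length[OF K WC] dm by simp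
  moreover have "length ?W < m" using Vs(1) unfolding eb by simp
  ultimately show ?thesis by simp
 qed
qed

end

section \<open>The tower\<close>

context dedekind_closed
begin

text \<open>Step k + 1 splits the only prime above M_{k+1} and ramifies all the others; the latter exist because n > 1,
and they are what makes the polynomial of the step irreducible. Numbers of primes and ramification indices
multiply along the tower.\<close>

lemma tower:
 fixes n k :: nat
 assumes n: "n > 1" and M: "!!i. i \<in> {1..n} ==> mxn (M i)" "inj_on M {1..n}" and e: "!!i. i \<in> {1..n} ==> e i > 0"
  and k: "k \<le> n"
 shows "\<exists>L E. dedekind_ext R K D L E & dimension (\<Prod>l\<in>{1..k}. e l) K L &
  (\<forall>p::nat. p > 0 --> (\<exists>us. set us \<subseteq> L & L = Span K (map (\<lambda>u. u [^] p) us))) &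
  (\<forall>i\<in>{1..n}. card (dedekind_ext.above R D E (M i)) = (if i \<le> k then e i else 1) &
   (\<forall>N\<in>dedekind_ext.above R D E (M i). (\<forall>y\<in>E. \<exists>d\<in>D. y \<ominus> d \<in> N) &
    (\<forall>x\<in>K. x ~= \<zero> --> dedekind.vl R L E N x = int (\<Prod>l\<in>{1..k} - {i}. e l) * vl (M i) x)))" using k
proof (induct k)
 case 0
 interpret X: dedekind_ext R K D K D
 proof (intro dedekind_ext.intro dedekind_axioms dedekind_ext_axioms.intro)
  show "\<exists>ws. set ws \<subseteq> carrier R & D = Span D ws" using Span_one[OF D] by (intro exI[of _ "[\<one>]"]) simp
 qed
 have ab: "X.above (M i) = {M i}" if "i \<in> {1..n}" for i
 proof -
  have "N \<inter> D = N" if "mx D N" for N using that unfolding mx_def by auto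
  thus ?thesis unfolding X.above_def using M(1)[OF that] by auto
 qed
 have res: "\<exists>d\<in>D. y \<ominus> d \<in> M i" if "i \<in> {1..n}" "y \<in> D" for i y
 proof (rule bexI[of _ y])
  show "y \<ominus> y \<in> M i" using M(1)[OF that(1)] M_closed(1) that(2) by (simp add: a_minus_def r_neg)
 qed (rule that(2))
 have ps: "\<exists>us. set us \<subseteq> K & K = Span K (map (\<lambda>u. u [^] p) us)" for p :: nat
  using Span_one[OF subfieldE(1)[OF K]] by (intro exI[of _ "[\<one>]"]) simp
 show ?case
 proof (rule exI[of _ K], rule exI[of _ D], intro conjI)
  show "dedekind_ext R K D K D" by (rule X.dedekind_ext_axioms)
  show "dimension (\<Prod>l\<in>{1..0}. e l) K K" using dimension_one[OF K] by simp
  show "\<forall>p::nat. p > 0 --> (\<exists>us. set us \<subseteq> K & K = Span K (map (\<lambda>u. u [^] p) us))" by (intro allI impI) (rule ps)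
 qed (simp add: ab res)
next
 case (Suc k)
 then obtain L E where LE: "dedekind_ext R K D L E" "dimension (\<Prod>l\<in>{1..k}. e l) K L"
  and ps: "!!p::nat. p > 0 ==> \<exists>us. set us \<subseteq> L & L = Span K (map (\<lambda>u. u [^] p) us)"
  and ab: "!!i. i \<in> {1..n} ==> card (dedekind_ext.above R D E (M i)) = (if i \<le> k then e i else 1)"
  and res: "!!i N y. i \<in> {1..n} ==> N \<in> dedekind_ext.above R D E (M i) ==> y \<in> E ==> \<exists>d\<in>D. y \<ominus> d \<in> N"
  and val: "!!i N x. i \<in> {1..n} ==> N \<in> dedekind_ext.above R D E (M i) ==> x \<in> K ==> x ~= \<zero> ==>
   dedekind.vl R L E N x = int (\<Prod>l\<in>{1..k} - {i}. e l) * vl (M i) x" by (auto simp del: One_nat_def)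
 interpret X: dedekind_ext R K D L E by (rule LE)
 interpret C: dedekind_closed R L E by (intro dedekind_closed.intro X.E.dedekind_axioms algebraically_closed_axioms)
 let ?j = "Suc k"
 have j: "?j \<in> {1..n}" using Suc by simp
 have "card (X.above (M ?j)) = 1" using ab[OF j] by simp
 then obtain Q where Q: "X.above (M ?j) = {Q}" by (rule card_1_singletonE)
 have mQ: "X.E.mxn Q" using Q unfolding X.above_def by blast
 define A where "A = (\<Union>i\<in>{1..n} - {?j}. X.above (M i))"
 have cpos: "card (X.above (M i)) > 0" if "i \<in> {1..n}" for i using ab[OF that] e[OF that] by simp
 have finab: "finite (X.above (M i))" if "i \<in> {1..n}" for i using cpos[OF that] card_ge_0_finite by blast
 have A: "finite A" "A ~= {}" "!!P. P \<in> A ==> X.E.mxn P" "Q \<notin> A"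
 proof -
  show "finite A" unfolding A_def using finab by auto
  obtain i where i: "i \<in> {1..n} - {?j}"
  proof (cases "?j = 1")
   case True thus ?thesis using n that[of 2] by auto
  next
   case False thus ?thesis using n that[of 1] by auto
  qed
  have "X.above (M i) ~= {}" using cpos[of i] i by auto
  thus "A ~= {}" unfolding A_def using i by blast
  show "!!P. P \<in> A ==> X.E.mxn P" unfolding A_def X.above_def by blast
  show "Q \<notin> A"
  proof
   assume "Q \<in> A"
   then obtain i where i: "i \<in> {1..n} - {?j}" "Q \<in> X.above (M i)" unfolding A_def by blast
   have "Q \<in> X.above (M ?j)" using Q by simp
   hence "M ?j = Q \<inter> D" "M i = Q \<inter> D" using i(2) unfolding X.above_def by simp_all
   hence "i = ?j" using inj_onD[OF M(2), of i ?j] i(1) j by (simp del: atLeastAtMost_iff)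
   thus False using i by simp
  qed
 qed
 obtain L' E' where S: "dedekind_ext R L E L' E'" "dimension (e ?j) L L'"
  "\<forall>p::nat. p > 0 --> (\<exists>us. set us \<subseteq> L' & L' = Span L (map (\<lambda>u. u [^] p) us))"
  "\<forall>P\<in>A. card (dedekind_ext.above R E E' P) = 1 & (\<forall>N\<in>dedekind_ext.above R E E' P. (\<forall>y\<in>E'. \<exists>d\<in>E. y \<ominus> d \<in> N) &
    (\<forall>x\<in>L. x ~= \<zero> --> dedekind.vl R L' E' N x = int (e ?j) * X.E.vl P x))"
  "card (dedekind_ext.above R E E' Q) = e ?j" "\<forall>N\<in>dedekind_ext.above R E E' Q. (\<forall>y\<in>E'. \<exists>d\<in>E. y \<ominus> d \<in> N) &
    (\<forall>x\<in>L. x ~= \<zero> --> dedekind.vl R L' E' N x = X.E.vl Q x)"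
  by (rule exE[OF C.extension_step[OF mQ A(1,2) _ A(4) e[OF j]]]) (rule A(3), assumption, elim exE conjE, (rule that; assumption))
 interpret Y: dedekind_ext R L E L' E' by (rule S(1))
 interpret Z: dedekind_ext R K D L' E'
 proof (intro dedekind_ext.intro dedekind_axioms Y.E.dedekind_axioms dedekind_ext_axioms.intro)
  show "x \<in> E'" if "x \<in> D" for x using Y.D_E[OF X.D_E[OF that]] .
  obtain us where us: "set us \<subseteq> carrier R" "E = Span D us" using X.fin by (elim exE conjE)
  obtain vs where vs: "set vs \<subseteq> carrier R" "E' = Span E vs" using Y.fin by (elim exE conjE)
  have "E' = Span D (span_prods us vs)" using Span_tower[OF D X.E.D us(2,1) vs(1)] vs(2) by simp
  moreover have "set (span_prods us vs) \<subseteq> carrier R" using us vs unfolding set_span_prods by blast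
  ultimately show "\<exists>ws. set ws \<subseteq> carrier R & E' = Span D ws" by blast
 qed
 have ps': "\<exists>us. set us \<subseteq> L' & L' = Span K (map (\<lambda>u. u [^] p) us)" if p: "p > 0" for p :: nat
 proof -
  obtain us where us: "set us \<subseteq> L" "L = Span K (map (\<lambda>u. u [^] p) us)" using ps[OF p] by blast
  obtain vs where vs: "set vs \<subseteq> L'" "L' = Span L (map (\<lambda>u. u [^] p) vs)" using S(3) p by blast
  have c: "set us \<subseteq> carrier R" "set vs \<subseteq> carrier R" using us(1) vs(1) by auto
  have "Span L (map (\<lambda>u. u [^] p) vs) = Span K (span_prods (map (\<lambda>u. u [^] p) us) (map (\<lambda>u. u [^] p) vs))"
   by (rule Span_tower[OF subfieldE(1)[OF K] subfieldE(1)[OF X.E.K] us(2)]) (use c in auto)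
  moreover have "span_prods (map (\<lambda>u. u [^] p) us) (map (\<lambda>u. u [^] p) vs) = map (\<lambda>u. u [^] p) (span_prods us vs)"
   unfolding span_prods_def using c by (auto simp: map_concat comp_def nat_pow_distrib subset_iff intro!: arg_cong[of _ _ concat])
  moreover have "set (span_prods us vs) \<subseteq> L'" using us(1) vs(1) Y.K_L Y.E.K_closed(4) unfolding set_span_prods by blast
  ultimately show ?thesis using vs(2) by (intro exI[of _ "span_prods us vs"]) simp
 qed
 have dimn: "dimension (\<Prod>l\<in>{1..?j}. e l) K L'" using telescopic_base[OF K X.E.K LE(2) S(2)] by (simp add: mult.commute)
 have zab: "Z.above (M i) = (\<Union>N\<in>X.above (M i). Y.above N)" for i
 proof (intro equalityI subsetI)
  fix N assume N: "N \<in> Z.above (M i)"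
  hence N': "Y.E.mxn N" "N \<inter> D = M i" unfolding Z.above_def by auto
  have "X.E.mxn (N \<inter> E)" using Y.contraction[OF N'(1)] .
  moreover have "(N \<inter> E) \<inter> D = M i" using N'(2) X.D_E by auto
  ultimately have "N \<inter> E \<in> X.above (M i)" unfolding X.above_def by simp
  moreover have "N \<in> Y.above (N \<inter> E)" unfolding Y.above_def using N'(1) by simp
  ultimately show "N \<in> (\<Union>N\<in>X.above (M i). Y.above N)" by blast
 next
  fix N' assume "N' \<in> (\<Union>N\<in>X.above (M i). Y.above N)"
  then obtain N where N: "X.E.mxn N" "N \<inter> D = M i" "Y.E.mxn N'" "N' \<inter> E = N" unfolding X.above_def Y.above_def by blast
  have "N' \<inter> D = M i" using N(2,4) X.D_E by auto
  thus "N' \<in> Z.above (M i)" unfolding Z.above_def using N(3) by simp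
 qed
 have low: "(\<forall>y\<in>E'. \<exists>d\<in>D. y \<ominus> d \<in> N')" 
  if i: "i \<in> {1..n}" and N: "N \<in> X.above (M i)" "N' \<in> Y.above N" and r: "\<forall>y\<in>E'. \<exists>d\<in>E. y \<ominus> d \<in> N'" for i N N'
 proof
  fix y assume y: "y \<in> E'"
  obtain d where d: "d \<in> E" "y \<ominus> d \<in> N'" using r y by blast
  obtain c where c: "c \<in> D" "d \<ominus> c \<in> N" using res[OF i N(1) d(1)] by blast
  have "d \<ominus> c \<in> N'" using c(2) N(2) unfolding Y.above_def by auto
  moreover have "mx E' N'" using N(2) unfolding Y.above_def by simp
  ultimately have "(y \<ominus> d) \<oplus> (d \<ominus> c) \<in> N'" using Y.E.M_closed(2) d(2) by blast
  moreover have "(y \<ominus> d) \<oplus> (d \<ominus> c) = y \<ominus> c"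
  proof -
   have "y \<in> carrier R" "d \<in> carrier R" "c \<in> carrier R" using y d(1) c(1) by auto
   thus ?thesis by algebra
  qed
  ultimately show "\<exists>d\<in>D. y \<ominus> d \<in> N'" using c(1) by auto
 qed
 have main: "card (Z.above (M i)) = (if i \<le> ?j then e i else 1) &
   (\<forall>N\<in>Z.above (M i). (\<forall>y\<in>E'. \<exists>d\<in>D. y \<ominus> d \<in> N) &
    (\<forall>x\<in>K. x ~= \<zero> --> Y.E.vl N x = int (\<Prod>l\<in>{1..?j} - {i}. e l) * vl (M i) x))" if i: "i \<in> {1..n}" for i
 proof (cases "i = ?j")
  case True
  have z: "Z.above (M i) = Y.above Q" unfolding zab True Q by simp
  have pr: "{1..?j} - {i} = {1..k} - {?j}" using True by auto
  have QX: "Q \<in> X.above (M i)" using Q True by simp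
  show ?thesis
  proof (intro conjI ballI impI)
   show "card (Z.above (M i)) = (if i \<le> ?j then e i else 1)" using z S(5) True by simp
   fix N assume N: "N \<in> Z.above (M i)"
   hence NY: "N \<in> Y.above Q" using z by simp
   show "\<exists>d\<in>D. y \<ominus> d \<in> N" if "y \<in> E'" for y using low[OF i QX NY] S(6) NY that by blast
   fix x assume x: "x \<in> K" "x ~= \<zero>"
   have "Y.E.vl N x = X.E.vl Q x" using S(6) NY X.K_L[OF x(1)] x(2) by blast
   thus "Y.E.vl N x = int (\<Prod>l\<in>{1..?j} - {i}. e l) * vl (M i) x" using val[OF i QX x] pr True by simp
  qed
 next
  case False
  have inA: "N \<in> A" if "N \<in> X.above (M i)" for N unfolding A_def using that False i by blast
  have "card (Z.above (M i)) = (\<Sum>N\<in>X.above (M i). card (Y.above N))" unfolding zab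
  proof (rule card_UN_disjoint[OF finab[OF i]])
   show "\<forall>N\<in>X.above (M i). finite (Y.above N)" using S(4) inA by (metis card.infinite zero_neq_one)
   show "\<forall>N\<in>X.above (M i). \<forall>N'\<in>X.above (M i). N ~= N' --> Y.above N \<inter> Y.above N' = {}" unfolding Y.above_def by blast
  qed
  also have "\<dots> = (\<Sum>N\<in>X.above (M i). 1)" by (rule sum.cong) (use S(4) inA in auto)
  also have "\<dots> = card (X.above (M i))" by simp
  also have "\<dots> = (if i \<le> ?j then e i else 1)" using ab[OF i] False by simp
  finally have c: "card (Z.above (M i)) = (if i \<le> ?j then e i else 1)" .
  show ?thesis
  proof (rule conjI[OF c], intro ballI conjI impI)
   fix N' assume "N' \<in> Z.above (M i)"
   then obtain N where N: "N \<in> X.above (M i)" "N' \<in> Y.above N" unfolding zab by blast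
   note s4 = bspec[OF S(4) inA[OF N(1)]]
   show "\<exists>d\<in>D. y \<ominus> d \<in> N'" if "y \<in> E'" for y using low[OF i N] s4 N(2) that by blast
   fix x assume x: "x \<in> K" "x ~= \<zero>"
   have "Y.E.vl N' x = int (e ?j) * X.E.vl N x" using s4 N(2) X.K_L[OF x(1)] x(2) by blast
   also have "\<dots> = int (e ?j * (\<Prod>l\<in>{1..k} - {i}. e l)) * vl (M i) x" using val[OF i N(1) x] by simp
   also have "e ?j * (\<Prod>l\<in>{1..k} - {i}. e l) = (\<Prod>l\<in>{1..?j} - {i}. e l)"
   proof -
    have "{1..?j} - {i} = insert ?j ({1..k} - {i})" using False by auto
    thus ?thesis by simp
   qed
   finally show "Y.E.vl N' x = int (\<Prod>l\<in>{1..?j} - {i}. e l) * vl (M i) x" .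
  qed
 qed
 show ?case
 proof (rule exI[of _ L'], rule exI[of _ E'], intro conjI)
  show "dedekind_ext R K D L' E'" by (rule Z.dedekind_ext_axioms)
  show "dimension (\<Prod>l\<in>{1..?j}. e l) K L'" by (rule dimn)
  show "\<forall>p::nat. p > 0 --> (\<exists>us. set us \<subseteq> L' & L' = Span K (map (\<lambda>u. u [^] p) us))" by (intro allI impI) (rule ps')
 qed (rule ballI, rule main)
qed

end

section \<open>Ideals, Noetherian domains and integral elements in terms of submodules\<close>

context cring
begin

lemma subring_cring: "subring D R ==> cring (R |: D)" using subcring_iff subcringI' subringE(1) by blast

lemma ideal_iff_submod:
 assumes D: "subring D R"
 shows "ideal J (R |: D) \<longleftrightarrow> submod D J & J \<subseteq> D"
proof -
 interpret A: cring "R |: D" by (rule subring_cring[OF D])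
 show ?thesis
 proof
  assume "ideal J (R |: D)"
  then interpret J: ideal J "R |: D" .
  have JD: "J \<subseteq> D" using J.a_subset by simp
  moreover have "J \<subseteq> carrier R" using JD subringE(1)[OF D] by (rule subset_trans)
  ultimately show "submod D J & J \<subseteq> D" unfolding submod_def using J.zero_closed J.a_closed J.I_l_closed by simp
 next
  assume J: "submod D J & J \<subseteq> D"
  hence sm: "submod D J" and JD: "!!x. x \<in> J ==> x \<in> D" by auto
  show "ideal J (R |: D)"
  proof (rule idealI)
   show "ring (R |: D)" by (rule A.ring_axioms)
   show "subgroup J (add_monoid (R |: D))"
   proof (rule A.add.subgroupI)
    show "J \<subseteq> carrier (R |: D)" using J by simp
    show "J ~= {}" using submodD(3)[OF sm] by blast
    fix a assume a: "a \<in> J"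
    have "\<ominus>\<^bsub>R |: D\<^esub> a = (\<ominus>\<^bsub>R |: D\<^esub> \<one>\<^bsub>R |: D\<^esub>) \<otimes>\<^bsub>R |: D\<^esub> a"
     using A.l_minus[of "\<one>\<^bsub>R |: D\<^esub>" a] A.l_one[of a] A.one_closed JD[OF a] by simp
    moreover have "\<ominus>\<^bsub>R |: D\<^esub> \<one>\<^bsub>R |: D\<^esub> \<in> D" using A.a_inv_closed[OF A.one_closed] by simp
    ultimately show "\<ominus>\<^bsub>R |: D\<^esub> a \<in> J" using submodD(5)[OF sm _ a] by simp
   next
    fix a b assume "a \<in> J" "b \<in> J"
    thus "a \<oplus>\<^bsub>R |: D\<^esub> b \<in> J" using submodD(4)[OF sm] by simp
   qed
  next
   fix a x assume a: "a \<in> J" and x: "x \<in> carrier (R |: D)"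
   show "x \<otimes>\<^bsub>R |: D\<^esub> a \<in> J" using submodD(5)[OF sm _ a] x by simp
   thus "a \<otimes>\<^bsub>R |: D\<^esub> x \<in> J" using A.m_comm[of a x] JD[OF a] x by simp
  qed
 qed
qed

lemma Idl_eq_Span:
 assumes D: "subring D R" and us: "set us \<subseteq> D"
 shows "Idl\<^bsub>R |: D\<^esub> (set us) = Span D us"
proof -
 interpret A: cring "R |: D" by (rule subring_cring[OF D])
 have uc: "set us \<subseteq> carrier R" using us subringE(1)[OF D] by (rule subset_trans)
 have "Span D us \<subseteq> D" by (rule Span_least[OF submod_subring[OF D order_refl] us])
 hence "ideal (Span D us) (R |: D)" using submod_Span[OF D uc] ideal_iff_submod[OF D] by simp
 hence 1: "Idl\<^bsub>R |: D\<^esub> (set us) \<subseteq> Span D us" by (rule A.genideal_minimal) (rule Span_gens[OF D uc])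
 have "ideal (Idl\<^bsub>R |: D\<^esub> (set us)) (R |: D)" by (rule A.genideal_ideal) (simp add: us)
 hence "submod D (Idl\<^bsub>R |: D\<^esub> (set us))" using ideal_iff_submod[OF D] by simp
 moreover have "set us \<subseteq> Idl\<^bsub>R |: D\<^esub> (set us)" by (rule A.genideal_self) (simp add: us)
 ultimately have "Span D us \<subseteq> Idl\<^bsub>R |: D\<^esub> (set us)" by (rule Span_least)
 with 1 show ?thesis by (rule equalityI)
qed

lemma maximalideal_iff_mx:
 assumes D: "subring D R"
 shows "maximalideal M (R |: D) \<longleftrightarrow> mx D M"
proof -
 interpret A: cring "R |: D" by (rule subring_cring[OF D])
 note sc = subringE[OF D]
 show ?thesis
 proof
  assume "maximalideal M (R |: D)"
  then interpret M: maximalideal M "R |: D" .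
  have sm: "submod D M" and MD: "M \<subseteq> D" using M.is_ideal ideal_iff_submod[OF D] by auto
  have o: "\<one> \<notin> M" using M.one_imp_carrier M.I_notcarr by auto
  have "\<exists>d\<in>D. \<one> \<ominus> d\<otimes>x \<in> M" if x: "x \<in> D" "x \<notin> M" for x
  proof -
   let ?J = "M <+>\<^bsub>R |: D\<^esub> PIdl\<^bsub>R |: D\<^esub> x"
   have xi: "ideal (PIdl\<^bsub>R |: D\<^esub> x) (R |: D)" by (rule A.cgenideal_ideal) (simp add: x(1))
   have Ji: "ideal ?J (R |: D)" by (rule A.add_ideals[OF M.is_ideal xi])
   have "M \<union> PIdl\<^bsub>R |: D\<^esub> x \<subseteq> ?J" using A.union_genideal[OF M.is_ideal xi] A.genideal_self[of "M \<union> PIdl\<^bsub>R |: D\<^esub> x"]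
     M.a_subset additive_subgroup.a_subset[OF ideal.axioms(1)[OF xi]] by simp
   moreover have "x \<in> PIdl\<^bsub>R |: D\<^esub> x" by (rule A.cgenideal_self) (simp add: x(1))
   ultimately have "M \<subseteq> ?J" "x \<in> ?J" by auto
   moreover have "?J \<subseteq> carrier (R |: D)" by (rule additive_subgroup.a_subset[OF ideal.axioms(1)[OF Ji]])
   ultimately have "?J = carrier (R |: D)" using M.I_maximal[OF Ji] x(2) by blast
   hence "\<one> \<in> ?J" using A.one_closed by simp
   then obtain m d where md: "m \<in> M" "d \<in> D" "\<one> = m \<oplus> d\<otimes>x" unfolding set_add_defs cgenideal_def by auto
   have c: "m \<in> carrier R" "d \<in> carrier R" "x \<in> carrier R" using md x(1) MD sc(1) by auto
   have "\<one> \<ominus> d\<otimes>x = m" unfolding md(3) using c by algebra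
   thus ?thesis using md(1,2) by auto
  qed
  thus "mx D M" unfolding mx_def using sm MD o by blast
 next
  assume M: "mx D M"
  have sm: "submod D M" and MD: "M \<subseteq> D" and o: "\<one> \<notin> M" and mm: "!!x. x \<in> D ==> x \<notin> M ==> \<exists>d\<in>D. \<one> \<ominus> d\<otimes>x \<in> M"
   using M unfolding mx_def by auto
  show "maximalideal M (R |: D)"
  proof (rule maximalidealI)
   show "ideal M (R |: D)" using sm MD ideal_iff_submod[OF D] by simp
   show "carrier (R |: D) ~= M" using o sc(3) by auto
   fix J assume J: "ideal J (R |: D)" "M \<subseteq> J" "J \<subseteq> carrier (R |: D)"
   have sJ: "submod D J" using J(1) ideal_iff_submod[OF D] by simp
   show "J = M \<or> J = carrier (R |: D)"
   proof (cases "J \<subseteq> M")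
    case True thus ?thesis using J(2) by auto
   next
    case False
    then obtain x where x: "x \<in> J" "x \<notin> M" by auto
    have xD: "x \<in> D" using x(1) J(3) by auto
    obtain d where d: "d \<in> D" "\<one> \<ominus> d\<otimes>x \<in> M" using mm[OF xD x(2)] by (rule bexE)
    have "d\<otimes>x \<in> J" by (rule submodD(5)[OF sJ d(1) x(1)])
    moreover have "\<one> \<ominus> d\<otimes>x \<in> J" using d(2) J(2) by (rule rev_subsetD)
    ultimately have "(\<one> \<ominus> d\<otimes>x) \<oplus> d\<otimes>x \<in> J" by (intro submodD(4)[OF sJ])
    moreover have "(\<one> \<ominus> d\<otimes>x) \<oplus> d\<otimes>x = \<one>"
    proof -
     have "d \<in> carrier R" "x \<in> carrier R" using d(1) xD sc(1) by auto
     thus ?thesis by algebra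
    qed
    ultimately have oJ: "\<one> \<in> J" by simp
    have "y \<in> J" if "y \<in> D" for y using submodD(5)[OF sJ that oJ] that sc(1) by (simp add: subset_iff)
    thus ?thesis using J(3) by auto
   qed
  qed
 qed
qed

lemma primeideal_iff_pri:
 assumes D: "subring D R"
 shows "primeideal P (R |: D) \<longleftrightarrow> pri D P"
proof -
 interpret A: cring "R |: D" by (rule subring_cring[OF D])
 show ?thesis
 proof
  assume "primeideal P (R |: D)"
  then interpret P: primeideal P "R |: D" .
  have "submod D P" "P \<subseteq> D" using P.is_ideal ideal_iff_submod[OF D] by auto
  moreover have "\<one> \<notin> P" using P.one_imp_carrier P.I_notcarr by auto
  ultimately show "pri D P" unfolding pri_def using P.I_prime by simp
 next
  assume P: "pri D P"
  show "primeideal P (R |: D)"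
  proof (rule primeidealI)
   show "ideal P (R |: D)" using P ideal_iff_submod[OF D] unfolding pri_def by simp
   show "cring (R |: D)" by (rule A.cring_axioms)
   show "carrier (R |: D) ~= P" using P subringE(3)[OF D] unfolding pri_def by auto
  qed (use P in \<open>simp add: pri_def\<close>)
 qed
qed

lemma noetherian_iff_noeth:
 assumes D: "subring D R"
 shows "noetherian_ring (R |: D) \<longleftrightarrow> noeth D"
proof -
 interpret A: cring "R |: D" by (rule subring_cring[OF D])
 show ?thesis
 proof
  assume "noetherian_ring (R |: D)"
  then interpret N: noetherian_ring "R |: D" .
  show "noeth D" unfolding noeth_def
  proof (intro allI impI)
   fix J assume "submod D J & J \<subseteq> D"
   hence "ideal J (R |: D)" using ideal_iff_submod[OF D] by simp
   then obtain A where A: "A \<subseteq> D" "finite A" "J = Idl\<^bsub>R |: D\<^esub> A" using N.finetely_gen by auto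
   obtain us where us: "set us = A" using finite_list[OF A(2)] by blast
   have "J = Span D us" using A(3) Idl_eq_Span[OF D, of us] A(1) us by simp
   moreover have "set us \<subseteq> J" unfolding A(3) us by (rule A.genideal_self) (simp add: A(1))
   ultimately show "\<exists>us. set us \<subseteq> J & J = Span D us" by (intro exI[of _ us] conjI)
  qed
 next
  assume N: "noeth D"
  show "noetherian_ring (R |: D)"
  proof (rule A.noetherian_ringI)
   fix J assume "ideal J (R |: D)"
   hence J: "submod D J" "J \<subseteq> D" using ideal_iff_submod[OF D] by auto
   then obtain us where us: "set us \<subseteq> J" "J = Span D us" using N unfolding noeth_def by (elim allE[of _ J]) auto
   have "set us \<subseteq> D" using us(1) J(2) by (rule subset_trans)
   thus "\<exists>A\<subseteq>carrier (R |: D). finite A & J = Idl\<^bsub>R |: D\<^esub> A" using us(2) Idl_eq_Span[OF D] by (intro exI[of _ "set us"]) simp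
  qed
 qed
qed

lemma integral_over_iff_intg:
 assumes D: "subring D R" and N: "noeth D" and x: "x \<in> carrier R" and ne: "\<one> ~= \<zero>"
 shows "integral_over D x \<longleftrightarrow> intg D x"
proof
 assume "integral_over D x"
 then obtain p where p: "p \<in> carrier (D[X])" "p ~= []" "lead_coeff p = \<one>" "eval p x = \<zero>" unfolding integral_over_def by blast
 obtain q where q: "p = \<one> # q" using p(2,3) by (cases p) auto
 have "set q \<subseteq> D" using p(1) unfolding q univ_poly_carrier[symmetric] polynomial_def by auto
 thus "intg D x" using monic_imp_intg[OF D x] p(4) unfolding q by blast
next
 assume "intg D x"
 then obtain q where q: "set q \<subseteq> D" "eval (\<one> # q) x = \<zero>" using intg_imp_monic[OF D N] by blast
 have "\<one> # q \<in> carrier (D[X])" using q(1) subringE(3)[OF D] ne unfolding univ_poly_carrier[symmetric] polynomial_def by simp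
 thus "integral_over D x" unfolding integral_over_def using q(2) by (intro bexI[of _ "\<one> # q"]) (auto simp del: eval.simps)
qed

end

lemma dedekind_domain_imp_dedekind:
 assumes dd: "dedekind_domain F D"
 shows "dedekind F (carrier F) D"
proof -
 have q: "is_quotient_field F D" using dd unfolding dedekind_domain_def by simp
 hence F: "field F" unfolding is_quotient_field_def by simp
 then interpret field F .
 have D: "subring D F" using q subcring.axioms(1)[OF subdomain.axioms(1)] unfolding is_quotient_field_def by blast
 have nr: "noetherian_ring (F |: D)" using dd noetherian_domain.axioms(1) unfolding dedekind_domain_def by blast
 show ?thesis
 proof (intro dedekind.intro dedekind_axioms.intro F carrier_is_subfield D)
  show "x \<in> carrier F" if "x \<in> D" for x using that subringE(1)[OF D] by auto
  show N: "noeth D" using nr noetherian_iff_noeth[OF D] by simp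
  fix x assume x: "x \<in> carrier F"
  have "x \<in> {a \<otimes>\<^bsub>F\<^esub> inv\<^bsub>F\<^esub> b | a b. a \<in> D & b \<in> D - {\<zero>\<^bsub>F\<^esub>}}" using q x unfolding is_quotient_field_def by simp
  then obtain a b where ab: "x = a \<otimes>\<^bsub>F\<^esub> inv\<^bsub>F\<^esub> b" "a \<in> D" "b \<in> D" "b ~= \<zero>\<^bsub>F\<^esub>" by blast
  have c: "a \<in> carrier F" "b \<in> carrier F" using ab subringE(1)[OF D] by auto
  have iv: "inv\<^bsub>F\<^esub> b \<in> carrier F" "b \<otimes>\<^bsub>F\<^esub> inv\<^bsub>F\<^esub> b = \<one>\<^bsub>F\<^esub>" using c(2) ab(4) field_Units by auto
  have "b \<otimes>\<^bsub>F\<^esub> x = a \<otimes>\<^bsub>F\<^esub> (b \<otimes>\<^bsub>F\<^esub> inv\<^bsub>F\<^esub> b)" unfolding ab(1) using c iv(1) by (simp add: m_ac)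
  hence "b \<otimes>\<^bsub>F\<^esub> x = a" using iv c by simp
  thus "\<exists>a\<in>D. \<exists>b\<in>D. b ~= \<zero>\<^bsub>F\<^esub> & b \<otimes>\<^bsub>F\<^esub> x = a" using ab by blast
  assume "intg D x"
  hence "integral_over D x" using integral_over_iff_intg[OF D N x one_not_zero] by simp
  thus "x \<in> D" using dd x unfolding dedekind_domain_def by blast
 next
  fix P assume P: "pri D P" "P ~= {\<zero>\<^bsub>F\<^esub>}"
  hence "primeideal P (F |: D)" using primeideal_iff_pri[OF D] by simp
  hence "maximalideal P (F |: D)" using dd P(2) unfolding dedekind_domain_def by blast
  thus "mx D P" using maximalideal_iff_mx[OF D] by simp
 qed
qed

lemma dedekind_imp_dedekind_domain:
 assumes dd: "dedekind F (carrier F) D"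
 shows "dedekind_domain F D"
proof -
 interpret dedekind F "carrier F" D by (rule dd)
 have q: "is_quotient_field F D" unfolding is_quotient_field_def
 proof (intro conjI equalityI subsetI)
  show "field F" by (rule field_axioms)
  show "subdomain D F" by (rule subdomainI'[OF D])
  fix x assume x: "x \<in> carrier F"
  obtain a b where ab: "a \<in> D" "b \<in> D" "b ~= \<zero>\<^bsub>F\<^esub>" "b \<otimes>\<^bsub>F\<^esub> x = a" using frac[OF x] by (elim bexE conjE)
  have c: "a \<in> carrier F" "b \<in> carrier F" using ab(1,2) by auto
  have "a \<otimes>\<^bsub>F\<^esub> inv\<^bsub>F\<^esub> b = x \<otimes>\<^bsub>F\<^esub> (b \<otimes>\<^bsub>F\<^esub> inv\<^bsub>F\<^esub> b)" unfolding ab(4)[symmetric]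
   using m_assoc[of x b "inv\<^bsub>F\<^esub> b"] m_comm[of b x] cinv(1)[OF c(2) ab(3)] c x by simp
  also have "\<dots> = x" using c ab(3) x cinv by simp
  finally show "x \<in> {a \<otimes>\<^bsub>F\<^esub> inv\<^bsub>F\<^esub> b | a b. a \<in> D & b \<in> D - {\<zero>\<^bsub>F\<^esub>}}" using ab by blast
 next
  fix x assume "x \<in> {a \<otimes>\<^bsub>F\<^esub> inv\<^bsub>F\<^esub> b | a b. a \<in> D & b \<in> D - {\<zero>\<^bsub>F\<^esub>}}"
  thus "x \<in> carrier F" using cinv by auto
 qed
 show ?thesis unfolding dedekind_domain_def
 proof (intro conjI ballI allI impI q)
  show "noetherian_domain (F |: D)"
   using noeth noetherian_iff_noeth[OF D] subring_is_domain[OF D] by (intro noetherian_domain.intro) auto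
  fix x assume x: "x \<in> carrier F" "integral_over D x"
  thus "x \<in> D" using normal[OF x(1)] integral_over_iff_intg[OF D noeth x(1) one_not_zero] by simp
 next
  fix P assume "primeideal P (F |: D) & P ~= {\<zero>\<^bsub>F\<^esub>}"
  thus "maximalideal P (F |: D)" using dim1 primeideal_iff_pri[OF D] maximalideal_iff_mx[OF D] by simp
 qed
qed


section \<open>Change of the ambient field\<close>

lemma (in field) subring_a_inv:
 assumes "subring L R" "x \<in> L"
 shows "\<ominus>\<^bsub>R |: L\<^esub> x = \<ominus> x"
proof -
 interpret A: cring "R |: L" by (rule subring_cring[OF assms(1)])
 have "\<ominus> x \<in> L" "x \<in> carrier R" using assms subringE(1,5)[OF assms(1)] by auto
 thus ?thesis using A.minus_equality[of "\<ominus> x" x] assms(2) l_neg by simp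
qed

text \<open>The extension field has to be a ring of its own, with carrier L, rather than a subset of the algebraic
closure.\<close>

lemma (in dedekind) restrict:
 assumes L: "subfield L R" and KL: "!!x. x \<in> K ==> x \<in> L"
 shows "dedekind (R |: L) K D" 
  and "dedekind.vl (R |: L) K D = vl"
  and "cring.mx (R |: L) D M \<longleftrightarrow> mx D M"
proof -
 interpret S: field "R |: L" by (rule subfield_iff(2)[OF L])
 note LS = subfieldE(1)[OF L]
 have DL: "!!x. x \<in> D ==> x \<in> L" using KL D_K by blast
 have sub: "S.submod D U \<longleftrightarrow> submod D U" if "!!x. x \<in> U ==> x \<in> L" for U
 proof -
  have "U \<subseteq> L" "U \<subseteq> carrier R" using that subfieldE(3)[OF L] by auto
  thus ?thesis unfolding S.submod_def submod_def by simp
 qed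
 have sD: "S.submod D U & U \<subseteq> D \<longleftrightarrow> submod D U & U \<subseteq> D" for U
 proof (cases "U \<subseteq> D")
  case True
  hence "!!x. x \<in> U ==> x \<in> L" using DL by auto
  thus ?thesis using sub by blast
 qed simp
 have sp: "S.Span = Span" by (rule Span_consistent[OF LS])
 have mx: "S.mx D U \<longleftrightarrow> mx D U" for U
 proof -
  have "\<one> \<ominus>\<^bsub>R |: L\<^esub> d\<otimes>x = \<one> \<ominus> d\<otimes>x" if "x \<in> D" "d \<in> D" for x d
   using subring_a_inv[OF LS, of "d\<otimes>x"] that DL by (simp add: a_minus_def)
  hence "(\<forall>x\<in>D - U. \<exists>d\<in>D. \<one> \<ominus>\<^bsub>R |: L\<^esub> d\<otimes>x \<in> U) \<longleftrightarrow> (\<forall>x\<in>D - U. \<exists>d\<in>D. \<one> \<ominus> d\<otimes>x \<in> U)" by (intro ball_cong bex_cong refl) simp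
  thus ?thesis unfolding S.mx_def mx_def using sD[of U] by (cases "U \<subseteq> D") simp_all
 qed
 thus "S.mx D M \<longleftrightarrow> mx D M" .
 have pri: "S.pri D U \<longleftrightarrow> pri D U" for U unfolding S.pri_def pri_def using sD[of U] by (cases "U \<subseteq> D") simp_all
 have rg: "subring D (R |: L)" by (rule S.ring_incl_imp_subring) (use DL subring_is_ring[OF D] in auto)
 show dd: "dedekind (R |: L) K D"
 proof (intro dedekind.intro dedekind_axioms.intro S.field_axioms rg)
  show "subfield K (R |: L)" by (rule S.subfield_iff(1)) (use KL subfield_iff(2)[OF K] in auto)
  show "x \<in> K" if "x \<in> D" for x using that by (rule D_K)
  show "\<exists>a\<in>D. \<exists>b\<in>D. b ~= \<zero>\<^bsub>R |: L\<^esub> & b \<otimes>\<^bsub>R |: L\<^esub> x = a" if "x \<in> K" for x using frac[OF that] by simp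
  show "S.noeth D" using noeth unfolding S.noeth_def noeth_def sp sD .
  show "x \<in> D" if "x \<in> K" "S.intg D x" for x
  proof (rule normal[OF that(1)])
   have "x [^]\<^bsub>R |: L\<^esub> n = x [^] n" for n :: nat by (rule nat_pow_consistent[symmetric])
   thus "intg D x" using that subfieldE(3)[OF L] unfolding S.intg_def intg_def sp by (auto intro: subset_trans)
  qed
  show "S.mx D P" if "S.pri D P" "P ~= {\<zero>\<^bsub>R |: L\<^esub>}" for P using dim1[of P] that unfolding mx pri by simp
 qed
 have "S.place K D = place K D" by (intro ext) (simp add: S.place_def place_def)
 thus "dedekind.vl (R |: L) K D = vl" unfolding dedekind.vl_def[OF dd] vl_def by simp
qed

lemma (in dedekind_ext) restrict_ext:
 shows "dedekind_ext (R |: L) K D L E"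
  and "dedekind_ext.above (R |: L) D E = above"
proof -
 note rD = restrict[OF E.K K_L]
 have rE: "dedekind (R |: L) L E" by (rule E.restrict(1)[OF E.K])
 have rE3: "cring.mx (R |: L) E N \<longleftrightarrow> mx E N" for N by (rule E.restrict(3)[OF E.K])
 show "dedekind_ext (R |: L) K D L E"
 proof (intro dedekind_ext.intro dedekind_ext_axioms.intro rD(1) rE)
  show "x \<in> E" if "x \<in> D" for x using that by (rule D_E)
  obtain ws where ws: "set ws \<subseteq> carrier R" "E = Span D ws" using fin by (elim exE conjE)
  have "set ws \<subseteq> E" using Span_gens[OF D ws(1)] ws(2) by simp
  hence "set ws \<subseteq> L" using E.D_K by auto
  thus "\<exists>ws. set ws \<subseteq> carrier (R |: L) & E = ring.Span (R |: L) D ws"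
   unfolding Span_consistent[OF subfieldE(1)[OF E.K]] using ws(2) by (intro exI[of _ ws]) simp
 qed
 then interpret S: dedekind_ext "R |: L" K D L E .
 show "S.above = above" unfolding S.above_def above_def rE3 by simp
qed

lemma (in ring) dimension_restrict:
 assumes L: "subring L R"
 shows "dimension n K U ==> subfield K R ==> U \<subseteq> L ==> ring.dimension (R |: L) n K U"
proof (induct rule: dimension.induct)
 interpret S: ring "R |: L" by (rule subring_is_ring[OF L])
 case zero_dim
 show ?case using S.zero_dim by simp
next
 interpret S: ring "R |: L" by (rule subring_is_ring[OF L])
 case (Suc_dim v E n K)
 note KL = Suc_dim(5)
 have le: "line_extension K v E = S.line_extension K v E" using line_extension_consistent[OF L] by simp
 have z: "\<zero> \<in> E" using space_subgroup_props(2)[OF KL Suc_dim(3)] .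
 have one: "\<one> \<in> K" "\<zero> \<in> K" using subringE(2,3)[OF subfieldE(1)[OF KL]] by auto
 have EC: "E \<subseteq> carrier R" using space_subgroup_props(1)[OF KL Suc_dim(3)] .
 have "v \<in> line_extension K v E" unfolding line_extension_mem_iff using one z Suc_dim(1) by (intro bexI[of _ \<one>] bexI[of _ \<zero>]) auto
 moreover have "x \<in> line_extension K v E" if "x \<in> E" for x
  unfolding line_extension_mem_iff using one that Suc_dim(1) EC by (intro bexI[of _ \<zero>] bexI[of _ x]) auto
 ultimately have "v \<in> L" "E \<subseteq> L" using Suc_dim(6) by auto
 thus ?case unfolding le using S.Suc_dim[of v E n K] Suc_dim(2) Suc_dim(4)[OF KL \<open>E \<subseteq> L\<close>] \<open>v \<in> L\<close> by simp
qed

lemma dedekind_image: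
 assumes C: "field C" and dd: "dedekind F (carrier F) D" and h: "h \<in> ring_hom F C"
 shows "dedekind C (h ` carrier F) (h ` D)"
  and "cring.mx F D M ==> cring.mx C (h ` D) (h ` M)"
  and "inj_on h (carrier F)"
proof -
 interpret dedekind F "carrier F" D by (rule dd)
 interpret S: field C by (rule C)
 interpret H: ring_hom_ring F C h using h by (intro ring_hom_ring.intro ring_axioms S.ring_axioms ring_hom_ring_axioms.intro)
 show inj: "inj_on h (carrier F)" by (rule H.img_is_subfield(1)[OF carrier_is_subfield]) simp
 have hD: "subring (h ` D) C" by (rule H.img_is_subring[OF D])
 have inD: "a = b" if "h a = h b" "a \<in> D" "b \<in> D" for a b using inj_onD[OF inj that(1)] that by simp
 have hs: "h ` Span D us = S.Span (h ` D) (map h us)" if "set us \<subseteq> carrier F" for us using that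
 proof (induct us)
  case Nil thus ?case by (simp add: Span_Nil S.Span_Nil)
 next
  case (Cons u us)
  hence u: "u \<in> carrier F" and us: "set us \<subseteq> carrier F" by auto
  note IH = Cons(1)[OF us]
  have sc: "x \<in> carrier F" if "x \<in> Span D us" for x using submodD(2)[OF submod_Span[OF D us] that] .
  have "y \<in> h ` Span D (u # us) \<longleftrightarrow> (\<exists>d\<in>D. \<exists>z\<in>Span D us. y = h d \<otimes>\<^bsub>C\<^esub> h u \<oplus>\<^bsub>C\<^esub> h z)" for y
  proof -
   have "y \<in> h ` Span D (u # us) \<longleftrightarrow> (\<exists>d\<in>D. \<exists>z\<in>Span D us. y = h (d \<otimes>\<^bsub>F\<^esub> u \<oplus>\<^bsub>F\<^esub> z))" unfolding image_iff Bex_def Span_Cons_iff by blast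
   also have "\<dots> \<longleftrightarrow> (\<exists>d\<in>D. \<exists>z\<in>Span D us. y = h d \<otimes>\<^bsub>C\<^esub> h u \<oplus>\<^bsub>C\<^esub> h z)" by (intro bex_cong refl) (use u sc in simp)
   finally show ?thesis .
  qed
  moreover have "y \<in> S.Span (h ` D) (map h (u # us)) \<longleftrightarrow> (\<exists>d\<in>D. \<exists>z\<in>Span D us. y = h d \<otimes>\<^bsub>C\<^esub> h u \<oplus>\<^bsub>C\<^esub> h z)" for y
   unfolding list.map S.Span_Cons_iff IH[symmetric] by blast
  ultimately show ?case by - (rule Set.set_eqI, simp only:)
 qed
 have pre: "submod D {d \<in> D. h d \<in> J}" if "S.submod (h ` D) J" for J unfolding submod_def using S.submodD(3,4,5)[OF that] by auto
 have him: "h ` {d \<in> D. h d \<in> J} = J" if "J \<subseteq> h ` D" for J using that by auto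
 have mxim: "S.mx (h ` D) (h ` N)" if N: "mx D N" for N
 proof -
  note n = M_sub[OF N] M_one[OF N] M_max[OF N] M_D[OF N]
  have "S.submod (h ` D) (h ` N)" unfolding S.submod_def
  proof (intro conjI ballI)
   show "h ` N \<subseteq> carrier C" using n(4) by auto
   show "\<zero>\<^bsub>C\<^esub> \<in> h ` N" using submodD(3)[OF n(1)] H.hom_zero by (metis imageI)
   fix x y assume "x \<in> h ` N" "y \<in> h ` N"
   then obtain a b where ab: "a \<in> N" "b \<in> N" "x = h a" "y = h b" by blast
   have "x \<oplus>\<^bsub>C\<^esub> y = h (a \<oplus>\<^bsub>F\<^esub> b)" using ab n(4) by simp
   thus "x \<oplus>\<^bsub>C\<^esub> y \<in> h ` N" using submodD(4)[OF n(1) ab(1,2)] by simp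
  next
   fix x y assume "x \<in> h ` D" "y \<in> h ` N"
   then obtain a b where ab: "a \<in> D" "b \<in> N" "x = h a" "y = h b" by blast
   have "x \<otimes>\<^bsub>C\<^esub> y = h (a \<otimes>\<^bsub>F\<^esub> b)" using ab n(4) by simp
   thus "x \<otimes>\<^bsub>C\<^esub> y \<in> h ` N" using submodD(5)[OF n(1) ab(1,2)] by simp
  qed
  moreover have "h ` N \<subseteq> h ` D" using n(4) by auto
  moreover have "\<one>\<^bsub>C\<^esub> \<notin> h ` N"
  proof
   assume "\<one>\<^bsub>C\<^esub> \<in> h ` N"
   then obtain a where a: "a \<in> N" "h a = \<one>\<^bsub>C\<^esub>" by auto
   have "a = \<one>\<^bsub>F\<^esub>" by (rule inD) (use a n(4) H.hom_one in auto)
   thus False using a n(2) by simp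
  qed
  moreover have "\<exists>d\<in>h ` D. \<one>\<^bsub>C\<^esub> \<ominus>\<^bsub>C\<^esub> d \<otimes>\<^bsub>C\<^esub> x \<in> h ` N" if x: "x \<in> h ` D - h ` N" for x
  proof -
   obtain a where a: "a \<in> D" "x = h a" "a \<notin> N" using x by blast
   obtain d where d: "d \<in> D" "\<one>\<^bsub>F\<^esub> \<ominus>\<^bsub>F\<^esub> d \<otimes>\<^bsub>F\<^esub> a \<in> N" using n(3)[OF a(1,3)] by (rule bexE)
   have "h (\<one>\<^bsub>F\<^esub> \<ominus>\<^bsub>F\<^esub> d \<otimes>\<^bsub>F\<^esub> a) = \<one>\<^bsub>C\<^esub> \<ominus>\<^bsub>C\<^esub> h d \<otimes>\<^bsub>C\<^esub> x" using a d(1) by (simp add: a_minus_def)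
   thus ?thesis using d by (metis imageI)
  qed
  ultimately show ?thesis unfolding S.mx_def by blast
 qed
 thus "mx D M ==> S.mx (h ` D) (h ` M)" .
 show "dedekind C (h ` carrier F) (h ` D)"
 proof (intro dedekind.intro dedekind_axioms.intro C hD)
  show "subfield (h ` carrier F) C" by (rule H.img_is_subfield(2)[OF carrier_is_subfield]) simp
  show "x \<in> h ` carrier F" if "x \<in> h ` D" for x using that by auto
  show N: "S.noeth (h ` D)" unfolding S.noeth_def
  proof (intro allI impI)
   fix J assume J: "S.submod (h ` D) J & J \<subseteq> h ` D"
   let ?J = "{d \<in> D. h d \<in> J}"
   have "submod D ?J & ?J \<subseteq> D" using pre J by auto
   then obtain us where us: "set us \<subseteq> ?J" "?J = Span D us" using noeth unfolding noeth_def by (elim allE[of _ ?J]) blast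
   have "set us \<subseteq> carrier F" using us(1) by auto
   hence "h ` ?J = S.Span (h ` D) (map h us)" using hs unfolding us(2) by blast
   hence "J = S.Span (h ` D) (map h us)" using him[of J] J by simp
   moreover have "set (map h us) \<subseteq> J" using us(1) by auto
   ultimately show "\<exists>us. set us \<subseteq> J & J = S.Span (h ` D) us" by (intro exI[of _ "map h us"] conjI)
  qed
  fix x assume x: "x \<in> h ` carrier F"
  then obtain y where y: "y \<in> carrier F" "x = h y" by auto
  obtain a b where ab: "a \<in> D" "b \<in> D" "b ~= \<zero>\<^bsub>F\<^esub>" "b \<otimes>\<^bsub>F\<^esub> y = a" using frac[OF y(1)] by (elim bexE conjE)
  have "h b ~= \<zero>\<^bsub>C\<^esub>" using inD[of b "\<zero>\<^bsub>F\<^esub>"] ab by auto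
  moreover have "h b \<otimes>\<^bsub>C\<^esub> x = h a" using y ab(2,4) by auto
  ultimately show "\<exists>a\<in>h ` D. \<exists>b\<in>h ` D. b ~= \<zero>\<^bsub>C\<^esub> & b \<otimes>\<^bsub>C\<^esub> x = a" using ab(1,2) by blast
  assume "S.intg (h ` D) x"
  then obtain p where p: "set p \<subseteq> h ` D" "S.eval (\<one>\<^bsub>C\<^esub> # p) x = \<zero>\<^bsub>C\<^esub>" using S.intg_imp_monic[OF hD N] by blast
  define q where "q = map (inv_into D h) p"
  have pD: "!!z. z \<in> set p ==> z \<in> h ` D" using p(1) by blast
  have q: "set q \<subseteq> D" "p = map h q"
   unfolding q_def using pD by (auto simp: comp_def f_inv_into_f inv_into_into intro!: map_idI[symmetric])
  have qc: "set (\<one>\<^bsub>F\<^esub> # q) \<subseteq> carrier F" using q(1) by auto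
  have "h (eval (\<one>\<^bsub>F\<^esub> # q) y) = S.eval (\<one>\<^bsub>C\<^esub> # p) x" using H.eval_hom'[OF y(1) qc] q(2) y(2) H.hom_one by (simp del: eval.simps S.eval.simps)
  hence "h (eval (\<one>\<^bsub>F\<^esub> # q) y) = h \<zero>\<^bsub>F\<^esub>" unfolding p(2) H.hom_zero .
  hence "eval (\<one>\<^bsub>F\<^esub> # q) y = \<zero>\<^bsub>F\<^esub>" by (rule inj_onD[OF inj]) (use eval_in_carrier[OF qc y(1)] in \<open>simp_all del: eval.simps\<close>)
  hence "intg D y" by (rule monic_imp_intg[OF D y(1) q(1)])
  hence "y \<in> D" by (rule normal[OF y(1)])
  thus "x \<in> h ` D" using y(2) by simp
 next
  fix P assume P: "S.pri (h ` D) P" "P ~= {\<zero>\<^bsub>C\<^esub>}"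
  let ?P = "{d \<in> D. h d \<in> P}"
  have PD: "P \<subseteq> h ` D" and Ps: "S.submod (h ` D) P" and Po: "\<one>\<^bsub>C\<^esub> \<notin> P" using P(1) unfolding S.pri_def by auto
  have Pp: "!!x y. x \<in> h ` D ==> y \<in> h ` D ==> x \<otimes>\<^bsub>C\<^esub> y \<in> P ==> x \<in> P \<or> y \<in> P" using P(1) unfolding S.pri_def by blast
  have "pri D ?P" unfolding pri_def
  proof (intro conjI ballI impI)
   show "submod D ?P" by (rule pre[OF Ps])
   show "\<one>\<^bsub>F\<^esub> \<notin> ?P" using Po by simp
   fix x y assume xy: "x \<in> D" "y \<in> D" "x \<otimes>\<^bsub>F\<^esub> y \<in> ?P"
   hence "h x \<otimes>\<^bsub>C\<^esub> h y \<in> P" by simp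
   thus "x \<in> ?P \<or> y \<in> ?P" using Pp[of "h x" "h y"] xy(1,2) by simp
  qed auto
  moreover have "?P ~= {\<zero>\<^bsub>F\<^esub>}" using him[OF PD] P(2) by force
  ultimately have "mx D ?P" by (rule dim1)
  thus "S.mx (h ` D) P" using mxim him[OF PD] by fastforce
 qed
qed

section \<open>Residue rings, orders of ideals, and localizations\<close>

text \<open>If A maps onto B / P, then A / h^{-1}(P) and B / P are isomorphic; on cosets the isomorphism is taking
preimages.\<close>

lemma quotient_iso_of_surjective:
 assumes A: "cring A" and B: "cring B" and h: "h \<in> ring_hom A B" and P: "ideal P B"
  and surj: "!!y. y \<in> carrier B ==> \<exists>a\<in>carrier A. \<exists>p\<in>P. y = p \<oplus>\<^bsub>B\<^esub> h a"
  and Q: "Q = {a \<in> carrier A. h a \<in> P}"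
 shows "(\<lambda>C. {a \<in> carrier A. h a \<in> C}) \<in> ring_iso (B Quot P) (A Quot Q)"
  and "a \<in> carrier A ==> {a' \<in> carrier A. h a' \<in> P +>\<^bsub>B\<^esub> h a} = Q +>\<^bsub>A\<^esub> a"
  and "carrier (B Quot P) = (\<lambda>a. P +>\<^bsub>B\<^esub> h a) ` carrier A"
proof -
 interpret A: cring A by (rule A)
 interpret B: cring B by (rule B)
 interpret H: ring_hom_ring A B h by (intro ring_hom_ring.intro A.ring_axioms B.ring_axioms ring_hom_ring_axioms.intro h)
 interpret P: ideal P B by (rule P)
 have Qi: "ideal Q A" unfolding Q by (rule H.ideal_vimage[OF P])
 then interpret Q: ideal Q A .
 let ?f = "\<lambda>C. {a \<in> carrier A. h a \<in> C}"
 have co: "?f (P +>\<^bsub>B\<^esub> h a) = Q +>\<^bsub>A\<^esub> a" if a: "a \<in> carrier A" for a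
 proof -
  have "h a' \<in> P +>\<^bsub>B\<^esub> h a \<longleftrightarrow> a' \<in> Q +>\<^bsub>A\<^esub> a" if a': "a' \<in> carrier A" for a'
  proof -
   have "h a' \<in> P +>\<^bsub>B\<^esub> h a \<longleftrightarrow> h a' \<ominus>\<^bsub>B\<^esub> h a \<in> P" by (rule P.a_rcos_module_minus[OF B.ring_axioms]) (use a a' in auto)
   also have "h a' \<ominus>\<^bsub>B\<^esub> h a = h (a' \<ominus>\<^bsub>A\<^esub> a)" using a a' by (simp add: a_minus_def)
   also have "h (a' \<ominus>\<^bsub>A\<^esub> a) \<in> P \<longleftrightarrow> a' \<ominus>\<^bsub>A\<^esub> a \<in> Q" unfolding Q using a a' by simp
   also have "\<dots> \<longleftrightarrow> a' \<in> Q +>\<^bsub>A\<^esub> a" by (rule Q.a_rcos_module_minus[OF A.ring_axioms, symmetric]) (use a a' in auto)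
   finally show ?thesis .
  qed
  moreover have "Q +>\<^bsub>A\<^esub> a \<subseteq> carrier A" using A.a_r_coset_subset_G[OF Q.a_subset a] .
  ultimately show ?thesis by blast
 qed
 thus "a \<in> carrier A ==> ?f (P +>\<^bsub>B\<^esub> h a) = Q +>\<^bsub>A\<^esub> a" .
 show car: "carrier (B Quot P) = (\<lambda>a. P +>\<^bsub>B\<^esub> h a) ` carrier A"
 proof (intro equalityI subsetI)
  fix C assume "C \<in> carrier (B Quot P)"
  then obtain y where y: "y \<in> carrier B" "C = P +>\<^bsub>B\<^esub> y" unfolding FactRing_def A_RCOSETS_def' by auto
  obtain a p where ap: "a \<in> carrier A" "p \<in> P" "y = p \<oplus>\<^bsub>B\<^esub> h a" using surj[OF y(1)] by blast
  have "y \<in> P +>\<^bsub>B\<^esub> h a" unfolding a_r_coset_def' using ap(2,3) by blast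
  hence "P +>\<^bsub>B\<^esub> h a = P +>\<^bsub>B\<^esub> y" using B.a_repr_independence[OF _ _ P.a_subgroup] ap(1) by simp
  thus "C \<in> (\<lambda>a. P +>\<^bsub>B\<^esub> h a) ` carrier A" using y(2) ap(1) by blast
 next
  fix C assume "C \<in> (\<lambda>a. P +>\<^bsub>B\<^esub> h a) ` carrier A"
  thus "C \<in> carrier (B Quot P)" unfolding FactRing_def A_RCOSETS_def' by auto
 qed
 have carA: "carrier (A Quot Q) = (\<lambda>a. Q +>\<^bsub>A\<^esub> a) ` carrier A" unfolding FactRing_def A_RCOSETS_def' by auto
 show "?f \<in> ring_iso (B Quot P) (A Quot Q)"
 proof (rule ring_iso_memI)
  fix C assume "C \<in> carrier (B Quot P)"
  then obtain a where a: "a \<in> carrier A" "C = P +>\<^bsub>B\<^esub> h a" unfolding car by (rule imageE)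
  show "?f C \<in> carrier (A Quot Q)" unfolding a(2) co[OF a(1)] carA using a(1) by (rule imageI)
  fix C' assume "C' \<in> carrier (B Quot P)"
  then obtain b where b: "b \<in> carrier A" "C' = P +>\<^bsub>B\<^esub> h b" unfolding car by (rule imageE)
  have "C \<otimes>\<^bsub>B Quot P\<^esub> C' = P +>\<^bsub>B\<^esub> h (a \<otimes>\<^bsub>A\<^esub> b)" unfolding a(2) b(2) FactRing_def using P.rcoset_mult_add a(1) b(1) by simp
  hence "?f (C \<otimes>\<^bsub>B Quot P\<^esub> C') = Q +>\<^bsub>A\<^esub> (a \<otimes>\<^bsub>A\<^esub> b)" using co[of "a \<otimes>\<^bsub>A\<^esub> b"] a(1) b(1) by simp
  also have "\<dots> = ?f C \<otimes>\<^bsub>A Quot Q\<^esub> ?f C'" unfolding a(2) b(2) co[OF a(1)] co[OF b(1)] FactRing_def using Q.rcoset_mult_add a(1) b(1) by simp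
  finally show "?f (C \<otimes>\<^bsub>B Quot P\<^esub> C') = ?f C \<otimes>\<^bsub>A Quot Q\<^esub> ?f C'" .
  have "C \<oplus>\<^bsub>B Quot P\<^esub> C' = P +>\<^bsub>B\<^esub> h (a \<oplus>\<^bsub>A\<^esub> b)" unfolding a(2) b(2) FactRing_def using P.a_rcos_sum a(1) b(1) by simp
  hence "?f (C \<oplus>\<^bsub>B Quot P\<^esub> C') = Q +>\<^bsub>A\<^esub> (a \<oplus>\<^bsub>A\<^esub> b)" using co[of "a \<oplus>\<^bsub>A\<^esub> b"] a(1) b(1) by simp
  also have "\<dots> = ?f C \<oplus>\<^bsub>A Quot Q\<^esub> ?f C'" unfolding a(2) b(2) co[OF a(1)] co[OF b(1)] FactRing_def using Q.a_rcos_sum a(1) b(1) by simp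
  finally show "?f (C \<oplus>\<^bsub>B Quot P\<^esub> C') = ?f C \<oplus>\<^bsub>A Quot Q\<^esub> ?f C'" .
 next
  show "?f \<one>\<^bsub>B Quot P\<^esub> = \<one>\<^bsub>A Quot Q\<^esub>" using co[of "\<one>\<^bsub>A\<^esub>"] unfolding FactRing_def by simp
  show "bij_betw ?f (carrier (B Quot P)) (carrier (A Quot Q))" unfolding bij_betw_def
  proof
   show "inj_on ?f (carrier (B Quot P))"
   proof (rule inj_onI)
    fix C C' assume CC: "C \<in> carrier (B Quot P)" "C' \<in> carrier (B Quot P)" "?f C = ?f C'"
    obtain a where a: "a \<in> carrier A" "C = P +>\<^bsub>B\<^esub> h a" using CC(1) unfolding car by (rule imageE)
    obtain b where b: "b \<in> carrier A" "C' = P +>\<^bsub>B\<^esub> h b" using CC(2) unfolding car by (rule imageE)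
    have "h a \<in> C" unfolding a(2) by (rule P.a_rcos_self) (use a(1) in simp)
    hence "a \<in> ?f C'" using CC(3) a(1) by blast
    hence "h a \<in> P +>\<^bsub>B\<^esub> h b" using b(2) by simp
    hence "P +>\<^bsub>B\<^esub> h b = P +>\<^bsub>B\<^esub> h a" by (rule B.a_repr_independence) (use b(1) P.a_subgroup in auto)
    thus "C = C'" using a(2) b(2) by simp
   qed
   have "?f ` carrier (B Quot P) = (\<lambda>a. ?f (P +>\<^bsub>B\<^esub> h a)) ` carrier A" unfolding car by (rule image_image)
   also have "\<dots> = carrier (A Quot Q)" unfolding carA by (rule image_cong) (use co in auto)
   finally show "?f ` carrier (B Quot P) = carrier (A Quot Q)" .
  qed
 qed
qed

lemma ideal_prod_carrier_update: "ideal_prod (R |: A) I J = ideal_prod R I J"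
proof (intro equalityI subsetI)
 fix x assume "x \<in> ideal_prod (R |: A) I J"
 thus "x \<in> ideal_prod R I J" by (induct rule: ideal_prod.induct) (auto intro: ideal_prod.intros)
next
 fix x assume "x \<in> ideal_prod R I J"
 thus "x \<in> ideal_prod (R |: A) I J"
 proof (induct rule: ideal_prod.induct)
  case (prod i j)
  thus ?case using ideal_prod.prod[of i I j J "R |: A"] by simp
 next
  case (sum s t)
  thus ?case using ideal_prod.sum[of s "R |: A" I J t] by simp
 qed
qed

text \<open>The order of an ideal or a generating set at v, as a relation: the minimum of the values of its elements,
attained by a non-zero element.\<close>

definition (in cring) ord_at :: "('a => int) => 'a set => int => bool" where
 "ord_at v J k \<longleftrightarrow> (\<forall>x\<in>J. vge v x k) & (\<exists>x\<in>J. x ~= \<zero> & v x = k)"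

context dedekind
begin

context
 fixes M v assumes v: "place K D M v"
begin

lemma ord_at_prod:
 assumes IJ: "!!x. x \<in> I ==> x \<in> K" "!!x. x \<in> J ==> x \<in> K" and o: "ord_at v I k" "ord_at v J l"
 shows "x \<in> ideal_prod (R |: A) I J ==> x \<in> K"
  and "ord_at v (ideal_prod (R |: A) I J) (k + l)"
proof -
 have 1: "x \<in> K & vge v x (k + l)" if "x \<in> ideal_prod R I J" for x using that
 proof (induct rule: ideal_prod.induct)
  case (prod i j)
  thus ?case using IJ o vge_mult[OF v, of i j k l] unfolding ord_at_def by simp
 next
  case (sum s t)
  thus ?case using vge_add[OF v, of s t] by simp
 qed
 thus "x \<in> ideal_prod (R |: A) I J ==> x \<in> K" unfolding ideal_prod_carrier_update by simp
 obtain a where a: "a \<in> I" "a ~= \<zero>" "v a = k" using o(1) unfolding ord_at_def by blast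
 obtain b where b: "b \<in> J" "b ~= \<zero>" "v b = l" using o(2) unfolding ord_at_def by blast
 have "a\<otimes>b \<in> ideal_prod R I J" by (rule ideal_prod.prod[OF a(1) b(1)])
 moreover have "a\<otimes>b ~= \<zero>" using integral_iff[of a b] a b IJ by simp
 moreover have "v (a\<otimes>b) = k + l" using v_mult[OF v] a b IJ by simp
 ultimately show "ord_at v (ideal_prod (R |: A) I J) (k + l)" unfolding ideal_prod_carrier_update ord_at_def using 1 by blast
qed

lemma ord_at_pow:
 assumes J: "!!x. x \<in> J ==> x \<in> K" "ord_at v J k" and A: "!!x. x \<in> A ==> x \<in> K" "ord_at v A 0"
 shows "x \<in> J [^]\<^bsub>ideals_set (R |: A)\<^esub> (n::nat) ==> x \<in> K"
  and "ord_at v (J [^]\<^bsub>ideals_set (R |: A)\<^esub> n) (int n * k)"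
proof -
 let ?P = "\<lambda>n::nat. J [^]\<^bsub>ideals_set (R |: A)\<^esub> n"
 have "(\<forall>x\<in>?P n. x \<in> K) & ord_at v (?P n) (int n * k)"
 proof (induct n)
  case 0
  have "?P 0 = A" by (simp add: nat_pow_def ideals_set_def)
  thus ?case using A by simp
 next
  case (Suc n)
  have "?P (Suc n) = ideal_prod (R |: A) (?P n) J" by (simp add: nat_pow_def ideals_set_def)
  moreover have "int (Suc n) * k = int n * k + k" by (simp add: algebra_simps)
  ultimately show ?case using ord_at_prod[of "?P n" J "int n * k" k] Suc J by simp
 qed
 thus "x \<in> ?P n ==> x \<in> K" "ord_at v (?P n) (int n * k)" by auto
qed

lemma vge_ideal:
 assumes A: "subring A R" "!!x. x \<in> A ==> x \<in> K" "!!x. x \<in> A ==> vge v x 0"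
 shows "ideal {x \<in> A. vge v x k} (R |: A)"
proof -
 have "submod A {x \<in> A. vge v x k}" unfolding submod_def
 proof (intro conjI ballI)
  show "{x \<in> A. vge v x k} \<subseteq> carrier R" using A(2) by auto
  show "\<zero> \<in> {x \<in> A. vge v x k}" using subringE(2)[OF A(1)] vge_zero[OF v] by simp
  fix x y assume "x \<in> {x \<in> A. vge v x k}" "y \<in> {x \<in> A. vge v x k}"
  thus "x \<oplus> y \<in> {x \<in> A. vge v x k}" using subringE(7)[OF A(1)] vge_add[OF v] A(2) by simp
 next
  fix d x assume "d \<in> A" "x \<in> {x \<in> A. vge v x k}"
  thus "d\<otimes>x \<in> {x \<in> A. vge v x k}" using subringE(6)[OF A(1)] vge_mult[OF v, of d x 0 k] A(2,3) by simp
 qed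
 thus ?thesis using ideal_iff_submod[OF A(1)] by auto
qed

lemma ord_at_Idl:
 assumes A: "subring A R" "!!x. x \<in> A ==> x \<in> K" "!!x. x \<in> A ==> vge v x 0"
  and S: "S \<subseteq> A" "ord_at v S k"
 shows "ord_at v (Idl\<^bsub>R |: A\<^esub> S) k"
proof -
 interpret A: cring "R |: A" by (rule subring_cring[OF A(1)])
 have "Idl\<^bsub>R |: A\<^esub> S \<subseteq> {x \<in> A. vge v x k}" by (rule A.genideal_minimal[OF vge_ideal[OF A]]) (use S in \<open>auto simp: ord_at_def\<close>)
 moreover have "S \<subseteq> Idl\<^bsub>R |: A\<^esub> S" by (rule A.genideal_self) (simp add: S(1))
 ultimately show ?thesis using S(2) unfolding ord_at_def by blast
qed

lemma vge_subring: "subring {x \<in> K. vge v x 0} R"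
proof (rule subringI)
 show "{x \<in> K. vge v x 0} \<subseteq> carrier R" by auto
 show "\<one> \<in> {x \<in> K. vge v x 0}" using vge_D[OF v, of \<one>] by simp
 fix x assume x: "x \<in> {x \<in> K. vge v x 0}"
 thus "\<ominus> x \<in> {x \<in> K. vge v x 0}" using vge_minus[OF v] by simp
 fix y assume y: "y \<in> {x \<in> K. vge v x 0}"
 show "x\<otimes>y \<in> {x \<in> K. vge v x 0}" using vge_mult[OF v, of x y 0 0] x y by simp
 show "x \<oplus> y \<in> {x \<in> K. vge v x 0}" using vge_add[OF v] x y by simp
qed

text \<open>In a discrete valuation ring an element of least value generates.\<close>

lemma ideal_of_vge_ring:
 assumes J: "ideal J (R |: {x \<in> K. vge v x 0})" "ord_at v J k"
 shows "J = {x \<in> K. vge v x k}"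
proof -
 let ?V = "{x \<in> K. vge v x 0}"
 have sm: "submod ?V J" "J \<subseteq> ?V" using J(1) ideal_iff_submod[OF vge_subring] by auto
 obtain a where a: "a \<in> J" "a ~= \<zero>" "v a = k" using J(2) unfolding ord_at_def by blast
 have aK: "a \<in> K" using a(1) sm(2) by blast
 show ?thesis
 proof (intro equalityI subsetI)
  fix x assume "x \<in> J"
  thus "x \<in> {x \<in> K. vge v x k}" using sm(2) J(2) unfolding ord_at_def by blast
 next
  fix x assume x: "x \<in> {x \<in> K. vge v x k}"
  have "vge v (x\<otimes>inv a) (k + - k)" by (rule vge_mult[OF v]) (use x aK a v_inv[OF v aK a(2)] in \<open>auto simp: vge_def\<close>)
  hence "x\<otimes>inv a \<in> ?V" using x aK a(2) by simp
  hence "(x\<otimes>inv a)\<otimes>a \<in> J" by (rule submodD(5)[OF sm(1) _ a(1)])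
  moreover have "(x\<otimes>inv a)\<otimes>a = x" using x aK a(2) cinv by (simp add: m_assoc)
  ultimately show "x \<in> J" by simp
 qed
qed

lemma ord_at_vge_ring:
 shows "ord_at v {x \<in> K. vge v x 0} 0" "ord_at v {x \<in> K. vge v x 1} 1" "ord_at v D 0"
proof -
 obtain t where t: "t \<in> D" "t ~= \<zero>" "v t = 1" using v_uniformizer[OF v] by blast
 show "ord_at v {x \<in> K. vge v x 1} 1" unfolding ord_at_def using t D_K[OF t(1)] by (auto simp: vge_def intro!: exI[of _ t])
 show "ord_at v {x \<in> K. vge v x 0} 0" "ord_at v D 0" unfolding ord_at_def
  using v_one[OF v] vge_D[OF v] by (auto simp: vge_def intro!: exI[of _ \<one>] bexI[of _ \<one>])
qed

end

lemma ord_at_finprod: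
 assumes v: "place K D M v" and "finite A" and f: "!!i. i \<in> A ==> ideal (f i) (R |: D)"
  and o: "!!i. i \<in> A ==> ord_at v (f i) (k i)"
 shows "ord_at v (finprod (ideals_set (R |: D)) f A) (\<Sum>i\<in>A. k i)"
proof -
 interpret RD: cring "R |: D" by (rule subring_cring[OF D])
 interpret IS: comm_monoid "ideals_set (R |: D)" by (rule RD.ideals_set_is_comm_monoid)
 have car: "carrier (ideals_set (R |: D)) = {J. ideal J (R |: D)}" by (simp add: ideals_set_def)
 show ?thesis using assms(2) f o
 proof (induct A rule: finite_induct)
  case empty
  have "finprod (ideals_set (R |: D)) f {} = D" using IS.finprod_empty[of f] by (simp add: ideals_set_def)
  thus ?case using ord_at_vge_ring(3)[OF v] by simp
 next
  case (insert i A)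
  have fc: "f \<in> A \<rightarrow> carrier (ideals_set (R |: D))" "f i \<in> carrier (ideals_set (R |: D))" using insert(4) unfolding car by auto
  let ?Q = "finprod (ideals_set (R |: D)) f A"
  have eq: "finprod (ideals_set (R |: D)) f (insert i A) = ideal_prod (R |: D) (f i) ?Q"
   using IS.finprod_insert[OF insert(1,2) fc] by (simp add: ideals_set_def)
  have "ideal ?Q (R |: D)" using IS.finprod_closed[OF fc(1)] unfolding car by simp
  hence QK: "x \<in> ?Q ==> x \<in> K" for x using ideal_iff_submod[OF D] D_K by blast
  have fK: "x \<in> f i ==> x \<in> K" for x using insert(4)[of i] ideal_iff_submod[OF D] D_K by blast
  have oi: "ord_at v (f i) (k i)" and oQ: "ord_at v ?Q (\<Sum>i\<in>A. k i)" using insert by auto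
  show ?case unfolding eq using ord_at_prod(2)[OF v fK QK oi oQ] insert(1,2) by simp
 qed
qed

lemma ord_at_maximal:
 assumes M: "mxn M" and P: "mxn P" and v: "place K D P v"
 shows "ord_at v M (if P = M then 1 else 0)"
proof -
 have mP: "mx D P" and mM: "mx D M" using P M by auto
 show ?thesis
 proof (cases "P = M")
  case True
  obtain t where t: "t \<in> D" "t ~= \<zero>" "v t = 1" using v_uniformizer[OF v] by blast
  have "t \<in> P" using M_vge[OF v mP t(1)] t(3) by (simp add: vge_def)
  moreover have "vge (v) x 1" if "x \<in> P" for x using M_vge[OF v mP M_D[OF mP that]] that by simp
  ultimately show ?thesis using True t unfolding ord_at_def by auto
 next
  case False
  then obtain x where x: "x \<in> M" "x \<notin> P" using mx_incl_eq[OF mM mP] by blast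
  have "x ~= \<zero>" using x(2) M_closed(1)[OF mP] by auto
  moreover have "v x = 0" by (rule v_unit[OF v M_D[OF mM x(1)] \<open>x ~= \<zero>\<close> x(2)])
  moreover have "vge (v) x 0" if "x \<in> M" for x using vge_D[OF v M_D[OF mM that]] .
  ultimately show ?thesis using x(1) False unfolding ord_at_def by auto
 qed
qed

text \<open>At each prime some element of J has no larger value than a given element of \<open>I\<close>; apply
\<open>local_global\<close>, and exchange \<open>I\<close> and J.\<close>

lemma ideal_eq_of_ord:
 assumes I: "ideal I (R |: D)" "I ~= {\<zero>}" and J: "ideal J (R |: D)" "J ~= {\<zero>}"
  and o: "!!P. mxn P ==> ord_at (vl P) I (k P)" "!!P. mxn P ==> ord_at (vl P) J (k P)"
 shows "I = J"
proof -
 have *: "x \<in> J" if J: "ideal J (R |: D)" "J ~= {\<zero>}" and I: "ideal I (R |: D)" and x: "x \<in> I"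
  and o: "!!P. mxn P ==> ord_at (vl P) I (k P)" "!!P. mxn P ==> ord_at (vl P) J (k P)" for x I J
 proof (cases "x = \<zero>")
  case True
  thus ?thesis using J(1) ideal_iff_submod[OF D] submodD(3) by blast
 next
  case False
  have sJ: "submod D J" "!!x. x \<in> J ==> x \<in> D" using J(1) ideal_iff_submod[OF D] by auto
  have xD: "x \<in> D" using I x ideal_iff_submod[OF D] by blast
  show ?thesis
  proof (rule local_global[OF sJ J(2) D_K[OF xD] False])
   fix P assume P: "mxn P"
   obtain b where b: "b \<in> J" "b ~= \<zero>" "vl P b = k P" using o(2)[OF P] unfolding ord_at_def by blast
   have "k P \<le> vl P x" using o(1)[OF P] x False unfolding ord_at_def vge_def by blast
   thus "\<exists>b\<in>J. b ~= \<zero> & vl P b \<le> vl P x" using b by auto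
  qed
 qed
 show ?thesis using *[OF J I(1) _ o] *[OF I J(1) _ o(2,1)] by blast
qed

end

text \<open>Plain ring records, the type for which localizations and residue fields are declared.\<close>

locale dedekind_std = dedekind R K D for R :: "'a ring" (structure) and K D
begin

lemma nonunits_vge_ring:
 assumes v: "place K D M v" shows "nonunits (R |: {x \<in> K. vge v x 0}) = {x \<in> K. vge v x 1}"
proof -
 let ?V = "{x \<in> K. vge v x 0}"
 have "x \<in> Units (R |: ?V) \<longleftrightarrow> \<not> vge v x 1" if x: "x \<in> K" "vge v x 0" for x
 proof
  assume "x \<in> Units (R |: ?V)"
  then obtain y where y: "y \<in> K" "vge v y 0" "x\<otimes>y = \<one>" unfolding Units_def by auto
  have nz: "x ~= \<zero>" "y ~= \<zero>" using y x(1) by auto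
  have "v x + v y = 0" using v_mult[OF v x(1) nz(1) y(1) nz(2)] y(3) v_one[OF v] by simp
  thus "\<not> vge v x 1" using x(2) y(2) nz unfolding vge_def by auto
 next
  assume nv: "\<not> vge v x 1"
  hence nz: "x ~= \<zero>" "v x = 0" using x(2) unfolding vge_def by auto
  have "inv x \<in> ?V" using nz v_inv[OF v x(1) nz(1)] x(1) by (simp add: vge_def)
  moreover have "x\<otimes>inv x = \<one>" "inv x\<otimes>x = \<one>" using cinv x(1) nz(1) by auto
  ultimately show "x \<in> Units (R |: ?V)" unfolding Units_def using x by auto
 qed
 moreover have "vge v x 1 ==> vge v x 0" for x unfolding vge_def by auto
 ultimately show ?thesis unfolding nonunits_def by auto
qed

lemma localization_eq:
 assumes M: "mxn M"
 shows "localization R D M = {x \<in> K. vge (vl M) x 0}"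
proof -
 note v = place_vl[OF M]
 have mM: "mx D M" using M by simp
 show ?thesis
 proof (intro equalityI subsetI)
  fix x assume "x \<in> localization R D M"
  then obtain a s where as: "x = a\<otimes>inv s" "a \<in> D" "s \<in> D" "s \<notin> M" unfolding localization_def by blast
  have s0: "s ~= \<zero>" using as(4) M_closed(1)[OF mM] by auto
  have si: "inv s \<in> K" "vl M (inv s) = 0" using as(3) s0 D_K v_inv[OF v D_K[OF as(3)] s0] v_unit[OF v as(3) s0 as(4)] by auto
  have "vge (vl M) (inv s) 0" using si(2) by (simp add: vge_def)
  hence "vge (vl M) (a\<otimes>inv s) (0 + 0)" by (rule vge_mult[OF v D_K[OF as(2)] si(1) vge_D[OF v as(2)]])
  thus "x \<in> {x \<in> K. vge (vl M) x 0}" using as(1,2) si(1) D_K by simp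
 next
  fix x assume x: "x \<in> {x \<in> K. vge (vl M) x 0}"
  have "\<exists>s\<in>D - M. s\<otimes>x \<in> D"
  proof (cases "x = \<zero>")
   case True
   thus ?thesis using M_one[OF mM] by (intro bexI[of _ \<one>]) auto
  next
   case False
   thus ?thesis using v_loc[OF v] x unfolding vge_def by auto
  qed
  then obtain s where s: "s \<in> D" "s \<notin> M" "s\<otimes>x \<in> D" by blast
  have s0: "s ~= \<zero>" using s(2) M_closed(1)[OF mM] by auto
  have c: "s \<in> carrier R" "x \<in> carrier R" "inv s \<in> carrier R" "s\<otimes>inv s = \<one>" using s x s0 cinv by auto
  have "(s\<otimes>x)\<otimes>inv s = x\<otimes>(s\<otimes>inv s)" using c(1-3) by (simp add: m_ac)
  also have "\<dots> = x" using c by simp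
  finally have "x = (s\<otimes>x)\<otimes>inv s" by simp
  thus "x \<in> localization R D M" unfolding localization_def using s by blast
 qed
qed

lemma localization_dvr:
 assumes M: "mxn M" and KC: "K = carrier R"
 shows "dvr R (localization R D M)"
proof -
 note v = place_vl[OF M]
 obtain t where t: "t \<in> D" "t ~= \<zero>" "vl M t = 1" using v_uniformizer[OF v] by blast
 have "k \<in> vl M ` (carrier R - {\<zero>})" for k
 proof (cases "0 \<le> k")
  case True
  have "vl M (t [^] nat k) = k" using v_pow[OF v D_K[OF t(1)] t(2), of "nat k"] t(3) True by simp
  thus ?thesis using t by (intro image_eqI[of _ _ "t [^] nat k"]) auto
 next
  case False
  have tk: "t [^] nat (- k) \<in> K" "t [^] nat (- k) ~= \<zero>" using t D_K by auto
  have "vl M (inv (t [^] nat (- k))) = k" using v_inv[OF v tk] v_pow[OF v D_K[OF t(1)] t(2), of "nat (- k)"] t(3) False by simp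
  moreover have "inv (t [^] nat (- k)) ~= \<zero>" using cinv(2)[of "t [^] nat (- k)"] tk by (metis K_carr one_not_zero r_null)
  ultimately show ?thesis using tk KC by (intro image_eqI[of _ _ "inv (t [^] nat (- k))"]) auto
 qed
 hence "discrete_valuation R (vl M)" unfolding discrete_valuation_def using v_mult[OF v] v_add[OF v] KC by auto
 moreover have "localization R D M = {x \<in> carrier R. x = \<zero> \<or> 0 \<le> vl M x}" unfolding localization_eq[OF M] vge_def KC ..
 ultimately show ?thesis unfolding dvr_def using field_axioms by blast
qed

lemma nonunits_localization:
 assumes M: "mxn M" shows "nonunits (R |: localization R D M) = {x \<in> K. vge (vl M) x 1}"
 unfolding localization_eq[OF M] by (rule nonunits_vge_ring[OF place_vl[OF M]])

lemma nonunits_localization_inter: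
 assumes M: "mxn M" shows "nonunits (R |: localization R D M) \<inter> D = M" unfolding nonunits_localization[OF M]
 using M_vge[OF place_vl[OF M]] M M_D[of M] D_K by blast

lemma nonunits_localization_ideal:
 assumes M: "mxn M" shows "ideal (nonunits (R |: localization R D M)) (R |: localization R D M)"
proof -
 note v = place_vl[OF M]
 have "ideal {x \<in> {x \<in> K. vge (vl M) x 0}. vge (vl M) x 1} (R |: {x \<in> K. vge (vl M) x 0})"
  by (rule vge_ideal[OF v vge_subring[OF v]]) auto
 moreover have "{x \<in> {x \<in> K. vge (vl M) x 0}. vge (vl M) x 1} = {x \<in> K. vge (vl M) x 1}" by (auto simp: vge_def)
 ultimately show ?thesis using nonunits_localization[OF M] unfolding localization_eq[OF M] by simp
qed

end

section \<open>Residue fields of localizations and extensions of valuation rings\<close>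

lemma nonunits_maximal:
 assumes "cring S" "ideal (nonunits S) S"
 shows "maximalideal (nonunits S) S"
proof (rule maximalidealI[OF assms(2)])
 interpret S: cring S by (rule assms(1))
 show "carrier S ~= nonunits S" using S.Units_one_closed unfolding nonunits_def by blast
 fix J assume J: "ideal J S" "nonunits S \<subseteq> J" "J \<subseteq> carrier S"
 show "J = nonunits S \<or> J = carrier S"
 proof (cases "J \<subseteq> nonunits S")
  case True thus ?thesis using J(2) by auto
 next
  case False
  then obtain x where x: "x \<in> J" "x \<in> Units S" using J(3) unfolding nonunits_def by blast
  have "inv\<^bsub>S\<^esub> x \<otimes>\<^bsub>S\<^esub> x \<in> J" using ideal.I_l_closed[OF J(1) x(1)] S.Units_inv_closed[OF x(2)] by simp
  hence "\<one>\<^bsub>S\<^esub> \<in> J" using S.Units_l_inv[OF x(2)] by simp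
  thus ?thesis using ideal.one_imp_carrier[OF J(1)] by simp
 qed
qed

lemma degree_one_extension:
 assumes k: "field k" and \<iota>: "\<iota> \<in> ring_iso k k'" and k': "field k'"
 shows "simple_algebraic_field_extension k k' \<iota>" and "extension_degree k k' \<iota> 1"
proof -
 interpret k': field k' by (rule k')
 have hom: "\<iota> \<in> ring_hom k k'" and im: "\<iota> ` carrier k = carrier k'" using \<iota> unfolding ring_iso_def bij_betw_def by auto
 have "ring.algebraic k' (carrier k') \<one>\<^bsub>k'\<^esub>" using k'.algebraic_self[OF k'.carrier_is_subring k'.one_closed] unfolding over_def .
 moreover have "carrier k' = generate_field k' (insert \<one>\<^bsub>k'\<^esub> (carrier k'))"
  using k'.generate_field_incl[of "insert \<one>\<^bsub>k'\<^esub> (carrier k')"] generate_field.incl[of _ "insert \<one>\<^bsub>k'\<^esub> (carrier k')" k'] by auto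
 ultimately show "simple_algebraic_field_extension k k' \<iota>"
  unfolding simple_algebraic_field_extension_def im using k k' hom by (intro conjI bexI[of _ "\<one>\<^bsub>k'\<^esub>"]) auto
 show "extension_degree k k' \<iota> 1" unfolding extension_degree_def im by (rule k'.dimension_one[OF k'.carrier_is_subfield])
qed

context dedekind_std
begin

text \<open>Every element of D_M is congruent to an element of D, so D maps onto the residue field of D_M, with kernel M.\<close>

lemma residue_identification:
 assumes M: "mxn M"
 shows "(\<lambda>C. C \<inter> D) \<in> ring_iso (residue_field (R |: localization R D M)) (R |: D Quot M)"
  and "field (residue_field (R |: localization R D M))" and "field (R |: D Quot M)"
proof -
 note v = place_vl[OF M]
 let ?V = "localization R D M"
 let ?P = "nonunits (R |: ?V)"
 have sV: "subring ?V R" unfolding localization_eq[OF M] by (rule vge_subring[OF v])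
 have cV: "cring (R |: ?V)" by (rule subring_cring[OF sV])
 have cD: "cring (R |: D)" by (rule subring_cring[OF D])
 have DV: "x \<in> ?V" if "x \<in> D" for x unfolding localization_eq[OF M] using vge_D[OF v that] D_K[OF that] by simp
 note Pi = nonunits_localization_ideal[OF M]
 have id: "id \<in> ring_hom (R |: D) (R |: ?V)" by (rule ring_hom_memI) (auto simp: DV)
 have surj: "\<exists>a\<in>carrier (R |: D). \<exists>p\<in>?P. y = p \<oplus>\<^bsub>R |: ?V\<^esub> id a" if y: "y \<in> carrier (R |: ?V)" for y
 proof -
  have y': "y \<in> K" "vge (vl M) y 0" using y unfolding localization_eq[OF M] by auto
  have mM: "mx D M" using M by simp
  obtain d where d: "d \<in> D" "vge (vl M) (y \<ominus> d) 1" using residue_representative[OF mM v y'] by blast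
  have "y \<ominus> d \<in> ?P" unfolding nonunits_localization[OF M] using d y' D_K by simp
  moreover have "y = (y \<ominus> d) \<oplus> d"
  proof -
   have "y \<in> carrier R" "d \<in> carrier R" using y' d by auto
   thus ?thesis by algebra
  qed
  ultimately show ?thesis using d(1) by auto
 qed
 have Q: "M = {a \<in> carrier (R |: D). id a \<in> ?P}" using nonunits_localization_inter[OF M] by auto
 have "(\<lambda>C. {a \<in> carrier (R |: D). id a \<in> C}) \<in> ring_iso ((R |: ?V) Quot ?P) (R |: D Quot M)"
  by (rule quotient_iso_of_surjective(1)[OF cD cV id Pi surj Q])
 moreover have "(\<lambda>C. {a \<in> carrier (R |: D). id a \<in> C}) = (\<lambda>C. C \<inter> D)" by auto
 ultimately show "(\<lambda>C. C \<inter> D) \<in> ring_iso (residue_field (R |: ?V)) (R |: D Quot M)" unfolding residue_field_def by simp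
 show "field (residue_field (R |: ?V))" unfolding residue_field_def
  by (rule maximalideal.quotient_is_field[OF nonunits_maximal[OF cV Pi] cV])
 show "field (R |: D Quot M)" by (rule maximalideal.quotient_is_field[OF _ cD]) (use M maximalideal_iff_mx[OF D] in simp)
qed

end

context cring
begin

lemma pow_cancel:
 fixes i k :: nat
 assumes y: "y \<in> carrier R" and z: "z \<in> carrier R" and yz: "y\<otimes>z = \<one>" and ik: "i \<le> k"
 shows "y [^] i\<otimes>z [^] k = z [^] (k - i)"
proof -
 have "z [^] k = z [^] i\<otimes>z [^] (k - i)" using nat_pow_mult[OF z, of i "k - i"] ik by simp
 hence "y [^] i\<otimes>z [^] k = (y [^] i\<otimes>z [^] i)\<otimes>z [^] (k - i)" using y z by (simp add: m_assoc)
 also have "y [^] i\<otimes>z [^] i = \<one>" using nat_pow_distrib[OF y z, of i] yz by simp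
 finally show ?thesis using z by simp
qed

lemma eval_times_pow:
 assumes W: "subring W R" and y: "y \<in> carrier R" and z: "z \<in> W" and yz: "y\<otimes>z = \<one>"
 shows "set p \<subseteq> W ==> length p \<le> Suc k ==> eval p y\<otimes>z [^] k \<in> W"
proof (induct p)
 note s = subringE[OF W]
 have zc: "z \<in> carrier R" using z s(1) by auto
 case Nil show ?case using s(2) zc by simp
next
 note s = subringE[OF W]
 have zc: "z \<in> carrier R" using z s(1) by auto
 have zp: "z [^] i \<in> W" for i :: nat by (induct i) (use s z in auto)
 case (Cons a p)
 have a: "a \<in> W" "a \<in> carrier R" and pc: "set p \<subseteq> carrier R" using Cons(2) s(1) by auto
 have e: "eval p y \<in> carrier R" by (rule eval_in_carrier[OF pc y])
 have "eval (a # p) y\<otimes>z [^] k = a\<otimes>(y [^] length p\<otimes>z [^] k) \<oplus> eval p y\<otimes>z [^] k" using a y zc e by (simp add: l_distr m_assoc)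
 also have "y [^] length p\<otimes>z [^] k = z [^] (k - length p)" by (rule pow_cancel[OF y zc yz]) (use Cons(3) in simp)
 finally show ?case using s(6)[OF a(1) zp] Cons s(7) by simp
qed

end

text \<open>If y \<notin> W, then 1/y \<in> W; dividing a monic relation for y of degree k + 1 by y^k expresses y through
elements of W.\<close>

lemma (in field) valuation_ring_integrally_closed:
 assumes W: "subring W R" "!!x. x \<in> carrier R ==> x ~= \<zero> ==> x \<in> W \<or> inv x \<in> W"
  and y: "y \<in> carrier R" and p: "set p \<subseteq> W" "eval (\<one> # p) y = \<zero>"
 shows "y \<in> W"
proof (rule ccontr)
 assume nW: "y \<notin> W"
 note s = subringE[OF W(1)]
 have y0: "y ~= \<zero>" using nW s(2) by auto
 have z: "inv y \<in> W" using W(2)[OF y y0] nW by simp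
 have zc: "inv y \<in> carrier R" using z s(1) by auto
 have yz: "y\<otimes>inv y = \<one>" using y y0 field_Units by simp
 have pc: "set p \<subseteq> carrier R" using p(1) s(1) by auto
 note e = eval_in_carrier[OF pc y]
 have ev: "y [^] length p \<oplus> eval p y = \<zero>" using p(2) y by simp
 have "p ~= []" using ev by auto
 then obtain k where k: "length p = Suc k" by (cases p) auto
 have "eval p y\<otimes>inv y [^] k \<in> W" by (rule eval_times_pow[OF W(1) y z yz p(1)]) (simp add: k)
 moreover have "y = \<ominus> (eval p y\<otimes>inv y [^] k)"
 proof -
  have "y [^] Suc k\<otimes>inv y [^] k = (y [^] k\<otimes>inv y [^] k)\<otimes>y" using y zc by (simp add: m_ac)
  hence "y [^] Suc k\<otimes>inv y [^] k = y" using pow_cancel[OF y zc yz, of k k] y by simp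
  hence "y \<oplus> eval p y\<otimes>inv y [^] k = (y [^] length p \<oplus> eval p y)\<otimes>inv y [^] k"
   using k y zc e l_distr[of "y [^] Suc k" "eval p y" "inv y [^] k"] by (simp del: nat_pow_Suc)
  hence "y \<oplus> eval p y\<otimes>inv y [^] k = \<zero>" using ev zc by simp
  thus ?thesis using minus_equality[of y "eval p y\<otimes>inv y [^] k"] y e zc by simp
 qed
 ultimately have "y \<in> W" using s(5) by metis
 thus False using nW by simp
qed

context field
begin

lemma field_inv: "x \<in> carrier R ==> x ~= \<zero> ==> inv x \<in> carrier R"
 "x \<in> carrier R ==> x ~= \<zero> ==> x\<otimes>inv x = \<one>" using field_Units by simp_all

lemma field_inv_mult:
 assumes x: "x \<in> carrier R" and y: "y \<in> carrier R" and nz: "x ~= \<zero>" "y ~= \<zero>"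
 shows "inv (x\<otimes>y) = inv x\<otimes>inv y"
proof -
 note ix = field_inv[OF x nz(1)] and iy = field_inv[OF y nz(2)]
 have "(x\<otimes>y)\<otimes>(inv x\<otimes>inv y) = (x\<otimes>inv x)\<otimes>(y\<otimes>inv y)" using x y ix(1) iy(1) by (simp add: m_ac del: ix(2) iy(2))
 hence "(x\<otimes>y)\<otimes>(inv x\<otimes>inv y) = \<one>" unfolding ix(2) iy(2) by simp
 thus ?thesis by (rule comm_inv_char[OF m_closed[OF x y] m_closed[OF ix(1) iy(1)]])
qed

context
 fixes W assumes W: "subring W R"
begin

lemma valuation_ring_nonunits_mult:
 assumes w: "w \<in> W" and x: "x \<in> carrier R" "x = \<zero> \<or> inv x \<notin> W"
 shows "w\<otimes>x = \<zero> \<or> inv (w\<otimes>x) \<notin> W"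
proof (rule ccontr)
 assume "\<not> (w\<otimes>x = \<zero> \<or> inv (w\<otimes>x) \<notin> W)"
 hence n: "w\<otimes>x ~= \<zero>" "inv (w\<otimes>x) \<in> W" by auto
 have wc: "w \<in> carrier R" using w subringE(1)[OF W] by auto
 have nz: "w ~= \<zero>" "x ~= \<zero>" using n(1) wc x(1) by auto
 note iw = field_inv[OF wc nz(1)] and ix = field_inv[OF x(1) nz(2)]
 have "w\<otimes>inv (w\<otimes>x) = (w\<otimes>inv w)\<otimes>inv x" unfolding field_inv_mult[OF wc x(1) nz] by (rule m_assoc[OF wc iw(1) ix(1), symmetric])
 also have "\<dots> = inv x" unfolding iw(2) using ix(1) by simp
 finally have "inv x \<in> W" using subringE(6)[OF W w n(2)] by simp
 thus False using x(2) nz by simp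
qed

lemma valuation_ring_nonunits_add:
 assumes Wv: "!!x. x \<in> carrier R ==> x ~= \<zero> ==> x \<in> W \<or> inv x \<in> W"
  and x: "x \<in> carrier R" and y: "y \<in> carrier R" and mx: "x = \<zero> \<or> inv x \<notin> W" and my: "y = \<zero> \<or> inv y \<notin> W"
 shows "x \<oplus> y = \<zero> \<or> inv (x \<oplus> y) \<notin> W"
proof -
 \<comment> \<open>\<open>x + y = (1 + x/y) y\<close>, and the factor lies in \<open>W\<close> after possibly exchanging \<open>x\<close> and \<open>y\<close>.\<close>
 have half: "a \<oplus> b = \<zero> \<or> inv (a \<oplus> b) \<notin> W"
  if a: "a \<in> carrier R" and b: "b \<in> carrier R" "b ~= \<zero>" "inv b \<notin> W" and q: "a\<otimes>inv b \<in> W" for a b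
 proof -
  note ib = field_inv[OF b(1,2)]
  have "(a\<otimes>inv b \<oplus> \<one>)\<otimes>b = a\<otimes>(b\<otimes>inv b) \<oplus> b"
   using l_distr[OF m_closed[OF a ib(1)] one_closed b(1)] m_assoc[OF a ib(1) b(1)] m_comm[OF ib(1) b(1)] b(1) by simp
  hence "(a\<otimes>inv b \<oplus> \<one>)\<otimes>b = a \<oplus> b" unfolding ib(2) using a by simp
  moreover have "a\<otimes>inv b \<oplus> \<one> \<in> W" using subringE(7)[OF W q subringE(3)[OF W]] .
  ultimately show ?thesis using valuation_ring_nonunits_mult[of "a\<otimes>inv b \<oplus> \<one>" b] b by simp
 qed
 show ?thesis
 proof (cases "x = \<zero> \<or> y = \<zero>")
  case True thus ?thesis using x y mx my by auto
 next
  case False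
  hence nz: "x ~= \<zero>" "y ~= \<zero>" by auto
  note ix = field_inv[OF x nz(1)] and iy = field_inv[OF y nz(2)]
  have iynz: "inv y ~= \<zero>"
  proof
   assume "inv y = \<zero>"
   thus False using iy(2) y by simp
  qed
  have "inv (inv y) = y" by (rule comm_inv_char[OF iy(1) y]) (use iy y in \<open>simp add: m_comm\<close>)
  hence "inv (x\<otimes>inv y) = y\<otimes>inv x" using field_inv_mult[OF x iy(1) nz(1) iynz] ix(1) y by (simp add: m_comm)
  moreover have "x\<otimes>inv y ~= \<zero>" using integral_iff[OF x iy(1)] nz(1) iynz by simp
  ultimately have "x\<otimes>inv y \<in> W \<or> y\<otimes>inv x \<in> W" using Wv[OF m_closed[OF x iy(1)]] by simp
  thus ?thesis
  proof
   assume "x\<otimes>inv y \<in> W"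
   thus ?thesis using half[OF x y nz(2)] my nz(2) by simp
  next
   assume "y\<otimes>inv x \<in> W"
   hence "y \<oplus> x = \<zero> \<or> inv (y \<oplus> x) \<notin> W" using half[OF y x nz(1)] mx nz(1) by simp
   thus ?thesis unfolding a_comm[OF x y] .
  qed
 qed
qed

end

end

text \<open>The case in which the extension field is the whole ambient field.\<close>

locale ext_std = dedekind_ext R K D "carrier R" E for R :: "'a ring" (structure) and K D E

sublocale ext_std \<subseteq> dedekind_std R K D ..
sublocale ext_std \<subseteq> ES: dedekind_std R "carrier R" E ..

context ext_std
begin

lemma above_ramification:
 assumes M: "mxn M" and N: "N \<in> above M"
 shows "\<exists>r>0. \<forall>x\<in>K. x ~= \<zero> --> E.vl N x = r * vl M x"
proof -
 have N': "E.mxn N" "N \<inter> D = M" using N unfolding above_def by auto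
 have mM: "mx D M" using M by simp
 show ?thesis by (rule ramification[OF mM place_vl[OF M] E.place_vl[OF N'(1)] N'(2)])
qed

lemma localization_above_valuation_ring:
 assumes M: "mxn M" and N: "N \<in> above M"
 shows "valuation_ring R (localization R E N)" "localization R E N \<inter> K = localization R D M"
proof -
 have N': "E.mxn N" using N unfolding above_def by auto
 note w = E.place_vl[OF N']
 show "valuation_ring R (localization R E N)" unfolding valuation_ring_def ES.localization_eq[OF N']
 proof (intro conjI ballI)
  show "field R" by (rule field_axioms)
  show "subring {x \<in> carrier R. vge (E.vl N) x 0} R" by (rule E.vge_subring[OF w])
  fix x assume x: "x \<in> carrier R - {\<zero>}"
  thus "x \<in> {x \<in> carrier R. vge (E.vl N) x 0} \<or> inv x \<in> {x \<in> carrier R. vge (E.vl N) x 0}"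
   using E.v_inv[OF w, of x] cinv(1)[of x] unfolding vge_def by auto
 qed
 obtain r where r: "r > 0" "!!x. x \<in> K ==> x ~= \<zero> ==> E.vl N x = r * vl M x" using above_ramification[OF M N] by blast
 have "vge (E.vl N) x 0 \<longleftrightarrow> vge (vl M) x 0" if "x \<in> K" for x
  using r that unfolding vge_def by (cases "x = \<zero>") (auto simp: zero_le_mult_iff)
 thus "localization R E N \<inter> K = localization R D M" unfolding ES.localization_eq[OF N'] localization_eq[OF M] by auto
qed

text \<open>W contains E, being integrally closed. Its non-units meet E in a prime N above M, and E_N \<subseteq> W. If y
\<in> W were not in the discrete valuation ring E_N, it would have negative value; then a uniformizer t of N
would be invertible in W, although t \<in> N.\<close>

lemma valuation_ring_is_localization:
 assumes M: "mxn M" and W: "valuation_ring R W" and WK: "W \<inter> K = localization R D M"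
 shows "\<exists>N\<in>above M. W = localization R E N"
proof -
 note v = place_vl[OF M]
 have mM: "mx D M" using M by simp
 have sW: "subring W R" and Wv: "!!x. x \<in> carrier R ==> x ~= \<zero> ==> x \<in> W \<or> inv x \<in> W" using W unfolding valuation_ring_def by auto
 note s = subringE[OF sW]
 have WC: "x \<in> carrier R" if "x \<in> W" for x using s(1) that by auto
 have WKv: "x \<in> W \<longleftrightarrow> vge (vl M) x 0" if "x \<in> K" for x using WK that unfolding localization_eq[OF M] by auto
 have DW: "x \<in> W" if "x \<in> D" for x using WKv[OF D_K[OF that]] vge_D[OF v that] by simp
 have EW: "y \<in> W" if y: "y \<in> E" for y
 proof -
  obtain p where p: "set p \<subseteq> D" "eval (\<one> # p) y = \<zero>" using intg_imp_monic[OF D noeth E_intg[OF y]] by blast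
  have "set p \<subseteq> W" using p(1) DW by auto
  thus ?thesis using valuation_ring_integrally_closed[OF sW _ _ _ p(2)] Wv y by simp
 qed
 \<comment> \<open>For x \<in> W this says that x is not a unit of W.\<close>
 define m where "m x \<longleftrightarrow> x = \<zero> \<or> inv x \<notin> W" for x
 have madd: "m (x \<oplus> y)" if "x \<in> carrier R" "m x" "y \<in> carrier R" "m y" for x y
  using valuation_ring_nonunits_add[OF sW _ that(1,3)] Wv that(2,4) unfolding m_def by simp
 have mmult: "m (w\<otimes>x)" if "w \<in> W" "x \<in> carrier R" "m x" for w x
  using valuation_ring_nonunits_mult[OF sW that(1,2)] that(3) unfolding m_def by simp
 define N where "N = {x \<in> E. m x}"
 have "pri E N" unfolding pri_def
 proof (intro conjI ballI impI)
  show "submod E N" unfolding submod_def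
  proof (intro conjI ballI)
   show "N \<subseteq> carrier R" unfolding N_def by auto
   show "\<zero> \<in> N" unfolding N_def m_def by simp
   fix x y assume "x \<in> N" "y \<in> N"
   thus "x \<oplus> y \<in> N" using madd unfolding N_def by simp
  next
   fix d x assume "d \<in> E" "x \<in> N"
   thus "d\<otimes>x \<in> N" using mmult EW unfolding N_def by simp
  qed
  show "N \<subseteq> E" unfolding N_def by auto
  show "\<one> \<notin> N" unfolding N_def m_def using s(3) by simp
  fix x y assume xy: "x \<in> E" "y \<in> E" "x\<otimes>y \<in> N"
  show "x \<in> N \<or> y \<in> N"
  proof (rule ccontr)
   assume "\<not> (x \<in> N \<or> y \<in> N)"
   hence nz: "x ~= \<zero>" "y ~= \<zero>" and iW: "inv x \<in> W" "inv y \<in> W" using xy(1,2) unfolding N_def m_def by auto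
   have c: "x \<in> carrier R" "y \<in> carrier R" using xy by auto
   have "inv (x\<otimes>y) = inv x\<otimes>inv y" by (rule field_inv_mult[OF c nz])
   hence "inv (x\<otimes>y) \<in> W" using s(6)[OF iW] by simp
   moreover have "x\<otimes>y ~= \<zero>" using integral_iff[OF c] nz by simp
   ultimately show False using xy(3) unfolding N_def m_def by simp
  qed
 qed
 have MN: "x \<in> N \<longleftrightarrow> x \<in> M" if x: "x \<in> D" for x
 proof (cases "x = \<zero>")
  case True thus ?thesis using M_closed(1)[OF mM] unfolding N_def m_def by simp
 next
  case False
  have ine: "inv x ~= \<zero>"
  proof
   assume "inv x = \<zero>"
   hence "x\<otimes>\<zero> = \<one>" using cinv(2)[OF D_carr[OF x] False] by simp
   thus False using x by simp
  qed
  have "inv x \<in> W \<longleftrightarrow> vge (vl M) (inv x) 0" by (rule WKv) (use D_K[OF x] False in simp)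
  also have "\<dots> \<longleftrightarrow> \<not> 0 < vl M x" using v_inv[OF v D_K[OF x] False] ine unfolding vge_def by auto
  finally show ?thesis using v_M[OF v x False] False D_E[OF x] unfolding N_def m_def by auto
 qed
 have ND: "N \<inter> D = M" using MN M_D[OF mM] by blast
 have "N ~= {\<zero>}" using ND M M_closed(1)[OF mM] by auto
 hence Nx: "E.mxn N" using E.dim1[OF \<open>pri E N\<close>] by simp
 hence Na: "N \<in> above M" unfolding above_def using ND by simp
 note w = E.place_vl[OF Nx]
 have EN: "x \<in> W" if xl: "x \<in> localization R E N" for x
 proof -
  obtain a t where at: "x = a\<otimes>inv t" "a \<in> E" "t \<in> E" "t \<notin> N" using xl unfolding localization_def by blast
  have "inv t \<in> W" using at(3,4) unfolding N_def m_def by simp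
  thus ?thesis unfolding at(1) by (rule s(6)[OF EW[OF at(2)]])
 qed
 have "y \<in> localization R E N" if y: "y \<in> W" for y
 proof (rule ccontr)
  assume "y \<notin> localization R E N"
  hence y0: "y ~= \<zero>" "E.vl N y < 0" unfolding ES.localization_eq[OF Nx] vge_def using WC[OF y] by auto
  obtain t where t: "t \<in> E" "t ~= \<zero>" "E.vl N t = 1" using E.v_uniformizer[OF w] by blast
  have tN: "t \<in> N" using E.v_M[OF w t(1,2)] t(3) by simp
  define k where "k = nat (- E.vl N y - 1)"
  have k: "int (Suc k) = - E.vl N y" unfolding k_def using y0(2) by simp
  let ?u = "y\<otimes>t [^] Suc k"
  have c: "y \<in> carrier R" "t \<in> carrier R" using WC[OF y] t(1) by auto
  have tk: "t [^] Suc k \<in> carrier R" "t [^] Suc k ~= \<zero>" using nat_pow_closed[OF c(2)] pow_nonzero[OF c(2) t(2)] by (simp_all only: not_False_eq_True)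
  have u: "?u \<in> carrier R" "?u ~= \<zero>" using m_closed[OF c(1) tk(1)] integral_iff[OF c(1) tk(1)] y0(1) tk(2) by blast+
  have "E.vl N ?u = E.vl N y + E.vl N (t [^] Suc k)" by (rule E.v_mult[OF w c(1) y0(1) tk])
  also have "E.vl N (t [^] Suc k) = int (Suc k) * E.vl N t" by (rule E.v_pow[OF w c(2) t(2)])
  finally have "E.vl N ?u = 0" unfolding t(3) mult_1_right k add.right_inverse .
  hence "E.vl N (inv ?u) = 0" using E.v_inv[OF w u] by (simp only: minus_zero)
  hence "inv ?u \<in> localization R E N" unfolding ES.localization_eq[OF Nx] vge_def using cinv(1)[OF u] by (simp del: nat_pow_Suc)
  hence iu: "inv ?u \<in> W" by (rule EN)
  have tW: "t [^] k \<in> W" using EW[OF E.D_pow[OF t(1)]] .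
  have z: "(y\<otimes>t [^] k)\<otimes>inv ?u \<in> W" by (intro s(6) y tW iu)
  have sh: "t\<otimes>((y\<otimes>s)\<otimes>i) = (y\<otimes>(s\<otimes>t))\<otimes>i" if "s \<in> carrier R" "i \<in> carrier R" for s i using c that by (simp add: m_ac)
  have "t\<otimes>((y\<otimes>t [^] k)\<otimes>inv ?u) = ?u\<otimes>inv ?u"
   unfolding nat_pow_Suc by (rule sh[OF nat_pow_closed[OF c(2)] cinv(1)[OF u, unfolded nat_pow_Suc]])
  also have "?u\<otimes>inv ?u = \<one>" by (rule cinv(2)[OF u])
  finally have ti: "t\<otimes>((y\<otimes>t [^] k)\<otimes>inv ?u) = \<one>" .
  have "inv t = (y\<otimes>t [^] k)\<otimes>inv ?u" by (rule comm_inv_char[OF c(2) WC[OF z] ti])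
  hence "inv t \<in> W" using z by (simp only:)
  thus False using tN t(2) unfolding N_def m_def by simp
 qed
 hence "W = localization R E N" using EN by blast
 thus ?thesis using Na by blast
qed

lemma localization_inj: "inj_on (localization R E) (above M)"
proof (rule inj_onI)
 fix N N' assume N: "N \<in> above M" "N' \<in> above M" "localization R E N = localization R E N'"
 have "E.mxn N" "E.mxn N'" using N unfolding above_def by auto
 thus "N = N'" using ES.nonunits_localization_inter N(3) by metis
qed

end

section \<open>The extension domain over the given Dedekind domain\<close>

lemma image_nonunits:
 fixes F :: "'a ring" and R :: "'b ring"
 assumes F: "ring F" and R: "ring R" and h: "h \<in> ring_hom F R" "inj_on h (carrier F)" and A: "subring A F"
 shows "nonunits (R |: (h ` A)) = h ` nonunits (F |: A)"
proof -
 note s = subringE[OF A]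
 have Ac: "!!a. a \<in> A ==> a \<in> carrier F" using s(1) by auto
 have e: "h y \<otimes>\<^bsub>R\<^esub> h x = \<one>\<^bsub>R\<^esub> \<longleftrightarrow> y \<otimes>\<^bsub>F\<^esub> x = \<one>\<^bsub>F\<^esub>" if "x \<in> A" "y \<in> A" for x y
 proof -
  have "h y \<otimes>\<^bsub>R\<^esub> h x = \<one>\<^bsub>R\<^esub> \<longleftrightarrow> h (y \<otimes>\<^bsub>F\<^esub> x) = h \<one>\<^bsub>F\<^esub>" using ring_hom_mult[OF h(1)] ring_hom_one[OF h(1)] Ac that by simp
  also have "\<dots> \<longleftrightarrow> y \<otimes>\<^bsub>F\<^esub> x = \<one>\<^bsub>F\<^esub>" by (rule inj_on_eq_iff[OF h(2) Ac[OF s(6)[OF that(2,1)]] Ac[OF s(3)]])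
  finally show ?thesis .
 qed
 have u: "h x \<in> Units (R |: (h ` A)) \<longleftrightarrow> x \<in> Units (F |: A)" if x: "x \<in> A" for x unfolding Units_def using e x by auto
 show ?thesis unfolding nonunits_def using u by auto
qed

text \<open>The extension E of the given ring DF along the embedding h. From here on K and D of the general theory are the
images of F and DF.\<close>

locale realization = base: dedekind_std F "carrier F" DF + ext_std R "h ` carrier F" "h ` DF" E
 for F :: "'a ring" and DF and R :: "'b ring" (structure) and h and E +
 assumes h: "h \<in> ring_hom F R"
begin

lemma inj_h: "inj_on h (carrier F)" by (rule dedekind_image(3)[OF field_axioms base.dedekind_axioms h])

lemma h_eq: "x \<in> carrier F ==> y \<in> carrier F ==> h x = h y \<longleftrightarrow> x = y" by (rule inj_on_eq_iff[OF inj_h])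

sublocale H: ring_hom_ring F R h using h by (intro ring_hom_ring.intro base.ring_axioms ring_axioms ring_hom_ring_axioms.intro)

lemma h_zero_iff: "x \<in> carrier F ==> h x = \<zero> \<longleftrightarrow> x = \<zero>\<^bsub>F\<^esub>" using h_eq[of x "\<zero>\<^bsub>F\<^esub>"] by simp

lemma mxn_image:
 assumes M: "base.mxn M" shows "mxn (h ` M)"
proof -
 have mM: "base.mx DF M" "M ~= {\<zero>\<^bsub>F\<^esub>}" using M by auto
 have "\<zero>\<^bsub>F\<^esub> \<in> M" by (rule base.M_closed(1)[OF mM(1)])
 then obtain x where x: "x \<in> M" "x ~= \<zero>\<^bsub>F\<^esub>" using mM(2) by blast
 have "h x ~= \<zero>" using h_zero_iff[of x] x base.M_D[OF mM(1) x(1)] by simp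
 hence "h ` M ~= {\<zero>}" using x(1) by auto
 thus ?thesis using dedekind_image(2)[OF field_axioms base.dedekind_axioms h mM(1)] by simp
qed

lemma mxn_preimage:
 assumes P: "mxn P" shows "base.mxn {d \<in> DF. h d \<in> P}" "h ` {d \<in> DF. h d \<in> P} = P"
proof -
 let ?P = "{d \<in> DF. h d \<in> P}"
 have mP: "mx (h ` DF) P" using P by simp
 have PD: "!!x. x \<in> P ==> x \<in> h ` DF" using M_D[OF mP] .
 show im: "h ` ?P = P" using PD by auto
 have "base.mx DF ?P" unfolding base.mx_def
 proof (intro conjI ballI)
  show "base.submod DF ?P" unfolding base.submod_def using M_closed[OF mP] by auto
  show "\<one>\<^bsub>F\<^esub> \<notin> ?P" using M_one[OF mP] by simp
  fix x assume x: "x \<in> DF - ?P"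
  have "\<exists>d\<in>h ` DF. \<one> \<ominus> d\<otimes>h x \<in> P" by (rule M_max[OF mP]) (use x in auto)
  then obtain d where d: "d \<in> DF" "\<one> \<ominus> h d\<otimes>h x \<in> P" by blast
  have "h (\<one>\<^bsub>F\<^esub> \<ominus>\<^bsub>F\<^esub> d \<otimes>\<^bsub>F\<^esub> x) = \<one> \<ominus> h d\<otimes>h x" using x d(1) by (simp add: a_minus_def)
  thus "\<exists>d\<in>DF. \<one>\<^bsub>F\<^esub> \<ominus>\<^bsub>F\<^esub> d \<otimes>\<^bsub>F\<^esub> x \<in> ?P" using d x by (intro bexI[of _ d]) auto
 qed auto
 moreover have "?P ~= {\<zero>\<^bsub>F\<^esub>}" using im P by force
 ultimately show "base.mxn ?P" by simp
qed

lemma h_localization: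
 assumes M: "base.mxn M"
 shows "h ` localization F DF M = localization R (h ` DF) (h ` M)"
proof -
 have mM: "base.mx DF M" using M by simp
 have MD: "!!x. x \<in> M ==> x \<in> DF" using base.M_D[OF mM] .
 have e: "h (a \<otimes>\<^bsub>F\<^esub> inv\<^bsub>F\<^esub> s) = h a\<otimes>inv (h s)" if a: "a \<in> DF" and s: "s \<in> DF" "s \<notin> M" for a s
 proof -
  have s0: "s ~= \<zero>\<^bsub>F\<^esub>" using s base.M_closed(1)[OF mM] by auto
  note si = base.cinv(1,2)[OF base.D_carr[OF s(1)] s0]
  have "h s\<otimes>h (inv\<^bsub>F\<^esub> s) = h (s \<otimes>\<^bsub>F\<^esub> inv\<^bsub>F\<^esub> s)" using s(1) si(1) by simp
  hence "h s\<otimes>h (inv\<^bsub>F\<^esub> s) = \<one>" unfolding si(2) by simp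
  hence "inv (h s) = h (inv\<^bsub>F\<^esub> s)" by (intro comm_inv_char) (use s(1) si(1) in auto)
  thus ?thesis using a si(1) by simp
 qed
 have nm: "h s \<in> h ` DF - h ` M \<longleftrightarrow> s \<in> DF - M" if "s \<in> DF" for s using h_eq that MD by (auto simp: image_iff)
 show ?thesis
 proof (intro equalityI subsetI)
  fix y assume "y \<in> h ` localization F DF M"
  then obtain a s where as: "y = h (a \<otimes>\<^bsub>F\<^esub> inv\<^bsub>F\<^esub> s)" "a \<in> DF" "s \<in> DF" "s \<notin> M" unfolding localization_def by blast
  have "y = h a\<otimes>inv (h s)" using e as by simp
  moreover have "h s \<in> h ` DF - h ` M" using nm as by simp
  ultimately show "y \<in> localization R (h ` DF) (h ` M)" unfolding localization_def using as(2) by blast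
 next
  fix y assume "y \<in> localization R (h ` DF) (h ` M)"
  then obtain b t where bt: "y = b\<otimes>inv t" "b \<in> h ` DF" "t \<in> h ` DF" "t \<notin> h ` M" unfolding localization_def by blast
  obtain a where a: "a \<in> DF" "b = h a" using bt(2) by blast
  obtain s where s: "s \<in> DF" "t = h s" using bt(3) by blast
  have sM: "s \<notin> M" using bt(4) s(2) by blast
  have "y = h (a \<otimes>\<^bsub>F\<^esub> inv\<^bsub>F\<^esub> s)" using e[OF a(1) s(1) sM] bt(1) a(2) s(2) by simp
  thus "y \<in> h ` localization F DF M" unfolding localization_def using a(1) s(1) sM by blast
 qed
qed

lemma h_nonunits:
 assumes M: "base.mxn M"
 shows "h ` nonunits (F |: localization F DF M) = {x \<in> h ` carrier F. vge (vl (h ` M)) x 1}"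
proof -
 have sV: "subring (localization F DF M) F" unfolding base.localization_eq[OF M] by (rule base.vge_subring[OF base.place_vl[OF M]])
 have "h ` nonunits (F |: localization F DF M) = nonunits (R |: (h ` localization F DF M))"
  by (rule image_nonunits[OF base.ring_axioms ring_axioms h inj_h sV, symmetric])
 also have "\<dots> = nonunits (R |: localization R (h ` DF) (h ` M))" unfolding h_localization[OF M] ..
 also have "\<dots> = {x \<in> h ` carrier F. vge (vl (h ` M)) x 1}" by (rule nonunits_localization[OF mxn_image[OF M]])
 finally show ?thesis .
qed

lemma valuation_extensions_eq:
 assumes M: "base.mxn M"
 shows "valuation_extensions F (localization F DF M) R h = localization R E ` above (h ` M)"
proof (intro equalityI subsetI)
 fix W assume "W \<in> valuation_extensions F (localization F DF M) R h"
 hence "valuation_ring R W" "W \<inter> h ` carrier F = localization R (h ` DF) (h ` M)"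
  unfolding valuation_extensions_def h_localization[OF M] by auto
 from valuation_ring_is_localization[OF mxn_image[OF M] this]
 show "W \<in> localization R E ` above (h ` M)" by blast
next
 fix W assume "W \<in> localization R E ` above (h ` M)"
 then obtain N where N: "N \<in> above (h ` M)" "W = localization R E N" by blast
 show "W \<in> valuation_extensions F (localization F DF M) R h" unfolding valuation_extensions_def h_localization[OF M] N(2)
  using localization_above_valuation_ring[OF mxn_image[OF M] N(1)] by simp
qed

context
 fixes M N assumes M: "base.mxn M" and N: "N \<in> above (h ` M)" and res: "!!y. y \<in> E ==> \<exists>d\<in>h ` DF. y \<ominus> d \<in> N"
begin

lemma N_mxn: "E.mxn N" and N_inter: "N \<inter> h ` DF = h ` M" using N unfolding above_def by auto

lemma N_preimage: "M = {d \<in> DF. h d \<in> N}"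
proof -
 have MD: "x \<in> DF" if "x \<in> M" for x using base.M_D[of M x] M that by simp
 have "h d \<in> N \<longleftrightarrow> d \<in> M" if d: "d \<in> DF" for d
 proof -
  have "h d \<in> N \<longleftrightarrow> h d \<in> h ` M" using N_inter d by blast
  also have "\<dots> \<longleftrightarrow> d \<in> M" using h_eq d MD by (auto simp: image_iff)
  finally show ?thesis .
 qed
 thus ?thesis using MD by blast
qed

text \<open>DF maps onto E / N, which is the residue field of E_N. The kernel is M, and h is compatible with the
identification of the residue field of DF_M with DF / M.\<close>

lemma residue_isomorphic:
 "residue_field_isomorphic F (localization F DF M) R h (localization R E N) (F |: DF Quot M) (\<lambda>C. C \<inter> DF)"
proof -
 note w = E.place_vl[OF N_mxn] and v = base.place_vl[OF M]
 let ?W = "localization R E N" and ?V = "localization F DF M"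
 let ?P = "nonunits (R |: ?W)"
 have sW: "subring ?W R" unfolding ES.localization_eq[OF N_mxn] by (rule E.vge_subring[OF w])
 have cW: "cring (R |: ?W)" by (rule subring_cring[OF sW])
 have sV: "subring ?V F" unfolding base.localization_eq[OF M] by (rule base.vge_subring[OF v])
 have cV: "cring (F |: ?V)" by (rule base.subring_cring[OF sV])
 have cD: "cring (F |: DF)" by (rule base.subring_cring[OF base.D])
 have EW: "x \<in> ?W" if "x \<in> E" for x unfolding ES.localization_eq[OF N_mxn] using E.vge_D[OF w that] that by simp
 have DV: "x \<in> ?V" if "x \<in> DF" for x unfolding base.localization_eq[OF M] using base.vge_D[OF v that] that by simp
 have hDW: "h x \<in> ?W" if "x \<in> DF" for x using EW[OF D_E[of "h x"]] that by simp
 note Pi = ES.nonunits_localization_ideal[OF N_mxn]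
 have hh: "h \<in> ring_hom (F |: DF) (R |: ?W)" by (rule ring_hom_memI) (use hDW in auto)
 have mN: "mx E N" using N_mxn by simp
 have surj: "\<exists>a\<in>carrier (F |: DF). \<exists>p\<in>?P. y = p \<oplus>\<^bsub>R |: ?W\<^esub> h a" if y: "y \<in> carrier (R |: ?W)" for y
 proof -
  have y': "y \<in> carrier R" "vge (E.vl N) y 0" using y unfolding ES.localization_eq[OF N_mxn] by auto
  obtain z where z: "z \<in> E" "vge (E.vl N) (y \<ominus> z) 1" using E.residue_representative[OF mN w y'] by blast
  obtain d where d: "d \<in> DF" "z \<ominus> h d \<in> N" using res[OF z(1)] by blast
  have c: "y \<in> carrier R" "z \<in> carrier R" "h d \<in> carrier R" using y' z(1) d(1) by auto
  have "vge (E.vl N) (z \<ominus> h d) 1" using E.M_vge[OF w mN E.M_D[OF mN d(2)]] d(2) by simp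
  hence "vge (E.vl N) ((y \<ominus> z) \<oplus> (z \<ominus> h d)) 1" by (intro E.vge_add[OF w _ _ z(2)]) (use c in auto)
  moreover have "(y \<ominus> z) \<oplus> (z \<ominus> h d) = y \<ominus> h d" using c by algebra
  ultimately have "y \<ominus> h d \<in> ?P" unfolding ES.nonunits_localization[OF N_mxn] using c by simp
  moreover have "y = (y \<ominus> h d) \<oplus> h d" using c by algebra
  ultimately show ?thesis using d(1) by auto
 qed
 have Q: "M = {a \<in> carrier (F |: DF). h a \<in> ?P}" using N_preimage ES.nonunits_localization_inter[OF N_mxn] D_E by auto
 have iso: "(\<lambda>C. {a \<in> carrier (F |: DF). h a \<in> C}) \<in> ring_iso ((R |: ?W) Quot ?P) (F |: DF Quot M)"
  by (rule quotient_iso_of_surjective(1)[OF cD cW hh Pi surj Q])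
 interpret W: cring "R |: ?W" by (rule cW)
 interpret V: cring "F |: ?V" by (rule cV)
 interpret P: ideal ?P "R |: ?W" by (rule Pi)
 interpret P': ideal "nonunits (F |: ?V)" "F |: ?V" by (rule base.nonunits_localization_ideal[OF M])
 have hVW: "h ` ?V = ?W \<inter> h ` carrier F"
  unfolding h_localization[OF M] using localization_above_valuation_ring(2)[OF mxn_image[OF M] N] by simp
 have hnon: "h x \<in> ?P \<longleftrightarrow> x \<in> nonunits (F |: ?V)" if x: "x \<in> ?V" for x
 proof -
  have xc: "x \<in> carrier F" using x subringE(1)[OF sV] by auto
  obtain r where r: "r > 0" "!!x. x \<in> h ` carrier F ==> x ~= \<zero> ==> E.vl N x = r * vl (h ` M) x"
   using above_ramification[OF mxn_image[OF M] N] by blast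
  have "h x \<in> ?P \<longleftrightarrow> vge (E.vl N) (h x) 1" unfolding ES.nonunits_localization[OF N_mxn] using xc by simp
  also have "\<dots> \<longleftrightarrow> vge (vl (h ` M)) (h x) 1"
  proof (cases "h x = \<zero>")
   case False
   have "1 \<le> r * k \<longleftrightarrow> 1 \<le> k" for k using r(1) by (metis int_one_le_iff_zero_less zero_less_mult_pos zero_less_mult_iff not_less)
   thus ?thesis using r(2)[of "h x"] False xc unfolding vge_def by simp
  qed (simp add: vge_def)
  also have "\<dots> \<longleftrightarrow> h x \<in> h ` nonunits (F |: ?V)" unfolding h_nonunits[OF M] using xc by simp
  also have "\<dots> \<longleftrightarrow> x \<in> nonunits (F |: ?V)"
   using inj_on_image_mem_iff[OF inj_h xc, of "nonunits (F |: ?V)"] subringE(1)[OF sV] unfolding nonunits_def by auto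
  finally show ?thesis .
 qed
 have "{a \<in> carrier (F |: DF). h a \<in> ?P +>\<^bsub>R |: ?W\<^esub> h x}
   = (nonunits (F |: ?V) +>\<^bsub>F |: ?V\<^esub> x) \<inter> DF" if x: "x \<in> ?V" for x
 proof -
  have "h a \<in> ?P +>\<^bsub>R |: ?W\<^esub> h x \<longleftrightarrow> a \<in> nonunits (F |: ?V) +>\<^bsub>F |: ?V\<^esub> x" if a: "a \<in> DF" for a
  proof -
   have hx: "h x \<in> ?W" using hVW x by blast
   have ac: "a \<in> carrier F" "x \<in> carrier F" using a x subringE(1)[OF sV] by auto
   have "h a \<in> ?P +>\<^bsub>R |: ?W\<^esub> h x \<longleftrightarrow> h a \<ominus>\<^bsub>R |: ?W\<^esub> h x \<in> ?P"
    by (rule P.a_rcos_module_minus[OF W.ring_axioms]) (use hx hDW[OF a] in auto)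
   also have "h a \<ominus>\<^bsub>R |: ?W\<^esub> h x = h (a \<ominus>\<^bsub>F |: ?V\<^esub> x)"
    using subring_a_inv[OF sW hx] base.subring_a_inv[OF sV x] ac by (simp add: a_minus_def)
   also have "\<dots> \<in> ?P \<longleftrightarrow> a \<ominus>\<^bsub>F |: ?V\<^esub> x \<in> nonunits (F |: ?V)" by (rule hnon) (use V.minus_closed[of a x] DV[OF a] x in simp)
   also have "\<dots> \<longleftrightarrow> a \<in> nonunits (F |: ?V) +>\<^bsub>F |: ?V\<^esub> x"
    by (rule P'.a_rcos_module_minus[OF V.ring_axioms, symmetric]) (use x DV[OF a] in auto)
   finally show ?thesis .
  qed
  thus ?thesis by auto
 qed
 note co = this
 show ?thesis unfolding residue_field_isomorphic_def Let_def residue_field_def by (rule bexI[OF _ iso], rule ballI, rule co)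
qed

lemma residue_dimension:
 "ring.dimension (R |: E Quot N) 1 ((\<lambda>d. N +>\<^bsub>R |: E\<^esub> h d) ` DF) (carrier (R |: E Quot N))"
proof -
 have mN: "mx E N" using N_mxn by simp
 have mi: "maximalideal N (R |: E)" using maximalideal_iff_mx[OF E.D] mN by simp
 have cE: "cring (R |: E)" by (rule subring_cring[OF E.D])
 have cD: "cring (F |: DF)" by (rule base.subring_cring[OF base.D])
 interpret k: field "R |: E Quot N" by (rule maximalideal.quotient_is_field[OF mi cE])
 have hh: "h \<in> ring_hom (F |: DF) (R |: E)" by (rule ring_hom_memI) (use D_E in auto)
 have surj: "\<exists>a\<in>carrier (F |: DF). \<exists>p\<in>N. y = p \<oplus>\<^bsub>R |: E\<^esub> h a" if y: "y \<in> carrier (R |: E)" for y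
 proof -
  obtain d where d: "d \<in> DF" "y \<ominus> h d \<in> N" using res[of y] y by auto
  have c: "y \<in> carrier R" "h d \<in> carrier R" using y d(1) by auto
  have "y = (y \<ominus> h d) \<oplus> h d" using c by algebra
  thus ?thesis using d by auto
 qed
 have "carrier (R |: E Quot N) = (\<lambda>d. N +>\<^bsub>R |: E\<^esub> h d) ` DF"
  using quotient_iso_of_surjective(3)[OF cD cE hh maximalideal.axioms(1)[OF mi] surj refl] by simp
 thus ?thesis using k.dimension_one[OF k.carrier_is_subfield] by simp
qed

end

lemma ord_at_scale:
 assumes o: "ord_at v S k" and S: "S \<subseteq> h ` carrier F" and r: "r \<ge> 0"
  and w: "!!x. x \<in> h ` carrier F ==> x ~= \<zero> ==> w x = r * v x"
 shows "ord_at w S (r * k)"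
proof -
 have "vge w x (r * k)" if "x \<in> S" for x
 proof (cases "x = \<zero>")
  case False
  have "k \<le> v x" using o that False unfolding ord_at_def vge_def by blast
  hence "r * k \<le> r * v x" by (rule mult_left_mono[OF _ r])
  thus ?thesis using w[of x] that S False unfolding vge_def by auto
 qed (simp add: vge_def)
 moreover obtain x where "x \<in> S" "x ~= \<zero>" "v x = k" using o unfolding ord_at_def by blast
 ultimately show ?thesis unfolding ord_at_def using w S by blast
qed

context
 fixes M N r assumes M: "base.mxn M" and N: "N \<in> above (h ` M)"
  and r: "!!x. x \<in> h ` carrier F ==> x ~= \<zero> ==> E.vl N x = int r * vl (h ` M) x"
begin

private lemma Nx: "E.mxn N" using N unfolding above_def by auto

private lemma loc: "localization R E N = {x \<in> carrier R. vge (E.vl N) x 0}" by (rule ES.localization_eq[OF Nx])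

private lemma Idl_loc:
 assumes S: "S \<subseteq> localization R E N" "ord_at (E.vl N) S k"
 shows "Idl\<^bsub>R |: localization R E N\<^esub> S = {x \<in> carrier R. vge (E.vl N) x k}"
proof -
 note w = E.place_vl[OF Nx]
 note sW = E.vge_subring[OF w]
 interpret W: cring "R |: localization R E N" unfolding loc by (rule subring_cring[OF sW])
 have "ideal (Idl\<^bsub>R |: localization R E N\<^esub> S) (R |: localization R E N)" by (rule W.genideal_ideal) (simp add: S(1))
 moreover have "ord_at (E.vl N) (Idl\<^bsub>R |: localization R E N\<^esub> S) k" unfolding loc by (rule E.ord_at_Idl[OF w sW]) (use S loc in auto)
 ultimately show ?thesis unfolding loc by (rule E.ideal_of_vge_ring[OF w])
qed

text \<open>Both sides are ideals of the discrete valuation ring E_N; they agree since both have order r.\<close>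

lemma ramification_index:
 "has_ramification_index F (localization F DF M) R h (localization R E N) r"
proof -
 note w = E.place_vl[OF Nx] and v = place_vl[OF mxn_image[OF M]]
 note sW = E.vge_subring[OF w]
 let ?W = "localization R E N"
 interpret W: cring "R |: ?W" unfolding loc by (rule subring_cring[OF sW])
 let ?S = "h ` nonunits (F |: localization F DF M)"
 have oS: "ord_at (E.vl N) ?S (int r * 1)" by (rule ord_at_scale[OF _ _ _ r])
   (use ord_at_vge_ring(2)[OF v] in \<open>auto simp: h_nonunits[OF M]\<close>)
 have "?S \<subseteq> ?W"
 proof
  fix x assume x: "x \<in> ?S"
  hence "x \<in> carrier R" unfolding h_nonunits[OF M] by auto
  moreover have "vge (E.vl N) x 0" using oS x unfolding ord_at_def vge_def by force
  ultimately show "x \<in> ?W" unfolding loc by simp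
 qed
 from Idl_loc[OF this oS] have 1: "Idl\<^bsub>R |: ?W\<^esub> ?S = {x \<in> carrier R. vge (E.vl N) x (int r)}" by simp
 let ?P = "nonunits (R |: ?W)"
 interpret IS: comm_monoid "ideals_set (R |: ?W)" by (rule W.ideals_set_is_comm_monoid)
 have "?P \<in> carrier (ideals_set (R |: ?W))" using ES.nonunits_localization_ideal[OF Nx] by (simp add: ideals_set_def)
 hence "?P [^]\<^bsub>ideals_set (R |: ?W)\<^esub> r \<in> carrier (ideals_set (R |: ?W))" by (rule IS.nat_pow_closed)
 hence "ideal (?P [^]\<^bsub>ideals_set (R |: ?W)\<^esub> r) (R |: ?W)" by (simp add: ideals_set_def)
 moreover have "ord_at (E.vl N) (?P [^]\<^bsub>ideals_set (R |: ?W)\<^esub> r) (int r * 1)"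
 proof (rule E.ord_at_pow(2)[OF w])
  show "x \<in> carrier R" if "x \<in> ?P" for x using that unfolding ES.nonunits_localization[OF Nx] by (elim CollectE conjE)
  show "x \<in> carrier R" if "x \<in> ?W" for x using that unfolding loc by (elim CollectE conjE)
  show "ord_at (E.vl N) ?P 1" unfolding ES.nonunits_localization[OF Nx] by (rule E.ord_at_vge_ring(2)[OF w])
  show "ord_at (E.vl N) ?W 0" unfolding loc by (rule E.ord_at_vge_ring(1)[OF w])
 qed
 ultimately have "?P [^]\<^bsub>ideals_set (R |: ?W)\<^esub> r = {x \<in> carrier R. vge (E.vl N) x (int r * 1)}"
  unfolding loc by (rule E.ideal_of_vge_ring[OF w])
 thus ?thesis unfolding has_ramification_index_def Let_def 1 mult_1_right by (rule sym)
qed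

lemma local_ideal_eq:
 "Idl\<^bsub>R |: localization R E N\<^esub> (h ` M) =
  Idl\<^bsub>R |: localization R E N\<^esub> (N [^]\<^bsub>ideals_set (R |: E)\<^esub> r)"
proof -
 note w = E.place_vl[OF Nx] and v = place_vl[OF mxn_image[OF M]]
 have EW: "x \<in> localization R E N" if "x \<in> E" for x unfolding loc using E.vge_D[OF w that] that by simp
 have hM: "mx (h ` DF) (h ` M)" using mxn_image[OF M] by simp
 have mN: "mx E N" using Nx by simp
 have "ord_at (vl (h ` M)) (h ` M) 1" using ord_at_maximal[OF mxn_image[OF M] mxn_image[OF M] v] by simp
 hence o1: "ord_at (E.vl N) (h ` M) (int r * 1)" by (rule ord_at_scale[OF _ _ _ r]) (use M_D[OF hM] D_K in auto)
 have "h ` M \<subseteq> localization R E N" using M_D[OF hM] D_E EW by blast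
 from Idl_loc[OF this o1] have 1: "Idl\<^bsub>R |: localization R E N\<^esub> (h ` M) = {x \<in> carrier R. vge (E.vl N) x (int r)}" by simp
 have "ord_at (E.vl N) N 1" using E.ord_at_maximal[OF Nx Nx w] by simp
 hence o2: "ord_at (E.vl N) (N [^]\<^bsub>ideals_set (R |: E)\<^esub> r) (int r * 1)"
  by (intro E.ord_at_pow(2)[OF w]) (use E.M_D[OF mN] E.ord_at_vge_ring(3)[OF w] in auto)
 interpret RE: cring "R |: E" by (rule subring_cring[OF E.D])
 interpret IS: comm_monoid "ideals_set (R |: E)" by (rule RE.ideals_set_is_comm_monoid)
 have "ideal N (R |: E)" using ideal_iff_submod[OF E.D] mN unfolding mx_def by simp
 hence "N [^]\<^bsub>ideals_set (R |: E)\<^esub> r \<in> carrier (ideals_set (R |: E))" by (intro IS.nat_pow_closed) (simp add: ideals_set_def)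
 hence "N [^]\<^bsub>ideals_set (R |: E)\<^esub> r \<subseteq> E" using ideal_iff_submod[OF E.D] by (simp add: ideals_set_def)
 hence "N [^]\<^bsub>ideals_set (R |: E)\<^esub> r \<subseteq> localization R E N" using EW by blast
 from Idl_loc[OF this o2] show ?thesis using 1 by simp
qed

end

end

section \<open>The extended ideal is a power of its radical\<close>

context realization
begin

text \<open>Makes the order calculus available over DF itself, with the valuations of its image.\<close>

lemma place_pullback:
 assumes P: "mxn P"
 shows "base.place (carrier F) DF {d \<in> DF. h d \<in> P} (\<lambda>x. vl P (h x))"
proof -
 note v = place_vl[OF P]
 have hz: "h x ~= \<zero>" if "x \<in> carrier F" "x ~= \<zero>\<^bsub>F\<^esub>" for x using h_zero_iff that by simp
 show ?thesis unfolding base.place_def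
 proof (intro conjI ballI impI)
  fix x y assume x: "x \<in> carrier F - {\<zero>\<^bsub>F\<^esub>}" and y: "y \<in> carrier F - {\<zero>\<^bsub>F\<^esub>}"
  show "vl P (h (x \<otimes>\<^bsub>F\<^esub> y)) = vl P (h x) + vl P (h y)" using v_mult[OF v, of "h x" "h y"] hz x y by simp
  assume "x \<oplus>\<^bsub>F\<^esub> y ~= \<zero>\<^bsub>F\<^esub>"
  hence "h x \<oplus> h y ~= \<zero>" using hz[of "x \<oplus>\<^bsub>F\<^esub> y"] x y by simp
  thus "min (vl P (h x)) (vl P (h y)) \<le> vl P (h (x \<oplus>\<^bsub>F\<^esub> y))" using v_add[OF v, of "h x" "h y"] hz x y by simp
 next
  obtain t where t: "t \<in> h ` DF" "t ~= \<zero>" "vl P t = 1" using v_uniformizer[OF v] by blast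
  then obtain d where d: "d \<in> DF" "t = h d" by blast
  show "\<exists>t\<in>DF - {\<zero>\<^bsub>F\<^esub>}. vl P (h t) = 1" using d t by (intro bexI[of _ d]) auto
 next
  fix x assume x: "x \<in> DF - {\<zero>\<^bsub>F\<^esub>}"
  show "0 \<le> vl P (h x)" using v_D[OF v, of "h x"] hz[of x] x by simp
  show "x \<in> {d \<in> DF. h d \<in> P} \<longleftrightarrow> 0 < vl P (h x)" using v_M[OF v, of "h x"] hz[of x] x by simp
 next
  fix x assume x: "x \<in> carrier F - {\<zero>\<^bsub>F\<^esub>}" "0 \<le> vl P (h x)"
  obtain s where s: "s \<in> h ` DF - P" "s\<otimes>h x \<in> h ` DF" using v_loc[OF v, of "h x"] hz[of x] x by auto
  obtain d where d: "d \<in> DF" "s = h d" using s(1) by blast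
  obtain c where c: "c \<in> DF" "s\<otimes>h x = h c" using s(2) by blast
  have "h (d \<otimes>\<^bsub>F\<^esub> x) = h c" using c(2) d x by simp
  hence "d \<otimes>\<^bsub>F\<^esub> x = c" using h_eq[of "d \<otimes>\<^bsub>F\<^esub> x" c] c(1) d(1) x(1) by simp
  thus "\<exists>s\<in>DF - {d \<in> DF. h d \<in> P}. s \<otimes>\<^bsub>F\<^esub> x \<in> DF" using d c(1) s(1) by (intro bexI[of _ d]) auto
 qed
qed

lemma ord_at_image:
 assumes S: "S \<subseteq> carrier F" and o: "base.ord_at (\<lambda>x. v (h x)) S k"
 shows "ord_at v (h ` S) k"
proof -
 have "vge v (h x) k" if "x \<in> S" for x using o that h_zero_iff[of x] S unfolding base.ord_at_def base.vge_def vge_def by auto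
 moreover obtain x where "x \<in> S" "x ~= \<zero>\<^bsub>F\<^esub>" "v (h x) = k" using o unfolding base.ord_at_def by blast
 ultimately show ?thesis unfolding ord_at_def using h_zero_iff[of x] S by blast
qed

lemma image_inj: "A \<subseteq> DF ==> B \<subseteq> DF ==> h ` A = h ` B \<longleftrightarrow> A = B" by (rule inj_on_image_eq_iff[OF inj_h]) auto

lemma ord_at_product:
 fixes e :: "'i => nat"
 assumes A: "finite A" and M: "!!i. i \<in> A ==> base.mxn (M i)" and P: "mxn P"
  and I: "I = finprod (ideals_set (F |: DF)) (\<lambda>i. M i [^]\<^bsub>ideals_set (F |: DF)\<^esub> e i) A"
 shows "I \<subseteq> DF" and "ord_at (vl P) (h ` I) (\<Sum>i\<in>A. if h ` M i = P then int (e i) else 0)"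
proof -
 note P0 = mxn_preimage[OF P] and v = place_pullback[OF P]
 interpret RD: cring "F |: DF" by (rule base.subring_cring[OF base.D])
 interpret IS: comm_monoid "ideals_set (F |: DF)" by (rule RD.ideals_set_is_comm_monoid)
 have MD: "M i \<subseteq> DF" if "i \<in> A" for i using base.M_D M[OF that] by blast
 have Mi: "M i \<in> carrier (ideals_set (F |: DF))" if "i \<in> A" for i
  using M[OF that] base.ideal_iff_submod[OF base.D] unfolding base.mx_def by (simp add: ideals_set_def)
 have pc: "M i [^]\<^bsub>ideals_set (F |: DF)\<^esub> e i \<in> carrier (ideals_set (F |: DF))" if "i \<in> A" for i
  by (rule IS.nat_pow_closed[OF Mi[OF that]])
 have "I \<in> carrier (ideals_set (F |: DF))" unfolding I by (rule IS.finprod_closed) (use pc in blast)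
 thus ID: "I \<subseteq> DF" using base.ideal_iff_submod[OF base.D] by (simp add: ideals_set_def)
 have "base.ord_at (\<lambda>x. vl P (h x)) I (\<Sum>i\<in>A. int (e i) * (if {d \<in> DF. h d \<in> P} = M i then 1 else 0))" unfolding I
 proof (rule base.ord_at_finprod[OF v A])
  fix i assume i: "i \<in> A"
  show "ideal (M i [^]\<^bsub>ideals_set (F |: DF)\<^esub> e i) (F |: DF)" using pc[OF i] by (simp add: ideals_set_def)
  show "base.ord_at (\<lambda>x. vl P (h x)) (M i [^]\<^bsub>ideals_set (F |: DF)\<^esub> e i)
    (int (e i) * (if {d \<in> DF. h d \<in> P} = M i then 1 else 0))"
  proof (rule base.ord_at_pow(2)[OF v])
   show "x \<in> carrier F" if "x \<in> M i" for x using MD[OF i] that by auto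
   show "base.ord_at (\<lambda>x. vl P (h x)) (M i) (if {d \<in> DF. h d \<in> P} = M i then 1 else 0)"
    by (rule base.ord_at_maximal[OF M[OF i] P0(1) v])
   show "base.ord_at (\<lambda>x. vl P (h x)) DF 0" by (rule base.ord_at_vge_ring(3)[OF v])
  qed auto
 qed
 moreover have "{d \<in> DF. h d \<in> P} = M i \<longleftrightarrow> h ` M i = P" if "i \<in> A" for i
  using image_inj[of "M i" "{d \<in> DF. h d \<in> P}"] MD[OF that] P0(2) by auto
 hence "(\<Sum>i\<in>A. int (e i) * (if {d \<in> DF. h d \<in> P} = M i then 1 else 0)) = (\<Sum>i\<in>A. if h ` M i = P then int (e i) else 0)"
  by (intro sum.cong) auto
 ultimately have "base.ord_at (\<lambda>x. vl P (h x)) I (\<Sum>i\<in>A. if h ` M i = P then int (e i) else 0)" by simp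
 moreover have "I \<subseteq> carrier F" using ID by auto
 ultimately show "ord_at (vl P) (h ` I) (\<Sum>i\<in>A. if h ` M i = P then int (e i) else 0)" by (intro ord_at_image)
qed

text \<open>An element that lies in all N \<in> S has its m-th power in J by \<open>local_global\<close>; conversely an
element outside some N \<in> S has all powers outside N. So the radical is the intersection of S. Its order is
1 on S, by approximation, and 0 elsewhere, so its m-th power has the same orders as J.\<close>

lemma radical_power:
 fixes J :: "'b set" and m :: nat
 assumes S: "finite S" "S ~= {}" "!!N. N \<in> S ==> E.mxn N" and m: "m > 0"
  and J: "ideal J (R |: E)" and o: "!!N. E.mxn N ==> ord_at (E.vl N) J (if N \<in> S then int m else 0)"
 shows "J = radical (R |: E) J [^]\<^bsub>ideals_set (R |: E)\<^esub> m"
proof -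
 interpret RE: cring "R |: E" by (rule subring_cring[OF E.D])
 interpret IS: comm_monoid "ideals_set (R |: E)" by (rule RE.ideals_set_is_comm_monoid)
 have Js: "submod E J" and JE: "!!x. x \<in> J ==> x \<in> E" using J ideal_iff_submod[OF E.D] by auto
 have pw: "x [^]\<^bsub>R |: E\<^esub> k = x [^] k" for x and k :: nat by (rule nat_pow_consistent[symmetric])
 obtain Q where Q: "Q \<in> S" using S(2) by blast
 have nz: "J' ~= {\<zero>}" if "ord_at (E.vl Q) J' k" for J' k using that unfolding ord_at_def by blast
 have J0: "J ~= {\<zero>}" by (rule nz[OF o[OF S(3)[OF Q]]])
 let ?T = "{x \<in> E. \<forall>N\<in>S. x \<in> N}"
 have TS: "x \<in> radical (R |: E) J" if x: "x \<in> ?T" for x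
 proof -
  have "x [^] m \<in> J"
  proof (cases "x = \<zero>")
   case True
   hence "x [^] m = \<zero>" using m by (simp add: nat_pow_zero)
   thus ?thesis using submodD(3)[OF Js] by simp
  next
   case False
   have xE: "x \<in> E" using x by blast
   have xm: "x [^] m \<in> carrier R" "x [^] m ~= \<zero>" using xE False by auto
   show ?thesis
   proof (rule E.local_global[OF Js JE J0 xm])
    fix N assume N: "E.mxn N"
    note w = E.place_vl[OF N]
    obtain b where b: "b \<in> J" "b ~= \<zero>" "E.vl N b = (if N \<in> S then int m else 0)" using o[OF N] unfolding ord_at_def by blast
    have vm: "E.vl N (x [^] m) = int m * E.vl N x" by (rule E.v_pow[OF w E.D_carr[OF xE] False])
    have "E.vl N b \<le> E.vl N (x [^] m)"
    proof (cases "N \<in> S")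
     case True
     hence "x \<in> N" using x by blast
     hence "1 \<le> E.vl N x" using E.v_M[OF w xE False] by simp
     hence "int m * 1 \<le> int m * E.vl N x" by (intro mult_left_mono) auto
     thus ?thesis using b(3) vm True by simp
    next
     case False
     thus ?thesis using b(3) E.v_D[OF w xE \<open>x ~= \<zero>\<close>] vm by simp
    qed
    thus "\<exists>b\<in>J. b ~= \<zero> & E.vl N b \<le> E.vl N (x [^] m)" using b(1,2) by blast
   qed
  qed
  thus ?thesis unfolding radical_def using x m pw by auto
 qed
 have ST: "x \<in> ?T" if x: "x \<in> radical (R |: E) J" for x
 proof -
  obtain k :: nat where k: "x \<in> E" "k > 0" "x [^] k \<in> J" using x pw unfolding radical_def by auto
  have "x \<in> N" if N: "N \<in> S" for N
  proof (rule ccontr)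
   assume xN: "x \<notin> N"
   have Nx: "E.mxn N" by (rule S(3)[OF N])
   hence mN: "mx E N" by simp
   note w = E.place_vl[OF Nx]
   have x0: "x ~= \<zero>" using xN E.M_closed(1)[OF mN] by auto
   have "E.vl N (x [^] k) = 0" using E.v_pow[OF w E.D_carr[OF k(1)] x0, of k] E.v_unit[OF w k(1) x0 xN] by simp
   moreover have "x [^] k ~= \<zero>" using k(1) x0 by simp
   ultimately show False using o[OF Nx] k(3) N m unfolding ord_at_def vge_def by auto
  qed
  thus ?thesis using k(1) by blast
 qed
 have rad: "radical (R |: E) J = ?T" using ST TS by blast
 have sT: "submod E ?T" unfolding submod_def
 proof (intro conjI ballI)
  have mx: "mx E N" if "N \<in> S" for N using S(3)[OF that] by simp
  show "?T \<subseteq> carrier R" by auto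
  show "\<zero> \<in> ?T" using E.M_closed(1)[OF mx] by simp
  show "x \<oplus> y \<in> ?T" if "x \<in> ?T" "y \<in> ?T" for x y using that E.M_closed(2)[OF mx] by simp
  show "d\<otimes>x \<in> ?T" if "d \<in> E" "x \<in> ?T" for d x using that E.M_closed(3)[OF mx] by simp
 qed
 hence iT: "ideal ?T (R |: E)" using ideal_iff_submod[OF E.D] by auto
 have oT: "ord_at (E.vl N) ?T (if N \<in> S then 1 else 0)" if N: "E.mxn N" for N
 proof (cases "N \<in> S")
  case True
  have mN: "mx E N" using N by simp
  note w = E.place_vl[OF N]
  obtain x where x: "x \<in> E" "x ~= \<zero>" "!!N. N \<in> S ==> E.vl N x = 1" using E.approximation[OF S, of "\<lambda>_. 1"] by auto
  have "x \<in> N'" if "N' \<in> S" for N' using E.v_M[OF E.place_vl[OF S(3)[OF that]] x(1,2)] x(3)[OF that] by simp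
  hence "x \<in> ?T" using x(1) by blast
  moreover have "vge (E.vl N) y 1" if "y \<in> ?T" for y using E.M_vge[OF w mN, of y] that True by blast
  ultimately show ?thesis unfolding ord_at_def using x(2) x(3)[OF True] True by auto
 next
  case False
  note w = E.place_vl[OF N]
  have mN: "mx E N" using N by simp
  obtain z where z: "z \<in> E - N" "\<forall>M\<in>S. int 1 \<le> E.vl M z" using E.avoiding_element[OF S(1,3) mN False, of 1] by blast
  have z0: "z ~= \<zero>" using E.DM_nonzero[OF mN z(1)] .
  have "z \<in> N'" if "N' \<in> S" for N' using E.v_M[OF E.place_vl[OF S(3)[OF that]] _ z0] z that by auto
  hence "z \<in> ?T" using z(1) by blast
  moreover have "E.vl N z = 0" using E.v_unit[OF w _ z0] z(1) by blast
  moreover have "vge (E.vl N) y 0" if "y \<in> ?T" for y using E.vge_D[OF w] that by blast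
  ultimately show ?thesis unfolding ord_at_def using z0 False by auto
 qed
 have oTm: "ord_at (E.vl N) (?T [^]\<^bsub>ideals_set (R |: E)\<^esub> m) (if N \<in> S then int m else 0)" if N: "E.mxn N" for N
 proof -
  note w = E.place_vl[OF N]
  have "ord_at (E.vl N) (?T [^]\<^bsub>ideals_set (R |: E)\<^esub> m) (int m * (if N \<in> S then 1 else 0))"
  proof (rule E.ord_at_pow(2)[OF w])
   show "x \<in> carrier R" if "x \<in> ?T" for x using that by auto
   show "ord_at (E.vl N) ?T (if N \<in> S then 1 else 0)" by (rule oT[OF N])
   show "ord_at (E.vl N) E 0" by (rule E.ord_at_vge_ring(3)[OF w])
  qed simp
  thus ?thesis by (cases "N \<in> S") simp_all
 qed
 have "?T [^]\<^bsub>ideals_set (R |: E)\<^esub> m \<in> carrier (ideals_set (R |: E))" by (rule IS.nat_pow_closed) (simp add: ideals_set_def iT)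
 hence iTm: "ideal (?T [^]\<^bsub>ideals_set (R |: E)\<^esub> m) (R |: E)" by (simp add: ideals_set_def)
 show ?thesis unfolding rad by (rule E.ideal_eq_of_ord[OF J J0 iTm nz[OF oTm[OF S(3)[OF Q]]] o oTm])
qed

lemma extended_ideal_radical_power:
 fixes e :: "'i => nat"
 assumes A: "finite A" "A ~= {}" and M: "!!i. i \<in> A ==> base.mxn (M i)" "inj_on M A"
  and em: "!!i. i \<in> A ==> e i dvd m" "m > 0"
  and ab: "!!i. i \<in> A ==> finite (above (h ` M i)) & above (h ` M i) ~= {}"
  and r: "!!i N x. i \<in> A ==> N \<in> above (h ` M i) ==> x \<in> h ` carrier F ==> x ~= \<zero> ==>
   E.vl N x = int (m div e i) * vl (h ` M i) x"
  and I: "I = finprod (ideals_set (F |: DF)) (\<lambda>i. M i [^]\<^bsub>ideals_set (F |: DF)\<^esub> e i) A"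
 shows "Idl\<^bsub>R |: E\<^esub> (h ` I) = radical (R |: E) (Idl\<^bsub>R |: E\<^esub> (h ` I)) [^]\<^bsub>ideals_set (R |: E)\<^esub> m"
proof -
 interpret RE: cring "R |: E" by (rule subring_cring[OF E.D])
 obtain i0 where i0: "i0 \<in> A" using A(2) by blast
 have ID: "h ` I \<subseteq> h ` DF"
 proof -
  have "mxn (h ` M i0)" by (rule mxn_image[OF M(1)[OF i0]])
  from ord_at_product(1)[OF A(1) M(1) this I] show ?thesis by blast
 qed
 have IE: "h ` I \<subseteq> E" using ID D_E by blast
 let ?S = "\<Union>i\<in>A. above (h ` M i)"
 have MD: "M i \<subseteq> DF" if "i \<in> A" for i using base.M_D M(1)[OF that] by blast
 show ?thesis
 proof (rule radical_power[where S="?S"])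
  show "finite ?S" using A(1) ab by blast
  show "?S ~= {}" using i0 ab by blast
  show "E.mxn N" if "N \<in> ?S" for N using that unfolding above_def by blast
  show "m > 0" by (rule em(2))
  show "ideal (Idl\<^bsub>R |: E\<^esub> (h ` I)) (R |: E)" by (rule RE.genideal_ideal) (simp add: IE)
  fix N assume N: "E.mxn N"
  note w = E.place_vl[OF N]
  let ?P = "N \<inter> h ` DF"
  have P: "mxn ?P" by (rule contraction[OF N])
  have NP: "N \<in> above ?P" unfolding above_def using N by simp
  note oI = ord_at_product(2)[OF A(1) M(1) P I]
  have IK: "h ` I \<subseteq> h ` carrier F" using ID by auto
  have "ord_at (E.vl N) (h ` I) (if N \<in> ?S then int m else 0)"
  proof (cases "N \<in> ?S")
   case True
   then obtain j where j: "j \<in> A" "N \<in> above (h ` M j)" by blast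
   have Pj: "?P = h ` M j" using j(2) unfolding above_def by simp
   have "(h ` M i = ?P) = (j = i)" if "i \<in> A" for i
    using image_inj[OF MD[OF that] MD[OF j(1)]] inj_on_eq_iff[OF M(2) that j(1)] Pj by auto
   hence "(\<Sum>i\<in>A. if h ` M i = ?P then int (e i) else 0) = (\<Sum>i\<in>A. if j = i then int (e i) else 0)" by (intro sum.cong) auto
   also have "\<dots> = int (e j)" using sum.delta'[OF A(1), of j "\<lambda>i. int (e i)"] j(1) by simp
   finally have "ord_at (vl ?P) (h ` I) (int (e j))" using oI by simp
   hence "ord_at (vl (h ` M j)) (h ` I) (int (e j))" unfolding Pj .
   hence "ord_at (E.vl N) (h ` I) (int (m div e j) * int (e j))" by (rule ord_at_scale[OF _ IK _ r[OF j]]) auto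
   moreover have "int (m div e j) * int (e j) = int m" using em(1)[OF j(1)] by (metis dvd_div_mult_self of_nat_mult)
   ultimately show ?thesis using True by simp
  next
   case False
   have "h ` M i ~= ?P" if "i \<in> A" for i using False NP that by auto
   hence "(\<Sum>i\<in>A. if h ` M i = ?P then int (e i) else 0) = 0" by (intro sum.neutral) auto
   hence o0: "ord_at (vl ?P) (h ` I) 0" using oI by simp
   obtain r' where r': "r' > 0" "!!x. x \<in> h ` carrier F ==> x ~= \<zero> ==> E.vl N x = r' * vl ?P x"
    using above_ramification[OF P NP] by blast
   have "ord_at (E.vl N) (h ` I) (r' * 0)" by (rule ord_at_scale[OF o0 IK _ r'(2)]) (use r'(1) in auto)
   thus ?thesis using False by simp
  qed
  thus "ord_at (E.vl N) (Idl\<^bsub>R |: E\<^esub> (h ` I)) (if N \<in> ?S then int m else 0)"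
   by (intro E.ord_at_Idl[OF w E.D _ _ IE]) (use E.vge_D[OF w] in auto)
 qed
qed

end

section \<open>The system and its realization\<close>

text \<open>All residue extensions have degree 1, so the sum over j is e_i (m / e_i) = m.\<close>

lemma system_consistent:
 assumes dF: "dedekind F (carrier F) D" and M: "!!i. i \<in> {1..n} ==> cring.mx F D (M i) & M i ~= {\<zero>\<^bsub>F\<^esub>}"
  and inj: "inj_on M {1..n}" and e: "!!i. i \<in> {1..n} ==> e i > 0" and m: "m = (\<Prod>k \<in> {1..n}. e k)"
 shows "consistent_system F n (\<lambda>i. localization F D (M i)) m
  (\<lambda>i. replicate (e i) ((F |: D Quot M i, \<lambda>C. C \<inter> D), 1::nat, m div e i))"
proof -
 interpret F: dedekind_std F "carrier F" D by (rule dedekind_std.intro[OF dF])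
 have m0: "m > 0" unfolding m using e by (intro prod_pos) auto
 have dv: "e i dvd m" if "i \<in> {1..n}" for i unfolding m using that by (intro dvd_prodI) auto
 have injl: "inj_on (\<lambda>i. localization F D (M i)) {1..n}"
 proof (rule inj_onI)
  fix i j assume ij: "i \<in> {1..n}" "j \<in> {1..n}" "localization F D (M i) = localization F D (M j)"
  have "M i = nonunits (F |: localization F D (M i)) \<inter> D" by (rule F.nonunits_localization_inter[OF M[OF ij(1)], symmetric])
  also have "\<dots> = nonunits (F |: localization F D (M j)) \<inter> D" unfolding ij(3) ..
  also have "\<dots> = M j" by (rule F.nonunits_localization_inter[OF M[OF ij(2)]])
  finally have "M i = M j" .
  thus "i = j" by (rule inj_onD[OF inj _ ij(1,2)])
 qed
 show ?thesis unfolding consistent_system_def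
 proof (intro conjI ballI injl m0)
  fix i assume i: "i \<in> {1..n}"
  show "dvr F (localization F D (M i))" by (rule F.localization_dvr[OF M[OF i] refl])
  have ei: "e i > 0" "e i * (m div e i) = m" using e[OF i] dv[OF i] by auto
  hence md: "m div e i > 0" using m0 by (metis gr0I mult_is_0 not_gr0)
  show "replicate (e i) ((F |: D Quot M i, \<lambda>C. C \<inter> D), 1::nat, m div e i) ~= []" using ei(1) by simp
  show "(\<Sum>(_, f, e) \<leftarrow> replicate (e i) ((F |: D Quot M i, \<lambda>C. C \<inter> D), 1::nat, m div e i). e * f) = m"
   using ei(2) by (simp add: sum_list_replicate)
  note res = F.residue_identification[OF M[OF i]]
  fix t assume "t \<in> set (replicate (e i) ((F |: D Quot M i, \<lambda>C. C \<inter> D), 1::nat, m div e i))"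
  hence t: "t = ((F |: D Quot M i, \<lambda>C. C \<inter> D), 1::nat, m div e i)" by (rule in_set_replicate[THEN iffD1, THEN conjunct1])
  show "(\<lambda>((K, \<iota>), f, e).
      simple_algebraic_field_extension (residue_field (F |: localization F D (M i))) K \<iota> &
      extension_degree (residue_field (F |: localization F D (M i))) K \<iota> f & e > 0) t"
   unfolding t using degree_one_extension[OF res(2,1,3)] md by simp
 qed
qed

context realization
begin

context
 fixes n m :: nat and M :: "nat => 'a set" and e :: "nat => nat"
 assumes n: "n > 0" and M: "!!i. i \<in> {1..n} ==> base.mxn (M i)" "inj_on M {1..n}"
  and e: "!!i. i \<in> {1..n} ==> e i > 0" and m: "m = (\<Prod>k \<in> {1..n}. e k)"
  and dm: "dimension m (h ` carrier F) (carrier R)"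
  and ps: "!!p::nat. p > 0 ==> \<exists>us. set us \<subseteq> carrier R & carrier R = Span (h ` carrier F) (map (\<lambda>u. u [^] p) us)"
  and ab: "!!i. i \<in> {1..n} ==> card (above (h ` M i)) = e i"
  and res: "!!i N y. i \<in> {1..n} ==> N \<in> above (h ` M i) ==> y \<in> E ==> \<exists>d\<in>h ` DF. y \<ominus> d \<in> N"
  and val: "!!i N x. i \<in> {1..n} ==> N \<in> above (h ` M i) ==> x \<in> h ` carrier F ==> x ~= \<zero> ==>
   E.vl N x = int (m div e i) * vl (h ` M i) x"
begin

lemma separable: "separable_algebraic_extension F R h" unfolding separable_algebraic_extension_def
proof (intro conjI ballI base.field_axioms field_axioms h)
 fix x assume x: "x \<in> carrier R"
 have "algebraic (h ` carrier F) x & separable_poly (h ` carrier F) (Irr (h ` carrier F) x)"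
  by (rule separable_of_power_span[OF K dm ps x])
 thus "algebraic (h ` carrier F) x" "separable_poly (h ` carrier F) (Irr (h ` carrier F) x)" by auto
qed

lemma system_realized:
 "is_realization F n (\<lambda>i. localization F DF (M i)) m
  (\<lambda>i. replicate (e i) ((F |: DF Quot M i, \<lambda>C. C \<inter> DF), 1, m div e i)) R h"
 (is "is_realization _ _ _ _ ?S _ _") unfolding is_realization_def
proof (intro conjI ballI separable)
 show "extension_degree F R h m" unfolding extension_degree_def by (rule dm)
 fix i assume i: "i \<in> {1..n}"
 have c: "card (valuation_extensions F (localization F DF (M i)) R h) = e i"
  unfolding valuation_extensions_eq[OF M(1)[OF i]] card_image[OF localization_inj] by (rule ab[OF i])
 have "finite (valuation_extensions F (localization F DF (M i)) R h)" using c e[OF i] by (metis card.infinite less_irrefl)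
 then obtain W where W: "bij_betw W {0..<e i} (valuation_extensions F (localization F DF (M i)) R h)"
  using ex_bij_betw_nat_finite c by metis
 show "\<exists>W. bij_betw W {..<length (?S i)}
      (valuation_extensions F (localization F DF (M i)) R h) &
     (\<forall>j<length (?S i).
       case ?S i ! j of
        ((K, \<iota>), f, ea) => residue_field_isomorphic F (localization F DF (M i)) R h (W j) K \<iota> &
         has_ramification_index F (localization F DF (M i)) R h (W j) ea)"
  (is "\<exists>W. bij_betw _ _ ?X & (\<forall>j<_. ?P W j)")
 proof (intro exI[of _ W] conjI allI impI)
  show "bij_betw W {..<length (?S i)} ?X" using W by (simp add: atLeast0LessThan)
  fix j assume "j < length (?S i)"
  hence j: "j < e i" by simp
  hence "W j \<in> localization R E ` above (h ` M i)" using bij_betwE[OF W] valuation_extensions_eq[OF M(1)[OF i]] by auto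
  then obtain N where N: "N \<in> above (h ` M i)" "W j = localization R E N" by blast
  have "residue_field_isomorphic F (localization F DF (M i)) R h (localization R E N) (F |: DF Quot M i) (\<lambda>C. C \<inter> DF)"
   by (rule residue_isomorphic[OF M(1)[OF i] N(1) res[OF i N(1)]])
  moreover have "has_ramification_index F (localization F DF (M i)) R h (localization R E N) (m div e i)"
   by (rule ramification_index[OF M(1)[OF i] N(1) val[OF i N(1)]])
  ultimately show "?P W j" unfolding N(2) nth_replicate[OF j] by simp
 qed
qed

lemma integral_extension: "finite_separable_integral_extension F DF R h E" unfolding finite_separable_integral_extension_def
proof (intro conjI ballI separable)
 show "is_quotient_field F DF" using dedekind_imp_dedekind_domain[OF base.dedekind_axioms] unfolding dedekind_domain_def by simp
 show "is_quotient_field R E" using dedekind_imp_dedekind_domain[OF E.dedekind_axioms] unfolding dedekind_domain_def by simp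
 show "h ` DF \<subseteq> E" using D_E by blast
 show "integral_over (h ` DF) x" if "x \<in> E" for x
  using integral_over_iff_intg[OF D noeth _ one_not_zero, of x] E_intg[OF that] that by simp
 show "\<exists>m. extension_degree F R h m" unfolding extension_degree_def using dm by blast
 obtain ws where ws: "set ws \<subseteq> carrier R" "E = Span (h ` DF) ws" using fin by (elim exE conjE)
 have "set ws \<subseteq> E" using Span_gens[OF D ws(1)] ws(2) by simp
 thus "\<exists>us. set us \<subseteq> E & Span (h ` DF) us = E" using ws(2) by (intro exI[of _ ws]) simp
qed

lemma maximal_ideals_above:
 assumes i: "i \<in> {1..n}"
 shows "{N. maximalideal N (R |: E) & N \<inter> h ` DF = h ` M i} = above (h ` M i)"
proof -
 have "N ~= {\<zero>}" if "mx E N" "N \<inter> h ` DF = h ` M i" for N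
 proof
  assume "N = {\<zero>}"
  hence "h ` M i = {\<zero>}" using that(2) by auto
  thus False using mxn_image[OF M(1)[OF i]] by simp
 qed
 thus ?thesis unfolding above_def maximalideal_iff_mx[OF E.D] by blast
qed

lemma dedekind_extension:
 assumes I: "I = finprod (ideals_set (F |: DF)) (\<lambda>i. M i [^]\<^bsub>ideals_set (F |: DF)\<^esub> e i) {1..n}"
 shows "dedekind_domain R E & finite_separable_integral_extension F DF R h E & extension_degree F R h m &
  (\<forall>i \<in> {1..n}.
    let Ns = {N. maximalideal N (R |: E) & N \<inter> h ` DF = h ` M i}
    in card Ns = e i &
     (\<forall>N \<in> Ns.
       ring.dimension (R |: E Quot N) 1 ((\<lambda>d. N +>\<^bsub>R |: E\<^esub> h d) ` DF)
        (carrier (R |: E Quot N)) &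
       Idl\<^bsub>R |: localization R E N\<^esub> (h ` M i) =
       Idl\<^bsub>R |: localization R E N\<^esub> (N [^]\<^bsub>ideals_set (R |: E)\<^esub> (m div e i)))) &
  Idl\<^bsub>R |: E\<^esub> (h ` I) =
   radical (R |: E) (Idl\<^bsub>R |: E\<^esub> (h ` I)) [^]\<^bsub>ideals_set (R |: E)\<^esub> m"
 (is "_ & _ & _ & (\<forall>i\<in>_. ?Q i) & ?eq")
proof (intro conjI ballI)
 show "dedekind_domain R E" by (rule dedekind_imp_dedekind_domain[OF E.dedekind_axioms])
 show "finite_separable_integral_extension F DF R h E" by (rule integral_extension)
 show "extension_degree F R h m" unfolding extension_degree_def by (rule dm)
next
 fix i assume i: "i \<in> {1..n}"
 show "?Q i" unfolding Let_def maximal_ideals_above[OF i]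
  using ab[OF i] residue_dimension[OF M(1)[OF i] _ res[OF i]] local_ideal_eq[OF M(1)[OF i] _ val[OF i]] by simp
next
 have m0: "m > 0" unfolding m using e by (intro prod_pos) auto
 have ei: "e i dvd m" if "i \<in> {1..n}" for i unfolding m using that by (intro dvd_prodI) auto
 have fab: "finite (above (h ` M i)) & above (h ` M i) ~= {}" if "i \<in> {1..n}" for i
  using ab[OF that] e[OF that] card_gt_0_iff[of "above (h ` M i)"] by auto
 have ne: "finite {1..n}" "{1..n} ~= {}" using n by auto
 show ?eq by (rule extended_ideal_radical_power[OF ne M ei m0 fab val I])
qed

end

end

text \<open>If 0 were maximal, D would be a field, equal to its quotient field.\<close>

lemma maximal_ideal_nonzero:
 assumes dF: "dedekind F (carrier F) D" and ne: "carrier F ~= D" and M: "cring.mx F D M"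
 shows "M ~= {\<zero>\<^bsub>F\<^esub>}"
proof
 interpret F: dedekind F "carrier F" D by (rule dF)
 assume M0: "M = {\<zero>\<^bsub>F\<^esub>}"
 have "x \<in> D" if x: "x \<in> carrier F" for x
 proof -
  obtain a b where ab: "a \<in> D" "b \<in> D" "b ~= \<zero>\<^bsub>F\<^esub>" "b \<otimes>\<^bsub>F\<^esub> x = a" using F.frac[OF x] by (elim bexE conjE)
  obtain d where d: "d \<in> D" "\<one>\<^bsub>F\<^esub> \<ominus>\<^bsub>F\<^esub> d \<otimes>\<^bsub>F\<^esub> b \<in> M" using F.M_max[OF M ab(2)] ab(3) M0 by auto
  have c: "d \<in> carrier F" "b \<in> carrier F" using d ab by auto
  have "\<one>\<^bsub>F\<^esub> \<ominus>\<^bsub>F\<^esub> d \<otimes>\<^bsub>F\<^esub> b = \<zero>\<^bsub>F\<^esub>" using d(2) M0 by simp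
  hence db: "d \<otimes>\<^bsub>F\<^esub> b = \<one>\<^bsub>F\<^esub>" using F.r_right_minus_eq[of "\<one>\<^bsub>F\<^esub>" "d \<otimes>\<^bsub>F\<^esub> b"] c by simp
  have "d \<otimes>\<^bsub>F\<^esub> a = (d \<otimes>\<^bsub>F\<^esub> b) \<otimes>\<^bsub>F\<^esub> x" unfolding ab(4)[symmetric] by (rule F.m_assoc[OF c x, symmetric])
  hence "d \<otimes>\<^bsub>F\<^esub> a = x" using db x by simp
  thus "x \<in> D" using F.D_closed(4)[OF d(1) ab(1)] by simp
 qed
 hence "carrier F = D" using F.D_carr by blast
 thus False using ne by simp
qed

theorem theorem3p3:
  fixes F :: "'a ring" and D :: "'a set" and n :: nat
    and M :: "nat \<Rightarrow> 'a set" and e :: "nat \<Rightarrow> nat"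
    and I :: "'a set" and m :: nat and S :: "('a, 'a set) system"
  assumes "dedekind_domain F D" and "carrier F \<noteq> D" and "n > 1"
    and "\<forall>i \<in> {1..n}. maximalideal (M i) (F\<lparr>carrier := D\<rparr>)" and "inj_on M {1..n}"
    and "\<forall>i \<in> {1..n}. e i > 0"
    and "I = finprod (ideals_set (F\<lparr>carrier := D\<rparr>))
               (\<lambda>i. M i [^]\<^bsub>ideals_set (F\<lparr>carrier := D\<rparr>)\<^esub> e i) {1..n}"
    and "m = (\<Prod>k \<in> {1..n}. e k)"
    \<comment> \<open>\<open>D/M\<^sub>i\<close> is identified with the residue field of \<open>D\<^bsub>M\<^sub>i\<^esub>\<close> by \<open>C \<mapsto> C \<inter> D\<close> on cosets\<close>
    and "S = (\<lambda>i. replicate (e i)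
                ((F\<lparr>carrier := D\<rparr> Quot M i, \<lambda>C. C \<inter> D), 1, m div e i))"
  shows "consistent_system F n (\<lambda>i. localization F D (M i)) m S \<and>
         realizable F n (\<lambda>i. localization F D (M i)) m S \<and>
         (\<exists>(L :: 'a closure_elem ring) h E.
            dedekind_domain L E \<and>
            finite_separable_integral_extension F D L h E \<and>
            extension_degree F L h m \<and>
            (\<forall>i \<in> {1..n}.
               let Ns = {N. maximalideal N (L\<lparr>carrier := E\<rparr>) \<and> N \<inter> h ` D = h ` M i}
               in card Ns = e i \<and>
                  (\<forall>N \<in> Ns.
                     ring.dimension (L\<lparr>carrier := E\<rparr> Quot N) 1
                       ((\<lambda>d. N +>\<^bsub>L\<lparr>carrier := E\<rparr>\<^esub> h d) ` D)
                       (carrier (L\<lparr>carrier := E\<rparr> Quot N)) \<and>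
                     Idl\<^bsub>L\<lparr>carrier := localization L E N\<rparr>\<^esub> (h ` M i) =
                     Idl\<^bsub>L\<lparr>carrier := localization L E N\<rparr>\<^esub>
                       (N [^]\<^bsub>ideals_set (L\<lparr>carrier := E\<rparr>)\<^esub> (m div e i)))) \<and>
            Idl\<^bsub>L\<lparr>carrier := E\<rparr>\<^esub> (h ` I) =
            radical (L\<lparr>carrier := E\<rparr>) (Idl\<^bsub>L\<lparr>carrier := E\<rparr>\<^esub> (h ` I))
              [^]\<^bsub>ideals_set (L\<lparr>carrier := E\<rparr>)\<^esub> m)"
proof -
 have dF: "dedekind F (carrier F) D" by (rule dedekind_domain_imp_dedekind[OF assms(1)])
 interpret F: dedekind F "carrier F" D by (rule dF)
 have Mx: "F.mxn (M i)" if i: "i \<in> {1..n}" for i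
  using assms(4) i F.maximalideal_iff_mx[OF F.D] maximal_ideal_nonzero[OF dF assms(2)] by simp
 have e: "!!i. i \<in> {1..n} ==> e i > 0" using assms(6) by simp
 have em: "(\<Prod>l\<in>{1..n} - {i}. e l) = m div e i" if i: "i \<in> {1..n}" for i
  unfolding assms(8) using prod.remove[of "{1..n}" i e] e[OF i] i by simp
 let ?C = "F.alg_closure" and ?h = "F.indexed_const :: 'a => 'a closure_elem"
 interpret C: algebraic_closure ?C "?h ` carrier F" by (rule F.alg_closureE(1))
 have h: "?h \<in> ring_hom F ?C" by (rule F.alg_closureE(2))
 note im = dedekind_image[OF C.field_axioms dF h]
 interpret T: dedekind_closed ?C "?h ` carrier F" "?h ` D" by (intro dedekind_closed.intro im(1) C.algebraically_closed_axioms)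
 have MD: "M i \<subseteq> carrier F" if "i \<in> {1..n}" for i using F.M_D[of "M i"] Mx[OF that] by auto
 have MC: "T.mxn (?h ` M i)" if i: "i \<in> {1..n}" for i
 proof -
  have "?h ` M i = ?h ` {\<zero>\<^bsub>F\<^esub>} \<longleftrightarrow> M i = {\<zero>\<^bsub>F\<^esub>}" by (rule inj_on_image_eq_iff[OF im(3) MD[OF i]]) simp
  moreover have "?h \<zero>\<^bsub>F\<^esub> = \<zero>\<^bsub>?C\<^esub>" by (rule ring_hom_zero[OF h F.ring_axioms C.ring_axioms])
  ultimately show ?thesis using im(2) Mx[OF i] by simp
 qed
 have MCi: "inj_on (\<lambda>i. ?h ` M i) {1..n}"
 proof (rule inj_onI)
  fix i j assume ij: "i \<in> {1..n}" "j \<in> {1..n}" "?h ` M i = ?h ` M j"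
  hence "M i = M j" using inj_on_image_eq_iff[OF im(3) MD MD] by blast
  thus "i = j" by (rule inj_onD[OF assms(5) _ ij(1,2)])
 qed
 obtain L E where LE: "dedekind_ext ?C (?h ` carrier F) (?h ` D) L E"
  "C.dimension (\<Prod>l\<in>{1..n}. e l) (?h ` carrier F) L"
  "\<forall>p::nat. p > 0 --> (\<exists>us. set us \<subseteq> L & L = C.Span (?h ` carrier F) (map (\<lambda>u. u [^]\<^bsub>?C\<^esub> p) us))"
  "\<forall>i\<in>{1..n}. card (dedekind_ext.above ?C (?h ` D) E (?h ` M i)) = (if i \<le> n then e i else 1) &
   (\<forall>N\<in>dedekind_ext.above ?C (?h ` D) E (?h ` M i). (\<forall>y\<in>E. \<exists>d\<in>?h ` D. y \<ominus>\<^bsub>?C\<^esub> d \<in> N) &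
    (\<forall>x\<in>?h ` carrier F. x ~= \<zero>\<^bsub>?C\<^esub> -->
     dedekind.vl ?C L E N x = int (\<Prod>l\<in>{1..n} - {i}. e l) * T.vl (?h ` M i) x))"
  by (rule exE[OF T.tower[where n=n and k=n and M="\<lambda>i. ?h ` M i" and e=e, OF assms(3) _ MCi _ order_refl]])
   (rule MC, assumption, rule e, assumption, elim exE conjE, (rule that; assumption))
 interpret X: dedekind_ext ?C "?h ` carrier F" "?h ` D" L E by (rule LE(1))
 let ?L = "?C |: L"
 note Ls = subfieldE(1)[OF X.E.K]
 have KL: "!!x. x \<in> ?h ` carrier F ==> x \<in> L" by (rule X.K_L)
 have "dedekind_ext ?L (?h ` carrier F) (?h ` D) (carrier ?L) E" using X.restrict_ext(1) by simp
 moreover have "?h \<in> ring_hom F ?L" by (rule ring_hom_memI) (use KL ring_hom_mult[OF h] ring_hom_add[OF h] ring_hom_one[OF h] in auto)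
 ultimately have "realization F D ?L ?h E" by (intro realization.intro dedekind_std.intro ext_std.intro dF realization_axioms.intro)
 then interpret Z: realization F D ?L ?h E .
 have abv: "Z.above = X.above" by (rule X.restrict_ext(2))
 have vlE: "Z.E.vl = X.E.vl" using X.E.restrict(2)[OF X.E.K] by simp
 have vlD: "Z.vl = T.vl" by (rule T.restrict(2)[OF X.E.K KL])
 have dm: "Z.dimension m (?h ` carrier F) (carrier ?L)" using C.dimension_restrict[OF Ls LE(2) T.K order_refl] assms(8) by simp
 have ps: "\<exists>us. set us \<subseteq> carrier ?L & carrier ?L = Z.Span (?h ` carrier F) (map (\<lambda>u. u [^]\<^bsub>?L\<^esub> p) us)" if "p > 0" for p :: nat
 proof -
  have "u [^]\<^bsub>?L\<^esub> p = u [^]\<^bsub>?C\<^esub> p" for u by (rule C.nat_pow_consistent[symmetric])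
  thus ?thesis unfolding C.Span_consistent[OF Ls] using LE(3) that by simp
 qed
 have ab: "card (Z.above (?h ` M i)) = e i" if "i \<in> {1..n}" for i using LE(4) that unfolding abv by simp
 have res: "\<exists>d\<in>?h ` D. y \<ominus>\<^bsub>?L\<^esub> d \<in> N" if i: "i \<in> {1..n}" and N: "N \<in> Z.above (?h ` M i)" and y: "y \<in> E" for i N y
 proof -
  obtain d where d: "d \<in> ?h ` D" "y \<ominus>\<^bsub>?C\<^esub> d \<in> N" using LE(4) i N y unfolding abv by blast
  have "y \<ominus>\<^bsub>?L\<^esub> d = y \<ominus>\<^bsub>?C\<^esub> d" using C.subring_a_inv[OF Ls KL[OF T.D_K[OF d(1)]]] by (simp add: a_minus_def)
  thus ?thesis using d by (intro bexI[of _ d]) simp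
 qed
 have val: "Z.E.vl N x = int (m div e i) * Z.vl (?h ` M i) x"
  if i: "i \<in> {1..n}" and N: "N \<in> Z.above (?h ` M i)" and x: "x \<in> ?h ` carrier F" "x ~= \<zero>\<^bsub>?L\<^esub>" for i N x
 proof -
  have "x ~= \<zero>\<^bsub>?C\<^esub>" using x(2) by simp
  thus ?thesis using LE(4) i N x(1) em[OF i] unfolding abv vlE vlD by metis
 qed
 have n0: "n > 0" using assms(3) by simp
 have c: "consistent_system F n (\<lambda>i. localization F D (M i)) m S"
  unfolding assms(9) by (rule system_consistent[OF dF Mx assms(5) e assms(8)])
 have "is_realization F n (\<lambda>i. localization F D (M i)) m S ?L ?h"
  unfolding assms(9) by (rule Z.system_realized[OF n0 Mx assms(5) e assms(8) dm ps ab res val])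
 hence r: "realizable F n (\<lambda>i. localization F D (M i)) m S" unfolding realizable_def by blast
 show ?thesis by (rule conjI[OF c conjI[OF r]], rule exI[of _ ?L], rule exI[of _ ?h], rule exI[of _ E])
   (rule Z.dedekind_extension[OF n0 Mx assms(5) e assms(8) dm ps ab res val assms(7)])
qed

end
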